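(* Suppose that rejective sampling is used at the first stage and that assumptions (FS1), (SS1) and (VA1) (written out in the context) hold. Then $$E\left(\left[A^{-2}n_I\left\{\hat V_{HAJ,A}(\hat\tau_\rho)-V_1(\hat\tau_\rho)-V_2(\hat\tau_\rho)\right\}\right]^2\right)=o(1).$$ If, in addition, (VA2) holds, then $$\frac{\hat\tau_\rho-\tau_\rho}{\sqrt{V(\hat\tau_\rho)}}\longrightarrow\mathcal N(0,1)\ \text{ in distribution,}$$ and also $$E\left(\left[A^{-2}n_I\left\{\hat V_{HAJ}(\hat\tau_\rho)-V(\hat\tau_\rho)\right\}\right]^2\right)=o(1),\qquad\frac{\hat V_{HAJ}(\hat\tau_\rho)}{V(\hat\tau_\rho)}\longrightarrow1\ \text{ in probability.}$$
   Context: Setting. $\mathcal F\subset\mathbb R^d$ is a fixed bounded measurable set of Lebesgue measure $A>0$, and $\rho:\mathcal F\to\mathbb R$ is Lebesgue integrable, with $\tau_\rho=\int_{\mathcal F}\rho(x)\,dx$. We consider a sequence (index suppressed) of partitions of $\mathcal F$ into $N_I$ disjoint measurable sub-regions (primary sampling units, PSUs) forming $U_I=\{u_1,\dots,u_{N_I}\}$; $A_i$ is the measure of $u_i$. Asymptotics: $A$ is fixed, $N_I\to\infty$, the partition becomes increasingly fine (PSU diameters shrink to $0$), and $n_I\to\infty$. Constants in the assumptions do not depend on the position in the sequence; $o(\cdot)$ and limits are along this sequence. Sampling. First stage: a random sample $S_{rI}\subset U_I$ of fixed size $n_I$ is selected by rejective (conditional Poisson) sampling with inclusion probabilities $\pi_{Ii}$,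 i.e. by a Poisson sampling design (independent selection of the units) conditioned on the sample size being $n_I$, its parameters being such that the resulting inclusion probabilities $P(u_i\in S_{rI})$ equal $\pi_{Ii}$. Write $\pi_{Iij}=P(u_i,u_j\in S_{rI})$ (so $\pi_{Iii}=\pi_{Ii}$) and $\Delta_{Iij}=\pi_{Iij}-\pi_{Ii}\pi_{Ij}$. Second stage: conditionally on $S_{rI}$, for each $u_i\in S_{rI}$ a sample $S_{IIi}$ of $n_{IIi}$ points is drawn independently from a probability density $f_{IIi}$ supported on $u_i$; the second-stage mechanism does not depend on the realization of $S_{rI}$, and the samples $S_{IIi}$ are conditionally independent across PSUs given $S_{rI}$. Put $\pi_{IIi}(x)=n_{IIi}f_{IIi}(x)$ and $n_{II0}=N_I^{-1}\sum_{i=1}^{N_I}n_{IIi}$. Estimator and variance. $\tau_{\rho i}=\int_{u_i}\rho(x)\,dx$, $\hat\tau_{\rho i}=\sum_{x\in S_{IIi}}\rho(x)/\pi_{IIi}(x)$, $\hat\tau_\rho=\sum_{u_i\in S_{rI}}\hat\tau_{\rho i}/\pi_{Ii}$. $V(\hat\tau_\rho)=V_1(\hat\tau_\rho)+V_2(\hat\tau_\rho)+V_3(\hat\tau_\rho)$ with $$V_1(\hat\tau_\rho)=\sum_{u_i\in U_I}\sum_{u_j\in U_I}\Delta_{Iij}\frac{\tau_{\rho i}}{\pi_{Ii}}\frac{\tau_{\rho j}}{\pi_{Ij}},\quad V_2(\hat\tau_\rho)=\sum_{u_i\in U_I}\frac{1-\pi_{Ii}}{\pi_{Ii}}V_i,\quad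 V_3(\hat\tau_\rho)=\sum_{u_i\in U_I}V_i,$$ $$V_i=\int_{u_i}\pi_{IIi}(x)\left\{\frac{\rho(x)}{\pi_{IIi}(x)}-\frac{\tau_{\rho i}}{n_{IIi}}\right\}^2dx.$$ Hájek variance estimator: $\hat V_{HAJ}(\hat\tau_\rho)=\hat V_{HAJ,A}(\hat\tau_\rho)+\hat V_B(\hat\tau_\rho)$ with $$\hat V_{HAJ,A}(\hat\tau_\rho)=\sum_{u_i\in S_{rI}}(1-\pi_{Ii})\left(\frac{\hat\tau_{\rho i}}{\pi_{Ii}}-\hat{\hat R}_{r\pi}\right)^2,\quad \hat{\hat R}_{r\pi}=\frac1{\hat d_{rI}}\sum_{u_i\in S_{rI}}(1-\pi_{Ii})\frac{\hat\tau_{\rho i}}{\pi_{Ii}},\quad \hat d_{rI}=\sum_{u_i\in S_{rI}}(1-\pi_{Ii}),$$ $$\hat V_B(\hat\tau_\rho)=\sum_{u_i\in S_{rI}}\frac{\hat V_i}{\pi_{Ii}},\quad \hat V_i=\frac{n_{IIi}}{n_{IIi}-1}\sum_{x\in S_{IIi}}\left\{\frac{\rho(x)}{\pi_{IIi}(x)}-\frac{\hat\tau_{\rho i}}{n_{IIi}}\right\}^2.$$ Assumptions. (FS1) There exist constants $f_{I0}<1$ and $0<c_{I1}\le C_{I1}<\infty$ with $n_I/N_I\le f_{I0}$ and $c_{I1}\le (N_I/n_I)\pi_{Ii}\le C_{I1}$ for all $i$. (SS1) There exist constants $0<\lambda_1\le\Lambda_1<\infty$, $0<\phi_1\le\Phi_1<\infty$,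 $0<c_1\le C_1<\infty$ such that for every PSU $u_i$: $\lambda_1n_{II0}\le n_{IIi}\le\Lambda_1n_{II0}$; $\phi_1A/N_I\le A_i\le\Phi_1A/N_I$; $c_1/A_i\le f_{IIi}(x)\le C_1/A_i$ for all $x\in u_i$; and $n_{IIi}\ge2$. (VA1) There exist constants $m_1,M_1$ such that $A^{-1}\int_{\mathcal F}\rho(x)^4dx\le M_1$ and $|A^{-1}\int_{\mathcal F}\rho(x)\,dx|\ge m_1>0$. (VA2) There exists a constant $m_2$ such that $n_IA^{-2}V_1(\hat\tau_\rho)\ge m_2>0$. *)

theory Defs
  imports "HOL-Probability.Probability"
begin

definition poisson_design :: "nat set \<Rightarrow> (nat \<Rightarrow> real) \<Rightarrow> nat set pmf" where
  "poisson_design U p =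
     map_pmf (\<lambda>b. {i \<in> U. b i}) (Pi_pmf U False (\<lambda>i. bernoulli_pmf (p i)))"

definition rejective_design :: "nat set \<Rightarrow> (nat \<Rightarrow> real) \<Rightarrow> nat \<Rightarrow> nat set pmf" where
  "rejective_design U p n = cond_pmf (poisson_design U p) {s. card s = n}"

(* One member of the sequence of surveys. The PSUs are psu i with i < num_psu;
   smp1 is the random first-stage sample, given as a set of indices;
   pt i j is the j-th second-stage draw (j < size2 i) in PSU i, and only the values on the event
   that i is in smp1 are ever used.
   prm is the family of parameters of the underlying Poisson design, incl the prescribed
   first-stage inclusion probabilities, dens i the second-stage density. *)
record ('a, 'w) survey =
  num_psu :: nat
  psu :: "nat \<Rightarrow> 'a set"
  size1 :: nat
  prm :: "nat \<Rightarrow> real"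
  incl :: "nat \<Rightarrow> real"
  size2 :: "nat \<Rightarrow> nat"
  dens :: "nat \<Rightarrow> 'a \<Rightarrow> real"
  prb :: "'w measure"
  smp1 :: "'w \<Rightarrow> nat set"
  pt :: "nat \<Rightarrow> nat \<Rightarrow> 'w \<Rightarrow> 'a"

definition psu_partition :: "'a::euclidean_space set \<Rightarrow> ('a, 'w) survey \<Rightarrow> bool" where
  "psu_partition F D \<longleftrightarrow>
     (\<forall>i<num_psu D. psu D i \<in> sets lebesgue) \<and>
     disjoint_family_on (psu D) {..<num_psu D} \<and>
     (\<Union>i<num_psu D. psu D i) = F"

(* The condition on set_pmf says that the conditioning event of the rejective design has positive
   probability; without it cond_pmf is unspecified. *)
definition rejective_first_stage :: "('a, 'w) survey \<Rightarrow> bool" where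
  "rejective_first_stage D \<longleftrightarrow>
     prob_space (prb D) \<and>
     (\<forall>i<num_psu D. 0 \<le> prm D i \<and> prm D i \<le> 1) \<and>
     set_pmf (poisson_design {..<num_psu D} (prm D)) \<inter> {s. card s = size1 D} \<noteq> {} \<and>
     smp1 D \<in> prb D \<rightarrow>\<^sub>M count_space (Pow {..<num_psu D}) \<and>
     (\<forall>s \<subseteq> {..<num_psu D}.
        measure (prb D) {\<omega> \<in> space (prb D). smp1 D \<omega> = s} =
        pmf (rejective_design {..<num_psu D} (prm D) (size1 D)) s) \<and>
     (\<forall>i<num_psu D. measure (prb D) {\<omega> \<in> space (prb D). i \<in> smp1 D \<omega>} = incl D i)"

definition given_smp1 :: "('a, 'w) survey \<Rightarrow> nat set \<Rightarrow> 'w measure" where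
  "given_smp1 D s = uniform_measure (prb D) {\<omega> \<in> space (prb D). smp1 D \<omega> = s}"

(* Given smp1 = s, all draws (within and across the selected PSUs) are independent, the draws in
   PSU i having density dens i, which does not depend on s. *)
definition second_stage :: "('a::euclidean_space, 'w) survey \<Rightarrow> bool" where
  "second_stage D \<longleftrightarrow>
     (\<forall>i<num_psu D.
        dens D i \<in> borel_measurable lebesgue \<and>
        (\<forall>x. 0 \<le> dens D i x) \<and> (\<forall>x. x \<notin> psu D i \<longrightarrow> dens D i x = 0) \<and>
        (\<integral>\<^sup>+x. ennreal (dens D i x) \<partial>lebesgue) = 1) \<and>
     (\<forall>s. measure (prb D) {\<omega> \<in> space (prb D). smp1 D \<omega> = s} > 0 \<longrightarrow>
        prob_space.indep_vars (given_smp1 D s) (\<lambda>_. lebesgue) (\<lambda>(i, j). pt D i j)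
          (SIGMA i:s. {..<size2 D i}) \<and>
        (\<forall>i\<in>s. \<forall>j<size2 D i.
           distributed (given_smp1 D s) lebesgue (pt D i j) (\<lambda>x. ennreal (dens D i x)))) \<and>
     (\<forall>\<omega>\<in>space (prb D). \<forall>i\<in>smp1 D \<omega>. \<forall>j<size2 D i. pt D i j \<omega> \<in> psu D i)"

definition incl2 :: "('a, 'w) survey \<Rightarrow> nat \<Rightarrow> nat \<Rightarrow> real" where
  "incl2 D i j = measure (prb D) {\<omega> \<in> space (prb D). i \<in> smp1 D \<omega> \<and> j \<in> smp1 D \<omega>}"

definition Delta1 :: "('a, 'w) survey \<Rightarrow> nat \<Rightarrow> nat \<Rightarrow> real" where
  "Delta1 D i j = incl2 D i j - incl D i * incl D j"

definition piII :: "('a, 'w) survey \<Rightarrow> nat \<Rightarrow> 'a \<Rightarrow> real" where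
  "piII D i x = real (size2 D i) * dens D i x"

definition mean_size2 :: "('a, 'w) survey \<Rightarrow> real" where
  "mean_size2 D = (\<Sum>i<num_psu D. real (size2 D i)) / real (num_psu D)"

definition tau_psu :: "('a::euclidean_space \<Rightarrow> real) \<Rightarrow> ('a, 'w) survey \<Rightarrow> nat \<Rightarrow> real" where
  "tau_psu \<rho> D i = (LINT x:psu D i|lebesgue. \<rho> x)"

definition tau_psu_hat :: "('a \<Rightarrow> real) \<Rightarrow> ('a, 'w) survey \<Rightarrow> nat \<Rightarrow> 'w \<Rightarrow> real" where
  "tau_psu_hat \<rho> D i \<omega> = (\<Sum>j<size2 D i. \<rho> (pt D i j \<omega>) / piII D i (pt D i j \<omega>))"

definition tau_hat :: "('a \<Rightarrow> real) \<Rightarrow> ('a, 'w) survey \<Rightarrow> 'w \<Rightarrow> real" where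
  "tau_hat \<rho> D \<omega> = (\<Sum>i\<in>smp1 D \<omega>. tau_psu_hat \<rho> D i \<omega> / incl D i)"

definition V_psu :: "('a::euclidean_space \<Rightarrow> real) \<Rightarrow> ('a, 'w) survey \<Rightarrow> nat \<Rightarrow> real" where
  "V_psu \<rho> D i =
     (LINT x:psu D i|lebesgue.
        piII D i x * (\<rho> x / piII D i x - tau_psu \<rho> D i / real (size2 D i))\<^sup>2)"

definition V1 :: "('a::euclidean_space \<Rightarrow> real) \<Rightarrow> ('a, 'w) survey \<Rightarrow> real" where
  "V1 \<rho> D =
     (\<Sum>i<num_psu D. \<Sum>j<num_psu D.
        Delta1 D i j * (tau_psu \<rho> D i / incl D i) * (tau_psu \<rho> D j / incl D j))"

definition V2 :: "('a::euclidean_space \<Rightarrow> real) \<Rightarrow> ('a, 'w) survey \<Rightarrow> real" where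
  "V2 \<rho> D = (\<Sum>i<num_psu D. (1 - incl D i) / incl D i * V_psu \<rho> D i)"

definition V3 :: "('a::euclidean_space \<Rightarrow> real) \<Rightarrow> ('a, 'w) survey \<Rightarrow> real" where
  "V3 \<rho> D = (\<Sum>i<num_psu D. V_psu \<rho> D i)"

definition V_tot :: "('a::euclidean_space \<Rightarrow> real) \<Rightarrow> ('a, 'w) survey \<Rightarrow> real" where
  "V_tot \<rho> D = V1 \<rho> D + V2 \<rho> D + V3 \<rho> D"

definition d_hat :: "('a, 'w) survey \<Rightarrow> 'w \<Rightarrow> real" where
  "d_hat D \<omega> = (\<Sum>i\<in>smp1 D \<omega>. 1 - incl D i)"

(* If d_hat vanishes, every weight 1 - incl D i in V_HAJ_A vanishes, so the value taken by
   R_hat there is immaterial. *)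
definition R_hat :: "('a \<Rightarrow> real) \<Rightarrow> ('a, 'w) survey \<Rightarrow> 'w \<Rightarrow> real" where
  "R_hat \<rho> D \<omega> =
     1 / d_hat D \<omega> * (\<Sum>i\<in>smp1 D \<omega>. (1 - incl D i) * (tau_psu_hat \<rho> D i \<omega> / incl D i))"

definition V_HAJ_A :: "('a \<Rightarrow> real) \<Rightarrow> ('a, 'w) survey \<Rightarrow> 'w \<Rightarrow> real" where
  "V_HAJ_A \<rho> D \<omega> =
     (\<Sum>i\<in>smp1 D \<omega>. (1 - incl D i) * (tau_psu_hat \<rho> D i \<omega> / incl D i - R_hat \<rho> D \<omega>)\<^sup>2)"

definition V_psu_hat :: "('a \<Rightarrow> real) \<Rightarrow> ('a, 'w) survey \<Rightarrow> nat \<Rightarrow> 'w \<Rightarrow> real" where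
  "V_psu_hat \<rho> D i \<omega> =
     real (size2 D i) / (real (size2 D i) - 1) *
     (\<Sum>j<size2 D i.
        (\<rho> (pt D i j \<omega>) / piII D i (pt D i j \<omega>) - tau_psu_hat \<rho> D i \<omega> / real (size2 D i))\<^sup>2)"

definition V_B_hat :: "('a \<Rightarrow> real) \<Rightarrow> ('a, 'w) survey \<Rightarrow> 'w \<Rightarrow> real" where
  "V_B_hat \<rho> D \<omega> = (\<Sum>i\<in>smp1 D \<omega>. V_psu_hat \<rho> D i \<omega> / incl D i)"

definition V_HAJ :: "('a \<Rightarrow> real) \<Rightarrow> ('a, 'w) survey \<Rightarrow> 'w \<Rightarrow> real" where
  "V_HAJ \<rho> D \<omega> = V_HAJ_A \<rho> D \<omega> + V_B_hat \<rho> D \<omega>"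

definition FS1 :: "(nat \<Rightarrow> ('a, 'w) survey) \<Rightarrow> bool" where
  "FS1 D \<longleftrightarrow>
     (\<exists>f0 c C :: real. f0 < 1 \<and> 0 < c \<and> c \<le> C \<and>
        (\<forall>k. real (size1 (D k)) / real (num_psu (D k)) \<le> f0 \<and>
           (\<forall>i<num_psu (D k).
              c \<le> real (num_psu (D k)) / real (size1 (D k)) * incl (D k) i \<and>
              real (num_psu (D k)) / real (size1 (D k)) * incl (D k) i \<le> C)))"

definition SS1 :: "'a::euclidean_space set \<Rightarrow> (nat \<Rightarrow> ('a, 'w) survey) \<Rightarrow> bool" where
  "SS1 F D \<longleftrightarrow>
     (\<exists>l L ph Ph c C :: real.
        0 < l \<and> l \<le> L \<and> 0 < ph \<and> ph \<le> Ph \<and> 0 < c \<and> c \<le> C \<and>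
        (\<forall>k. \<forall>i<num_psu (D k).
           l * mean_size2 (D k) \<le> real (size2 (D k) i) \<and>
           real (size2 (D k) i) \<le> L * mean_size2 (D k) \<and>
           ph * measure lebesgue F / real (num_psu (D k)) \<le> measure lebesgue (psu (D k) i) \<and>
           measure lebesgue (psu (D k) i) \<le> Ph * measure lebesgue F / real (num_psu (D k)) \<and>
           (\<forall>x\<in>psu (D k) i.
              c / measure lebesgue (psu (D k) i) \<le> dens (D k) i x \<and>
              dens (D k) i x \<le> C / measure lebesgue (psu (D k) i)) \<and>
           2 \<le> size2 (D k) i))"

(* Integrability of the fourth power is part of the assumption that its integral is bounded:
   the LINT of a non-integrable function is 0. *)
definition VA1 :: "'a::euclidean_space set \<Rightarrow> ('a \<Rightarrow> real) \<Rightarrow> bool" where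
  "VA1 F \<rho> \<longleftrightarrow>
     set_integrable lebesgue F (\<lambda>x. \<rho> x ^ 4) \<and>
     (\<exists>m M :: real.
        (LINT x:F|lebesgue. \<rho> x ^ 4) / measure lebesgue F \<le> M \<and>
        0 < m \<and> m \<le> \<bar>(LINT x:F|lebesgue. \<rho> x) / measure lebesgue F\<bar>)"

definition VA2 :: "'a::euclidean_space set \<Rightarrow> ('a \<Rightarrow> real) \<Rightarrow> (nat \<Rightarrow> ('a, 'w) survey) \<Rightarrow> bool" where
  "VA2 F \<rho> D \<longleftrightarrow>
     (\<exists>m::real. 0 < m \<and>
        (\<forall>k. m \<le> real (size1 (D k)) * V1 \<rho> (D k) / (measure lebesgue F)\<^sup>2))"

definition mean_square_null :: "(nat \<Rightarrow> 'w measure) \<Rightarrow> (nat \<Rightarrow> 'w \<Rightarrow> real) \<Rightarrow> bool" where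
  "mean_square_null P X \<longleftrightarrow>
     (\<forall>k. integrable (P k) (\<lambda>\<omega>. (X k \<omega>)\<^sup>2)) \<and>
     (\<lambda>k. \<integral>\<omega>. (X k \<omega>)\<^sup>2 \<partial>P k) \<longlonglongrightarrow> 0"

definition tendsto_in_prob ::
  "(nat \<Rightarrow> 'w measure) \<Rightarrow> (nat \<Rightarrow> 'w \<Rightarrow> real) \<Rightarrow> real \<Rightarrow> bool" where
  "tendsto_in_prob P X c \<longleftrightarrow>
     (\<forall>k. X k \<in> borel_measurable (P k)) \<and>
     (\<forall>\<epsilon>>0. (\<lambda>k. measure (P k) {\<omega> \<in> space (P k). \<bar>X k \<omega> - c\<bar> > \<epsilon>}) \<longlonglongrightarrow> 0)"

end

theory Submission
  imports Defs
begin

text \<open>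
  The odds of the Poisson design can be rescaled by a common factor without changing the rejective
  design, so its parameters \<open>p i\<close> may be taken to sum to the sample size \<open>n\<close>. Exchanging a selected
  unit \<open>i\<close> for an unselected unit \<open>j\<close> at rate \<open>p j * (1 - p i)\<close> is then reversible, and its generator
  multiplies a centred linear statistic \<open>T\<close> by \<open>- rate s\<close>, where \<open>rate s\<close> is at the same time the
  sum of \<open>1 - p i\<close> over the selected units and the sum of \<open>p j\<close> over the unselected ones. It
  therefore lies between fixed multiples of \<open>n\<close>, and it concentrates because selections are
  negatively correlated. Testing this Stein-type identity with \<open>T\<close>, \<open>T\<^sup>3\<close> and \<open>exp (\<i> t T)\<close> yields
  Hajek's variance approximation, a fourth moment bound, and a differential equation for the
  characteristic function of \<open>T\<close> that differs from the Gaussian one by \<open>O (1 / sqrt n)\<close>; no local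
  limit theorem is needed.

  Given the first-stage sample the PSU estimates are independent, so that their conditional
  characteristic function is close to a Gaussian one whose variance is itself a linear statistic
  and concentrates. The variance estimators are functions of linear statistics, and everything is
  controlled by a single quantity, the sum over all PSUs of \<open>\<pi> i\<close> times the fourth moment of the
  expanded PSU estimate.
\<close>

section \<open>Negative correlation in the rejective design\<close>

text \<open>The jump rate is random, so the swap dynamics has no exact linear regression property,
  and this shapes all estimates. Whatever has to be replaced by its mean (the rate, the sum of
  squared jumps, the conditional variances) is built from sample totals, and the variance of such a
  total is at most twice an \<open>inc\<close>-weighted sum of squares. A replacement then costs
  \<open>sqrt n\<close> against main terms of order \<open>n\<close>. The centre for which the swap
  identity is exact is the sum of \<open>p i * a i\<close>, while the estimator is centred at the
  sum of \<open>inc i * a i\<close>. The identity itself closes this gap: tested with a constant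
  function it bounds \<open>inc i - p i\<close>. All estimates are explicit bounds for one single
  design. They depend on the sample size and on two constants only: \<open>g\<close>, which controls
  the rate from below, and \<open>k\<close>, the size of an array whose entries are of order
  \<open>1 / sqrt n\<close>. Uniformity along the sequence is therefore automatic, and the same
  bounds serve with scale \<open>sqrt n / A\<close> for the variance estimators and with scale
  \<open>1 / sqrt V\<close> for the limit law.\<close>

lemma sum_subsets_insert:
  fixes f :: "'i set \<Rightarrow> 'b::comm_monoid_add"
  assumes "finite V" "x \<notin> V"
  shows "(\<Sum>s | s \<subseteq> insert x V \<and> int (card s) = k. f s) =
    (\<Sum>s | s \<subseteq> V \<and> int (card s) = k. f s) + (\<Sum>s | s \<subseteq> V \<and> int (card s) = k - 1. f (insert x s))"
proof -
  have fin: "finite s" if "s \<subseteq> V" for s using that assms finite_subset by blast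
  have inj: "inj_on (insert x) {s. s \<subseteq> V \<and> int (card s) = k - 1}"
    using assms by (auto simp: inj_on_def)
  have split: "{s. s \<subseteq> insert x V \<and> int (card s) = k} =
      {s. s \<subseteq> V \<and> int (card s) = k} \<union> insert x ` {s. s \<subseteq> V \<and> int (card s) = k - 1}"
  proof (intro equalityI subsetI)
    fix s assume s: "s \<in> {s. s \<subseteq> insert x V \<and> int (card s) = k}"
    show "s \<in> {s. s \<subseteq> V \<and> int (card s) = k} \<union> insert x ` {s. s \<subseteq> V \<and> int (card s) = k - 1}"
    proof (cases "x \<in> s")
      case True
      have "s - {x} \<subseteq> V" using s by auto
      moreover have "card s = Suc (card (s - {x}))"
        using True s assms(1) by (metis (mono_tags) card.remove finite_insert mem_Collect_eq rev_finite_subset)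
      moreover have "s = insert x (s - {x})" using True by auto
      ultimately show ?thesis using s by (intro UnI2 image_eqI[of _ _ "s - {x}"]) auto
    next
      case False then show ?thesis using s by auto
    qed
  next
    fix s assume "s \<in> {s. s \<subseteq> V \<and> int (card s) = k} \<union> insert x ` {s. s \<subseteq> V \<and> int (card s) = k - 1}"
    then show "s \<in> {s. s \<subseteq> insert x V \<and> int (card s) = k}"
    proof
      assume "s \<in> insert x ` {s. s \<subseteq> V \<and> int (card s) = k - 1}"
      then obtain t where t: "s = insert x t" "t \<subseteq> V" "int (card t) = k - 1" by auto
      then have "card s = Suc (card t)" using fin assms by (simp add: subset_iff card_insert_if) blast
      then show ?thesis using t by auto
    qed auto
  qed
  show ?thesis
    unfolding split
    by (subst sum.union_disjoint) (use assms fin in \<open>auto simp: sum.reindex[OF inj]\<close>)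
qed

definition bern_weight :: "('i \<Rightarrow> real) \<Rightarrow> 'i set \<Rightarrow> 'i set \<Rightarrow> real" where
  "bern_weight p V s = (\<Prod>i\<in>s. p i) * (\<Prod>i\<in>V - s. 1 - p i)"

lemma bern_weight_insert_notin:
  assumes "finite V" "x \<notin> V" "s \<subseteq> V"
  shows "bern_weight p (insert x V) s = (1 - p x) * bern_weight p V s"
proof -
  have "insert x V - s = insert x (V - s)" using assms by auto
  then show ?thesis using assms by (simp add: bern_weight_def)
qed

lemma bern_weight_insert_in:
  assumes "finite V" "x \<notin> V" "s \<subseteq> V"
  shows "bern_weight p (insert x V) (insert x s) = p x * bern_weight p V s"
proof -
  have "insert x V - insert x s = V - s" "x \<notin> s" "finite s" using assms finite_subset by auto
  then show ?thesis using assms by (simp add: bern_weight_def)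
qed

text \<open>The size is an integer so that the Pascal-type recursion needs no case distinction at 0.\<close>
definition size_weight :: "('i \<Rightarrow> real) \<Rightarrow> 'i set \<Rightarrow> int \<Rightarrow> real" where
  "size_weight p V k = (\<Sum>s | s \<subseteq> V \<and> int (card s) = k. bern_weight p V s)"

lemma size_weight_insert:
  assumes "finite V" "x \<notin> V"
  shows "size_weight p (insert x V) k = (1 - p x) * size_weight p V k + p x * size_weight p V (k - 1)"
  unfolding size_weight_def sum_subsets_insert[OF assms] sum_distrib_left
  by (intro arg_cong2[where f = "(+)"] sum.cong)
    (auto simp: bern_weight_insert_in[OF assms] bern_weight_insert_notin[OF assms])

lemma bern_weight_nonneg:
  assumes "\<And>i. i \<in> V \<Longrightarrow> 0 \<le> p i \<and> p i \<le> 1" "s \<subseteq> V"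
  shows "0 \<le> bern_weight p V s"
  unfolding bern_weight_def using assms by (intro mult_nonneg_nonneg prod_nonneg) auto

text \<open>Log-concavity of the Poisson-binomial weights, obtained by adding one unit at a time.
  The form with two indices carries the induction: the case \<open>a = b\<close> alone could not be
  chained to wider index gaps, because weights may vanish and cannot be divided out.\<close>

lemma size_weight_log_concave:
  assumes "finite V" "\<And>i. i \<in> V \<Longrightarrow> 0 \<le> p i \<and> p i \<le> 1" "a \<le> b"
  shows "size_weight p V (a - 1) * size_weight p V (b + 1) \<le> size_weight p V a * size_weight p V b"
  using assms
proof (induction V arbitrary: a b rule: finite_induct)
  case empty
  have [simp]: "size_weight p {} k = (if k = 0 then 1 else 0)" for k
  proof -
    have "{s. s \<subseteq> ({}::'a set) \<and> int (card s) = k} = (if k = 0 then {{}} else {})" by auto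
    then show ?thesis by (simp add: size_weight_def bern_weight_def)
  qed
  show ?case using empty by auto
next
  case (insert x V)
  let ?e = "size_weight p V"
  define y where "y = p x"
  have y: "0 \<le> y" "0 \<le> 1 - y" using insert.prems(1)[of x] by (auto simp: y_def)
  have IH: "?e (c - 1) * ?e (d + 1) \<le> ?e c * ?e d" if "c \<le> d" for c d
    using insert.IH[OF _ that] insert.prems(1) by simp
  have e1: "?e (a - 1) * ?e (b + 1) \<le> ?e a * ?e b" using IH insert.prems(2) .
  have e2: "?e (a - 2) * ?e b \<le> ?e (a - 1) * ?e (b - 1)"
    using IH[of "a - 1" "b - 1"] insert.prems(2) by simp
  \<comment> \<open>In the \<open>y * (1 - y)\<close> part of the expansion the terms
    \<open>?e (a - 1) * ?e b\<close> cancel. What is left needs two applications of the hypothesis,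
    or a single one when \<open>a = b\<close>, where the pair \<open>a\<close>, \<open>b - 1\<close>
    is out of order.\<close>
  have e3: "?e (a - 2) * ?e (b + 1) \<le> ?e a * ?e (b - 1)"
  proof (cases "a = b")
    case True
    show ?thesis using IH[of "a - 1" "a"] True by (simp add: mult.commute)
  next
    case False
    then have "?e (a - 1) * ?e b \<le> ?e a * ?e (b - 1)" using IH[of a "b - 1"] insert.prems(2) by simp
    moreover have "?e (a - 2) * ?e (b + 1) \<le> ?e (a - 1) * ?e b"
      using IH[of "a - 1" "b"] insert.prems(2) by simp
    ultimately show ?thesis by simp
  qed
  have "(1 - y)\<^sup>2 * (?e a * ?e b - ?e (a - 1) * ?e (b + 1)) +
      y\<^sup>2 * (?e (a - 1) * ?e (b - 1) - ?e (a - 2) * ?e b) +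
      y * (1 - y) * (?e a * ?e (b - 1) - ?e (a - 2) * ?e (b + 1)) \<ge> 0"
    using e1 e2 e3 y by (intro add_nonneg_nonneg mult_nonneg_nonneg) auto
  then show ?case
    unfolding size_weight_insert[OF insert.hyps(1,2)] y_def[symmetric]
    by (simp add: algebra_simps power2_eq_square)
qed

text \<open>Only proportionality to the Bernoulli weights is required, with an unspecified constant.
  A common factor on the odds is invisible in such a law, which leaves room for the normalisation
  \<open>sum_p\<close>.\<close>

locale rejective =
  fixes U :: "'i set" and n :: nat and p :: "'i \<Rightarrow> real" and P :: "'i set \<Rightarrow> real"
  assumes fin [simp]: "finite U"
    and p01: "\<And>i. i \<in> U \<Longrightarrow> 0 \<le> p i \<and> p i \<le> 1"
    and sum_p: "sum p U = real n"
    and n_pos: "0 < n"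
    and P_prop: "\<exists>Z>0. \<forall>s. s \<subseteq> U \<and> card s = n \<longrightarrow> P s = bern_weight p U s / Z"
    and sum_P: "sum P {s. s \<subseteq> U \<and> card s = n} = 1"
begin

definition samples :: "'i set set" where "samples = {s. s \<subseteq> U \<and> card s = n}"

lemma fin_samples [simp]: "finite samples" unfolding samples_def by simp

lemma samplesD: assumes "s \<in> samples" shows "s \<subseteq> U" "card s = n" "finite s"
  using assms finite_subset[OF _ fin] by (auto simp: samples_def)

lemma P_nonneg: "s \<in> samples \<Longrightarrow> 0 \<le> P s"
proof -
  assume s: "s \<in> samples"
  obtain Z where "Z > 0" "P s = bern_weight p U s / Z" using P_prop s by (auto simp: samples_def)
  then show ?thesis using bern_weight_nonneg[OF p01 samplesD(1)[OF s]] by simp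
qed

text \<open>A finite sum with values in any real vector space: real moments and complex
  characteristic functions share one set of rules, and no integrability has to be discussed.\<close>

definition ex :: "('i set \<Rightarrow> 'b::real_vector) \<Rightarrow> 'b" where
  "ex f = (\<Sum>s\<in>samples. P s *\<^sub>R f s)"

definition inc :: "'i \<Rightarrow> real" where "inc i = ex (\<lambda>s. of_bool (i \<in> s))"
definition inc2 :: "'i \<Rightarrow> 'i \<Rightarrow> real" where "inc2 i j = ex (\<lambda>s. of_bool (i \<in> s) * of_bool (j \<in> s))"
definition cov :: "'i \<Rightarrow> 'i \<Rightarrow> real" where "cov i j = inc2 i j - inc i * inc j"

lemma ex_add: "ex (\<lambda>s. f s + g s) = ex f + ex g"
  by (simp add: ex_def scaleR_add_right sum.distrib)
lemma ex_diff: "ex (\<lambda>s. f s - g s) = ex f - ex g"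
  by (simp add: ex_def scaleR_diff_right sum_subtractf)
lemma ex_scaleR: "ex (\<lambda>s. c *\<^sub>R f s) = c *\<^sub>R ex f"
  by (simp add: ex_def scaleR_sum_right mult.commute)
lemma ex_cmult: "ex (\<lambda>s. c * f s) = c * ex f" for c :: "'b::real_algebra"
  by (simp add: ex_def sum_distrib_left)
lemma ex_scaleR_left: "ex (\<lambda>s. f s *\<^sub>R v) = ex f *\<^sub>R v" for f :: "_ \<Rightarrow> real"
  unfolding ex_def scaleR_sum_left by simp
lemma ex_const [simp]: "ex (\<lambda>s. c) = c"
  using sum_P by (simp add: ex_def samples_def flip: scaleR_sum_left)
lemma ex_sum: "ex (\<lambda>s. \<Sum>i\<in>I. f i s) = (\<Sum>i\<in>I. ex (f i))"
  unfolding ex_def scaleR_sum_right by (rule sum.swap)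
lemma ex_cong: "(\<And>s. s \<in> samples \<Longrightarrow> f s = g s) \<Longrightarrow> ex f = ex g"
  by (simp add: ex_def)
lemma ex_mono: "(\<And>s. s \<in> samples \<Longrightarrow> f s \<le> g s) \<Longrightarrow> ex f \<le> ex g" for f :: "_ \<Rightarrow> real"
  unfolding ex_def by (intro sum_mono) (simp add: P_nonneg mult_left_mono)
lemma ex_nonneg: "(\<And>s. s \<in> samples \<Longrightarrow> 0 \<le> f s) \<Longrightarrow> 0 \<le> ex f" for f :: "_ \<Rightarrow> real"
  using ex_mono[of "\<lambda>_. 0" f] by simp
lemma norm_ex_le: "norm (ex f) \<le> ex (\<lambda>s. norm (f s))" for f :: "_ \<Rightarrow> 'b::real_normed_vector"
  unfolding ex_def by (rule order.trans[OF norm_sum]) (auto intro!: sum_mono simp: P_nonneg)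
lemma abs_ex_le: "\<bar>ex f\<bar> \<le> ex (\<lambda>s. \<bar>f s\<bar>)" for f :: "_ \<Rightarrow> real"
  using norm_ex_le[of f] by simp

lemma ex_Cauchy_Schwarz: "(ex (\<lambda>s. f s * g s))\<^sup>2 \<le> ex (\<lambda>s. (f s)\<^sup>2) * ex (\<lambda>s. (g s)\<^sup>2)" for f g :: "_ \<Rightarrow> real"
proof -
  have "(\<Sum>s\<in>samples. (sqrt (P s) * f s) * (sqrt (P s) * g s))\<^sup>2 \<le>
      (\<Sum>s\<in>samples. (sqrt (P s) * f s)\<^sup>2) * (\<Sum>s\<in>samples. (sqrt (P s) * g s)\<^sup>2)"
    by (rule Cauchy_Schwarz_ineq_sum)
  moreover have "(\<Sum>s\<in>samples. (sqrt (P s) * f s) * (sqrt (P s) * g s)) = ex (\<lambda>s. f s * g s)"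
  proof -
    have "(sqrt (P s) * f s) * (sqrt (P s) * g s) = (sqrt (P s))\<^sup>2 * (f s * g s)" for s
      by (simp add: power2_eq_square algebra_simps)
    then show ?thesis unfolding ex_def by (intro sum.cong) (auto simp: P_nonneg)
  qed
  moreover have "(\<Sum>s\<in>samples. (sqrt (P s) * h s)\<^sup>2) = ex (\<lambda>s. (h s)\<^sup>2)" for h :: "_ \<Rightarrow> real"
    unfolding ex_def by (intro sum.cong) (auto simp: P_nonneg power_mult_distrib)
  ultimately show ?thesis by simp
qed

lemma ex_abs_mult_le: "ex (\<lambda>s. \<bar>f s * g s\<bar>) \<le> sqrt (ex (\<lambda>s. (f s)\<^sup>2) * ex (\<lambda>s. (g s)\<^sup>2))" for f g :: "_ \<Rightarrow> real"
  using ex_Cauchy_Schwarz[of "\<lambda>s. \<bar>f s\<bar>" "\<lambda>s. \<bar>g s\<bar>"] by (simp add: abs_mult real_le_rsqrt)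

lemma ex_abs_le: "ex (\<lambda>s. \<bar>f s\<bar>) \<le> sqrt (ex (\<lambda>s. (f s)\<^sup>2))" for f :: "_ \<Rightarrow> real"
  using ex_abs_mult_le[of f "\<lambda>_. 1"] by simp

lemma ex_abs_product_diff:
  fixes f h :: "'i set \<Rightarrow> real"
  shows "ex (\<lambda>s. \<bar>f s * h s - c * d\<bar>) \<le> ex (\<lambda>s. \<bar>(f s - c) * h s\<bar>) + \<bar>c\<bar> * ex (\<lambda>s. \<bar>h s - d\<bar>)"
proof -
  have "ex (\<lambda>s. \<bar>f s * h s - c * d\<bar>) \<le> ex (\<lambda>s. \<bar>(f s - c) * h s\<bar> + \<bar>c\<bar> * \<bar>h s - d\<bar>)"
  proof (intro ex_mono)
    fix s
    have "f s * h s - c * d = (f s - c) * h s + c * (h s - d)" by (simp add: algebra_simps)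
    then show "\<bar>f s * h s - c * d\<bar> \<le> \<bar>(f s - c) * h s\<bar> + \<bar>c\<bar> * \<bar>h s - d\<bar>"
      by (metis abs_mult abs_triangle_ineq)
  qed
  then show ?thesis by (simp add: ex_add ex_cmult)
qed

lemma ex_lin: "ex (\<lambda>s. \<Sum>i\<in>s. f i) = (\<Sum>i\<in>U. inc i *\<^sub>R f i)"
proof -
  have "ex (\<lambda>s. \<Sum>i\<in>s. f i) = ex (\<lambda>s. \<Sum>i\<in>U. of_bool (i \<in> s) *\<^sub>R f i)"
    by (intro ex_cong sum.mono_neutral_cong_left) (auto dest: samplesD)
  also have "\<dots> = (\<Sum>i\<in>U. ex (\<lambda>s. of_bool (i \<in> s) *\<^sub>R f i))" by (rule ex_sum)
  also have "\<dots> = (\<Sum>i\<in>U. inc i *\<^sub>R f i)"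
    by (simp only: ex_scaleR_left inc_def)
  finally show ?thesis .
qed

lemma ex_lin_lin: "ex (\<lambda>s. (\<Sum>i\<in>s. a i) * (\<Sum>j\<in>s. b j)) = (\<Sum>i\<in>U. \<Sum>j\<in>U. inc2 i j * (a i * b j))"
  for a b :: "'i \<Rightarrow> real"
proof -
  have "ex (\<lambda>s. (\<Sum>i\<in>s. a i) * (\<Sum>j\<in>s. b j)) = ex (\<lambda>s. \<Sum>i\<in>U. \<Sum>j\<in>U. of_bool (i \<in> s) * of_bool (j \<in> s) * (a i * b j))"
  proof (intro ex_cong)
    fix s assume s: "s \<in> samples"
    have *: "(\<Sum>i\<in>s. c i) = (\<Sum>i\<in>U. of_bool (i \<in> s) * c i)" for c :: "'i \<Rightarrow> real"
      using s by (intro sum.mono_neutral_cong_left) (auto dest: samplesD)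
    show "(\<Sum>i\<in>s. a i) * (\<Sum>j\<in>s. b j) = (\<Sum>i\<in>U. \<Sum>j\<in>U. of_bool (i \<in> s) * of_bool (j \<in> s) * (a i * b j))"
      unfolding *[of a] *[of b] sum_product by (intro sum.cong) (auto simp only: mult_ac)
  qed
  also have "\<dots> = (\<Sum>i\<in>U. \<Sum>j\<in>U. inc2 i j * (a i * b j))"
    unfolding ex_sum inc2_def
    by (intro sum.cong refl) (use ex_scaleR_left[where 'b = real] in simp)
  finally show ?thesis .
qed

lemma inc_nonneg: "0 \<le> inc i" unfolding inc_def by (rule ex_nonneg) simp
lemma inc_le_1: "inc i \<le> 1" unfolding inc_def using ex_mono[of "\<lambda>s. of_bool (i \<in> s)" "\<lambda>_. 1"] by simp
lemma sum_inc: "sum inc U = real n"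
  using ex_lin[of "\<lambda>_. 1::real"] ex_cong[of "\<lambda>s. \<Sum>i\<in>s. 1::real" "\<lambda>_. real n"] by (simp add: samplesD)
lemma inc2_commute: "inc2 i j = inc2 j i" by (simp add: inc2_def mult.commute)
lemma cov_commute: "cov i j = cov j i" by (simp add: cov_def inc2_commute)
lemma inc2_same: "inc2 i i = inc i"
  unfolding inc2_def inc_def by (intro ex_cong) simp
lemma sum_inc2: "(\<Sum>j\<in>U. inc2 i j) = real n * inc i"
proof -
  have "(\<Sum>j\<in>U. inc2 i j) = ex (\<lambda>s. of_bool (i \<in> s) * (\<Sum>j\<in>U. of_bool (j \<in> s)))"
    unfolding inc2_def ex_sum[symmetric] sum_distrib_left ..
  also have "\<dots> = ex (\<lambda>s. real n * of_bool (i \<in> s))"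
  proof (intro ex_cong)
    fix s assume "s \<in> samples"
    then have "(\<Sum>j\<in>U. of_bool (j \<in> s)) = real n"
      using samplesD[of s] by (simp add: Int_absorb1)
    then show "of_bool (i \<in> s) * (\<Sum>j\<in>U. of_bool (j \<in> s)) = real n * of_bool (i \<in> s)" by simp
  qed
  finally show ?thesis by (simp add: ex_cmult inc_def)
qed
lemma sum_cov: "(\<Sum>j\<in>U. cov i j) = 0"
  by (simp add: cov_def sum_subtractf sum_inc2 sum_inc flip: sum_distrib_left)

text \<open>Once the membership of \<open>i\<close> and \<open>j\<close> is fixed, the other units
  contribute a weight that depends only on how many of them are still to be drawn. The covariance
  then factors into the Bernoulli variances of \<open>i\<close> and \<open>j\<close> times
  \<open>E 2 * E 0 - E 1 * E 1\<close>, whose sign is log-concavity at \<open>n - 1\<close>.\<close>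

lemma cov_nonpos:
  assumes "i \<in> U" "j \<in> U" "i \<noteq> j"
  shows "cov i j \<le> 0"
proof -
  obtain Z where Z: "Z > 0" "\<And>s. s \<in> samples \<Longrightarrow> P s = bern_weight p U s / Z"
    using P_prop by (auto simp: samples_def)
  define V where "V = U - {i, j}"
  have V: "finite V" "i \<notin> insert j V" "j \<notin> V" "U = insert i (insert j V)" "finite (insert j V)" "i \<notin> V"
    using assms fin by (auto simp: V_def)
  have S: "samples = {s. s \<subseteq> U \<and> int (card s) = int n}" by (auto simp: samples_def)
  define E where "E k = size_weight p V (int n - k)" for k
  have W: "Z * ex f = (\<Sum>s | s \<subseteq> U \<and> int (card s) = int n. bern_weight p U s * f s)" for f :: "_ \<Rightarrow> real"
    unfolding ex_def sum_distrib_left S[symmetric] using Z by (intro sum.cong) auto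
  have split: "(\<Sum>s | s \<subseteq> U \<and> int (card s) = int n. h s) =
      (\<Sum>s | s \<subseteq> V \<and> int (card s) = int n. h s) + (\<Sum>s | s \<subseteq> V \<and> int (card s) = int n - 1. h (insert j s)) +
      ((\<Sum>s | s \<subseteq> V \<and> int (card s) = int n - 1. h (insert i s)) +
       (\<Sum>s | s \<subseteq> V \<and> int (card s) = int n - 1 - 1. h (insert i (insert j s))))" for h :: "'i set \<Rightarrow> real"
    unfolding V(4) sum_subsets_insert[OF V(5) V(2)] sum_subsets_insert[OF V(1) V(3)] ..
  \<comment> \<open>For \<open>f\<close> depending on \<open>s\<close> only through the membership
    of \<open>i\<close> and \<open>j\<close> there are four terms; \<open>E m\<close> is the total
    weight of the sets of \<open>n - m\<close> other units.\<close>
  have decomp: "Z * ex f = 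
      (1 - p i) * (1 - p j) * F00 * E 0 + (1 - p i) * p j * F01 * E 1 +
      p i * (1 - p j) * F10 * E 1 + p i * p j * F11 * E 2"
    if f: "\<And>s. s \<subseteq> V \<Longrightarrow> f s = F00 \<and> f (insert j s) = F01 \<and> f (insert i s) = F10 \<and> f (insert i (insert j s)) = F11"
    for f :: "_ \<Rightarrow> real" and F00 F01 F10 F11
  proof -
    have w: "bern_weight p (insert i (insert j V)) s = (1 - p i) * (1 - p j) * bern_weight p V s"
       "bern_weight p (insert i (insert j V)) (insert j s) = (1 - p i) * p j * bern_weight p V s"
       "bern_weight p (insert i (insert j V)) (insert i s) = p i * (1 - p j) * bern_weight p V s"
       "bern_weight p (insert i (insert j V)) (insert i (insert j s)) = p i * p j * bern_weight p V s"
      if "s \<subseteq> V" for s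
      using that V by (simp_all add: bern_weight_insert_in bern_weight_insert_notin subset_insertI2 insert_mono)
    have *: "(\<Sum>s | s \<subseteq> V \<and> int (card s) = k. bern_weight p U (g s) * f (g s)) = c * F * size_weight p V k"
      if "\<And>s. s \<subseteq> V \<Longrightarrow> bern_weight p U (g s) = c * bern_weight p V s \<and> f (g s) = F" for g c F k
      unfolding size_weight_def sum_distrib_left using that by (intro sum.cong) auto
    have 1: "(\<Sum>s | s \<subseteq> V \<and> int (card s) = int n. bern_weight p U s * f s) = (1 - p i) * (1 - p j) * F00 * size_weight p V (int n)"
      by (rule *[of "\<lambda>s. s"]) (use w f V(4) in auto)
    have 2: "(\<Sum>s | s \<subseteq> V \<and> int (card s) = int n - 1. bern_weight p U (insert j s) * f (insert j s)) = (1 - p i) * p j * F01 * size_weight p V (int n - 1)"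
      by (rule *[of "\<lambda>s. insert j s"]) (use w f V(4) in auto)
    have 3: "(\<Sum>s | s \<subseteq> V \<and> int (card s) = int n - 1. bern_weight p U (insert i s) * f (insert i s)) = p i * (1 - p j) * F10 * size_weight p V (int n - 1)"
      by (rule *[of "\<lambda>s. insert i s"]) (use w f V(4) in auto)
    have 4: "(\<Sum>s | s \<subseteq> V \<and> int (card s) = int n - 1 - 1. bern_weight p U (insert i (insert j s)) * f (insert i (insert j s))) = p i * p j * F11 * size_weight p V (int n - 1 - 1)"
      by (rule *[of "\<lambda>s. insert i (insert j s)"]) (use w f V(4) in auto)
    show ?thesis
      unfolding W split[of "\<lambda>s. bern_weight p U s * f s"] 1 2 3 4 by (simp add: E_def)
  qed
  have a0: "Z = (1 - p i) * (1 - p j) * E 0 + (1 - p i) * p j * E 1 + p i * (1 - p j) * E 1 + p i * p j * E 2"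
    using decomp[of "\<lambda>_. 1" 1 1 1 1] by simp
  have a1: "Z * inc i = p i * (1 - p j) * E 1 + p i * p j * E 2"
    using decomp[of "\<lambda>s. of_bool (i \<in> s)" 0 0 1 1] V assms unfolding inc_def by auto
  have a2: "Z * inc j = (1 - p i) * p j * E 1 + p i * p j * E 2"
    using decomp[of "\<lambda>s. of_bool (j \<in> s)" 0 1 0 1] V assms unfolding inc_def by auto
  have a3: "Z * inc2 i j = p i * p j * E 2"
    using decomp[of "\<lambda>s. of_bool (i \<in> s) * of_bool (j \<in> s)" 0 0 0 1] V assms unfolding inc2_def by auto
  have lc: "E 2 * E 0 \<le> E 1 * E 1"
    using size_weight_log_concave[OF V(1), of p "int n - 1" "int n - 1"] p01 unfolding E_def V_def
    by (simp add: mult.commute)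
  have "Z\<^sup>2 * cov i j = Z * (Z * inc2 i j) - (Z * inc i) * (Z * inc j)"
    by (simp add: cov_def power2_eq_square algebra_simps)
  also have "\<dots> = (p i * (1 - p i)) * (p j * (1 - p j)) * (E 2 * E 0 - E 1 * E 1)"
    unfolding a1 a2 a3 by (subst a0) (simp add: algebra_simps)
  also have "\<dots> \<le> 0" using lc p01[OF assms(1)] p01[OF assms(2)]
    by (intro mult_nonneg_nonpos mult_nonneg_nonneg) auto
  finally show ?thesis using Z(1) by (simp add: mult_le_0_iff)
qed

end

section \<open>The swap dynamics\<close>

context rejective begin

definition swap :: "'i \<Rightarrow> 'i \<Rightarrow> 'i set \<Rightarrow> 'i set" where "swap i j s = insert j (s - {i})"

text \<open>A sum over all moves out of \<open>s\<close>, weighted by their rates. With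
  \<open>G i j\<close> the increment of a function under the move it is the generator applied to
  that function.\<close>

definition swap_sum :: "'i set \<Rightarrow> ('i \<Rightarrow> 'i \<Rightarrow> 'b::real_vector) \<Rightarrow> 'b" where
  "swap_sum s G = (\<Sum>i\<in>s. \<Sum>j\<in>U - s. (p j * (1 - p i)) *\<^sub>R G i j)"

definition rate :: "'i set \<Rightarrow> real" where "rate s = (\<Sum>i\<in>s. 1 - p i)"
definition mrate :: real where "mrate = ex rate"
text \<open>The expectation of the sample total of \<open>a\<close>: the weights add up to
  \<open>n\<close>, so this is not an average.\<close>

definition mean :: "('i \<Rightarrow> real) \<Rightarrow> real" where "mean a = (\<Sum>i\<in>U. inc i * a i)"

lemma ex_mean: "ex (\<lambda>s. \<Sum>i\<in>s. a i) = mean a" using ex_lin[of a] by (simp add: mean_def)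

text \<open>The fifth conclusion is detailed balance. The weights of \<open>s\<close> and of the
  swapped sample share the factor \<open>R\<close>, and what remains of each is the rate of the move
  that leads to it.\<close>

lemma swap_samples:
  assumes "s \<in> samples" "i \<in> s" "j \<in> U - s"
  shows "swap i j s \<in> samples" "j \<in> swap i j s" "i \<in> U - swap i j s" "swap j i (swap i j s) = s"
    "P (swap i j s) * (p i * (1 - p j)) = P s * (p j * (1 - p i))"
    "(\<Sum>k\<in>swap i j s. a k) = (\<Sum>k\<in>s. a k) + (a j - a i :: real)"
proof -
  have s: "s \<subseteq> U" "card s = n" "finite s" using samplesD assms(1) by auto
  have "i \<noteq> j" using assms by auto
  have "card (swap i j s) = n"
    using assms s unfolding swap_def by (simp add: card_insert_if) (metis card_gt_0_iff empty_iff Suc_pred)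
  then show sw: "swap i j s \<in> samples" using assms s by (auto simp: samples_def swap_def)
  show "j \<in> swap i j s" by (simp add: swap_def)
  show "i \<in> U - swap i j s" using assms s \<open>i \<noteq> j\<close> by (auto simp: swap_def)
  show "swap j i (swap i j s) = s" using assms by (auto simp: swap_def)
  show "(\<Sum>k\<in>swap i j s. a k) = (\<Sum>k\<in>s. a k) + (a j - a i :: real)"
    using assms s by (simp add: swap_def sum.remove[of s i a])
  obtain Z where Z: "Z > 0" "\<And>s. s \<in> samples \<Longrightarrow> P s = bern_weight p U s / Z"
    using P_prop by (auto simp: samples_def)
  define R where "R = (\<Prod>k\<in>s - {i}. p k) * (\<Prod>k\<in>U - s - {j}. 1 - p k)"
  have 1: "bern_weight p U s = p i * (1 - p j) * R"
    unfolding bern_weight_def R_def using assms s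
    by (simp add: prod.remove[of s i p] prod.remove[of "U - s" j "\<lambda>k. 1 - p k"])
  have "U - swap i j s = insert i (U - s - {j})" using assms s \<open>i \<noteq> j\<close> by (auto simp: swap_def)
  then have 2: "bern_weight p U (swap i j s) = p j * (1 - p i) * R"
    unfolding bern_weight_def R_def using assms s by (simp add: swap_def)
  show "P (swap i j s) * (p i * (1 - p j)) = P s * (p j * (1 - p i))"
    using Z(2)[OF sw] Z(2)[OF assms(1)] by (simp add: 1 2)
qed

text \<open>By detailed balance a move and its reversal carry the same weight, so sending
  \<open>(s, i, j)\<close> to \<open>(swap i j s, j, i)\<close> permutes the terms of the
  expectation.\<close>

lemma ex_swap_sum:
  fixes F :: "'i set \<Rightarrow> 'i \<Rightarrow> 'i \<Rightarrow> 'b::real_vector"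
  shows "ex (\<lambda>s. swap_sum s (F s)) = ex (\<lambda>s. swap_sum s (\<lambda>i j. F (swap i j s) j i))"
proof -
  have T: "ex (\<lambda>s. swap_sum s (G s)) =
     (\<Sum>(s, i, j)\<in>Sigma samples (\<lambda>s. s \<times> (U - s)). (P s * (p j * (1 - p i))) *\<^sub>R G s i j)"
    for G :: "'i set \<Rightarrow> 'i \<Rightarrow> 'i \<Rightarrow> 'b"
    unfolding ex_def swap_sum_def
    by (subst sum.Sigma[symmetric])
      (auto intro!: sum.cong simp: scaleR_sum_right samplesD sum.cartesian_product)
  show ?thesis unfolding T
    by (rule sum.reindex_bij_witness[of _ "\<lambda>(s, i, j). (swap i j s, j, i)" "\<lambda>(s, i, j). (swap i j s, j, i)"])
      (use swap_samples in auto)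
qed

lemma rate_eq: assumes "s \<in> samples" shows "rate s = (\<Sum>j\<in>U - s. p j)"
proof -
  have "(\<Sum>j\<in>U - s. p j) = real n - (\<Sum>j\<in>s. p j)"
    using samplesD[OF assms] by (subst sum_diff) (auto simp: sum_p)
  then show ?thesis using samplesD[OF assms] by (simp add: rate_def sum_subtractf)
qed

lemma rate_bounds: assumes "s \<in> samples" shows "0 \<le> rate s" "rate s \<le> real n"
proof -
  have *: "0 \<le> p i \<and> p i \<le> 1" if "i \<in> s" for i using samplesD[OF assms] p01 that by auto
  show "0 \<le> rate s" unfolding rate_def using * by (intro sum_nonneg) auto
  have "rate s \<le> (\<Sum>i\<in>s. 1)" unfolding rate_def using * by (intro sum_mono) auto
  then show "rate s \<le> real n" using samplesD[OF assms] by simp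
qed

lemma swap_sum_scaleR:
  fixes G :: "'i \<Rightarrow> 'i \<Rightarrow> real"
  shows "swap_sum s (\<lambda>i j. G i j *\<^sub>R v) = swap_sum s G *\<^sub>R v"
  by (simp add: swap_sum_def scaleR_sum_left)

lemma swap_sum_diff: "swap_sum s (\<lambda>i j. G i j - H i j) = swap_sum s G - swap_sum s H"
  by (simp add: swap_sum_def sum_subtractf scaleR_diff_right)
lemma swap_sum_add: "swap_sum s (\<lambda>i j. G i j + H i j) = swap_sum s G + swap_sum s H"
  by (simp add: swap_sum_def sum.distrib scaleR_add_right)
lemma swap_sum_cmult:
  fixes c :: "'b::real_algebra"
  shows "swap_sum s (\<lambda>i j. c * G i j) = c * swap_sum s G"
  by (simp add: swap_sum_def sum_distrib_left)

lemma swap_sum_mono: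
  fixes G :: "'i \<Rightarrow> 'i \<Rightarrow> real"
  assumes "s \<in> samples" "\<And>i j. i \<in> s \<Longrightarrow> j \<in> U - s \<Longrightarrow> G i j \<le> H i j"
  shows "swap_sum s G \<le> swap_sum s H"
  unfolding swap_sum_def using assms p01 samplesD[OF assms(1)]
  by (intro sum_mono) (auto intro!: mult_left_mono mult_nonneg_nonneg simp: subset_iff)

lemma norm_swap_sum_le:
  fixes G :: "'i \<Rightarrow> 'i \<Rightarrow> 'b::real_normed_vector"
  assumes "s \<in> samples"
  shows "norm (swap_sum s G) \<le> swap_sum s (\<lambda>i j. norm (G i j))"
  unfolding swap_sum_def using assms p01 samplesD[OF assms(1)]
  by (intro order.trans[OF norm_sum] sum_mono) (auto simp: subset_iff abs_mult)

lemma swap_sum_prod: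
  fixes f g :: "'i \<Rightarrow> real"
  shows "swap_sum s (\<lambda>i j. f i * g j) = (\<Sum>i\<in>s. (1 - p i) * f i) * (\<Sum>j\<in>U - s. p j * g j)"
  unfolding swap_sum_def sum_product by (intro sum.cong) (auto simp: algebra_simps)

text \<open>The rates are products, and \<open>1 - p i\<close> summed over the sample equals
  \<open>p j\<close> summed over the complement. Both marginal sums are therefore
  \<open>rate s\<close>, which factors out of the drift and leaves the centred total.\<close>

lemma swap_sum_linear:
  assumes "s \<in> samples"
  shows "swap_sum s (\<lambda>i j. a j - a i) = - (rate s * ((\<Sum>i\<in>s. a i) - (\<Sum>i\<in>U. p i * a i)))"
proof -
  have 1: "swap_sum s (\<lambda>i j. a j) = rate s * (\<Sum>j\<in>U - s. p j * a j)"
    using swap_sum_prod[of s "\<lambda>_. 1" a] by (simp add: rate_def)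
  have 2: "swap_sum s (\<lambda>i j. a i) = (\<Sum>i\<in>s. (1 - p i) * a i) * rate s"
    using swap_sum_prod[of s a "\<lambda>_. 1"] rate_eq[OF assms] by simp
  have 3: "(\<Sum>j\<in>U - s. p j * a j) = (\<Sum>j\<in>U. p j * a j) - (\<Sum>j\<in>s. p j * a j)"
    using samplesD[OF assms] by (subst sum_diff) auto
  show ?thesis unfolding swap_sum_diff 1 2 3
    by (simp add: algebra_simps sum_subtractf)
qed

text \<open>Exchanging one selected unit against one unselected unit with rate \<open>p j * (1 - p i)\<close> is a
  reversible dynamics, and the centred linear statistic is an eigenfunction up to the factor
  \<open>rate s\<close>.\<close>
lemma swap_identity:
  "ex (\<lambda>s. (rate s * ((\<Sum>i\<in>s. a i) - (\<Sum>i\<in>U. p i * a i))) *\<^sub>R g s) =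
   (1 / 2) *\<^sub>R ex (\<lambda>s. swap_sum s (\<lambda>i j. (a j - a i) *\<^sub>R (g (swap i j s) - g s)))"
proof -
  let ?E = "ex (\<lambda>s. swap_sum s (\<lambda>i j. (a j - a i) *\<^sub>R g s))"
  have 1: "ex (\<lambda>s. (rate s * ((\<Sum>i\<in>s. a i) - (\<Sum>i\<in>U. p i * a i))) *\<^sub>R g s) = - ?E"
    unfolding swap_sum_scaleR ex_scaleR[of "-1", simplified, symmetric]
    by (intro ex_cong) (simp add: swap_sum_linear)
  have 2: "?E = ex (\<lambda>s. swap_sum s (\<lambda>i j. (a i - a j) *\<^sub>R g (swap i j s)))"
    by (rule ex_swap_sum)
  have "ex (\<lambda>s. swap_sum s (\<lambda>i j. (a j - a i) *\<^sub>R (g (swap i j s) - g s))) =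
    ex (\<lambda>s. - swap_sum s (\<lambda>i j. (a i - a j) *\<^sub>R g (swap i j s)) - swap_sum s (\<lambda>i j. (a j - a i) *\<^sub>R g s))"
    by (intro ex_cong) (simp add: swap_sum_def flip: sum_negf sum_subtractf scaleR_diff_right, simp add: algebra_simps)
  also have "\<dots> = - ?E - ?E" unfolding ex_diff 2[symmetric]
    using ex_scaleR[of "-1" "\<lambda>s. swap_sum s (\<lambda>i j. (a i - a j) *\<^sub>R g (swap i j s))"] 2 by simp
  also have "\<dots> = -2 *\<^sub>R ?E" by (simp add: scaleR_2)
  finally show ?thesis unfolding 1 by simp
qed

section \<open>Variances and covariances of sample totals\<close>

lemma cov_same: "cov i i = inc i * (1 - inc i)" by (simp add: cov_def inc2_same algebra_simps)

text \<open>With a fixed sample size each row of covariances sums to zero, and off the diagonal all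
  entries are non-positive. The absolute row sum is hence twice the diagonal entry.\<close>

lemma sum_abs_cov: assumes "i \<in> U" shows "(\<Sum>j\<in>U. \<bar>cov i j\<bar>) \<le> 2 * inc i"
proof -
  have "(\<Sum>j\<in>U. \<bar>cov i j\<bar>) = \<bar>cov i i\<bar> + (\<Sum>j\<in>U - {i}. \<bar>cov i j\<bar>)"
    using assms by (simp add: sum.remove)
  also have "(\<Sum>j\<in>U - {i}. \<bar>cov i j\<bar>) = - (\<Sum>j\<in>U - {i}. cov i j)"
    unfolding sum_negf[symmetric] using cov_nonpos assms by (intro sum.cong) auto
  also have "\<dots> = cov i i" using sum_cov[of i] assms by (simp add: sum.remove[of U i])
  also have "\<bar>cov i i\<bar> + cov i i \<le> 2 * inc i"
    using inc_nonneg[of i] inc_le_1[of i] by (simp add: cov_same abs_mult mult_left_le)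
  finally show ?thesis .
qed

lemma sum_sum_abs_cov:
  assumes "\<And>i. i \<in> U \<Longrightarrow> 0 \<le> f i"
  shows "(\<Sum>i\<in>U. \<Sum>j\<in>U. \<bar>cov i j\<bar> * f i) \<le> 2 * mean f" "(\<Sum>i\<in>U. \<Sum>j\<in>U. \<bar>cov i j\<bar> * f j) \<le> 2 * mean f"
proof -
  show 1: "(\<Sum>i\<in>U. \<Sum>j\<in>U. \<bar>cov i j\<bar> * f i) \<le> 2 * mean f"
    unfolding mean_def sum_distrib_left sum_distrib_right[symmetric]
    using sum_abs_cov assms by (intro sum_mono) (simp add: mult_right_mono mult.assoc[symmetric])
  have "(\<Sum>i\<in>U. \<Sum>j\<in>U. \<bar>cov i j\<bar> * f j) = (\<Sum>i\<in>U. \<Sum>j\<in>U. \<bar>cov i j\<bar> * f i)"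
    by (subst sum.swap) (simp add: cov_commute)
  then show "(\<Sum>i\<in>U. \<Sum>j\<in>U. \<bar>cov i j\<bar> * f j) \<le> 2 * mean f" using 1 by simp
qed

lemma mean_nonneg: "(\<And>i. i \<in> U \<Longrightarrow> 0 \<le> f i) \<Longrightarrow> 0 \<le> mean f"
  unfolding mean_def by (intro sum_nonneg mult_nonneg_nonneg inc_nonneg)
lemma mean_mono: "(\<And>i. i \<in> U \<Longrightarrow> f i \<le> g i) \<Longrightarrow> mean f \<le> mean g"
  unfolding mean_def by (intro sum_mono mult_left_mono inc_nonneg) auto
lemma mean_add: "mean (\<lambda>i. f i + g i) = mean f + mean g"
  by (simp add: mean_def sum.distrib algebra_simps)
lemma mean_cmult: "mean (\<lambda>i. c * f i) = c * mean f"
  by (simp add: mean_def sum_distrib_left algebra_simps)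
lemma mean_const: "mean (\<lambda>i. c) = real n * c"
  by (simp add: mean_def sum_inc flip: sum_distrib_right)
lemma mean_Cauchy_Schwarz: "(mean (\<lambda>i. f i * g i))\<^sup>2 \<le> mean (\<lambda>i. (f i)\<^sup>2) * mean (\<lambda>i. (g i)\<^sup>2)"
proof -
  have "(\<Sum>i\<in>U. (sqrt (inc i) * f i) * (sqrt (inc i) * g i))\<^sup>2 \<le>
      (\<Sum>i\<in>U. (sqrt (inc i) * f i)\<^sup>2) * (\<Sum>i\<in>U. (sqrt (inc i) * g i)\<^sup>2)"
    by (rule Cauchy_Schwarz_ineq_sum)
  moreover have "(sqrt (inc i) * f i) * (sqrt (inc i) * g i) = inc i * (f i * g i)" for i
  proof -
    have "(sqrt (inc i) * f i) * (sqrt (inc i) * g i) = (sqrt (inc i))\<^sup>2 * (f i * g i)"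
      by (simp add: power2_eq_square algebra_simps)
    then show ?thesis using inc_nonneg[of i] by simp
  qed
  moreover have "(sqrt (inc i) * h i)\<^sup>2 = inc i * (h i)\<^sup>2" for i and h :: "'i \<Rightarrow> real"
    using inc_nonneg by (simp add: power_mult_distrib)
  ultimately show ?thesis by (simp add: mean_def)
qed

definition covar :: "('i \<Rightarrow> real) \<Rightarrow> ('i \<Rightarrow> real) \<Rightarrow> real" where
  "covar a b = (\<Sum>i\<in>U. \<Sum>j\<in>U. cov i j * (a i * b j))"

lemma ex_covar: "ex (\<lambda>s. ((\<Sum>i\<in>s. a i) - mean a) * ((\<Sum>i\<in>s. b i) - mean b)) = covar a b"
proof -
  have "ex (\<lambda>s. ((\<Sum>i\<in>s. a i) - mean a) * ((\<Sum>i\<in>s. b i) - mean b)) =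
    ex (\<lambda>s. (\<Sum>i\<in>s. a i) * (\<Sum>i\<in>s. b i) - mean a * (\<Sum>i\<in>s. b i) - mean b * (\<Sum>i\<in>s. a i) + mean a * mean b)"
    by (simp add: algebra_simps)
  also have "\<dots> = ex (\<lambda>s. (\<Sum>i\<in>s. a i) * (\<Sum>i\<in>s. b i)) - mean a * mean b"
    by (simp add: ex_add ex_diff ex_cmult ex_mean)
  also have "\<dots> = covar a b"
    unfolding ex_lin_lin
    by (simp add: covar_def cov_def mean_def sum_product flip: sum_subtractf) (simp add: algebra_simps)
  finally show ?thesis .
qed

lemma ex_variance: "ex (\<lambda>s. ((\<Sum>i\<in>s. a i) - mean a)\<^sup>2) = covar a a"
  using ex_covar[of a a] by (simp add: power2_eq_square)

text \<open>Each product \<open>a i * a j\<close> is at most half the sum of the squares, and the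
  absolute row sums do the rest. The variance of a total is thus bounded by a plain sum of squares,
  as under independent selection; this is the source of all concentration below.\<close>

lemma covar_le: "covar a a \<le> 2 * mean (\<lambda>i. (a i)\<^sup>2)"
proof -
  have "covar a a \<le> (\<Sum>i\<in>U. \<Sum>j\<in>U. \<bar>cov i j\<bar> * (a i)\<^sup>2 / 2 + \<bar>cov i j\<bar> * (a j)\<^sup>2 / 2)"
    unfolding covar_def
  proof (intro sum_mono)
    fix i j
    have "cov i j * (a i * a j) \<le> \<bar>cov i j\<bar> * \<bar>a i * a j\<bar>" by (metis abs_ge_self abs_mult)
    also have "\<bar>a i * a j\<bar> \<le> (a i)\<^sup>2 / 2 + (a j)\<^sup>2 / 2"
      using sum_squares_bound[of "\<bar>a i\<bar>" "\<bar>a j\<bar>"] by (simp add: abs_mult field_simps)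
    finally show "cov i j * (a i * a j) \<le> \<bar>cov i j\<bar> * (a i)\<^sup>2 / 2 + \<bar>cov i j\<bar> * (a j)\<^sup>2 / 2"
      by (simp add: distrib_left mult_left_mono)
  qed
  also have "\<dots> = (\<Sum>i\<in>U. \<Sum>j\<in>U. \<bar>cov i j\<bar> * (a i)\<^sup>2) / 2 + (\<Sum>i\<in>U. \<Sum>j\<in>U. \<bar>cov i j\<bar> * (a j)\<^sup>2) / 2"
    by (simp add: sum.distrib sum_divide_distrib)
  finally show ?thesis using sum_sum_abs_cov[of "\<lambda>i. (a i)\<^sup>2"] by simp
qed

lemma variance_le: "ex (\<lambda>s. ((\<Sum>i\<in>s. a i) - mean a)\<^sup>2) \<le> 2 * mean (\<lambda>i. (a i)\<^sup>2)"
  using covar_le by (simp add: ex_variance)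

lemma mrate_eq: "mrate = mean (\<lambda>i. 1 - p i)"
  unfolding mrate_def rate_def by (rule ex_mean)

text \<open>With the indicator of \<open>i\<close> as statistic and a constant test function the
  right-hand side of the swap identity vanishes. So \<open>rate\<close> times the indicator centred
  at \<open>p i\<close> has mean zero, which makes \<open>mrate * (inc i - p i)\<close> minus the
  covariance of \<open>rate\<close> with the indicator. The weights \<open>1 - p k\<close> in
  \<open>rate\<close> are at most one, and a single absolute row sum bounds it.\<close>

lemma mrate_inc_diff: assumes "i \<in> U" shows "\<bar>mrate * (inc i - p i)\<bar> \<le> 2 * inc i"
proof -
  have 0: "(\<Sum>k\<in>s. of_bool (k = i)) = (of_bool (i \<in> s) :: real)" if "s \<in> samples" for s
    using samplesD[OF that] by (simp add: of_bool_def)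
  have "ex (\<lambda>s. rate s * ((\<Sum>k\<in>s. of_bool (k = i)) - (\<Sum>k\<in>U. p k * of_bool (k = i)))) = 0"
    using swap_identity[of "\<lambda>k. of_bool (k = i)" "\<lambda>_. 1::real"] by (simp add: swap_sum_def)
  moreover have "ex (\<lambda>s. rate s * ((\<Sum>k\<in>s. of_bool (k = i)) - (\<Sum>k\<in>U. p k * of_bool (k = i)))) =
     ex (\<lambda>s. ((\<Sum>k\<in>s. 1 - p k) - mean (\<lambda>i. 1 - p i)) * ((\<Sum>k\<in>s. of_bool (k = i)) - mean (\<lambda>k. of_bool (k = i)))
       + mrate * ((\<Sum>k\<in>s. of_bool (k = i)) - mean (\<lambda>k. of_bool (k = i)))
       + (mean (\<lambda>k. of_bool (k = i)) - (\<Sum>k\<in>U. p k * of_bool (k = i))) * rate s)"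
    by (intro ex_cong) (simp add: rate_def mrate_eq algebra_simps)
  moreover have "\<dots> = covar (\<lambda>i. 1 - p i) (\<lambda>k. of_bool (k = i)) + (mean (\<lambda>k. of_bool (k = i)) - (\<Sum>k\<in>U. p k * of_bool (k = i))) * mrate"
    unfolding ex_add ex_cmult ex_covar by (simp add: ex_diff ex_mean mrate_def)
  moreover have "mean (\<lambda>k. of_bool (k = i)) = inc i" "(\<Sum>k\<in>U. p k * of_bool (k = i)) = p i"
    using assms by (simp_all add: mean_def of_bool_def if_distrib[of "\<lambda>x. _ * x"] cong: if_cong)
  ultimately have "mrate * (inc i - p i) = - covar (\<lambda>i. 1 - p i) (\<lambda>k. of_bool (k = i))"
    by (simp add: algebra_simps)
  also have "covar (\<lambda>i. 1 - p i) (\<lambda>k. of_bool (k = i)) = (\<Sum>k\<in>U. cov i k * (1 - p k))"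
    unfolding covar_def using assms by (intro sum.cong) (auto simp: of_bool_def cov_commute if_distrib[of "\<lambda>x. _ * x"] cong: if_cong)
  finally have "\<bar>mrate * (inc i - p i)\<bar> = \<bar>\<Sum>k\<in>U. cov i k * (1 - p k)\<bar>" by simp
  also have "\<dots> \<le> (\<Sum>k\<in>U. \<bar>cov i k * (1 - p k)\<bar>)" by (rule sum_abs)
  also have "\<dots> \<le> (\<Sum>k\<in>U. \<bar>cov i k\<bar>)"
    using p01 by (intro sum_mono) (auto simp: abs_mult intro!: mult_left_le)
  also have "\<dots> \<le> 2 * inc i" using sum_abs_cov[OF assms] .
  finally show ?thesis .
qed

end

section \<open>Moment bounds for designs with regular inclusion probabilities\<close>

lemma diff_power2_le: "(x - y)\<^sup>2 \<le> 2 * (x\<^sup>2 + y\<^sup>2)" for x y :: real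
  using zero_le_power2[of "x + y"] by (simp add: power2_eq_square algebra_simps)

lemma diff_power4_le: "(x - y) ^ 4 \<le> 8 * (x ^ 4 + y ^ 4)" for x y :: real
proof -
  have "(x - y) ^ 4 = ((x - y)\<^sup>2)\<^sup>2" by simp
  also have "\<dots> \<le> (2 * (x\<^sup>2 + y\<^sup>2))\<^sup>2" using diff_power2_le by (intro power_mono) auto
  also have "\<dots> \<le> 8 * (x ^ 4 + y ^ 4)"
    using zero_le_power2[of "x\<^sup>2 - y\<^sup>2"] by (simp add: power2_eq_square power4_eq_xxxx algebra_simps)
  finally show ?thesis .
qed

text \<open>\<open>q\<close> is a lower bound of the inclusion probabilities and may be as small as
  the order of \<open>n / card U\<close>. \<open>g\<close> compares \<open>q\<close> times the
  number of unselected units with \<open>n\<close>, and so bounds jump rates below by a multiple of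
  \<open>n\<close> uniformly over designs. The assumption \<open>large\<close> makes the relative
  error \<open>2 / (g * n)\<close> of \<open>p i\<close> at most one half.\<close>

locale rejective_regular = rejective U n p P
  for U :: "'i set" and n :: nat and p :: "'i \<Rightarrow> real" and P :: "'i set \<Rightarrow> real" +
  fixes q g :: real
  assumes g_pos: "0 < g" and q_pos: "0 < q"
    and inc_ge: "\<And>i. i \<in> U \<Longrightarrow> q \<le> inc i"
    and gap: "g * real n \<le> q * (real (card U) - real n)"
    and large: "4 \<le> g * real n"
begin

lemma g_le_1: "g \<le> 1"
proof -
  have "q * real (card U) \<le> real n"
    using sum_mono[of U "\<lambda>_. q" inc] inc_ge by (simp add: sum_inc mult.commute)
  moreover have "0 \<le> q * real n" using q_pos by simp
  ultimately have "g * real n \<le> 1 * real n" using gap by (simp only: right_diff_distrib)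
  then show ?thesis using n_pos by simp
qed

text \<open>Meant for \<open>1 - p i\<close> and \<open>1 - inc i\<close>, which have the same total
  over \<open>U\<close>.\<close>

lemma mean_ge: 
  assumes "\<And>i. i \<in> U \<Longrightarrow> 0 \<le> f i" "(\<Sum>i\<in>U. f i) = real (card U) - real n"
  shows "g * real n \<le> mean f"
proof -
  have "q * (\<Sum>i\<in>U. f i) \<le> mean f" unfolding mean_def sum_distrib_left
    using assms inc_ge by (intro sum_mono mult_right_mono) auto
  then show ?thesis using gap assms(2) by simp
qed

lemma mrate_ge: "g * real n \<le> mrate"
  unfolding mrate_eq using p01 by (intro mean_ge) (auto simp: sum_subtractf sum_p)

lemma mrate_pos: "0 < mrate" using mrate_ge large by linarith

lemma inc_diff: assumes "i \<in> U" shows "\<bar>inc i - p i\<bar> \<le> 2 / (g * real n) * inc i"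
proof -
  have "g * real n * \<bar>inc i - p i\<bar> \<le> mrate * \<bar>inc i - p i\<bar>"
    using mrate_ge by (intro mult_right_mono) auto
  also have "\<dots> \<le> 2 * inc i" using mrate_inc_diff[OF assms] mrate_pos by (simp add: abs_mult)
  finally show ?thesis using large by (simp add: field_simps)
qed

lemma p_bounds: assumes "i \<in> U" shows "inc i / 2 \<le> p i" "p i \<le> 2 * inc i"
proof -
  have "2 / (g * real n) * inc i \<le> 1 / 2 * inc i"
    using large inc_nonneg by (intro mult_right_mono) (auto simp: field_simps)
  then show "inc i / 2 \<le> p i" "p i \<le> 2 * inc i" using inc_diff[OF assms] inc_nonneg[of i] by auto
qed

text \<open>\<open>rate s\<close> was defined through the selected units; because the \<open>p i\<close> sum to \<open>n\<close> it is also a sum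
  over the unselected ones, which is bounded below.\<close>
lemma rate_ge: assumes "s \<in> samples" shows "g * real n / 2 \<le> rate s"
proof -
  have "q / 2 * (real (card U) - real n) = (\<Sum>j\<in>U - s. q / 2)"
    using samplesD[OF assms] card_mono[OF fin samplesD(1)[OF assms]] by (simp add: card_Diff_subset)
  also have "\<dots> \<le> rate s" unfolding rate_eq[OF assms]
  proof (intro sum_mono)
    fix i assume "i \<in> U - s" then show "q / 2 \<le> p i" using p_bounds[of i] inc_ge[of i] by auto
  qed
  finally show ?thesis using gap by simp
qed

lemma mean_abs_le: "mean (\<lambda>i. \<bar>a i\<bar>) \<le> sqrt (real n * mean (\<lambda>i. (a i)\<^sup>2))"
  using mean_Cauchy_Schwarz[of "\<lambda>_. 1" "\<lambda>i. \<bar>a i\<bar>"] by (simp add: mean_const real_le_rsqrt)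

lemma abs_mean_le: "\<bar>mean a\<bar> \<le> mean (\<lambda>i. \<bar>a i\<bar>)"
  unfolding mean_def by (rule order.trans[OF sum_abs]) (simp add: abs_mult inc_nonneg)

lemma mean_diff_p: "\<bar>mean f - (\<Sum>i\<in>U. p i * f i)\<bar> \<le> 2 / (g * real n) * mean (\<lambda>i. \<bar>f i\<bar>)"
proof -
  have "\<bar>mean f - (\<Sum>i\<in>U. p i * f i)\<bar> = \<bar>\<Sum>i\<in>U. (inc i - p i) * f i\<bar>"
    by (simp add: mean_def sum_subtractf algebra_simps)
  also have "\<dots> \<le> (\<Sum>i\<in>U. \<bar>inc i - p i\<bar> * \<bar>f i\<bar>)"
    by (rule order.trans[OF sum_abs]) (simp add: abs_mult)
  also have "\<dots> \<le> (\<Sum>i\<in>U. 2 / (g * real n) * inc i * \<bar>f i\<bar>)"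
    using inc_diff by (intro sum_mono mult_right_mono) auto
  finally show ?thesis by (simp add: mean_def sum_distrib_left mult.assoc)
qed

text \<open>Each term has relative error of order \<open>1 / n\<close>, and Cauchy-Schwarz against
  the total weight \<open>n\<close> gives back only a factor \<open>sqrt n\<close>.\<close>

lemma mean_diff_p_sq: "(mean a - (\<Sum>i\<in>U. p i * a i))\<^sup>2 \<le> 4 / (g\<^sup>2 * real n) * mean (\<lambda>i. (a i)\<^sup>2)"
proof -
  let ?K = "mean (\<lambda>i. (a i)\<^sup>2)"
  have K: "0 \<le> ?K" by (intro mean_nonneg) simp
  have "\<bar>mean a - (\<Sum>i\<in>U. p i * a i)\<bar> \<le> 2 / (g * real n) * sqrt (real n * ?K)"
    using mean_abs_le g_pos by (intro order.trans[OF mean_diff_p] mult_left_mono) auto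
  then have "\<bar>mean a - (\<Sum>i\<in>U. p i * a i)\<bar>\<^sup>2 \<le> (2 / (g * real n) * sqrt (real n * ?K))\<^sup>2"
    by (intro power_mono) auto
  also have "\<dots> = 4 / (g\<^sup>2 * real n) * ?K" using K n_pos
    by (simp add: power_mult_distrib power_divide real_sqrt_pow2) (simp add: field_simps power2_eq_square)
  finally show ?thesis by simp
qed

lemma sum_p_le: assumes "\<And>i. i \<in> U \<Longrightarrow> 0 \<le> f i" shows "(\<Sum>i\<in>U. p i * f i) \<le> 2 * mean f"
  unfolding mean_def sum_distrib_left mult.assoc[symmetric] using p_bounds(2) assms
  by (intro sum_mono mult_right_mono) auto

lemma swap_sum_le:
  assumes s: "s \<in> samples" and f: "\<And>i. i \<in> U \<Longrightarrow> 0 \<le> f i"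
  shows "swap_sum s (\<lambda>i j. f i + f j) \<le> real n * ((\<Sum>i\<in>s. f i) + 2 * mean f)"
proof -
  have sU: "s \<subseteq> U" using samplesD[OF s] by simp
  have 1: "swap_sum s (\<lambda>i j. f j) = rate s * (\<Sum>j\<in>U - s. p j * f j)"
    using swap_sum_prod[of s "\<lambda>_. 1" f] by (simp add: rate_def)
  have 2: "swap_sum s (\<lambda>i j. f i) = rate s * (\<Sum>i\<in>s. (1 - p i) * f i)"
    using swap_sum_prod[of s f "\<lambda>_. 1"] rate_eq[OF s] by simp
  have 3: "(\<Sum>j\<in>U - s. p j * f j) \<le> (\<Sum>j\<in>U. p j * f j)"
    using p01 f by (intro sum_mono2) auto
  have 4: "(\<Sum>i\<in>s. (1 - p i) * f i) \<le> (\<Sum>i\<in>s. f i)"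
    using p01 f sU by (intro sum_mono) (auto intro!: mult_right_le_one_le mult_left_le_one_le)
  have "0 \<le> (\<Sum>i\<in>s. (1 - p i) * f i) + (\<Sum>j\<in>U - s. p j * f j)"
    using p01 f sU by (intro add_nonneg_nonneg sum_nonneg) auto
  moreover have "(\<Sum>i\<in>s. (1 - p i) * f i) + (\<Sum>j\<in>U - s. p j * f j) \<le> (\<Sum>i\<in>s. f i) + 2 * mean f"
    using 3 4 sum_p_le[of f] f by simp
  ultimately have "rate s * ((\<Sum>i\<in>s. (1 - p i) * f i) + (\<Sum>j\<in>U - s. p j * f j)) \<le> real n * ((\<Sum>i\<in>s. f i) + 2 * mean f)"
    using rate_bounds[OF s] by (intro mult_mono) auto
  then show ?thesis unfolding swap_sum_add 1 2 by (simp add: distrib_left)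
qed

lemma ex_swap_sum_le:
  assumes f: "\<And>i. i \<in> U \<Longrightarrow> 0 \<le> f i"
  shows "ex (\<lambda>s. swap_sum s (\<lambda>i j. f i + f j)) \<le> 3 * real n * mean f"
proof -
  have "ex (\<lambda>s. swap_sum s (\<lambda>i j. f i + f j)) \<le> ex (\<lambda>s. real n * ((\<Sum>i\<in>s. f i) + 2 * mean f))"
    by (intro ex_mono swap_sum_le f)
  then show ?thesis by (simp add: ex_cmult ex_add ex_mean)
qed

lemma swap_sum_power2_le:
  assumes s: "s \<in> samples"
  shows "swap_sum s (\<lambda>i j. (a j - a i)\<^sup>2) \<le> 2 * (real n * ((\<Sum>i\<in>s. (a i)\<^sup>2) + 2 * mean (\<lambda>i. (a i)\<^sup>2)))"
proof -
  have "swap_sum s (\<lambda>i j. (a j - a i)\<^sup>2) \<le> swap_sum s (\<lambda>i j. 2 * ((a i)\<^sup>2 + (a j)\<^sup>2))"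
    by (intro swap_sum_mono[OF s]) (metis add.commute diff_power2_le)
  also have "\<dots> \<le> 2 * (real n * ((\<Sum>i\<in>s. (a i)\<^sup>2) + 2 * mean (\<lambda>i. (a i)\<^sup>2)))"
    unfolding swap_sum_cmult using swap_sum_le[OF s, of "\<lambda>i. (a i)\<^sup>2"] by simp
  finally show ?thesis .
qed

lemma ex_swap_sum_power2_le: "ex (\<lambda>s. swap_sum s (\<lambda>i j. (a j - a i)\<^sup>2)) \<le> 6 * real n * mean (\<lambda>i. (a i)\<^sup>2)"
proof -
  have "ex (\<lambda>s. swap_sum s (\<lambda>i j. (a j - a i)\<^sup>2)) \<le> ex (\<lambda>s. 2 * (real n * ((\<Sum>i\<in>s. (a i)\<^sup>2) + 2 * mean (\<lambda>i. (a i)\<^sup>2))))"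
    by (intro ex_mono swap_sum_power2_le)
  then show ?thesis by (simp add: ex_cmult ex_add ex_mean)
qed

lemma ex_swap_sum_power4_le: "ex (\<lambda>s. swap_sum s (\<lambda>i j. (a j - a i) ^ 4)) \<le> 24 * real n * mean (\<lambda>i. a i ^ 4)"
proof -
  have "ex (\<lambda>s. swap_sum s (\<lambda>i j. (a j - a i) ^ 4)) \<le> ex (\<lambda>s. swap_sum s (\<lambda>i j. 8 * (a i ^ 4 + a j ^ 4)))"
    by (intro ex_mono swap_sum_mono, assumption) (subst add.commute, rule diff_power4_le)
  also have "\<dots> \<le> 8 * (3 * real n * mean (\<lambda>i. a i ^ 4))"
    unfolding swap_sum_cmult ex_cmult using ex_swap_sum_le[of "\<lambda>i. a i ^ 4"] by simp
  finally show ?thesis by simp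
qed

text \<open>With the statistic itself as test function the right-hand side of the swap identity
  contains only squared jumps, and the left-hand side is the mean of
  \<open>rate s * (Y s)^2\<close>. The lower bound of the rate isolates the second moment.\<close>

lemma second_moment_le:
  "ex (\<lambda>s. ((\<Sum>i\<in>s. a i) - (\<Sum>i\<in>U. p i * a i))\<^sup>2) \<le> 6 / g * mean (\<lambda>i. (a i)\<^sup>2)"
proof -
  define Y where "Y s = (\<Sum>i\<in>s. a i) - (\<Sum>i\<in>U. p i * a i)" for s
  have "g * real n / 2 * ex (\<lambda>s. (Y s)\<^sup>2) \<le> ex (\<lambda>s. rate s * (Y s)\<^sup>2)"
    unfolding ex_cmult[symmetric] using rate_ge by (intro ex_mono mult_right_mono) auto
  also have "\<dots> = ex (\<lambda>s. (rate s * Y s) *\<^sub>R Y s)" by (simp add: power2_eq_square mult.assoc)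
  also have "\<dots> = (1 / 2) *\<^sub>R ex (\<lambda>s. swap_sum s (\<lambda>i j. (a j - a i) *\<^sub>R (Y (swap i j s) - Y s)))"
    unfolding Y_def by (rule swap_identity)
  also have "\<dots> = (1 / 2) * ex (\<lambda>s. swap_sum s (\<lambda>i j. (a j - a i)\<^sup>2))"
    unfolding real_scaleR_def swap_sum_def
    by (intro arg_cong[where f = "\<lambda>x. 1 / 2 * x"] ex_cong sum.cong refl)
      (auto simp: Y_def swap_samples power2_eq_square)
  also have "\<dots> \<le> 1 / 2 * (6 * real n * mean (\<lambda>i. (a i)\<^sup>2))"
    by (intro mult_left_mono ex_swap_sum_power2_le) simp
  finally have "real n * (g * ex (\<lambda>s. (Y s)\<^sup>2)) \<le> real n * (6 * mean (\<lambda>i. (a i)\<^sup>2))" by (simp add: mult_ac)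
  then have "g * ex (\<lambda>s. (Y s)\<^sup>2) \<le> 6 * mean (\<lambda>i. (a i)\<^sup>2)" using n_pos by simp
  then show ?thesis unfolding Y_def using g_pos by (simp add: field_simps)
qed

text \<open>The variance of a linear statistic is read off from an identity that weights its square with
  \<open>rate s\<close>. Replacing \<open>rate s\<close> by its mean there requires this fourth moment.\<close>
lemma fourth_moment_le:
  "ex (\<lambda>s. ((\<Sum>i\<in>s. a i) - (\<Sum>i\<in>U. p i * a i)) ^ 4) \<le>
     900 / g\<^sup>2 * ((mean (\<lambda>i. (a i)\<^sup>2))\<^sup>2 + mean (\<lambda>i. a i ^ 4))"
proof -
  define Y where "Y s = (\<Sum>i\<in>s. a i) - (\<Sum>i\<in>U. p i * a i)" for s
  define K K4 M A where "K = mean (\<lambda>i. (a i)\<^sup>2)" and "K4 = mean (\<lambda>i. a i ^ 4)" and "M = ex (\<lambda>s. Y s ^ 4)"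
    and "A s = (\<Sum>i\<in>s. (a i)\<^sup>2)" for s
  define B where "B = 2 * K4 + 9 * K\<^sup>2"
  have nn: "0 \<le> K4" "0 \<le> M" unfolding K4_def M_def by (auto intro!: mean_nonneg ex_nonneg)
  have B: "0 \<le> B" using nn by (simp add: B_def)
  have eA: "ex (\<lambda>s. (A s + 2 * K)\<^sup>2) \<le> B"
  proof -
    have "ex (\<lambda>s. (A s + 2 * K)\<^sup>2) = ex (\<lambda>s. (A s - K)\<^sup>2 + 6 * K * (A s - K) + 9 * K\<^sup>2)"
      by (intro ex_cong) (simp add: power2_eq_square algebra_simps)
    also have "\<dots> = ex (\<lambda>s. (A s - K)\<^sup>2) + 9 * K\<^sup>2"
      unfolding ex_add ex_cmult by (simp add: ex_diff A_def ex_mean K_def)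
    also have "ex (\<lambda>s. (A s - K)\<^sup>2) \<le> 2 * K4"
      using variance_le[of "\<lambda>i. (a i)\<^sup>2"] by (simp add: A_def K_def K4_def flip: power_mult)
    finally show ?thesis by (simp add: B_def)
  qed
  \<comment> \<open>The expansion is \<open>3 * y^2 * d^2 + 3 * y * d^3 + d^4\<close>; the odd term
    is absorbed into the two even ones.\<close>
  have step: "d * ((y + d) ^ 3 - y ^ 3) \<le> 5 * y\<^sup>2 * d\<^sup>2 + 3 * d ^ 4" for d y :: real
  proof -
    have "0 \<le> d\<^sup>2 * ((y * 3 / 2 - d)\<^sup>2 + (y\<^sup>2 + 4 * d\<^sup>2) / 4)" by (intro mult_nonneg_nonneg) auto
    moreover have "0 \<le> d\<^sup>2 * (y - d)\<^sup>2" "0 \<le> d\<^sup>2 * y\<^sup>2" "0 \<le> d\<^sup>2 * d\<^sup>2" by auto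
    ultimately show ?thesis by (simp add: power2_eq_square power3_eq_cube power4_eq_xxxx algebra_simps)
  qed
  have "g * real n / 2 * M \<le> ex (\<lambda>s. rate s * Y s ^ 4)"
    unfolding M_def ex_cmult[symmetric] using rate_ge by (intro ex_mono mult_right_mono) auto
  also have "\<dots> = ex (\<lambda>s. (rate s * Y s) *\<^sub>R Y s ^ 3)"
    by (intro ex_cong) (simp add: power3_eq_cube power4_eq_xxxx)
  also have "\<dots> = (1 / 2) *\<^sub>R ex (\<lambda>s. swap_sum s (\<lambda>i j. (a j - a i) *\<^sub>R (Y (swap i j s) ^ 3 - Y s ^ 3)))"
    unfolding Y_def by (rule swap_identity)
  also have "ex (\<lambda>s. swap_sum s (\<lambda>i j. (a j - a i) *\<^sub>R (Y (swap i j s) ^ 3 - Y s ^ 3)))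
      \<le> ex (\<lambda>s. swap_sum s (\<lambda>i j. 5 * (Y s)\<^sup>2 * (a j - a i)\<^sup>2 + 3 * (a j - a i) ^ 4))"
  proof (intro ex_mono swap_sum_mono)
    fix s i j assume "s \<in> samples" "i \<in> s" "j \<in> U - s"
    then have "Y (swap i j s) = Y s + (a j - a i)" by (simp add: Y_def swap_samples)
    then show "(a j - a i) *\<^sub>R (Y (swap i j s) ^ 3 - Y s ^ 3) \<le> 5 * (Y s)\<^sup>2 * (a j - a i)\<^sup>2 + 3 * (a j - a i) ^ 4"
      using step by simp
  qed
  also have "\<dots> = ex (\<lambda>s. 5 * (Y s)\<^sup>2 * swap_sum s (\<lambda>i j. (a j - a i)\<^sup>2)) + 3 * ex (\<lambda>s. swap_sum s (\<lambda>i j. (a j - a i) ^ 4))"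
    by (simp only: swap_sum_add swap_sum_cmult ex_add ex_cmult)
  also have "ex (\<lambda>s. 5 * (Y s)\<^sup>2 * swap_sum s (\<lambda>i j. (a j - a i)\<^sup>2)) \<le> ex (\<lambda>s. 10 * real n * ((Y s)\<^sup>2 * (A s + 2 * K)))"
  proof (intro ex_mono)
    fix s assume s: "s \<in> samples"
    have "5 * (Y s)\<^sup>2 * swap_sum s (\<lambda>i j. (a j - a i)\<^sup>2) \<le> 5 * (Y s)\<^sup>2 * (2 * (real n * (A s + 2 * K)))"
      unfolding A_def K_def by (intro mult_left_mono swap_sum_power2_le[OF s]) simp
    then show "5 * (Y s)\<^sup>2 * swap_sum s (\<lambda>i j. (a j - a i)\<^sup>2) \<le> 10 * real n * ((Y s)\<^sup>2 * (A s + 2 * K))"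
      by (simp add: algebra_simps)
  qed
  also have "\<dots> = 10 * real n * ex (\<lambda>s. (Y s)\<^sup>2 * (A s + 2 * K))" by (rule ex_cmult)
  also have "ex (\<lambda>s. (Y s)\<^sup>2 * (A s + 2 * K)) \<le> sqrt (M * B)"
  proof -
    have "ex (\<lambda>s. (Y s)\<^sup>2 * (A s + 2 * K)) \<le> ex (\<lambda>s. \<bar>(Y s)\<^sup>2 * (A s + 2 * K)\<bar>)" by (intro ex_mono) simp
    also have "\<dots> \<le> sqrt (ex (\<lambda>s. ((Y s)\<^sup>2)\<^sup>2) * ex (\<lambda>s. (A s + 2 * K)\<^sup>2))" by (rule ex_abs_mult_le)
    also have "\<dots> \<le> sqrt (M * B)" using eA nn by (simp add: M_def mult_left_mono)
    finally show ?thesis .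
  qed
  also have "ex (\<lambda>s. swap_sum s (\<lambda>i j. (a j - a i) ^ 4)) \<le> 24 * real n * K4"
    unfolding K4_def by (rule ex_swap_sum_power4_le)
  finally have "g * real n / 2 * M \<le> (1 / 2) *\<^sub>R (10 * real n * sqrt (M * B) + 3 * (24 * real n * K4))"
    using n_pos by simp
  then have "real n * (g / 2 * M) \<le> real n * (5 * sqrt (M * B) + 36 * K4)" by (simp add: algebra_simps)
  then have 1: "g / 2 * M \<le> 5 * sqrt (M * B) + 36 * K4" using n_pos by simp
  \<comment> \<open>The arithmetic-geometric mean is weighted so that the share of \<open>M\<close>
    comes out as \<open>g * M / 4\<close>, half of the left-hand side, and can be absorbed
    there.\<close>
  have "sqrt (M * B) = sqrt (g * M / 10 * (10 * B / g))" using g_pos by simp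
  also have "\<dots> \<le> (g * M / 10 + 10 * B / g) / 2"
    using g_pos nn B by (intro arith_geo_mean_sqrt) auto
  finally have 2: "5 * sqrt (M * B) \<le> g * M / 4 + 25 * B / g" by simp
  have "g * M \<le> 100 * B / g + 144 * K4" using 1 2 by simp
  also have "144 * K4 \<le> 144 * K4 / g" using g_le_1 g_pos nn by (simp add: field_simps mult_left_le)
  also have "100 * B / g + 144 * K4 / g \<le> 900 * (K\<^sup>2 + K4) / g"
    using g_pos nn unfolding B_def add_divide_distrib[symmetric] by (intro divide_right_mono) auto
  finally have "g * M \<le> 900 * (K\<^sup>2 + K4) / g" by simp
  then have "M \<le> 900 / g\<^sup>2 * (K\<^sup>2 + K4)" using g_pos by (simp add: field_simps power2_eq_square)
  then show ?thesis by (simp add: M_def Y_def K_def K4_def)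
qed

end

section \<open>Hajek's variance approximation\<close>

context rejective_regular begin

definition contrast :: "'i \<Rightarrow> real" where "contrast i = inc i * (1 - inc i)"

text \<open>The minimum over \<open>R\<close> of the sum of \<open>contrast i * (a i - R)^2\<close>:
  the variance of the total under Poisson sampling with probabilities \<open>inc i\<close> after
  regressing out the random sample size.\<close>

definition hajek_var :: "('i \<Rightarrow> real) \<Rightarrow> real" where
  "hajek_var a = (\<Sum>i\<in>U. contrast i * (a i)\<^sup>2) - (\<Sum>i\<in>U. contrast i * a i)\<^sup>2 / sum contrast U"

lemma contrast_nonneg: "0 \<le> contrast i" using inc_nonneg[of i] inc_le_1[of i] by (simp add: contrast_def)
lemma contrast_le: "contrast i \<le> inc i"
  using inc_nonneg[of i] inc_le_1[of i] by (simp add: contrast_def mult_left_le)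

lemma sum_contrast_ge: "g * real n \<le> sum contrast U"
  using mean_ge[of "\<lambda>i. 1 - inc i"] inc_le_1 by (simp add: mean_def contrast_def[abs_def] sum_subtractf sum_inc)

lemma sum_contrast_le: "sum contrast U \<le> real n"
  using sum_mono[of U contrast inc] contrast_le by (simp add: sum_inc)

text \<open>The factor \<open>inc i - inc2 i j\<close> is the probability that \<open>i\<close> is
  selected and \<open>j\<close> is not.\<close>

lemma ex_swap_sum_eq:
  fixes G :: "'i \<Rightarrow> 'i \<Rightarrow> real"
  shows "ex (\<lambda>s. swap_sum s G) = (\<Sum>i\<in>U. \<Sum>j\<in>U. (inc i - inc2 i j) * (p j * (1 - p i) * G i j))"
proof -
  have "ex (\<lambda>s. swap_sum s G) = ex (\<lambda>s. \<Sum>i\<in>U. \<Sum>j\<in>U.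
     (of_bool (i \<in> s) - of_bool (i \<in> s) * of_bool (j \<in> s)) *\<^sub>R (p j * (1 - p i) * G i j))"
  proof (intro ex_cong)
    fix s assume "s \<in> samples"
    then have s: "s \<subseteq> U" by (rule samplesD)
    have 1: "(\<Sum>i\<in>s. F i) = (\<Sum>i\<in>U. of_bool (i \<in> s) * F i)" for F :: "'i \<Rightarrow> real"
      using s by (intro sum.mono_neutral_cong_left) auto
    have 2: "(\<Sum>i\<in>U - s. F i) = (\<Sum>i\<in>U. (1 - of_bool (i \<in> s)) * F i)" for F :: "'i \<Rightarrow> real"
      by (intro sum.mono_neutral_cong_left) auto
    show "swap_sum s G = (\<Sum>i\<in>U. \<Sum>j\<in>U. (of_bool (i \<in> s) - of_bool (i \<in> s) * of_bool (j \<in> s)) *\<^sub>R (p j * (1 - p i) * G i j))"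
      unfolding swap_sum_def 1 2 sum_distrib_left by (intro sum.cong) (auto simp: algebra_simps)
  qed
  then show ?thesis unfolding ex_sum ex_scaleR_left ex_diff inc_def inc2_def by simp
qed

text \<open>If distinct selections were uncorrelated and \<open>p\<close> were equal to
  \<open>inc\<close>, the pair \<open>i\<close>, \<open>j\<close> would have weight
  \<open>contrast i * contrast j\<close>, and Lagrange's identity turns the double sum of squared
  differences into \<open>2 * sum contrast U * hajek_var a\<close>. The dependence costs absolute
  covariances, and exchanging \<open>p\<close> for \<open>inc\<close> costs a relative error of
  order \<open>1 / n\<close>. Summed over all pairs, neither leaves a factor
  \<open>n\<close>.\<close>

lemma ex_swap_sum_power2_approx:
  "\<bar>ex (\<lambda>s. swap_sum s (\<lambda>i j. (a j - a i)\<^sup>2)) - 2 * (sum contrast U * hajek_var a)\<bar> \<le> 24 / g * mean (\<lambda>i. (a i)\<^sup>2)"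
proof -
  let ?K = "mean (\<lambda>i. (a i)\<^sup>2)"
  have K: "0 \<le> ?K" by (intro mean_nonneg) simp
  define G where "G i j = 2 * (a i)\<^sup>2 + 2 * (a j)\<^sup>2" for i j
  have arith: "2 * (x * y - z\<^sup>2) = y * x + x * y - 2 * (z * z)" for x y z :: real
    by (simp add: power2_eq_square)
  have eq0: "sum contrast U * hajek_var a = sum contrast U * (\<Sum>i\<in>U. contrast i * (a i)\<^sup>2) - (\<Sum>i\<in>U. contrast i * a i)\<^sup>2"
    using sum_contrast_ge large by (simp add: hajek_var_def right_diff_distrib)
  have "2 * (sum contrast U * hajek_var a) = (\<Sum>i\<in>U. \<Sum>j\<in>U. (contrast i * (a i)\<^sup>2) * contrast j) + (\<Sum>i\<in>U. \<Sum>j\<in>U. contrast i * (contrast j * (a j)\<^sup>2))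
     - 2 * (\<Sum>i\<in>U. \<Sum>j\<in>U. (contrast i * a i) * (contrast j * a j))"
    unfolding eq0 sum_product[of contrast U "\<lambda>j. contrast j * (a j)\<^sup>2" U, symmetric]
      sum_product[of "\<lambda>i. contrast i * (a i)\<^sup>2" U contrast U, symmetric]
      sum_product[of "\<lambda>i. contrast i * a i" U "\<lambda>j. contrast j * a j" U, symmetric]
    by (rule arith)
  also have "\<dots> = (\<Sum>i\<in>U. \<Sum>j\<in>U. contrast i * contrast j * (a j - a i)\<^sup>2)"
  proof -
    have "contrast i * contrast j * (a j - a i)\<^sup>2 = (contrast i * (a i)\<^sup>2) * contrast j +
      contrast i * (contrast j * (a j)\<^sup>2) - 2 * ((contrast i * a i) * (contrast j * a j))" for i j
      by (simp add: power2_eq_square algebra_simps)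
    then show ?thesis by (simp only: sum.distrib sum_subtractf sum_distrib_left[of 2])
  qed
  finally have eq: "2 * (sum contrast U * hajek_var a) = (\<Sum>i\<in>U. \<Sum>j\<in>U. contrast i * contrast j * (a j - a i)\<^sup>2)" .
  have "\<bar>ex (\<lambda>s. swap_sum s (\<lambda>i j. (a j - a i)\<^sup>2)) - 2 * (sum contrast U * hajek_var a)\<bar> =
    \<bar>\<Sum>i\<in>U. \<Sum>j\<in>U. ((inc i - inc2 i j) * (p j * (1 - p i)) - contrast i * contrast j) * (a j - a i)\<^sup>2\<bar>"
    unfolding ex_swap_sum_eq eq sum_subtractf[symmetric] by (simp add: algebra_simps)
  also have "\<dots> \<le> (\<Sum>i\<in>U. \<Sum>j\<in>U. \<bar>cov i j\<bar> * G i j + 4 / (g * real n) * (inc i * inc j) * G i j)"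
  proof (intro order.trans[OF sum_abs] sum_mono)
    fix i j assume ij: "i \<in> U" "j \<in> U"
    have b: "0 \<le> p i" "p i \<le> 1" "0 \<le> p j" "p j \<le> 1" "0 \<le> inc i" "inc i \<le> 1" "0 \<le> inc j" "inc j \<le> 1"
      using p01 ij inc_nonneg inc_le_1 by auto
    define e where "e = 2 / (g * real n)"
    have e: "0 \<le> e" using g_pos by (simp add: e_def)
    have di: "\<bar>inc i - p i\<bar> \<le> e * inc i" "\<bar>inc j - p j\<bar> \<le> e * inc j" using inc_diff ij by (auto simp: e_def)
    \<comment> \<open>Here \<open>inc i - inc2 i j\<close> is written as
      \<open>inc i * (1 - inc j) - cov i j\<close>, after which \<open>p j\<close> and
      \<open>p i\<close> are replaced one after the other.\<close>
    have "(inc i - inc2 i j) * (p j * (1 - p i)) - contrast i * contrast j =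
      - (cov i j * (p j * (1 - p i))) + inc i * (1 - inc j) * ((p j - inc j) * (1 - p i) + inc j * (inc i - p i))"
      by (simp add: cov_def contrast_def algebra_simps)
    also have "\<bar>\<dots>\<bar> \<le> \<bar>cov i j * (p j * (1 - p i))\<bar> + \<bar>inc i * (1 - inc j) * ((p j - inc j) * (1 - p i) + inc j * (inc i - p i))\<bar>"
      by linarith
    also have "\<bar>cov i j * (p j * (1 - p i))\<bar> \<le> \<bar>cov i j\<bar>"
      using b by (simp add: abs_mult mult_left_le mult_le_one)
    also have "\<bar>inc i * (1 - inc j) * ((p j - inc j) * (1 - p i) + inc j * (inc i - p i))\<bar> \<le> inc i * 1 * (e * inc j + inc j * e)"
      unfolding abs_mult
    proof (intro mult_mono)
      have "\<bar>(p j - inc j) * (1 - p i)\<bar> \<le> \<bar>p j - inc j\<bar>" using b by (simp add: abs_mult mult_left_le)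
      moreover have "\<bar>inc j * (inc i - p i)\<bar> \<le> inc j * e"
      proof -
        have "e * inc i \<le> e" using e b by (simp add: mult_left_le)
        then show ?thesis using di b unfolding abs_mult by (intro mult_mono) auto
      qed
      ultimately show "\<bar>(p j - inc j) * (1 - p i) + inc j * (inc i - p i)\<bar> \<le> e * inc j + inc j * e" using di by linarith
    qed (use b e in auto)
    also have "inc i * 1 * (e * inc j + inc j * e) = 4 / (g * real n) * (inc i * inc j)" by (simp add: e_def)
    finally have 1: "\<bar>(inc i - inc2 i j) * (p j * (1 - p i)) - contrast i * contrast j\<bar> \<le> \<bar>cov i j\<bar> + 4 / (g * real n) * (inc i * inc j)"
      by simp
    have 2: "(a j - a i)\<^sup>2 \<le> G i j" using diff_power2_le[of "a j" "a i"] by (simp add: G_def)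
    have "\<bar>((inc i - inc2 i j) * (p j * (1 - p i)) - contrast i * contrast j) * (a j - a i)\<^sup>2\<bar> \<le> (\<bar>cov i j\<bar> + 4 / (g * real n) * (inc i * inc j)) * G i j"
      unfolding abs_mult using 1 2 b g_pos by (intro mult_mono) (auto intro!: add_nonneg_nonneg)
    then show "\<bar>((inc i - inc2 i j) * (p j * (1 - p i)) - contrast i * contrast j) * (a j - a i)\<^sup>2\<bar> \<le> \<bar>cov i j\<bar> * G i j + 4 / (g * real n) * (inc i * inc j) * G i j"
      by (simp only: distrib_right)
  qed
  also have "\<dots> = 2 * (\<Sum>i\<in>U. \<Sum>j\<in>U. \<bar>cov i j\<bar> * (a i)\<^sup>2) + 2 * (\<Sum>i\<in>U. \<Sum>j\<in>U. \<bar>cov i j\<bar> * (a j)\<^sup>2)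
     + 4 / (g * real n) * (\<Sum>i\<in>U. \<Sum>j\<in>U. (inc i * inc j) * G i j)"
  proof -
    have "\<bar>cov i j\<bar> * G i j + 4 / (g * real n) * (inc i * inc j) * G i j = 2 * (\<bar>cov i j\<bar> * (a i)\<^sup>2) +
      2 * (\<bar>cov i j\<bar> * (a j)\<^sup>2) + 4 / (g * real n) * ((inc i * inc j) * G i j)" for i j
      by (simp only: G_def distrib_left mult_ac)
    then show ?thesis by (simp only: sum.distrib sum_distrib_left)
  qed
  also have "(\<Sum>i\<in>U. \<Sum>j\<in>U. (inc i * inc j) * G i j) = 2 * (?K * sum inc U) + 2 * (sum inc U * ?K)"
  proof -
    have "(inc i * inc j) * G i j = 2 * ((inc i * (a i)\<^sup>2) * inc j) + 2 * (inc i * (inc j * (a j)\<^sup>2))" for i j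
      by (simp add: G_def algebra_simps)
    then have "(\<Sum>i\<in>U. \<Sum>j\<in>U. (inc i * inc j) * G i j) =
        2 * (\<Sum>i\<in>U. \<Sum>j\<in>U. (inc i * (a i)\<^sup>2) * inc j) + 2 * (\<Sum>i\<in>U. \<Sum>j\<in>U. inc i * (inc j * (a j)\<^sup>2))"
      by (simp only: sum.distrib sum_distrib_left)
    then show ?thesis
      unfolding mean_def sum_product[of "\<lambda>i. inc i * (a i)\<^sup>2" U inc U]
        sum_product[of inc U "\<lambda>j. inc j * (a j)\<^sup>2" U] .
  qed
  also have "2 * (\<Sum>i\<in>U. \<Sum>j\<in>U. \<bar>cov i j\<bar> * (a i)\<^sup>2) + 2 * (\<Sum>i\<in>U. \<Sum>j\<in>U. \<bar>cov i j\<bar> * (a j)\<^sup>2) \<le> 8 * ?K"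
    using sum_sum_abs_cov[of "\<lambda>i. (a i)\<^sup>2"] by simp
  also have "8 * ?K + 4 / (g * real n) * (2 * (?K * sum inc U) + 2 * (sum inc U * ?K)) = 8 * ?K + 16 / g * ?K"
    using n_pos g_pos by (simp add: sum_inc field_simps)
  also have "8 * ?K \<le> 8 / g * ?K" using g_le_1 g_pos K by (intro mult_right_mono) (auto simp: field_simps)
  finally show ?thesis by (simp add: add_divide_distrib[symmetric] distrib_right[symmetric])
qed

lemma rate_variance_le: "ex (\<lambda>s. (rate s - mrate)\<^sup>2) \<le> 2 * real n"
proof -
  have "ex (\<lambda>s. (rate s - mrate)\<^sup>2) \<le> 2 * mean (\<lambda>i. (1 - p i)\<^sup>2)"
    unfolding mrate_eq unfolding rate_def by (rule variance_le)
  also have "mean (\<lambda>i. (1 - p i)\<^sup>2) \<le> mean (\<lambda>i. 1)"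
    using p01 by (intro mean_mono) (auto intro!: power_le_one)
  finally show ?thesis by (simp add: mean_const)
qed

lemma mrate_le: "mrate \<le> real n" unfolding mrate_def using ex_mono[of rate "\<lambda>_. real n"] rate_bounds by simp

lemma mrate_contrast: "\<bar>mrate - sum contrast U\<bar> \<le> 2 / g"
proof -
  have "mrate - sum contrast U = mean (\<lambda>i. inc i - p i)"
    by (simp add: mrate_eq mean_def contrast_def[abs_def] sum_subtractf algebra_simps)
  also have "\<bar>\<dots>\<bar> \<le> mean (\<lambda>i. \<bar>inc i - p i\<bar>)" by (rule abs_mean_le)
  also have "\<dots> \<le> mean (\<lambda>i. 2 / (g * real n))"
  proof (intro mean_mono)
    fix i assume "i \<in> U"
    have "2 / (g * real n) * inc i \<le> 2 / (g * real n)" using inc_le_1 g_pos by (intro mult_left_le) auto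
    then show "\<bar>inc i - p i\<bar> \<le> 2 / (g * real n)" using inc_diff[OF \<open>i \<in> U\<close>] by simp
  qed
  finally show ?thesis using n_pos by (simp add: mean_const)
qed

end

text \<open>These are the bounds of an array with entries of order \<open>1 / sqrt n\<close>:
  squares have a total of order one, fourth powers a total of order \<open>1 / n\<close>. As
  \<open>1 \<le> k\<close>, lower powers of \<open>k\<close> may be enlarged whenever bounds are
  merged.\<close>

locale rejective_array = rejective_regular U n p P q g
  for U :: "'i set" and n :: nat and p :: "'i \<Rightarrow> real" and P :: "'i set \<Rightarrow> real" and q g :: real +
  fixes a :: "'i \<Rightarrow> real" and k :: real
  assumes k1: "1 \<le> k" and K2: "mean (\<lambda>i. (a i)\<^sup>2) \<le> k" and K4: "mean (\<lambda>i. a i ^ 4) \<le> k\<^sup>2 / real n"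
begin

text \<open>\<open>Y\<close> is centred where the swap identity is exact; by \<open>ctr_sq\<close>
  the shift to the true mean is only of order \<open>1 / sqrt n\<close>. \<open>Q s\<close> is the
  sum of squared jumps out of \<open>s\<close>, the local variance of the dynamics.\<close>

definition ctr :: real where "ctr = (\<Sum>i\<in>U. p i * a i)"
definition Y :: "'i set \<Rightarrow> real" where "Y s = (\<Sum>i\<in>s. a i) - ctr"
definition Q :: "'i set \<Rightarrow> real" where "Q s = swap_sum s (\<lambda>i j. (a j - a i)\<^sup>2)"

lemma n1: "1 \<le> real n" using n_pos by simp
lemma sqrt_n: "sqrt (real n) * sqrt (real n) = real n" "1 \<le> sqrt (real n)" using n1 by auto

lemma Y2: "ex (\<lambda>s. (Y s)\<^sup>2) \<le> 6 * k / g"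
proof -
  have "6 / g * mean (\<lambda>i. (a i)\<^sup>2) \<le> 6 / g * k" using K2 g_pos by (intro mult_left_mono) auto
  then show ?thesis unfolding Y_def ctr_def using second_moment_le[of a] by simp
qed

lemma Y4: "ex (\<lambda>s. Y s ^ 4) \<le> 1800 * k\<^sup>2 / g\<^sup>2"
proof -
  have "(mean (\<lambda>i. (a i)\<^sup>2))\<^sup>2 \<le> k\<^sup>2" using K2 by (intro power_mono mean_nonneg) auto
  moreover have "k\<^sup>2 / real n \<le> k\<^sup>2" using n1 by (simp add: divide_le_eq mult_le_cancel_left1)
  ultimately have "(mean (\<lambda>i. (a i)\<^sup>2))\<^sup>2 + mean (\<lambda>i. a i ^ 4) \<le> 2 * k\<^sup>2" using K4 by simp
  then have "900 / g\<^sup>2 * ((mean (\<lambda>i. (a i)\<^sup>2))\<^sup>2 + mean (\<lambda>i. a i ^ 4)) \<le> 900 / g\<^sup>2 * (2 * k\<^sup>2)"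
    using g_pos by (intro mult_left_mono) auto
  then show ?thesis unfolding Y_def ctr_def using fourth_moment_le[of a] by simp
qed

lemma ctr_sq: "(mean a - ctr)\<^sup>2 \<le> 4 * k / (g\<^sup>2 * real n)"
proof -
  have "4 / (g\<^sup>2 * real n) * mean (\<lambda>i. (a i)\<^sup>2) \<le> 4 / (g\<^sup>2 * real n) * k" using K2 by (intro mult_left_mono) auto
  then show ?thesis unfolding ctr_def using mean_diff_p_sq[of a] by simp
qed

lemma Y2_covar: "ex (\<lambda>s. (Y s)\<^sup>2) = covar a a + (mean a - ctr)\<^sup>2"
proof -
  have "ex (\<lambda>s. (Y s)\<^sup>2) = ex (\<lambda>s. ((\<Sum>i\<in>s. a i) - mean a)\<^sup>2 + 2 * (mean a - ctr) * ((\<Sum>i\<in>s. a i) - mean a) + (mean a - ctr)\<^sup>2)"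
    by (intro ex_cong) (simp add: Y_def power2_eq_square algebra_simps)
  also have "\<dots> = covar a a + 2 * (mean a - ctr) * (mean a - mean a) + (mean a - ctr)\<^sup>2"
    unfolding ex_add ex_cmult ex_variance by (simp add: ex_diff ex_mean)
  finally show ?thesis by simp
qed

text \<open>With test function \<open>Y\<close> the identity equates the mean of
  \<open>rate s * (Y s)^2\<close> with half the mean of \<open>Q\<close>. Replacing the rate by its
  mean costs, by Cauchy-Schwarz, its standard deviation of order \<open>sqrt n\<close> times the
  root of the fourth moment of \<open>Y\<close>.\<close>

lemma mrate_Y2: "\<bar>mrate * ex (\<lambda>s. (Y s)\<^sup>2) - ex Q / 2\<bar> \<le> 60 * k * sqrt (real n) / g"
proof -
  have "ex (\<lambda>s. rate s * (Y s)\<^sup>2) = ex (\<lambda>s. (rate s * Y s) *\<^sub>R Y s)" by (simp add: power2_eq_square mult.assoc)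
  also have "\<dots> = (1 / 2) *\<^sub>R ex (\<lambda>s. swap_sum s (\<lambda>i j. (a j - a i) *\<^sub>R (Y (swap i j s) - Y s)))"
    unfolding Y_def ctr_def by (rule swap_identity)
  also have "\<dots> = (1 / 2) * ex Q"
    unfolding real_scaleR_def swap_sum_def Q_def
    by (intro arg_cong[where f = "\<lambda>x. 1 / 2 * x"] ex_cong sum.cong refl)
      (auto simp: Y_def swap_samples power2_eq_square)
  finally have "mrate * ex (\<lambda>s. (Y s)\<^sup>2) - ex Q / 2 = - ex (\<lambda>s. (rate s - mrate) * (Y s)\<^sup>2)"
    unfolding left_diff_distrib ex_diff ex_cmult by simp
  also have "\<bar>\<dots>\<bar> \<le> ex (\<lambda>s. \<bar>(rate s - mrate) * (Y s)\<^sup>2\<bar>)" unfolding abs_minus_cancel by (rule abs_ex_le)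
  also have "\<dots> \<le> sqrt (ex (\<lambda>s. (rate s - mrate)\<^sup>2) * ex (\<lambda>s. ((Y s)\<^sup>2)\<^sup>2))" by (rule ex_abs_mult_le)
  also have "\<dots> \<le> sqrt (2 * real n * (1800 * k\<^sup>2 / g\<^sup>2))"
    using rate_variance_le Y4 by (intro real_sqrt_le_mono mult_mono) (auto intro!: ex_nonneg)
  also have "2 * real n * (1800 * k\<^sup>2 / g\<^sup>2) = (60 * k / g)\<^sup>2 * real n" by (simp add: power_mult_distrib power_divide)
  also have "sqrt \<dots> = 60 * k * sqrt (real n) / g" using k1 g_pos by (simp add: real_sqrt_mult)
  finally show ?thesis .
qed

lemma variance_approx: "\<bar>covar a a - hajek_var a\<bar> \<le> 100 * k / (g ^ 3 * sqrt (real n))"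
proof -
  define d where "d = sum contrast U"
  have d: "g * real n \<le> d" "d \<le> real n" using sum_contrast_ge sum_contrast_le by (auto simp: d_def)
  have "24 / g * mean (\<lambda>i. (a i)\<^sup>2) \<le> 24 / g * k" using K2 g_pos by (intro mult_left_mono) auto
  then have 1: "\<bar>ex Q / 2 - d * hajek_var a\<bar> \<le> 12 * k / g"
    using ex_swap_sum_power2_approx[of a] unfolding Q_def[symmetric] d_def[symmetric] by auto
  have 2: "\<bar>(d - mrate) * ex (\<lambda>s. (Y s)\<^sup>2)\<bar> \<le> 2 / g * (6 * k / g)"
  proof -
    have "0 \<le> ex (\<lambda>s. (Y s)\<^sup>2)" by (intro ex_nonneg) simp
    then show ?thesis unfolding abs_mult
      using mrate_contrast Y2 g_pos by (intro mult_mono) (auto simp: d_def)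
  qed
  have 3: "d * (mean a - ctr)\<^sup>2 \<le> real n * (4 * k / (g\<^sup>2 * real n))"
    using ctr_sq d by (intro mult_mono) auto
  have 3: "d * (mean a - ctr)\<^sup>2 \<le> 4 * k / g\<^sup>2" "0 \<le> d * (mean a - ctr)\<^sup>2"
    using 3 n_pos d by (auto simp: g_pos less_imp_le intro!: mult_nonneg_nonneg order.trans[OF _ d(1)])
  \<comment> \<open>The four errors are the fluctuation of the rate, squared jumps against Hajek's
    formula, \<open>mrate\<close> against the total contrast, and the shift of the centre. The first
    is of order \<open>sqrt n\<close>, the others are bounded, and \<open>d\<close> is of order
    \<open>n\<close>.\<close>
  have "d * (covar a a - hajek_var a) = (mrate * ex (\<lambda>s. (Y s)\<^sup>2) - ex Q / 2) + (ex Q / 2 - d * hajek_var a) +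
      (d - mrate) * ex (\<lambda>s. (Y s)\<^sup>2) - d * (mean a - ctr)\<^sup>2"
    unfolding Y2_covar by (simp add: algebra_simps)
  then have "\<bar>d * (covar a a - hajek_var a)\<bar> \<le> 60 * k * sqrt (real n) / g + 12 * k / g + 2 / g * (6 * k / g) + 4 * k / g\<^sup>2"
    using mrate_Y2 1 2 3 by linarith
  also have "\<dots> \<le> 88 * (k * sqrt (real n) / g\<^sup>2)"
  proof -
    have i: "1 / g \<le> 1 / g\<^sup>2" using g_pos g_le_1 by (simp add: field_simps power2_eq_square mult_left_le)
    have "k * sqrt (real n) * (1 / g) \<le> k * sqrt (real n) * (1 / g\<^sup>2)" using i k1 by (intro mult_left_mono) auto
    moreover have "k * 1 * (1 / g) \<le> k * sqrt (real n) * (1 / g\<^sup>2)" using i k1 sqrt_n g_pos by (intro mult_mono) auto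
    moreover have "k * 1 * (1 / g\<^sup>2) \<le> k * sqrt (real n) * (1 / g\<^sup>2)" using k1 sqrt_n by (intro mult_mono) auto
    moreover have "60 * k * sqrt (real n) / g + 12 * k / g + 2 / g * (6 * k / g) + 4 * k / g\<^sup>2 =
        60 * (k * sqrt (real n) * (1 / g)) + 12 * (k * 1 * (1 / g)) + 16 * (k * 1 * (1 / g\<^sup>2))"
      by (simp add: power2_eq_square)
    moreover have "k * sqrt (real n) / g\<^sup>2 = k * sqrt (real n) * (1 / g\<^sup>2)" by simp
    moreover have "60 * x + 12 * y + 16 * z \<le> 88 * w"
      if "x \<le> w" "y \<le> w" "z \<le> w" for x y z w :: real using that by linarith
    ultimately show ?thesis by presburger
  qed
  finally have 4: "d * \<bar>covar a a - hajek_var a\<bar> \<le> 88 * (k * sqrt (real n) / g\<^sup>2)"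
    using d large by (simp add: abs_mult)
  have "g * real n * \<bar>covar a a - hajek_var a\<bar> \<le> d * \<bar>covar a a - hajek_var a\<bar>" using d by (intro mult_right_mono) auto
  then have "g * real n * \<bar>covar a a - hajek_var a\<bar> \<le> 88 * (k * sqrt (real n) / g\<^sup>2)" using 4 by simp
  then have "\<bar>covar a a - hajek_var a\<bar> \<le> 88 * (k * sqrt (real n) / g\<^sup>2) / (g * real n)"
    using g_pos n_pos by (subst pos_le_divide_eq) (simp_all only: mult.commute[of "\<bar>covar a a - hajek_var a\<bar>"] mult_pos_pos of_nat_0_less_iff)
  also have "\<dots> = 88 * k / (g ^ 3 * sqrt (real n))"
    using g_pos n_pos by (simp add: field_simps power2_eq_square power3_eq_cube)
  also have "\<dots> \<le> 100 * k / (g ^ 3 * sqrt (real n))" using k1 g_pos by (intro divide_right_mono) auto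
  finally show ?thesis .
qed

end

section \<open>Characteristic function of a linear statistic\<close>

text \<open>The integrating factor \<open>exp (v * u^2 / 2)\<close> turns the Gaussian solution into
  a constant, so that the product moves at speed at most \<open>exp (v * t^2 / 2) * B\<close>
  between 0 and \<open>t\<close>. The exponential in this speed is its value at the end point and
  cancels when the factor is divided out there.\<close>

lemma gaussian_ODE_bound:
  fixes \<phi> \<phi>' :: "real \<Rightarrow> complex" and v B t :: real
  assumes v: "0 \<le> v" and \<phi>0: "\<phi> 0 = 1"
    and deriv: "\<And>u. (\<phi> has_vector_derivative \<phi>' u) (at u)"
    and bound: "\<And>u. \<bar>u\<bar> \<le> \<bar>t\<bar> \<Longrightarrow> norm (\<phi>' u + (u * v) *\<^sub>R \<phi> u) \<le> B"
  shows "norm (\<phi> t - exp (- (v * t\<^sup>2 / 2))) \<le> \<bar>t\<bar> * B"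
proof -
  define \<psi> where "\<psi> u = exp (v * u\<^sup>2 / 2) *\<^sub>R \<phi> u" for u
  have d: "(\<psi> has_vector_derivative exp (v * u\<^sup>2 / 2) *\<^sub>R (\<phi>' u + (u * v) *\<^sub>R \<phi> u)) (at u)" for u
  proof -
    have "((\<lambda>u. exp (v * u\<^sup>2 / 2)) has_real_derivative exp (v * u\<^sup>2 / 2) * (u * v)) (at u)"
      by (auto intro!: derivative_eq_intros)
    from has_vector_derivative_scaleR[OF this deriv[of u]] show ?thesis
      unfolding \<psi>_def[abs_def] by (simp add: scaleR_add_right)
  qed
  have B: "0 \<le> B" using bound[of t] norm_ge_zero order.trans by blast
  have "norm (\<psi> (0 + t) - \<psi> 0) \<le> norm t * (exp (v * t\<^sup>2 / 2) * B)"
  proof (rule differentiable_bound_segment[where G = UNIV and f' = "\<lambda>u x. x *\<^sub>R (exp (v * u\<^sup>2 / 2) *\<^sub>R (\<phi>' u + (u * v) *\<^sub>R \<phi> u))"])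
    fix u :: real
    show "(\<psi> has_derivative (\<lambda>x. x *\<^sub>R (exp (v * u\<^sup>2 / 2) *\<^sub>R (\<phi>' u + (u * v) *\<^sub>R \<phi> u)))) (at u within UNIV)"
      using d[of u] by (simp add: has_vector_derivative_def)
  next
    fix s :: real assume s: "s \<in> {0..1}"
    let ?u = "0 + s *\<^sub>R t"
    have u: "\<bar>?u\<bar> \<le> \<bar>t\<bar>" using s by (simp add: abs_mult mult_left_le_one_le)
    then have "?u\<^sup>2 \<le> t\<^sup>2" by (simp only: abs_le_square_iff)
    then have "exp (v * ?u\<^sup>2 / 2) \<le> exp (v * t\<^sup>2 / 2)" using v by (simp add: mult_left_mono)
    then have "norm (exp (v * ?u\<^sup>2 / 2) *\<^sub>R (\<phi>' ?u + (?u * v) *\<^sub>R \<phi> ?u)) \<le> exp (v * t\<^sup>2 / 2) * B"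
      using bound[OF u] unfolding norm_scaleR by (intro mult_mono) auto
    then show "onorm (\<lambda>x. x *\<^sub>R (exp (v * ?u\<^sup>2 / 2) *\<^sub>R (\<phi>' ?u + (?u * v) *\<^sub>R \<phi> ?u))) \<le> exp (v * t\<^sup>2 / 2) * B"
      by (intro onorm_le) (simp only: norm_scaleR[of _ "exp _ *\<^sub>R _"] real_norm_def
        mult.commute[of "exp (v * t\<^sup>2 / 2) * B"] mult_left_mono abs_ge_zero)
  qed auto
  moreover have "\<psi> t - \<psi> 0 = exp (v * t\<^sup>2 / 2) *\<^sub>R (\<phi> t - exp (- (v * t\<^sup>2 / 2)))"
    by (simp add: \<psi>_def \<phi>0 scaleR_diff_right scaleR_conv_of_real exp_minus exp_of_real flip: of_real_mult)
      (simp add: exp_of_real[symmetric] right_diff_distrib)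
  ultimately have "exp (v * t\<^sup>2 / 2) * norm (\<phi> t - exp (- (v * t\<^sup>2 / 2))) \<le> exp (v * t\<^sup>2 / 2) * (\<bar>t\<bar> * B)"
    by (simp add: mult_ac)
  then show ?thesis by simp
qed

lemma iexp_diff_bound: "norm (iexp x - 1 - \<i> * complex_of_real x) \<le> x\<^sup>2 / 2"
  using iexp_approx1[of x 1] by (simp add: diff_diff_eq power2_eq_square)

lemma iexp_distrib: "iexp (u * (y + d)) = iexp (u * y) * iexp (u * d)"
  by (simp add: distrib_left exp_add)

lemma iexp_lipschitz: "norm (iexp x - iexp y) \<le> \<bar>x - y\<bar>"
proof -
  have "iexp x - iexp y = iexp y * (iexp (x - y) - 1)"
    by (simp add: algebra_simps exp_add[symmetric])
  then have "norm (iexp x - iexp y) = norm (iexp (x - y) - 1)" by (simp add: norm_mult)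
  then show ?thesis using iexp_approx1[of "x - y" 0] by simp
qed

context rejective_array
begin

lemma K4_sqrt: "sqrt (2 * mean (\<lambda>i. a i ^ 4)) \<le> 2 * k / sqrt (real n)"
proof (rule real_le_lsqrt)
  have "2 * mean (\<lambda>i. a i ^ 4) \<le> 2 * (k\<^sup>2 / real n)" using K4 by simp
  also have "\<dots> \<le> 4 * k\<^sup>2 / real n" by (simp add: divide_right_mono)
  also have "\<dots> = (2 * k / sqrt (real n))\<^sup>2" by (simp add: power_mult_distrib power_divide)
  finally show "2 * mean (\<lambda>i. a i ^ 4) \<le> (2 * k / sqrt (real n))\<^sup>2" .
qed (use k1 in auto)

text \<open>Needed with the weights \<open>p\<close> and \<open>1 - p\<close>. In the second bound
  the summands \<open>(a i)^2\<close> have squares with a total of order \<open>1 / n\<close>, hence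
  the gain of \<open>sqrt n\<close>.\<close>

lemma lin_dev:
  assumes w: "\<And>i. i \<in> U \<Longrightarrow> 0 \<le> w i \<and> w i \<le> 1"
  shows "ex (\<lambda>s. ((\<Sum>i\<in>s. w i * a i) - mean (\<lambda>i. w i * a i))\<^sup>2) \<le> 2 * k"
    and "ex (\<lambda>s. \<bar>(\<Sum>i\<in>s. w i * (a i)\<^sup>2) - mean (\<lambda>i. w i * (a i)\<^sup>2)\<bar>) \<le> 2 * k / sqrt (real n)"
proof -
  have w2: "(w i)\<^sup>2 \<le> 1" if "i \<in> U" for i using w[OF that] by (simp add: power_le_one)
  have "ex (\<lambda>s. ((\<Sum>i\<in>s. w i * a i) - mean (\<lambda>i. w i * a i))\<^sup>2) \<le> 2 * mean (\<lambda>i. (w i * a i)\<^sup>2)"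
    by (rule variance_le)
  also have "mean (\<lambda>i. (w i * a i)\<^sup>2) \<le> mean (\<lambda>i. (a i)\<^sup>2)"
    using w2 by (intro mean_mono) (simp add: power_mult_distrib mult_left_le_one_le)
  finally show "ex (\<lambda>s. ((\<Sum>i\<in>s. w i * a i) - mean (\<lambda>i. w i * a i))\<^sup>2) \<le> 2 * k" using K2 by simp
  have "ex (\<lambda>s. ((\<Sum>i\<in>s. w i * (a i)\<^sup>2) - mean (\<lambda>i. w i * (a i)\<^sup>2))\<^sup>2) \<le> 2 * mean (\<lambda>i. (w i * (a i)\<^sup>2)\<^sup>2)"
    by (rule variance_le)
  also have "mean (\<lambda>i. (w i * (a i)\<^sup>2)\<^sup>2) \<le> mean (\<lambda>i. a i ^ 4)"
    using w2 by (intro mean_mono) (simp add: power_mult_distrib mult_left_le_one_le flip: power_mult)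
  finally have "sqrt (ex (\<lambda>s. ((\<Sum>i\<in>s. w i * (a i)\<^sup>2) - mean (\<lambda>i. w i * (a i)\<^sup>2))\<^sup>2)) \<le> 2 * k / sqrt (real n)"
    using K4_sqrt by (meson mult_left_mono order.trans real_sqrt_le_mono zero_le_numeral)
  then show "ex (\<lambda>s. \<bar>(\<Sum>i\<in>s. w i * (a i)\<^sup>2) - mean (\<lambda>i. w i * (a i)\<^sup>2)\<bar>) \<le> 2 * k / sqrt (real n)"
    by (rule order.trans[OF ex_abs_le])
qed

lemma rate_dev: "ex (\<lambda>s. \<bar>rate s - mrate\<bar>) \<le> 2 * sqrt (real n)"
proof -
  have "ex (\<lambda>s. \<bar>rate s - mrate\<bar>) \<le> sqrt (ex (\<lambda>s. (rate s - mrate)\<^sup>2))" by (rule ex_abs_le)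
  also have "\<dots> \<le> sqrt (4 * real n)" using rate_variance_le by simp
  also have "\<dots> = 2 * sqrt (real n)" by (simp add: real_sqrt_mult)
  finally show ?thesis .
qed

text \<open>Because the rates are products, expanding \<open>(a j - a i)^2\<close> expresses
  \<open>Q\<close> through products of totals, each of which concentrates. A total over the
  unselected units is a constant minus a sample total, which explains the form of the centres
  \<open>v2\<close> and \<open>z\<close>.\<close>

lemma Q_dev: "ex (\<lambda>s. \<bar>Q s - ex Q\<bar>) \<le> 60 * k * sqrt (real n)"
proof -
  let ?r = "sqrt (real n)"
  define U1 where "U1 s = (\<Sum>i\<in>s. (1 - p i) * (a i)\<^sup>2)" for s
  define u1 where "u1 = mean (\<lambda>i. (1 - p i) * (a i)\<^sup>2)"
  define V2 where "V2 s = (\<Sum>i\<in>U - s. p i * (a i)\<^sup>2)" for s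
  define v2 where "v2 = (\<Sum>i\<in>U. p i * (a i)\<^sup>2) - mean (\<lambda>i. p i * (a i)\<^sup>2)"
  define X where "X s = (\<Sum>i\<in>s. (1 - p i) * a i)" for s
  define x where "x = mean (\<lambda>i. (1 - p i) * a i)"
  define Z where "Z s = (\<Sum>i\<in>U - s. p i * a i)" for s
  define z where "z = (\<Sum>i\<in>U. p i * a i) - mean (\<lambda>i. p i * a i)"
  have V2': "V2 s - v2 = - ((\<Sum>i\<in>s. p i * (a i)\<^sup>2) - mean (\<lambda>i. p i * (a i)\<^sup>2))"
   and Z': "Z s - z = - ((\<Sum>i\<in>s. p i * a i) - mean (\<lambda>i. p i * a i))" if "s \<in> samples" for s
    using samplesD[OF that] by (simp_all add: V2_def v2_def Z_def z_def sum_diff)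
  have w1: "0 \<le> 1 - p i \<and> 1 - p i \<le> 1" "0 \<le> p i \<and> p i \<le> 1" if "i \<in> U" for i using p01 that by auto
  have nn: "0 \<le> mean (\<lambda>i. (a i)\<^sup>2)" by (intro mean_nonneg) simp
  have u1: "0 \<le> u1" "u1 \<le> k"
  proof -
    show "0 \<le> u1" unfolding u1_def using w1 by (intro mean_nonneg) auto
    have "u1 \<le> mean (\<lambda>i. (a i)\<^sup>2)" unfolding u1_def using w1 by (intro mean_mono) (simp add: mult_left_le_one_le)
    then show "u1 \<le> k" using K2 by simp
  qed
  have v2: "\<bar>v2\<bar> \<le> 2 * k"
  proof -
    have "mean (\<lambda>i. p i * (a i)\<^sup>2) \<le> mean (\<lambda>i. (a i)\<^sup>2)" using w1 by (intro mean_mono) (simp add: mult_left_le_one_le)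
    moreover have "0 \<le> mean (\<lambda>i. p i * (a i)\<^sup>2)" using w1 by (intro mean_nonneg) auto
    moreover have "0 \<le> (\<Sum>i\<in>U. p i * (a i)\<^sup>2)" using w1 by (intro sum_nonneg) auto
    moreover have "(\<Sum>i\<in>U. p i * (a i)\<^sup>2) \<le> 2 * mean (\<lambda>i. (a i)\<^sup>2)" by (rule sum_p_le) simp
    ultimately show ?thesis using K2 nn unfolding v2_def by linarith
  qed
  have r: "2 * k / ?r * real n = 2 * k * ?r" using sqrt_n n_pos by (simp add: real_div_sqrt field_simps)
  have rate_le: "ex (\<lambda>s. \<bar>f s * rate s\<bar>) \<le> ex (\<lambda>s. \<bar>f s\<bar>) * real n" for f :: "'i set \<Rightarrow> real"
  proof -
    have "ex (\<lambda>s. \<bar>f s * rate s\<bar>) \<le> ex (\<lambda>s. real n * \<bar>f s\<bar>)"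
      using rate_bounds by (intro ex_mono) (auto simp: abs_mult mult.commute[of "real n"] intro!: mult_left_mono)
    then show ?thesis by (simp add: ex_cmult mult.commute)
  qed
  have A: "ex (\<lambda>s. \<bar>U1 s * rate s - u1 * mrate\<bar>) \<le> 4 * k * ?r"
  proof -
    have "ex (\<lambda>s. \<bar>(U1 s - u1) * rate s\<bar>) \<le> 2 * k / ?r * real n"
      using rate_le[of "\<lambda>s. U1 s - u1"] lin_dev(2)[OF w1(1)] mult_right_mono[of _ _ "real n"]
      unfolding U1_def u1_def by (meson of_nat_0_le_iff order.trans)
    moreover have "\<bar>u1\<bar> * ex (\<lambda>s. \<bar>rate s - mrate\<bar>) \<le> k * (2 * ?r)"
      using u1 rate_dev k1 by (intro mult_mono) (auto intro!: ex_nonneg)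
    ultimately show ?thesis using ex_abs_product_diff[of U1 rate u1 mrate] r by linarith
  qed
  have B: "ex (\<lambda>s. \<bar>V2 s * rate s - v2 * mrate\<bar>) \<le> 6 * k * ?r"
  proof -
    have "ex (\<lambda>s. \<bar>V2 s - v2\<bar>) = ex (\<lambda>s. \<bar>(\<Sum>i\<in>s. p i * (a i)\<^sup>2) - mean (\<lambda>i. p i * (a i)\<^sup>2)\<bar>)"
      by (intro ex_cong) (simp only: V2' abs_minus_cancel)
    then have "ex (\<lambda>s. \<bar>V2 s - v2\<bar>) \<le> 2 * k / ?r" using lin_dev(2)[of p] w1(2) by simp
    then have "ex (\<lambda>s. \<bar>(V2 s - v2) * rate s\<bar>) \<le> 2 * k / ?r * real n"
      using rate_le[of "\<lambda>s. V2 s - v2"] mult_right_mono[of _ _ "real n"] by (meson of_nat_0_le_iff order.trans)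
    moreover have "\<bar>v2\<bar> * ex (\<lambda>s. \<bar>rate s - mrate\<bar>) \<le> (2 * k) * (2 * ?r)"
      using v2 rate_dev k1 by (intro mult_mono) (auto intro!: ex_nonneg)
    ultimately show ?thesis using ex_abs_product_diff[of V2 rate v2 mrate] r by linarith
  qed
  have C: "ex (\<lambda>s. \<bar>X s * Z s - x * z\<bar>) \<le> 4 * k * ?r"
  proof -
    \<comment> \<open>The bound holds for every single sample: Cauchy-Schwarz is applied with the
      weights \<open>p i\<close>, whose sum over the complement is \<open>rate s\<close>.\<close>
    have Z2: "ex (\<lambda>s. (Z s)\<^sup>2) \<le> 2 * real n * k"
    proof -
      have "(Z s)\<^sup>2 \<le> real n * (2 * k)" if s: "s \<in> samples" for s
      proof -
        have "(Z s)\<^sup>2 = (\<Sum>i\<in>U - s. sqrt (p i) * (sqrt (p i) * a i))\<^sup>2"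
          unfolding Z_def using w1 by (simp add: mult.assoc[symmetric])
        also have "\<dots> \<le> (\<Sum>i\<in>U - s. (sqrt (p i))\<^sup>2) * (\<Sum>i\<in>U - s. (sqrt (p i) * a i)\<^sup>2)"
          by (rule Cauchy_Schwarz_ineq_sum)
        also have "\<dots> = rate s * (\<Sum>i\<in>U - s. p i * (a i)\<^sup>2)"
          unfolding rate_eq[OF s] using w1 by (simp add: power_mult_distrib)
        also have "\<dots> \<le> real n * (2 * k)"
        proof (intro mult_mono)
          have "(\<Sum>i\<in>U - s. p i * (a i)\<^sup>2) \<le> (\<Sum>i\<in>U. p i * (a i)\<^sup>2)" using w1 by (intro sum_mono2) auto
          also have "\<dots> \<le> 2 * mean (\<lambda>i. (a i)\<^sup>2)" by (rule sum_p_le) simp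
          finally show "(\<Sum>i\<in>U - s. p i * (a i)\<^sup>2) \<le> 2 * k" using K2 by simp
        qed (use rate_bounds[OF s] w1 in \<open>auto intro!: sum_nonneg\<close>)
        finally show ?thesis .
      qed
      then show ?thesis using ex_mono[of "\<lambda>s. (Z s)\<^sup>2" "\<lambda>_. real n * (2 * k)"] by simp
    qed
    have "ex (\<lambda>s. \<bar>(X s - x) * Z s\<bar>) \<le> sqrt (ex (\<lambda>s. (X s - x)\<^sup>2) * ex (\<lambda>s. (Z s)\<^sup>2))" by (rule ex_abs_mult_le)
    also have "\<dots> \<le> sqrt ((2 * k) * (2 * real n * k))"
      using lin_dev(1)[OF w1(1)] Z2 k1 unfolding X_def x_def
      by (intro real_sqrt_le_mono mult_mono) (auto intro!: ex_nonneg)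
    also have "\<dots> = sqrt ((2 * k)\<^sup>2 * real n)" by (simp add: power2_eq_square algebra_simps)
    also have "\<dots> = 2 * k * ?r" using k1 by (simp add: real_sqrt_mult)
    finally have 1: "ex (\<lambda>s. \<bar>(X s - x) * Z s\<bar>) \<le> 2 * k * ?r" .
    have "\<bar>x\<bar> \<le> mean (\<lambda>i. \<bar>a i\<bar>)" unfolding x_def
      using w1 by (intro order.trans[OF abs_mean_le] mean_mono) (simp add: abs_mult mult_left_le_one_le)
    also have "\<dots> \<le> sqrt (real n * mean (\<lambda>i. (a i)\<^sup>2))" by (rule mean_abs_le)
    also have "\<dots> \<le> sqrt (real n * k)" using K2 by (simp add: mult_left_mono)
    finally have 2: "\<bar>x\<bar> \<le> sqrt (real n * k)" .
    have "ex (\<lambda>s. \<bar>Z s - z\<bar>) \<le> sqrt (ex (\<lambda>s. (Z s - z)\<^sup>2))" by (rule ex_abs_le)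
    also have "ex (\<lambda>s. (Z s - z)\<^sup>2) = ex (\<lambda>s. ((\<Sum>i\<in>s. p i * a i) - mean (\<lambda>i. p i * a i))\<^sup>2)"
      by (intro ex_cong) (simp only: Z' power2_minus)
    also have "sqrt \<dots> \<le> sqrt (4 * k)" using lin_dev(1)[of p] w1(2) k1 by (intro real_sqrt_le_mono) simp
    finally have 3: "ex (\<lambda>s. \<bar>Z s - z\<bar>) \<le> sqrt (4 * k)" .
    have "\<bar>x\<bar> * ex (\<lambda>s. \<bar>Z s - z\<bar>) \<le> sqrt (real n * k) * sqrt (4 * k)"
      using 2 3 k1 by (intro mult_mono) (auto intro!: ex_nonneg)
    also have "\<dots> = sqrt ((2 * k)\<^sup>2 * real n)" unfolding real_sqrt_mult[symmetric]
      by (simp add: power2_eq_square algebra_simps)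
    also have "\<dots> = 2 * k * ?r" using k1 by (simp add: real_sqrt_mult)
    finally show ?thesis using 1 ex_abs_product_diff[of X Z x z] by linarith
  qed
  define q0 where "q0 = u1 * mrate - 2 * (x * z) + v2 * mrate"
  have Qs: "Q s = U1 s * rate s - 2 * (X s * Z s) + V2 s * rate s" if s: "s \<in> samples" for s
  proof -
    have "Q s = swap_sum s (\<lambda>i j. (a i)\<^sup>2 * 1 - 2 * (a i * a j) + 1 * (a j)\<^sup>2)"
      unfolding Q_def swap_sum_def by (intro sum.cong refl) (simp add: power2_eq_square algebra_simps)
    also have "\<dots> = U1 s * rate s - 2 * (X s * Z s) + rate s * V2 s"
    proof -
      have "swap_sum s (\<lambda>i j. (a i)\<^sup>2 * 1) = U1 s * rate s"
        using swap_sum_prod[of s "\<lambda>i. (a i)\<^sup>2" "\<lambda>_. 1"] rate_eq[OF s] by (simp add: U1_def)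
      moreover have "swap_sum s (\<lambda>i j. 1 * (a j)\<^sup>2) = rate s * V2 s"
        using swap_sum_prod[of s "\<lambda>_. 1" "\<lambda>i. (a i)\<^sup>2"] by (simp add: V2_def rate_def)
      moreover have "swap_sum s (\<lambda>i j. a i * a j) = X s * Z s"
        unfolding X_def Z_def by (rule swap_sum_prod)
      ultimately show ?thesis by (simp only: swap_sum_add swap_sum_diff swap_sum_cmult[of s 2])
    qed
    finally show ?thesis by simp
  qed
  have triangle: "\<bar>a - 2 * b + c - (d - 2 * e + f)\<bar> \<le> \<bar>a - d\<bar> + 2 * \<bar>b - e\<bar> + \<bar>c - f\<bar>" for a b c d e f :: real
    by (smt (verit))
  have q0: "ex (\<lambda>s. \<bar>Q s - q0\<bar>) \<le> 18 * k * ?r"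
  proof -
    have "ex (\<lambda>s. \<bar>Q s - q0\<bar>) \<le> ex (\<lambda>s. \<bar>U1 s * rate s - u1 * mrate\<bar> + 2 * \<bar>X s * Z s - x * z\<bar> + \<bar>V2 s * rate s - v2 * mrate\<bar>)"
    proof (intro ex_mono)
      fix s assume "s \<in> samples"
      show "\<bar>Q s - q0\<bar> \<le> \<bar>U1 s * rate s - u1 * mrate\<bar> + 2 * \<bar>X s * Z s - x * z\<bar> + \<bar>V2 s * rate s - v2 * mrate\<bar>"
        unfolding Qs[OF \<open>s \<in> samples\<close>] q0_def by (rule triangle)
    qed
    then show ?thesis using A B C unfolding ex_add ex_cmult by linarith
  qed
  \<comment> \<open>\<open>q0\<close> is built from means of the factors and need not be the mean of
    \<open>Q\<close>, since the factors are dependent; recentring at most doubles the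
    deviation.\<close>
  have "\<bar>ex Q - q0\<bar> \<le> ex (\<lambda>s. \<bar>Q s - q0\<bar>)" using abs_ex_le[of "\<lambda>s. Q s - q0"] by (simp add: ex_diff)
  moreover have "ex (\<lambda>s. \<bar>Q s - ex Q\<bar>) \<le> ex (\<lambda>s. \<bar>Q s - q0\<bar> + \<bar>ex Q - q0\<bar>)" by (intro ex_mono) linarith
  moreover have "0 \<le> k * ?r" using k1 by simp
  ultimately show ?thesis using q0 unfolding ex_add by simp
qed


section \<open>The differential equation for the characteristic function\<close>

definition phi :: "real \<Rightarrow> complex" where "phi u = ex (\<lambda>s. iexp (u * Y s))"
definition phi' :: "real \<Rightarrow> complex" where "phi' u = ex (\<lambda>s. Y s *\<^sub>R (\<i> * iexp (u * Y s)))"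

lemma phi_deriv: "(phi has_vector_derivative phi' u) (at u)"
proof -
  have d: "((\<lambda>u. iexp (u * y)) has_vector_derivative y *\<^sub>R (\<i> * iexp (u * y))) (at u)" for y :: real
  proof -
    have "((\<lambda>z. exp (\<i> * (z * complex_of_real y))) has_field_derivative
        complex_of_real y * (\<i> * exp (\<i> * (complex_of_real u * complex_of_real y)))) (at (complex_of_real u))"
      by (auto intro!: derivative_eq_intros)
    from has_vector_derivative_real_field[OF this] show ?thesis by (simp add: scaleR_conv_of_real)
  qed
  show ?thesis unfolding phi_def[abs_def] phi'_def ex_def
    by (intro has_vector_derivative_sum bounded_linear.has_vector_derivative[OF bounded_linear_scaleR_right] d)
qed

lemma norm_phi: "norm (phi u) \<le> 1"
  unfolding phi_def using norm_ex_le[of "\<lambda>s. iexp (u * Y s)"] by simp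

text \<open>Third absolute powers are interpolated between second and fourth powers with weight
  \<open>sqrt n\<close>, the balance point for jumps of size \<open>1 / sqrt n\<close>; both parts
  are then of order \<open>sqrt n\<close>.\<close>

lemma ex_swap_sum_abs3_le: "ex (\<lambda>s. swap_sum s (\<lambda>i j. \<bar>a j - a i\<bar> ^ 3)) \<le> 15 * k\<^sup>2 * sqrt (real n)"
proof -
  let ?r = "sqrt (real n)"
  have am: "2 * \<bar>d\<bar> ^ 3 \<le> (1 / ?r) * d\<^sup>2 + ?r * d ^ 4" for d :: real
  proof -
    have r: "0 < ?r" using n_pos by simp
    have "0 \<le> \<bar>d\<bar>\<^sup>2 * (?r * \<bar>d\<bar> - 1)\<^sup>2 / ?r" using r by simp
    also have "\<dots> = ?r * \<bar>d\<bar> ^ 4 - 2 * \<bar>d\<bar> ^ 3 + \<bar>d\<bar>\<^sup>2 / ?r"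
      using r by (simp add: power2_eq_square power3_eq_cube power4_eq_xxxx field_simps)
    finally show ?thesis by simp
  qed
  have "2 * ex (\<lambda>s. swap_sum s (\<lambda>i j. \<bar>a j - a i\<bar> ^ 3)) = ex (\<lambda>s. swap_sum s (\<lambda>i j. 2 * \<bar>a j - a i\<bar> ^ 3))"
    unfolding swap_sum_cmult ex_cmult ..
  also have "\<dots> \<le> ex (\<lambda>s. swap_sum s (\<lambda>i j. (1 / ?r) * (a j - a i)\<^sup>2 + ?r * (a j - a i) ^ 4))"
    using am by (intro ex_mono swap_sum_mono) auto
  also have "\<dots> = (1 / ?r) * ex (\<lambda>s. swap_sum s (\<lambda>i j. (a j - a i)\<^sup>2)) + ?r * ex (\<lambda>s. swap_sum s (\<lambda>i j. (a j - a i) ^ 4))"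
    unfolding swap_sum_add swap_sum_cmult ex_add ex_cmult ..
  also have "\<dots> \<le> (1 / ?r) * (6 * real n * k) + ?r * (24 * real n * (k\<^sup>2 / real n))"
  proof (intro add_mono mult_left_mono)
    show "ex (\<lambda>s. swap_sum s (\<lambda>i j. (a j - a i)\<^sup>2)) \<le> 6 * real n * k"
      by (rule order.trans[OF ex_swap_sum_power2_le]) (use K2 in \<open>simp add: mult_left_mono\<close>)
    show "ex (\<lambda>s. swap_sum s (\<lambda>i j. (a j - a i) ^ 4)) \<le> 24 * real n * (k\<^sup>2 / real n)"
      by (rule order.trans[OF ex_swap_sum_power4_le]) (use K4 in \<open>intro mult_left_mono, auto\<close>)
  qed auto
  also have "\<dots> = 6 * (k * ?r) + 24 * (k\<^sup>2 * ?r)"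
    using n_pos by (simp add: real_div_sqrt field_simps)
  also have "k * ?r \<le> k\<^sup>2 * ?r" using k1 by (intro mult_right_mono) (auto simp: power2_eq_square)
  finally show ?thesis by linarith
qed

text \<open>The test function is \<open>iexp (u * Y s)\<close>. To first order a jump multiplies it
  by \<open>\<i> * u * (a j - a i)\<close>, so the right-hand side of the swap identity becomes
  \<open>Q s\<close> times the test function. The errors are the Taylor remainder with its third
  powers of jumps, the deviation of \<open>Q\<close>, and the deviation of \<open>rate\<close> on
  the left; each is of order \<open>sqrt n\<close>.\<close>

lemma mrate_phi':
  "norm (mrate *\<^sub>R phi' u + (u * ex Q / 2) *\<^sub>R phi u) \<le>
     4 * k\<^sup>2 * sqrt (real n) / g + (15 * u\<^sup>2 / 4 + 30 * \<bar>u\<bar>) * k\<^sup>2 * sqrt (real n)"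
proof -
  let ?r = "sqrt (real n)"
  define e where "e s = iexp (u * Y s)" for s
  have ne [simp]: "norm (e s) = 1" for s by (simp add: e_def)
  define D where "D s = swap_sum s (\<lambda>i j. (a j - a i) *\<^sub>R (e (swap i j s) - e s))" for s
  have id: "ex (\<lambda>s. (rate s * Y s) *\<^sub>R e s) = (1 / 2) *\<^sub>R ex D"
    unfolding D_def Y_def ctr_def by (rule swap_identity)
  have D: "norm (D s - Q s *\<^sub>R (\<i> * u * e s)) \<le> u\<^sup>2 / 2 * swap_sum s (\<lambda>i j. \<bar>a j - a i\<bar> ^ 3)"
    if s: "s \<in> samples" for s
  proof -
    define G where "G i j = (a j - a i) *\<^sub>R (e s * (iexp (u * (a j - a i)) - 1 - \<i> * complex_of_real (u * (a j - a i))))" for i j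
    have "D s = swap_sum s (\<lambda>i j. (a j - a i)\<^sup>2 *\<^sub>R (\<i> * u * e s) + G i j)"
      unfolding D_def swap_sum_def
    proof (intro sum.cong refl arg_cong[where f = "\<lambda>x. _ *\<^sub>R x"])
      fix i j assume "i \<in> s" "j \<in> U - s"
      then have "Y (swap i j s) = Y s + (a j - a i)" using s by (simp add: Y_def swap_samples)
      then have "e (swap i j s) = e s * iexp (u * (a j - a i))"
        by (simp only: e_def iexp_distrib)
      then show "(a j - a i) *\<^sub>R (e (swap i j s) - e s) = (a j - a i)\<^sup>2 *\<^sub>R (\<i> * u * e s) + G i j"
        by (simp add: G_def scaleR_conv_of_real power2_eq_square algebra_simps)
    qed
    also have "\<dots> = Q s *\<^sub>R (\<i> * u * e s) + swap_sum s G"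
      unfolding swap_sum_add swap_sum_scaleR Q_def ..
    finally have "norm (D s - Q s *\<^sub>R (\<i> * u * e s)) \<le> swap_sum s (\<lambda>i j. norm (G i j))"
      using norm_swap_sum_le[OF s, of G] by simp
    also have "\<dots> \<le> swap_sum s (\<lambda>i j. u\<^sup>2 / 2 * \<bar>a j - a i\<bar> ^ 3)"
    proof (intro swap_sum_mono[OF s])
      fix i j
      have "norm (G i j) \<le> \<bar>a j - a i\<bar> * ((u * (a j - a i))\<^sup>2 / 2)"
        unfolding G_def norm_scaleR norm_mult ne mult_1 by (intro mult_left_mono iexp_diff_bound) simp
      also have "\<dots> = u\<^sup>2 / 2 * \<bar>a j - a i\<bar> ^ 3"
        by (simp add: power_mult_distrib power3_eq_cube power2_eq_square)
      finally show "norm (G i j) \<le> u\<^sup>2 / 2 * \<bar>a j - a i\<bar> ^ 3" .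
    qed
    finally show ?thesis unfolding swap_sum_cmult .
  qed
  have 1: "norm (ex D - ex (\<lambda>s. Q s *\<^sub>R (\<i> * u * e s))) \<le> u\<^sup>2 / 2 * (15 * k\<^sup>2 * ?r)"
  proof -
    have "norm (ex D - ex (\<lambda>s. Q s *\<^sub>R (\<i> * u * e s))) \<le> ex (\<lambda>s. u\<^sup>2 / 2 * swap_sum s (\<lambda>i j. \<bar>a j - a i\<bar> ^ 3))"
      unfolding ex_diff[symmetric] by (rule order.trans[OF norm_ex_le]) (intro ex_mono D)
    also have "\<dots> \<le> u\<^sup>2 / 2 * (15 * k\<^sup>2 * ?r)"
      unfolding ex_cmult by (intro mult_left_mono ex_swap_sum_abs3_le) simp
    finally show ?thesis .
  qed
  have 2: "norm (ex (\<lambda>s. Q s *\<^sub>R (\<i> * u * e s)) - ex Q *\<^sub>R (\<i> * u * phi u)) \<le> \<bar>u\<bar> * (60 * k\<^sup>2 * ?r)"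
  proof -
    have "ex Q *\<^sub>R (\<i> * u * phi u) = ex (\<lambda>s. ex Q *\<^sub>R (\<i> * u * e s))"
      by (simp add: phi_def e_def ex_scaleR ex_cmult)
    then have "norm (ex (\<lambda>s. Q s *\<^sub>R (\<i> * u * e s)) - ex Q *\<^sub>R (\<i> * u * phi u)) =
        norm (ex (\<lambda>s. (Q s - ex Q) *\<^sub>R (\<i> * u * e s)))"
      by (simp add: scaleR_diff_left ex_diff)
    also have "\<dots> \<le> ex (\<lambda>s. norm ((Q s - ex Q) *\<^sub>R (\<i> * u * e s)))" by (rule norm_ex_le)
    also have "\<dots> = ex (\<lambda>s. \<bar>u\<bar> * \<bar>Q s - ex Q\<bar>)" by (intro ex_cong) (simp add: norm_mult)
    also have "\<dots> \<le> \<bar>u\<bar> * (60 * k * ?r)" unfolding ex_cmult using Q_dev by (intro mult_left_mono) auto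
    also have "\<dots> \<le> \<bar>u\<bar> * (60 * k\<^sup>2 * ?r)"
      using k1 by (intro mult_left_mono mult_right_mono) (auto simp: power2_eq_square)
    finally show ?thesis .
  qed
  have 3: "norm (ex (\<lambda>s. (rate s * Y s) *\<^sub>R e s) - mrate *\<^sub>R ex (\<lambda>s. Y s *\<^sub>R e s)) \<le> 4 * k\<^sup>2 * ?r / g"
  proof -
    have "norm (ex (\<lambda>s. (rate s * Y s) *\<^sub>R e s) - mrate *\<^sub>R ex (\<lambda>s. Y s *\<^sub>R e s)) =
        norm (ex (\<lambda>s. ((rate s - mrate) * Y s) *\<^sub>R e s))"
      by (simp add: ex_diff[symmetric] ex_scaleR[symmetric] left_diff_distrib scaleR_diff_left)
    also have "\<dots> \<le> ex (\<lambda>s. \<bar>(rate s - mrate) * Y s\<bar>)"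
      by (rule order.trans[OF norm_ex_le]) (simp add: abs_mult)
    also have "\<dots> \<le> sqrt (ex (\<lambda>s. (rate s - mrate)\<^sup>2) * ex (\<lambda>s. (Y s)\<^sup>2))" by (rule ex_abs_mult_le)
    also have "\<dots> \<le> sqrt (2 * real n * (6 * k / g))"
      using rate_variance_le Y2 by (intro real_sqrt_le_mono mult_mono) (auto intro!: ex_nonneg)
    also have "\<dots> \<le> sqrt ((4 * k\<^sup>2 * ?r / g)\<^sup>2)"
    proof (rule real_sqrt_le_mono)
      have "k \<le> k ^ 4" using k1 power_increasing[of 1 4 k] by simp
      moreover have "1 / g \<le> 1 / g\<^sup>2" using g_pos g_le_1 by (simp add: field_simps power2_eq_square mult_left_le)
      ultimately have "12 * real n * (k * (1 / g)) \<le> 16 * real n * (k ^ 4 * (1 / g\<^sup>2))"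
        using k1 g_pos by (intro mult_mono) auto
      then show "2 * real n * (6 * k / g) \<le> (4 * k\<^sup>2 * ?r / g)\<^sup>2"
        by (simp add: power_mult_distrib power_divide mult_ac flip: power_mult)
    qed
    also have "\<dots> = 4 * k\<^sup>2 * ?r / g" using k1 g_pos by simp
    finally show ?thesis .
  qed
  have triangle: "norm (- x + (1 / 2) *\<^sub>R y + (1 / 2) *\<^sub>R z) \<le> A + 1 / 2 * B + 1 / 2 * C"
    if "norm x \<le> A" "norm y \<le> B" "norm z \<le> C" for x y z :: complex and A B C
    using norm_triangle_ineq[of "- x + (1 / 2) *\<^sub>R y" "(1 / 2) *\<^sub>R z"] norm_triangle_ineq[of "- x" "(1 / 2) *\<^sub>R y"] that
    by simp
  have "phi' u = \<i> * ex (\<lambda>s. Y s *\<^sub>R e s)"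
    unfolding phi'_def e_def ex_cmult[symmetric] by simp
  then have "mrate *\<^sub>R phi' u + (u * ex Q / 2) *\<^sub>R phi u =
     \<i> * (- (ex (\<lambda>s. (rate s * Y s) *\<^sub>R e s) - mrate *\<^sub>R ex (\<lambda>s. Y s *\<^sub>R e s))
       + (1 / 2) *\<^sub>R (ex D - ex (\<lambda>s. Q s *\<^sub>R (\<i> * u * e s)))
       + (1 / 2) *\<^sub>R (ex (\<lambda>s. Q s *\<^sub>R (\<i> * u * e s)) - ex Q *\<^sub>R (\<i> * u * phi u)))"
    unfolding id by (simp add: scaleR_conv_of_real algebra_simps)
  also have "norm \<dots> \<le> 4 * k\<^sup>2 * ?r / g + 1 / 2 * (u\<^sup>2 / 2 * (15 * k\<^sup>2 * ?r)) + 1 / 2 * (\<bar>u\<bar> * (60 * k\<^sup>2 * ?r))"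
    unfolding norm_mult norm_ii mult_1 by (rule triangle[OF 3 1 2])
  finally show ?thesis by (simp add: algebra_simps)
qed

text \<open>Division of \<open>mrate_phi'\<close> by \<open>mrate\<close> gives a perturbed Gaussian
  equation with variance \<open>ex Q / (2 * mrate)\<close>, which \<open>mrate_Y2\<close> and
  \<open>ctr_sq\<close> exchange for the exact \<open>covar a a\<close>. The constant is 98 from the
  differential equation plus 2 for moving the centre from \<open>ctr\<close> to the mean.\<close>

lemma char_approx:
  "norm (ex (\<lambda>s. iexp (t * ((\<Sum>i\<in>s. a i) - mean a))) - exp (- (covar a a * t\<^sup>2 / 2))) \<le>
     100 * k\<^sup>2 / (g ^ 3 * sqrt (real n)) * \<bar>t\<bar> * (1 + t\<^sup>2)"
proof -
  let ?r = "sqrt (real n)"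
  define L where "L = k\<^sup>2 / (g ^ 3 * ?r)"
  have L: "0 \<le> L" using g_pos by (simp add: L_def)
  have covar0: "0 \<le> covar a a" unfolding ex_variance[symmetric] by (intro ex_nonneg) simp
  have g2: "1 / g \<le> 1 / g\<^sup>2" "1 \<le> 1 / g\<^sup>2"
    using g_pos g_le_1 by (auto simp: field_simps power2_eq_square mult_left_le mult_le_one)
  have kk: "k \<le> k\<^sup>2" using k1 by (simp add: power2_eq_square)
  have cv: "\<bar>mrate * covar a a - ex Q / 2\<bar> \<le> 64 * (k\<^sup>2 * ?r * (1 / g\<^sup>2))"
  proof -
    have "mrate * (mean a - ctr)\<^sup>2 \<le> real n * (4 * k / (g\<^sup>2 * real n))"
      using ctr_sq mrate_le mrate_pos by (intro mult_mono) auto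
    also have "\<dots> = 4 * (k * 1 * (1 / g\<^sup>2))" using n_pos by simp
    also have "\<dots> \<le> 4 * (k\<^sup>2 * ?r * (1 / g\<^sup>2))" using kk sqrt_n k1 by (intro mult_mono) auto
    finally have A: "mrate * (mean a - ctr)\<^sup>2 \<le> 4 * (k\<^sup>2 * ?r * (1 / g\<^sup>2))" .
    have "0 \<le> mrate * (mean a - ctr)\<^sup>2" using mrate_pos by simp
    moreover have "60 * k * ?r / g \<le> 60 * (k\<^sup>2 * ?r * (1 / g\<^sup>2))"
    proof -
      have "k * ?r * (1 / g) \<le> k\<^sup>2 * ?r * (1 / g\<^sup>2)" using kk g2 k1 g_pos by (intro mult_mono) auto
      then show ?thesis by simp
    qed
    ultimately show ?thesis using A mrate_Y2 unfolding Y2_covar distrib_left by linarith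
  qed
  have bound: "norm (phi' u + (u * covar a a) *\<^sub>R phi u) \<le> L * (98 * (1 + t\<^sup>2))" if u: "\<bar>u\<bar> \<le> \<bar>t\<bar>" for u
  proof -
    define w where "w = k\<^sup>2 * ?r * (1 / g\<^sup>2)"
    have w: "0 \<le> w" by (simp add: w_def)
    have "mrate *\<^sub>R (phi' u + (u * covar a a) *\<^sub>R phi u) =
        (mrate *\<^sub>R phi' u + (u * ex Q / 2) *\<^sub>R phi u) + (u * (mrate * covar a a - ex Q / 2)) *\<^sub>R phi u"
      by (simp add: scaleR_conv_of_real algebra_simps)
    then have "mrate * norm (phi' u + (u * covar a a) *\<^sub>R phi u) =
      norm ((mrate *\<^sub>R phi' u + (u * ex Q / 2) *\<^sub>R phi u) + (u * (mrate * covar a a - ex Q / 2)) *\<^sub>R phi u)"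
      using mrate_pos by (metis abs_of_pos norm_scaleR)
    also have "\<dots> \<le> 4 * k\<^sup>2 * ?r / g + (15 * u\<^sup>2 / 4 + 30 * \<bar>u\<bar>) * k\<^sup>2 * ?r + \<bar>u\<bar> * (64 * (k\<^sup>2 * ?r * (1 / g\<^sup>2))) * 1"
    proof (rule order.trans[OF norm_triangle_ineq add_mono[OF mrate_phi']])
      show "norm ((u * (mrate * covar a a - ex Q / 2)) *\<^sub>R phi u) \<le> \<bar>u\<bar> * (64 * (k\<^sup>2 * ?r * (1 / g\<^sup>2))) * 1"
        unfolding norm_scaleR abs_mult by (intro mult_mono mult_left_mono cv norm_phi) auto
    qed
    also have "\<dots> \<le> 4 * w + (15 * u\<^sup>2 / 4 + 30 * \<bar>u\<bar>) * w + 64 * \<bar>u\<bar> * w"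
    proof -
      have "k\<^sup>2 * ?r * (1 / g) \<le> w" unfolding w_def using g2 by (intro mult_left_mono) auto
      then have "4 * k\<^sup>2 * ?r / g \<le> 4 * w" by simp
      moreover have "k\<^sup>2 * ?r * 1 \<le> w" unfolding w_def using g2 by (intro mult_left_mono) auto
      then have "(15 * u\<^sup>2 / 4 + 30 * \<bar>u\<bar>) * (k\<^sup>2 * ?r) \<le> (15 * u\<^sup>2 / 4 + 30 * \<bar>u\<bar>) * w"
        by (intro mult_left_mono) auto
      then have "(15 * u\<^sup>2 / 4 + 30 * \<bar>u\<bar>) * k\<^sup>2 * ?r \<le> (15 * u\<^sup>2 / 4 + 30 * \<bar>u\<bar>) * w"
        by (simp only: mult.assoc)
      moreover have "\<bar>u\<bar> * (64 * (k\<^sup>2 * ?r * (1 / g\<^sup>2))) * 1 = 64 * \<bar>u\<bar> * w"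
        by (simp add: w_def)
      ultimately show ?thesis by linarith
    qed
    also have "\<dots> = (4 + 15 * u\<^sup>2 / 4 + 94 * \<bar>u\<bar>) * w" by (simp add: algebra_simps)
    also have "\<dots> \<le> (98 * (1 + t\<^sup>2)) * w"
    proof (intro mult_right_mono w)
      have "u\<^sup>2 \<le> t\<^sup>2" using u by (simp add: abs_le_square_iff)
      moreover have "2 * \<bar>u\<bar> \<le> 1 + u\<^sup>2" using sum_squares_bound[of 1 "\<bar>u\<bar>"] by simp
      ultimately show "4 + 15 * u\<^sup>2 / 4 + 94 * \<bar>u\<bar> \<le> 98 * (1 + t\<^sup>2)"
        using zero_le_power2[of t] zero_le_power2[of u] by (simp add: distrib_left; linarith)
    qed
    finally have "mrate * norm (phi' u + (u * covar a a) *\<^sub>R phi u) \<le> (98 * (1 + t\<^sup>2)) * w" .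
    moreover have "g * real n * norm (phi' u + (u * covar a a) *\<^sub>R phi u) \<le> mrate * norm (phi' u + (u * covar a a) *\<^sub>R phi u)"
      using mrate_ge by (intro mult_right_mono) auto
    moreover have "w = g * real n * L"
      unfolding w_def L_def using g_pos n_pos sqrt_n(1)
      by (simp add: field_simps power2_eq_square power3_eq_cube)
    ultimately have "g * real n * norm (phi' u + (u * covar a a) *\<^sub>R phi u) \<le> g * real n * (L * (98 * (1 + t\<^sup>2)))"
      by (simp only: mult_ac)
    then show ?thesis using g_pos n_pos by simp
  qed
  have phi0: "phi 0 = 1" by (simp add: phi_def)
  have 1: "norm (phi t - exp (- (covar a a * t\<^sup>2 / 2))) \<le> \<bar>t\<bar> * (L * (98 * (1 + t\<^sup>2)))"
    by (rule gaussian_ODE_bound[OF covar0 phi0 phi_deriv bound])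
  have 2: "norm (ex (\<lambda>s. iexp (t * ((\<Sum>i\<in>s. a i) - mean a))) - phi t) \<le> \<bar>t\<bar> * (2 * L)"
  proof -
    have "norm (ex (\<lambda>s. iexp (t * ((\<Sum>i\<in>s. a i) - mean a))) - phi t) \<le>
        ex (\<lambda>s. norm (iexp (t * ((\<Sum>i\<in>s. a i) - mean a)) - iexp (t * Y s)))"
      unfolding phi_def ex_diff[symmetric] by (rule norm_ex_le)
    also have "\<dots> \<le> ex (\<lambda>s. \<bar>t\<bar> * \<bar>mean a - ctr\<bar>)"
    proof (intro ex_mono order.trans[OF iexp_lipschitz])
      fix s
      have "t * ((\<Sum>i\<in>s. a i) - mean a) - t * Y s = t * (ctr - mean a)" by (simp add: Y_def algebra_simps)
      then show "\<bar>t * ((\<Sum>i\<in>s. a i) - mean a) - t * Y s\<bar> \<le> \<bar>t\<bar> * \<bar>mean a - ctr\<bar>"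
        by (simp add: abs_mult abs_minus_commute)
    qed
    also have "\<bar>mean a - ctr\<bar> \<le> 2 * L"
    proof (rule power2_le_imp_le)
      have "k \<le> k ^ 4" using k1 power_increasing[of 1 4 k] by simp
      moreover have "1 / g\<^sup>2 \<le> 1 / (g ^ 3)\<^sup>2"
        using g_pos g_le_1 power_decreasing[of 2 6 g] by (simp add: frac_le flip: power_mult)
      ultimately have "4 / real n * (k * (1 / g\<^sup>2)) \<le> 4 / real n * (k ^ 4 * (1 / (g ^ 3)\<^sup>2))"
        using k1 by (intro mult_left_mono mult_mono) auto
      then have "4 * k / (g\<^sup>2 * real n) \<le> (2 * L)\<^sup>2"
        by (simp add: L_def power_mult_distrib power_divide mult_ac flip: power_mult)
      then show "\<bar>mean a - ctr\<bar>\<^sup>2 \<le> (2 * L)\<^sup>2" using ctr_sq by simp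
    qed (use L in simp)
    finally show ?thesis by (simp add: mult_left_mono)
  qed
  have "norm (ex (\<lambda>s. iexp (t * ((\<Sum>i\<in>s. a i) - mean a))) - exp (- (covar a a * t\<^sup>2 / 2))) \<le>
      \<bar>t\<bar> * (2 * L) + \<bar>t\<bar> * (L * (98 * (1 + t\<^sup>2)))"
    using norm_triangle_mono[OF 2 1] by simp
  also have "\<dots> \<le> \<bar>t\<bar> * (2 * L * (1 + t\<^sup>2)) + \<bar>t\<bar> * (L * (98 * (1 + t\<^sup>2)))"
    using L by (intro add_mono mult_left_mono) (auto simp: mult_le_cancel_left1)
  also have "\<dots> = 100 * L * \<bar>t\<bar> * (1 + t\<^sup>2)" by (simp add: algebra_simps)
  finally show ?thesis by (simp add: L_def)
qed

end

section \<open>Two-stage sampling\<close>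

lemma (in prob_space) expectation_square_le:
  fixes f :: "'a \<Rightarrow> real"
  assumes [measurable]: "f \<in> borel_measurable M" and "integrable M (\<lambda>x. (f x)\<^sup>2)"
  shows "(expectation f)\<^sup>2 \<le> expectation (\<lambda>x. (f x)\<^sup>2)"
proof -
  have "integrable M f" using square_integrable_imp_integrable[OF assms] .
  then have "expectation (\<lambda>x. (f x)\<^sup>2) - (expectation f)\<^sup>2 = variance f"
    using assms by (simp add: variance_eq)
  moreover have "0 \<le> variance f" by (intro Bochner_Integration.integral_nonneg) simp
  ultimately show ?thesis by linarith
qed

lemma (in prob_space) indep_sum_second_moment:
  fixes Z :: "'i \<Rightarrow> 'a \<Rightarrow> real"
  assumes I: "finite I" and ind: "indep_vars (\<lambda>_. borel) Z I"
    and sq: "\<And>i. i \<in> I \<Longrightarrow> integrable M (\<lambda>x. (Z i x)\<^sup>2)"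
  shows "integrable M (\<lambda>x. ((\<Sum>i\<in>I. Z i x) - c)\<^sup>2)" (is ?int)
    and "expectation (\<lambda>x. ((\<Sum>i\<in>I. Z i x) - c)\<^sup>2) =
      (\<Sum>i\<in>I. expectation (\<lambda>x. (Z i x)\<^sup>2) - (expectation (Z i))\<^sup>2) + ((\<Sum>i\<in>I. expectation (Z i)) - c)\<^sup>2" (is ?eq)
proof -
  have rv: "random_variable borel (Z i)" if "i \<in> I" for i using ind that by (auto simp: indep_vars_def)
  have int: "integrable M (Z i)" if "i \<in> I" for i
    using square_integrable_imp_integrable[OF rv sq] that by simp
  define m where "m i = expectation (Z i)" for i
  define W where "W i x = Z i x - m i" for i x
  have intW: "integrable M (W i)" if "i \<in> I" for i using int that by (simp add: W_def[abs_def])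
  have W0: "expectation (W i) = 0" if "i \<in> I" for i using int that by (simp add: W_def[abs_def] m_def prob_space)
  have W2: "integrable M (\<lambda>x. (W i x)\<^sup>2)" "expectation (\<lambda>x. (W i x)\<^sup>2) = expectation (\<lambda>x. (Z i x)\<^sup>2) - (m i)\<^sup>2"
    if "i \<in> I" for i
  proof -
    have "(\<lambda>x. (W i x)\<^sup>2) = (\<lambda>x. (Z i x)\<^sup>2 - 2 * m i * Z i x + (m i)\<^sup>2)"
      by (simp add: W_def power2_eq_square algebra_simps)
    then show "integrable M (\<lambda>x. (W i x)\<^sup>2)" using int sq that by simp
    show "expectation (\<lambda>x. (W i x)\<^sup>2) = expectation (\<lambda>x. (Z i x)\<^sup>2) - (m i)\<^sup>2"
      using variance_eq[OF int[OF that] sq[OF that]] by (simp add: W_def m_def)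
  qed
  have indW: "indep_vars (\<lambda>_. borel) W I"
    unfolding W_def[abs_def] by (rule indep_vars_compose2[OF ind]) simp
  have cross: "integrable M (\<lambda>x. W i x * W j x)" "expectation (\<lambda>x. W i x * W j x) = 0"
    if "i \<in> I" "j \<in> I" "i \<noteq> j" for i j
  proof -
    have *: "indep_vars (\<lambda>_. borel) W {i, j}" using indep_vars_subset[OF indW] that by simp
    have 1: "integrable M (\<lambda>x. \<Prod>k\<in>{i, j}. W k x)" using indep_vars_integrable[OF _ *] intW that by auto
    have 2: "expectation (\<lambda>x. \<Prod>k\<in>{i, j}. W k x) = (\<Prod>k\<in>{i, j}. expectation (W k))"
      using indep_vars_lebesgue_integral[OF _ *] intW that by auto
    show "integrable M (\<lambda>x. W i x * W j x)" "expectation (\<lambda>x. W i x * W j x) = 0"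
      using 1 2 W0 that by simp_all
  qed
  define e where "e = (\<Sum>i\<in>I. m i) - c"
  have eq: "(\<lambda>x. ((\<Sum>i\<in>I. Z i x) - c)\<^sup>2) = (\<lambda>x. (\<Sum>i\<in>I. \<Sum>j\<in>I. W i x * W j x) + 2 * e * (\<Sum>i\<in>I. W i x) + e\<^sup>2)"
  proof
    fix x
    have "(\<Sum>i\<in>I. Z i x) - c = (\<Sum>i\<in>I. W i x) + e" by (simp add: W_def e_def sum_subtractf)
    moreover have "(A + e)\<^sup>2 = A * A + 2 * e * A + e\<^sup>2" for A
      by (simp add: power2_eq_square algebra_simps)
    ultimately show "((\<Sum>i\<in>I. Z i x) - c)\<^sup>2 = (\<Sum>i\<in>I. \<Sum>j\<in>I. W i x * W j x) + 2 * e * (\<Sum>i\<in>I. W i x) + e\<^sup>2"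
      by (simp only: sum_product)
  qed
  have intWW: "integrable M (\<lambda>x. W i x * W j x)" if "i \<in> I" "j \<in> I" for i j
    using cross(1)[of i j] W2(1)[of i] that by (cases "i = j") (auto simp: power2_eq_square)
  show ?int unfolding eq using intWW intW by simp
  have "expectation (\<lambda>x. \<Sum>i\<in>I. \<Sum>j\<in>I. W i x * W j x) = (\<Sum>i\<in>I. \<Sum>j\<in>I. expectation (\<lambda>x. W i x * W j x))"
    using intWW by (simp add: Bochner_Integration.integral_sum)
  also have "\<dots> = (\<Sum>i\<in>I. \<Sum>j\<in>I. if j = i then expectation (\<lambda>x. (W i x)\<^sup>2) else 0)"
    using cross(2) by (intro sum.cong) (auto simp: power2_eq_square)
  also have "\<dots> = (\<Sum>i\<in>I. expectation (\<lambda>x. (Z i x)\<^sup>2) - (m i)\<^sup>2)"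
    using I W2(2) by simp
  finally have 1: "expectation (\<lambda>x. \<Sum>i\<in>I. \<Sum>j\<in>I. W i x * W j x) = (\<Sum>i\<in>I. expectation (\<lambda>x. (Z i x)\<^sup>2) - (m i)\<^sup>2)" .
  have "expectation (\<lambda>x. (\<Sum>i\<in>I. \<Sum>j\<in>I. W i x * W j x) + 2 * e * (\<Sum>i\<in>I. W i x) + e\<^sup>2) =
     (\<Sum>i\<in>I. expectation (\<lambda>x. (Z i x)\<^sup>2) - (m i)\<^sup>2) + e\<^sup>2"
    using intWW intW W0 1 by (simp add: prob_space Bochner_Integration.integral_sum)
  then show ?eq unfolding eq by (simp add: m_def e_def)
qed

text \<open>The whole second-stage sample of unit \<open>i\<close> is one random element
  \<open>X i\<close>, so the number of draws disappears from the argument. \<open>X i\<close> lives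
  on all of \<open>M\<close>, but its law is prescribed only given a sample containing
  \<open>i\<close>; that the same \<open>L i\<close> serves for every such sample expresses that the
  second stage does not depend on the first.\<close>

locale two_stage = prob_space M for M :: "'w measure" +
  fixes U :: "'i set" and S :: "'w \<Rightarrow> 'i set" and N :: "'i \<Rightarrow> 'x measure"
    and X :: "'i \<Rightarrow> 'w \<Rightarrow> 'x" and L :: "'i \<Rightarrow> 'x measure"
  assumes finite_U: "finite U"
    and S_meas [measurable]: "S \<in> M \<rightarrow>\<^sub>M count_space (Pow U)"
    and X_meas [measurable]: "\<And>i. i \<in> U \<Longrightarrow> X i \<in> M \<rightarrow>\<^sub>M N i"
    and law_prob: "\<And>i. i \<in> U \<Longrightarrow> prob_space (L i)"
    and law_sets: "\<And>i. i \<in> U \<Longrightarrow> sets (L i) = sets (N i)"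
    and cond_indep: "\<And>s. 0 < prob {\<omega> \<in> space M. S \<omega> = s} \<Longrightarrow>
      prob_space.indep_vars (uniform_measure M {\<omega> \<in> space M. S \<omega> = s}) N X s"
    and cond_law: "\<And>s i. 0 < prob {\<omega> \<in> space M. S \<omega> = s} \<Longrightarrow> i \<in> s \<Longrightarrow>
      distr (uniform_measure M {\<omega> \<in> space M. S \<omega> = s}) (N i) (X i) = L i"
begin

definition event :: "'i set \<Rightarrow> 'w set" where "event s = {\<omega> \<in> space M. S \<omega> = s}"
definition cnd :: "'i set \<Rightarrow> 'w measure" where "cnd s = uniform_measure M (event s)"

lemma S_subset: "\<omega> \<in> space M \<Longrightarrow> S \<omega> \<subseteq> U" using measurable_space[OF S_meas] by auto

lemma event_sets [measurable]: "event s \<in> events"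
proof (cases "s \<subseteq> U")
  case True
  have "event s = S -` {s} \<inter> space M" by (auto simp: event_def)
  then show ?thesis using measurable_sets[OF S_meas, of "{s}"] True by simp
next
  case False
  then have "event s = {}" using S_subset by (auto simp: event_def)
  then show ?thesis by simp
qed

lemma cnd_density: assumes "0 < prob (event s)"
  shows "cnd s = density M (\<lambda>x. ennreal (indicator (event s) x / prob (event s)))"
  unfolding cnd_def uniform_measure_def
  by (intro arg_cong2[where f = density] ext refl)
    (use assms in \<open>auto simp: emeasure_eq_measure divide_ennreal ennreal_indicator[symmetric] simp del: ennreal_indicator\<close>)

lemma prob_space_cnd: assumes "0 < prob (event s)" shows "prob_space (cnd s)"
  unfolding cnd_def using assms by (intro prob_space_uniform_measure) (auto simp: emeasure_eq_measure)

lemma sets_cnd [simp, measurable_cong]: "sets (cnd s) = events" by (simp add: cnd_def)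

text \<open>Total expectation over finitely many samples. The integrand is a family indexed by
  \<open>s\<close>, so that the index set of a sum is constant inside each conditional
  expectation.\<close>

lemma integral_split:
  fixes F :: "'i set \<Rightarrow> 'w \<Rightarrow> 'b::{banach, second_countable_topology}"
  assumes F: "\<And>s. s \<subseteq> U \<Longrightarrow> F s \<in> borel_measurable M"
    and int: "\<And>s. s \<subseteq> U \<Longrightarrow> 0 < prob (event s) \<Longrightarrow> integrable (cnd s) (F s)"
  shows "integrable M (\<lambda>\<omega>. F (S \<omega>) \<omega>)" (is ?int)
    and "expectation (\<lambda>\<omega>. F (S \<omega>) \<omega>) = (\<Sum>s\<in>Pow U. prob (event s) *\<^sub>R integral\<^sup>L (cnd s) (F s))" (is ?eq)
proof -
  have *: "integrable M (\<lambda>\<omega>. indicator (event s) \<omega> *\<^sub>R F s \<omega>) \<and>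
      expectation (\<lambda>\<omega>. indicator (event s) \<omega> *\<^sub>R F s \<omega>) = prob (event s) *\<^sub>R integral\<^sup>L (cnd s) (F s)"
    if s: "s \<subseteq> U" for s
  proof (cases "prob (event s) = 0")
    case True
    then have "AE \<omega> in M. \<omega> \<notin> event s" by (simp add: prob_eq_0)
    then have ae: "AE \<omega> in M. indicator (event s) \<omega> *\<^sub>R F s \<omega> = 0" by eventually_elim auto
    have m: "(\<lambda>\<omega>. indicator (event s) \<omega> *\<^sub>R F s \<omega>) \<in> borel_measurable M" using F[OF s] by measurable
    show ?thesis
      using integrable_cong_AE[of "\<lambda>\<omega>. indicator (event s) \<omega> *\<^sub>R F s \<omega>" M "\<lambda>_. 0"]
        integral_cong_AE[of "\<lambda>\<omega>. indicator (event s) \<omega> *\<^sub>R F s \<omega>" M "\<lambda>_. 0"] ae m True by simp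
  next
    case False
    then have pos: "0 < prob (event s)" by (simp add: zero_less_measure_iff)
    have m: "F s \<in> borel_measurable M" by (rule F[OF s])
    have i: "integrable M (\<lambda>\<omega>. (indicator (event s) \<omega> / prob (event s)) *\<^sub>R F s \<omega>)"
      using int[OF s pos] unfolding cnd_density[OF pos] by (subst (asm) integrable_density) (use m in auto)
    have e: "integral\<^sup>L (cnd s) (F s) = expectation (\<lambda>\<omega>. (indicator (event s) \<omega> / prob (event s)) *\<^sub>R F s \<omega>)"
      unfolding cnd_density[OF pos] by (subst integral_density) (use m in auto)
    have eq: "(\<lambda>\<omega>. indicator (event s) \<omega> *\<^sub>R F s \<omega>) =
       (\<lambda>\<omega>. prob (event s) *\<^sub>R ((indicator (event s) \<omega> / prob (event s)) *\<^sub>R F s \<omega>))"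
      using pos by auto
    show ?thesis unfolding eq
      by (intro conjI integrable_scaleR_right i) (simp only: e integral_scaleR_right)
  qed
  have split: "F (S \<omega>) \<omega> = (\<Sum>s\<in>Pow U. indicator (event s) \<omega> *\<^sub>R F s \<omega>)" if "\<omega> \<in> space M" for \<omega>
  proof -
    have "(\<Sum>s\<in>Pow U. indicator (event s) \<omega> *\<^sub>R F s \<omega>) = (\<Sum>s\<in>{S \<omega>}. indicator (event s) \<omega> *\<^sub>R F s \<omega>)"
      using that S_subset finite_U by (intro sum.mono_neutral_right) (auto simp: event_def indicator_def split: if_splits)
    then show ?thesis using that by (simp add: event_def)
  qed
  have i: "integrable M (\<lambda>\<omega>. \<Sum>s\<in>Pow U. indicator (event s) \<omega> *\<^sub>R F s \<omega>)" using * by auto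
  show ?int using i by (subst Bochner_Integration.integrable_cong[OF refl split])
  have "expectation (\<lambda>\<omega>. F (S \<omega>) \<omega>) = expectation (\<lambda>\<omega>. \<Sum>s\<in>Pow U. indicator (event s) \<omega> *\<^sub>R F s \<omega>)"
    by (intro Bochner_Integration.integral_cong refl split)
  also have "\<dots> = (\<Sum>s\<in>Pow U. expectation (\<lambda>\<omega>. indicator (event s) \<omega> *\<^sub>R F s \<omega>))"
    using * by (intro Bochner_Integration.integral_sum) auto
  also have "\<dots> = (\<Sum>s\<in>Pow U. prob (event s) *\<^sub>R integral\<^sup>L (cnd s) (F s))"
    using * by (intro sum.cong) auto
  finally show ?eq .
qed

lemma sample_measurable:
  assumes "\<And>s. s \<subseteq> U \<Longrightarrow> F s \<in> M \<rightarrow>\<^sub>M K"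
  shows "(\<lambda>\<omega>. F (S \<omega>) \<omega>) \<in> M \<rightarrow>\<^sub>M K"
  by (rule measurable_compose_countable'[OF _ S_meas]) (use assms finite_U in \<open>auto simp: countable_finite\<close>)

lemma cond_law_integral:
  fixes f :: "'x \<Rightarrow> 'b::{banach, second_countable_topology}"
  assumes "0 < prob (event s)" "i \<in> s" "s \<subseteq> U" "f \<in> borel_measurable (N i)"
  shows "integrable (cnd s) (\<lambda>\<omega>. f (X i \<omega>)) \<longleftrightarrow> integrable (L i) f"
    and "(\<integral>\<omega>. f (X i \<omega>) \<partial>cnd s) = integral\<^sup>L (L i) f"
proof -
  have X: "X i \<in> cnd s \<rightarrow>\<^sub>M N i" using X_meas[of i] assms by (auto simp: cnd_def)
  have L: "L i = distr (cnd s) (N i) (X i)" using cond_law[of s i] assms by (simp add: cnd_def event_def)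
  show "integrable (cnd s) (\<lambda>\<omega>. f (X i \<omega>)) \<longleftrightarrow> integrable (L i) f"
    unfolding L using integrable_distr_eq[OF X assms(4)] by simp
  show "(\<integral>\<omega>. f (X i \<omega>) \<partial>cnd s) = integral\<^sup>L (L i) f"
    unfolding L using integral_distr[OF X assms(4)] by simp
qed

lemma cond_indep_compose:
  assumes "0 < prob (event s)" "s \<subseteq> U" "\<And>i. i \<in> U \<Longrightarrow> h i \<in> N i \<rightarrow>\<^sub>M K"
  shows "prob_space.indep_vars (cnd s) (\<lambda>_. K) (\<lambda>i \<omega>. h i (X i \<omega>)) s"
proof -
  interpret C: prob_space "cnd s" by (rule prob_space_cnd[OF assms(1)])
  have "C.indep_vars N X s" using cond_indep[of s] assms(1) by (simp add: cnd_def event_def)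
  then show ?thesis by (rule C.indep_vars_compose2) (use assms in auto)
qed

lemma sample_sum_measurable:
  assumes "\<And>i. i \<in> U \<Longrightarrow> h i \<in> borel_measurable (N i)" "s \<subseteq> U"
  shows "(\<lambda>\<omega>. \<Sum>i\<in>s. h i (X i \<omega>) :: real) \<in> borel_measurable M"
  using assms by (intro borel_measurable_sum measurable_compose[OF X_meas]) auto

lemma cond_second_moment:
  fixes h :: "'i \<Rightarrow> 'x \<Rightarrow> real"
  assumes s: "0 < prob (event s)" "s \<subseteq> U"
    and h: "\<And>i. i \<in> U \<Longrightarrow> h i \<in> borel_measurable (N i)"
    and h2: "\<And>i. i \<in> U \<Longrightarrow> integrable (L i) (\<lambda>x. (h i x)\<^sup>2)"
  shows "integrable (cnd s) (\<lambda>\<omega>. ((\<Sum>i\<in>s. h i (X i \<omega>)) - c)\<^sup>2)"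
    and "(\<integral>\<omega>. ((\<Sum>i\<in>s. h i (X i \<omega>)) - c)\<^sup>2 \<partial>cnd s) =
      (\<Sum>i\<in>s. (\<integral>x. (h i x)\<^sup>2 \<partial>L i) - (\<integral>x. h i x \<partial>L i)\<^sup>2) + ((\<Sum>i\<in>s. \<integral>x. h i x \<partial>L i) - c)\<^sup>2"
proof -
  interpret C: prob_space "cnd s" by (rule prob_space_cnd[OF s(1)])
  have ind: "C.indep_vars (\<lambda>_. borel) (\<lambda>i \<omega>. h i (X i \<omega>)) s"
    using cond_indep_compose[OF s h] .
  have sq: "integrable (cnd s) (\<lambda>\<omega>. (h i (X i \<omega>))\<^sup>2)" if "i \<in> s" for i
    using cond_law_integral(1)[OF s(1) that s(2), of "\<lambda>x. (h i x)\<^sup>2"] h h2 that s(2) by auto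
  have "finite s" using finite_subset[OF s(2) finite_U] .
  note * = C.indep_sum_second_moment[OF this ind sq, where c = c]
  show "integrable (cnd s) (\<lambda>\<omega>. ((\<Sum>i\<in>s. h i (X i \<omega>)) - c)\<^sup>2)" by (rule *(1))
  have m: "(\<integral>\<omega>. (h i (X i \<omega>))\<^sup>2 \<partial>cnd s) = (\<integral>x. (h i x)\<^sup>2 \<partial>L i)" "(\<integral>\<omega>. h i (X i \<omega>) \<partial>cnd s) = (\<integral>x. h i x \<partial>L i)"
    if "i \<in> s" for i
    using cond_law_integral(2)[OF s(1) that s(2), of "\<lambda>x. (h i x)\<^sup>2"] cond_law_integral(2)[OF s(1) that s(2), of "h i"] h that s(2) by auto
  show "(\<integral>\<omega>. ((\<Sum>i\<in>s. h i (X i \<omega>)) - c)\<^sup>2 \<partial>cnd s) =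
      (\<Sum>i\<in>s. (\<integral>x. (h i x)\<^sup>2 \<partial>L i) - (\<integral>x. h i x \<partial>L i)\<^sup>2) + ((\<Sum>i\<in>s. \<integral>x. h i x \<partial>L i) - c)\<^sup>2"
    by (subst *(2), assumption, intro arg_cong2[where f = "(+)"] sum.cong arg_cong[where f = "\<lambda>x. (x - c)\<^sup>2"] refl) (simp_all add: m)
qed

lemma sample_sum_square_integrable:
  fixes h :: "'i \<Rightarrow> 'x \<Rightarrow> real"
  assumes h: "\<And>i. i \<in> U \<Longrightarrow> h i \<in> borel_measurable (N i)"
    and h2: "\<And>i. i \<in> U \<Longrightarrow> integrable (L i) (\<lambda>x. (h i x)\<^sup>2)"
  shows "integrable M (\<lambda>\<omega>. ((\<Sum>i\<in>S \<omega>. h i (X i \<omega>)) - c)\<^sup>2)"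
  by (rule integral_split(1)[where F = "\<lambda>s \<omega>. ((\<Sum>i\<in>s. h i (X i \<omega>)) - c)\<^sup>2"])
    (use cond_second_moment(1)[OF _ _ h h2] sample_sum_measurable[OF h] in auto)

end

text \<open>\<open>rejective\<close> constrains \<open>P\<close> only on sets of size
  \<open>n\<close>; \<open>size_n\<close> adds that no mass lies on other sets, which identifies
  sums over all samples with \<open>ex\<close>.\<close>

locale two_stage_rejective = two_stage M U S N X L + rejective U n p "\<lambda>s. measure M {\<omega> \<in> space M. S \<omega> = s}"
  for M :: "'w measure" and U :: "'i set" and S :: "'w \<Rightarrow> 'i set" and N :: "'i \<Rightarrow> 'x measure"
    and X :: "'i \<Rightarrow> 'w \<Rightarrow> 'x" and L :: "'i \<Rightarrow> 'x measure" and n :: nat and p :: "'i \<Rightarrow> real" +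
  assumes size_n: "\<And>s. s \<subseteq> U \<Longrightarrow> card s \<noteq> n \<Longrightarrow> measure M {\<omega> \<in> space M. S \<omega> = s} = 0"
begin

lemma sum_Pow_eq_ex: "(\<Sum>s\<in>Pow U. prob (event s) *\<^sub>R f s) = ex f"
  unfolding ex_def event_def using size_n finite_U
  by (intro sum.mono_neutral_cong_right) (auto simp: samples_def)

lemma AE_samples: "AE \<omega> in M. S \<omega> \<in> samples"
proof -
  have "AE \<omega> in M. \<forall>s\<in>Pow U - samples. \<omega> \<notin> event s"
    using size_n finite_U by (intro AE_finite_allI) (auto simp: prob_eq_0[symmetric] event_def[symmetric] samples_def)
  then show ?thesis
    using AE_space by eventually_elim (use S_subset in \<open>auto simp: event_def\<close>)
qed

text \<open>The constant is 1 + 2: conditional variances add up to at most the second moments, and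
  the conditional mean is a linear statistic to which \<open>variance_le\<close> applies.\<close>

lemma sample_sum_deviation:
  fixes h :: "'i \<Rightarrow> 'x \<Rightarrow> real"
  assumes h: "\<And>i. i \<in> U \<Longrightarrow> h i \<in> borel_measurable (N i)"
    and h2: "\<And>i. i \<in> U \<Longrightarrow> integrable (L i) (\<lambda>x. (h i x)\<^sup>2)"
  shows "expectation (\<lambda>\<omega>. ((\<Sum>i\<in>S \<omega>. h i (X i \<omega>)) - mean (\<lambda>i. \<integral>x. h i x \<partial>L i))\<^sup>2)
    \<le> 3 * mean (\<lambda>i. \<integral>x. (h i x)\<^sup>2 \<partial>L i)"
proof -
  define m m2 where "m i = (\<integral>x. h i x \<partial>L i)" and "m2 i = (\<integral>x. (h i x)\<^sup>2 \<partial>L i)" for i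
  have mm: "(m i)\<^sup>2 \<le> m2 i" if "i \<in> U" for i
  proof -
    show ?thesis unfolding m_def m2_def
      using prob_space.expectation_square_le[OF law_prob[OF that] _ h2[OF that]] h[OF that] law_sets[OF that] by (simp cong: measurable_cong_sets)
  qed
  have "expectation (\<lambda>\<omega>. ((\<Sum>i\<in>S \<omega>. h i (X i \<omega>)) - mean m)\<^sup>2) =
      (\<Sum>s\<in>Pow U. prob (event s) *\<^sub>R (\<integral>\<omega>. ((\<Sum>i\<in>s. h i (X i \<omega>)) - mean m)\<^sup>2 \<partial>cnd s))"
    by (rule integral_split(2)[where F = "\<lambda>s \<omega>. ((\<Sum>i\<in>s. h i (X i \<omega>)) - mean m)\<^sup>2"])
      (use cond_second_moment(1)[OF _ _ h h2] sample_sum_measurable[OF h] in auto)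
  also have "\<dots> = (\<Sum>s\<in>Pow U. prob (event s) *\<^sub>R ((\<Sum>i\<in>s. m2 i - (m i)\<^sup>2) + ((\<Sum>i\<in>s. m i) - mean m)\<^sup>2))"
  proof (intro sum.cong refl)
    fix s assume "s \<in> Pow U"
    then show "prob (event s) *\<^sub>R (\<integral>\<omega>. ((\<Sum>i\<in>s. h i (X i \<omega>)) - mean m)\<^sup>2 \<partial>cnd s) =
      prob (event s) *\<^sub>R ((\<Sum>i\<in>s. m2 i - (m i)\<^sup>2) + ((\<Sum>i\<in>s. m i) - mean m)\<^sup>2)"
      using cond_second_moment(2)[OF _ _ h h2, of s "mean m"]
      by (cases "prob (event s) = 0") (auto simp: m_def m2_def zero_less_measure_iff)
  qed
  also have "\<dots> = ex (\<lambda>s. (\<Sum>i\<in>s. m2 i - (m i)\<^sup>2)) + ex (\<lambda>s. ((\<Sum>i\<in>s. m i) - mean m)\<^sup>2)"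
    unfolding sum_Pow_eq_ex by (rule ex_add)
  also have "ex (\<lambda>s. (\<Sum>i\<in>s. m2 i - (m i)\<^sup>2)) = mean (\<lambda>i. m2 i - (m i)\<^sup>2)" by (rule ex_mean)
  also have "\<dots> \<le> mean m2" by (intro mean_mono) simp
  also have "ex (\<lambda>s. ((\<Sum>i\<in>s. m i) - mean m)\<^sup>2) \<le> 2 * mean (\<lambda>i. (m i)\<^sup>2)" by (rule variance_le)
  also have "mean (\<lambda>i. (m i)\<^sup>2) \<le> mean m2" by (intro mean_mono mm)
  finally show ?thesis by (simp add: m_def[abs_def] m2_def[abs_def])
qed

end

section \<open>Error of the Hajek estimator, and characteristic functions to second order\<close>

lemma power2_power2: "(x\<^sup>2)\<^sup>2 = x ^ 4" for x :: real
  by (simp flip: power_mult)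

text \<open>The Cauchy-Schwarz bound on \<open>M1\<close> makes the quadratic remainder \<open>G = (M1 - m1)\<^sup>2 / dh\<close> satisfy
  an inequality of the form \<open>G\<^sup>2 \<le> C * G + 4 * (M2 - m2)\<^sup>2\<close>, so that no fourth moment of \<open>M1\<close> is needed.\<close>
lemma hajek_estimator_bound:
  fixes M1 M2 m1 m2 dh d k g n :: real
  assumes g: "0 < g" "g \<le> 1" and n: "1 \<le> n" and k: "1 \<le> k"
    and dh: "g * n \<le> dh" and d: "g * n \<le> d"
    and M: "M1\<^sup>2 \<le> dh * M2" and m1: "m1\<^sup>2 \<le> n * k" and m2: "m2 \<le> k"
  shows "((M2 - M1\<^sup>2 / dh) - (m2 - m1\<^sup>2 / d))\<^sup>2 \<le>
    20 * (M2 - m2)\<^sup>2 + 48 * k / (g\<^sup>2 * n) * (M1 - m1)\<^sup>2 + 4 * k\<^sup>2 / (g ^ 4 * n\<^sup>2) * (dh - d)\<^sup>2"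
proof -
  have gn: "0 < g * n" using g n by simp
  have pos: "0 < dh" "0 < d" using gn dh d by linarith+
  define G A2 A3 e where "G = (M1 - m1)\<^sup>2 / dh" and "A2 = 2 * m1 * (M1 - m1) / dh"
    and "A3 = m1\<^sup>2 * (d - dh) / (d * dh)" and "e = M2 - m2"
  have "M1\<^sup>2 = (M1 - m1)\<^sup>2 + 2 * m1 * (M1 - m1) + m1\<^sup>2" by (simp add: power2_eq_square algebra_simps)
  then have "M1\<^sup>2 / dh = G + A2 + m1\<^sup>2 / dh" by (simp add: G_def A2_def add_divide_distrib)
  moreover have "m1\<^sup>2 / dh = m1\<^sup>2 / d + A3" using pos by (simp add: A3_def field_simps)
  ultimately have eq: "(M2 - M1\<^sup>2 / dh) - (m2 - m1\<^sup>2 / d) = e - G - A2 - A3" by (simp add: e_def)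
  have sq4: "(e - G - A2 - A3)\<^sup>2 \<le> 4 * (e\<^sup>2 + G\<^sup>2 + A2\<^sup>2 + A3\<^sup>2)"
    using zero_le_power2[of "e + G"] zero_le_power2[of "e + A2"] zero_le_power2[of "e + A3"]
      zero_le_power2[of "G - A2"] zero_le_power2[of "G - A3"] zero_le_power2[of "A2 - A3"]
    by (simp add: power2_eq_square algebra_simps)
  have "A2\<^sup>2 = 4 * (m1\<^sup>2 / dh\<^sup>2) * (M1 - m1)\<^sup>2" by (simp add: A2_def power_mult_distrib power_divide)
  also have "\<dots> \<le> 4 * (n * k / (g * n)\<^sup>2) * (M1 - m1)\<^sup>2"
    using m1 dh gn pos n k by (intro mult_right_mono mult_left_mono frac_le power_mono) auto
  also have "4 * (n * k / (g * n)\<^sup>2) = 4 * k / (g\<^sup>2 * n)" using n by (simp add: power2_eq_square)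
  finally have A2: "A2\<^sup>2 \<le> 4 * k / (g\<^sup>2 * n) * (M1 - m1)\<^sup>2" .
  have "A3\<^sup>2 = ((m1\<^sup>2)\<^sup>2 / (d\<^sup>2 * dh\<^sup>2)) * (dh - d)\<^sup>2"
    by (simp add: A3_def power_mult_distrib power_divide power2_commute)
  also have "\<dots> \<le> ((n * k)\<^sup>2 / ((g * n)\<^sup>2 * (g * n)\<^sup>2)) * (dh - d)\<^sup>2"
    using m1 dh d gn pos by (intro mult_right_mono frac_le mult_mono power_mono) auto
  also have "(n * k)\<^sup>2 / ((g * n)\<^sup>2 * (g * n)\<^sup>2) = k\<^sup>2 / (g ^ 4 * n\<^sup>2)"
    using n g by (simp add: power2_eq_square power4_eq_xxxx)
  finally have A3: "A3\<^sup>2 \<le> k\<^sup>2 / (g ^ 4 * n\<^sup>2) * (dh - d)\<^sup>2" .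
  define c where "c = k / g"
  have G0: "0 \<le> G" using pos by (simp add: G_def)
  have "G \<le> (2 * M1\<^sup>2 + 2 * m1\<^sup>2) / dh"
    unfolding G_def using pos zero_le_power2[of "M1 + m1"]
    by (intro divide_right_mono) (auto simp: power2_eq_square algebra_simps)
  also have "\<dots> \<le> (2 * (dh * M2)) / dh + 2 * (n * k) / (g * n)"
    unfolding add_divide_distrib using M m1 pos dh gn n k by (intro add_mono divide_right_mono frac_le) auto
  also have "\<dots> = 2 * M2 + 2 * (k / g)" using pos n by simp
  also have "\<dots> \<le> 2 * e + 4 * (k / g)"
  proof -
    have "k \<le> k / g" using g k by (simp add: field_simps)
    then show ?thesis using m2 by (simp add: e_def)
  qed
  finally have "G * G \<le> G * (2 * e + 4 * c)" unfolding c_def using G0 by (intro mult_left_mono)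
  moreover have "2 * (G * e) \<le> G * G / 2 + 2 * (e * e)"
    using zero_le_power2[of "G - 2 * e"] by (simp add: power2_eq_square algebra_simps)
  ultimately have "G\<^sup>2 \<le> 8 * c * G + 4 * e\<^sup>2" by (simp add: power2_eq_square algebra_simps)
  then have 1: "G\<^sup>2 \<le> 8 * (k / g) * G + 4 * e\<^sup>2" by (simp only: c_def)
  have "G \<le> (M1 - m1)\<^sup>2 / (g * n)" unfolding G_def using dh gn by (intro frac_le) auto
  then have "8 * (k / g) * G \<le> 8 * (k / g) * ((M1 - m1)\<^sup>2 / (g * n))" using k g by (intro mult_left_mono) auto
  also have "\<dots> = 8 * k / (g\<^sup>2 * n) * (M1 - m1)\<^sup>2" by (simp add: power2_eq_square)
  finally have "G\<^sup>2 \<le> 8 * k / (g\<^sup>2 * n) * (M1 - m1)\<^sup>2 + 4 * e\<^sup>2" using 1 by simp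
  then have "4 * (e\<^sup>2 + G\<^sup>2 + A2\<^sup>2 + A3\<^sup>2) \<le> 4 * (e\<^sup>2 + (8 * k / (g\<^sup>2 * n) * (M1 - m1)\<^sup>2 + 4 * e\<^sup>2) +
      4 * k / (g\<^sup>2 * n) * (M1 - m1)\<^sup>2 + k\<^sup>2 / (g ^ 4 * n\<^sup>2) * (dh - d)\<^sup>2)"
    using A2 A3 by (intro mult_left_mono add_mono) auto
  also have "\<dots> = 20 * e\<^sup>2 + 48 * k / (g\<^sup>2 * n) * (M1 - m1)\<^sup>2 + 4 * k\<^sup>2 / (g ^ 4 * n\<^sup>2) * (dh - d)\<^sup>2"
    by (simp add: field_simps)
  finally show ?thesis using sq4 unfolding eq e_def by linarith
qed

lemma exp_neg_diff_bound: "\<bar>exp (- x) - exp (- y)\<bar> \<le> \<bar>x - y\<bar>" if "0 \<le> x" "0 \<le> y" for x y :: real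
proof -
  have *: "\<bar>exp (- x) - exp (- y)\<bar> \<le> \<bar>x - y\<bar>" if "0 \<le> x" "x \<le> y" for x y :: real
  proof -
    have "exp (- x) - exp (- y) = exp (- x) * (1 - exp (- (y - x)))"
      by (simp add: algebra_simps exp_add[symmetric])
    also have "\<dots> \<le> 1 * (y - x)"
      using that exp_ge_add_one_self[of "x - y"] by (intro mult_mono) (auto simp del: exp_ge_add_one_self)
    finally show ?thesis using that by simp
  qed
  show ?thesis using *[of x y] *[of y x] that by (cases "x \<le> y") (auto simp: abs_minus_commute)
qed

lemma exp_neg_second_order: "\<bar>exp (- x) - (1 - x)\<bar> \<le> x\<^sup>2 / 2" if "0 \<le> x" for x :: real
proof -
  define f where "f x = 1 - x + x\<^sup>2 / 2 - exp (- x)" for x :: real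
  have "f 0 \<le> f x"
  proof (rule DERIV_nonneg_imp_nondecreasing[OF that])
    fix y :: real assume "0 \<le> y"
    have "DERIV f y :> - 1 + y + exp (- y)"
      unfolding f_def[abs_def] by (auto intro!: derivative_eq_intros)
    moreover have "0 \<le> - 1 + y + exp (- y)" using exp_ge_add_one_self[of "- y"] by simp
    ultimately show "\<exists>z. DERIV f y :> z \<and> 0 \<le> z" by blast
  qed
  then have "exp (- x) \<le> 1 - x + x\<^sup>2 / 2" by (simp add: f_def)
  moreover have "1 - x \<le> exp (- x)" using exp_ge_add_one_self[of "- x"] by simp
  ultimately show ?thesis by simp
qed

text \<open>Both sides are compared with the Taylor polynomial of degree two. The third absolute
  moment is split by \<open>2 * \<bar>f x\<bar> ^ 3 \<le> (f x)^2 / r + r * f x ^ 4\<close>; the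
  free \<open>r\<close> will be \<open>sqrt n\<close>.\<close>

lemma (in prob_space) char_second_order:
  fixes f :: "'a \<Rightarrow> real"
  assumes [measurable]: "f \<in> borel_measurable M" and i4: "integrable M (\<lambda>x. f x ^ 4)"
    and m0: "expectation f = 0" and r: "0 < r"
  shows "norm ((CLINT x|M. iexp (t * f x)) - exp (- (t\<^sup>2 * expectation (\<lambda>x. (f x)\<^sup>2) / 2))) \<le>
    \<bar>t\<bar> ^ 3 / 12 * (expectation (\<lambda>x. (f x)\<^sup>2) / r + r * expectation (\<lambda>x. f x ^ 4)) +
    t ^ 4 / 8 * (expectation (\<lambda>x. (f x)\<^sup>2))\<^sup>2"
proof -
  define v where "v = expectation (\<lambda>x. (f x)\<^sup>2)"
  have i4': "integrable M (\<lambda>x. ((f x)\<^sup>2)\<^sup>2)" using i4 by (simp add: power2_power2)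
  have i2: "integrable M (\<lambda>x. (f x)\<^sup>2)" by (rule square_integrable_imp_integrable[OF _ i4']) simp
  have i1: "integrable M f" by (rule square_integrable_imp_integrable[OF _ i2]) simp
  have ie: "integrable M (\<lambda>x. iexp (t * f x))"
    by (rule integrable_const_bound[of _ 1]) auto
  have v0: "0 \<le> v" unfolding v_def by (intro Bochner_Integration.integral_nonneg) simp
  define u w where "u x = 1 - t\<^sup>2 / 2 * (f x)\<^sup>2" and "w x = t * f x" for x
  define T where "T x = complex_of_real (u x) + \<i> * complex_of_real (w x)" for x
  have iu: "integrable M u" and iw: "integrable M w"
    unfolding u_def[abs_def] w_def[abs_def] using i1 i2 by auto
  have iT: "integrable M T" unfolding T_def[abs_def] using iu iw by auto
  have "integral\<^sup>L M T = complex_of_real (expectation u) + \<i> * complex_of_real (expectation w)"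
    unfolding T_def[abs_def] using iu iw by simp
  moreover have "expectation u = 1 - t\<^sup>2 * v / 2" unfolding u_def[abs_def] v_def using i2 by (simp add: prob_space)
  moreover have "expectation w = 0" unfolding w_def[abs_def] using i1 m0 by simp
  ultimately have ET: "integral\<^sup>L M T = complex_of_real (1 - t\<^sup>2 * v / 2)" by simp
  have pt: "norm (iexp (t * f x) - T x) \<le> \<bar>t\<bar> ^ 3 / 12 * ((f x)\<^sup>2 / r + r * f x ^ 4)" for x
  proof -
    have T: "(\<Sum>k\<le>2. (\<i> * complex_of_real (t * f x)) ^ k / fact k) = T x"
      by (simp add: T_def u_def w_def numeral_2_eq_2 power_mult_distrib)
    have "norm (iexp (t * f x) - T x) \<le> \<bar>t * f x\<bar> ^ Suc 2 / fact (Suc 2)"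
      using iexp_approx1[of "t * f x" 2] unfolding T .
    also have "\<dots> = \<bar>t * f x\<bar> ^ 3 / 6" by (simp add: eval_nat_numeral)
    also have "\<dots> = \<bar>t\<bar> ^ 3 / 12 * (2 * \<bar>f x\<bar> ^ 3)" by (simp add: abs_mult power_mult_distrib)
    also have "2 * \<bar>f x\<bar> ^ 3 \<le> (f x)\<^sup>2 / r + r * f x ^ 4"
    proof -
      have "0 \<le> \<bar>f x\<bar>\<^sup>2 * (r * \<bar>f x\<bar> - 1)\<^sup>2 / r" using r by simp
      also have "\<dots> = r * \<bar>f x\<bar> ^ 4 - 2 * \<bar>f x\<bar> ^ 3 + \<bar>f x\<bar>\<^sup>2 / r"
        using r by (simp add: power2_eq_square power3_eq_cube power4_eq_xxxx field_simps)
      finally show ?thesis by simp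
    qed
    finally show ?thesis by (simp add: mult_left_mono)
  qed
  have "norm ((CLINT x|M. iexp (t * f x)) - integral\<^sup>L M T) = norm (CLINT x|M. iexp (t * f x) - T x)"
    using ie iT by simp
  also have "\<dots> \<le> expectation (\<lambda>x. norm (iexp (t * f x) - T x))" by (rule integral_norm_bound)
  also have "\<dots> \<le> expectation (\<lambda>x. \<bar>t\<bar> ^ 3 / 12 * ((f x)\<^sup>2 / r + r * f x ^ 4))"
    using ie iT i2 i4 pt by (intro integral_mono) auto
  also have "\<dots> = \<bar>t\<bar> ^ 3 / 12 * (v / r + r * expectation (\<lambda>x. f x ^ 4))"
    using i2 i4 by (simp add: v_def)
  finally have 1: "norm ((CLINT x|M. iexp (t * f x)) - integral\<^sup>L M T) \<le> \<bar>t\<bar> ^ 3 / 12 * (v / r + r * expectation (\<lambda>x. f x ^ 4))" .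
  have "norm (integral\<^sup>L M T - exp (- (t\<^sup>2 * v / 2))) = \<bar>exp (- (t\<^sup>2 * v / 2)) - (1 - t\<^sup>2 * v / 2)\<bar>"
    unfolding ET by (metis abs_minus_commute norm_of_real of_real_diff)
  also have "\<dots> \<le> (t\<^sup>2 * v / 2)\<^sup>2 / 2" using v0 by (intro exp_neg_second_order) simp
  also have "\<dots> = t ^ 4 / 8 * v\<^sup>2" by (simp add: power_mult_distrib power_divide flip: power_mult)
  finally have 2: "norm (integral\<^sup>L M T - exp (- (t\<^sup>2 * v / 2))) \<le> t ^ 4 / 8 * v\<^sup>2" .
  show ?thesis using norm_triangle_mono[OF 1 2] by (simp add: v_def)
qed

text \<open>\<open>b i\<close> stands for the rescaled expanded estimate of a unit. The single bound
  on fourth moments yields the others: Jensen's inequality dominates means and variances, and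
  Cauchy-Schwarz against the total weight \<open>n\<close> gives \<open>mean m2 \<le> k\<close>. The
  conditional means \<open>m1\<close> therefore form a \<open>rejective_array\<close>.\<close>

locale two_stage_array = two_stage_rejective M U S N X L n p +
  rejective_regular U n p "\<lambda>s. measure M {\<omega> \<in> space M. S \<omega> = s}" q g
  for M :: "'w measure" and U :: "'i set" and S :: "'w \<Rightarrow> 'i set" and N :: "'i \<Rightarrow> 'x measure"
    and X :: "'i \<Rightarrow> 'w \<Rightarrow> 'x" and L :: "'i \<Rightarrow> 'x measure" and n :: nat and p :: "'i \<Rightarrow> real"
    and q g :: real +
  fixes b :: "'i \<Rightarrow> 'x \<Rightarrow> real" and k :: real
  assumes b_meas: "\<And>i. i \<in> U \<Longrightarrow> b i \<in> borel_measurable (N i)"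
    and b4: "\<And>i. i \<in> U \<Longrightarrow> integrable (L i) (\<lambda>x. b i x ^ 4)"
    and k_ge_1: "1 \<le> k"
    and mean_b4: "mean (\<lambda>i. \<integral>x. b i x ^ 4 \<partial>L i) \<le> k\<^sup>2 / real n"
begin

definition m1 :: "'i \<Rightarrow> real" where "m1 i = (\<integral>x. b i x \<partial>L i)"
definition m2 :: "'i \<Rightarrow> real" where "m2 i = (\<integral>x. (b i x)\<^sup>2 \<partial>L i)"
definition m4 :: "'i \<Rightarrow> real" where "m4 i = (\<integral>x. b i x ^ 4 \<partial>L i)"
definition vr :: "'i \<Rightarrow> real" where "vr i = (\<integral>x. (b i x - m1 i)\<^sup>2 \<partial>L i)"

lemma b_meas_L: "i \<in> U \<Longrightarrow> b i \<in> borel_measurable (L i)"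
  using b_meas law_sets by (simp cong: measurable_cong_sets)

lemma b_integrable:
  assumes "i \<in> U"
  shows "integrable (L i) (\<lambda>x. (b i x)\<^sup>2)" "integrable (L i) (b i)"
proof -
  note [measurable] = b_meas_L[OF assms]
  have fm: "finite_measure (L i)" using law_prob[OF assms] by (simp add: prob_space_def)
  have "integrable (L i) (\<lambda>x. ((b i x)\<^sup>2)\<^sup>2)" using b4[OF assms] by (simp only: power2_power2)
  then show 1: "integrable (L i) (\<lambda>x. (b i x)\<^sup>2)"
    by (rule finite_measure.square_integrable_imp_integrable[OF fm, rotated]) measurable
  show "integrable (L i) (b i)" by (rule finite_measure.square_integrable_imp_integrable[OF fm _ 1]) measurable
qed

lemma moments:
  assumes "i \<in> U"
  shows "(m1 i)\<^sup>2 \<le> m2 i" "(m2 i)\<^sup>2 \<le> m4 i" "vr i = m2 i - (m1 i)\<^sup>2" "0 \<le> vr i" "vr i \<le> m2 i"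
    "0 \<le> m2 i" "0 \<le> m4 i" "m1 i ^ 4 \<le> m4 i"
proof -
  note [measurable] = b_meas_L[OF assms]
  note P = law_prob[OF assms]
  show 1: "(m1 i)\<^sup>2 \<le> m2 i" unfolding m1_def m2_def
    by (rule prob_space.expectation_square_le[OF P]) (auto simp: b_integrable assms)
  have "(m2 i)\<^sup>2 \<le> (\<integral>x. ((b i x)\<^sup>2)\<^sup>2 \<partial>L i)" unfolding m2_def
    by (rule prob_space.expectation_square_le[OF P]) (use b4[OF assms] in \<open>auto simp: power2_power2\<close>)
  then show 2: "(m2 i)\<^sup>2 \<le> m4 i" by (simp add: m4_def power2_power2)
  show 3: "vr i = m2 i - (m1 i)\<^sup>2" unfolding vr_def m1_def m2_def
    by (rule prob_space.variance_eq[OF P]) (auto simp: b_integrable assms)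
  show "0 \<le> vr i" using 1 3 by simp
  show "vr i \<le> m2 i" using 3 by simp
  show 4: "0 \<le> m2 i" unfolding m2_def by (intro Bochner_Integration.integral_nonneg) simp
  show "0 \<le> m4 i" unfolding m4_def by (intro Bochner_Integration.integral_nonneg) simp
  have "((m1 i)\<^sup>2)\<^sup>2 \<le> (m2 i)\<^sup>2" using 1 by (intro power_mono) auto
  then show "m1 i ^ 4 \<le> m4 i" using 2 by (simp add: power2_power2)
qed

lemma mean_m4: "mean m4 \<le> k\<^sup>2 / real n" using mean_b4 by (simp add: m4_def[abs_def])

lemma mean_m2: "mean m2 \<le> k"
proof (rule power2_le_imp_le)
  have "(mean m2)\<^sup>2 = (mean (\<lambda>i. 1 * m2 i))\<^sup>2" by (simp only: mult_1)
  also have "\<dots> \<le> mean (\<lambda>i. 1\<^sup>2) * mean (\<lambda>i. (m2 i)\<^sup>2)" by (rule mean_Cauchy_Schwarz)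
  also have "\<dots> = real n * mean (\<lambda>i. (m2 i)\<^sup>2)" by (simp add: mean_const)
  also have "\<dots> \<le> real n * (k\<^sup>2 / real n)"
    using moments(2) by (intro mult_left_mono order.trans[OF _ mean_m4] mean_mono) auto
  also have "\<dots> = k\<^sup>2" using n_pos by simp
  finally show "(mean m2)\<^sup>2 \<le> k\<^sup>2" .
qed (use k_ge_1 in simp)

sublocale rejective_array U n p "\<lambda>s. measure M {\<omega> \<in> space M. S \<omega> = s}" q g m1 k
proof
  show "1 \<le> k" by (rule k_ge_1)
  show "mean (\<lambda>i. (m1 i)\<^sup>2) \<le> k" using moments(1) by (intro order.trans[OF mean_mono mean_m2])
  show "mean (\<lambda>i. m1 i ^ 4) \<le> k\<^sup>2 / real n" using moments(8) by (intro order.trans[OF mean_mono mean_m4])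
qed

text \<open>A weighted sum of squared deviations from the weighted mean, multiplied out so that only
  three linear statistics occur.\<close>

definition hajek_hat :: "'w \<Rightarrow> real" where
  "hajek_hat \<omega> = (\<Sum>i\<in>S \<omega>. (1 - inc i) * (b i (X i \<omega>))\<^sup>2) -
     (\<Sum>i\<in>S \<omega>. (1 - inc i) * b i (X i \<omega>))\<^sup>2 / (\<Sum>i\<in>S \<omega>. 1 - inc i)"

definition hajek_limit :: real where
  "hajek_limit = (\<Sum>i\<in>U. contrast i * m2 i) - (\<Sum>i\<in>U. contrast i * m1 i)\<^sup>2 / sum contrast U"

lemma hajek_hat_measurable: "hajek_hat \<in> borel_measurable M"
  unfolding hajek_hat_def[abs_def]
proof (rule sample_measurable)
  fix s assume s: "s \<subseteq> U"
  have *: "(\<lambda>\<omega>. b i (X i \<omega>)) \<in> borel_measurable M" if "i \<in> s" for i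
    using that s b_meas X_meas by (intro measurable_compose[OF X_meas]) auto
  show "(\<lambda>\<omega>. (\<Sum>i\<in>s. (1 - inc i) * (b i (X i \<omega>))\<^sup>2) - (\<Sum>i\<in>s. (1 - inc i) * b i (X i \<omega>))\<^sup>2 / (\<Sum>i\<in>s. 1 - inc i)) \<in> borel_measurable M"
    using * by (intro borel_measurable_diff borel_measurable_divide borel_measurable_power borel_measurable_sum borel_measurable_times) auto
qed

lemma one_minus_inc: "0 \<le> 1 - inc i" "1 - inc i \<le> 1" using inc_nonneg[of i] inc_le_1[of i] by auto

text \<open>As the \<open>inc i\<close> sum to \<open>n\<close>, the total is also that of
  \<open>inc i\<close> over the unselected units. The denominator of the estimator is thus of order
  \<open>n\<close> for every sample, not just on average.\<close>

lemma sum_one_minus_inc_ge: assumes "s \<in> samples" shows "g * real n \<le> (\<Sum>i\<in>s. 1 - inc i)"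
proof -
  note s = samplesD[OF assms]
  have "(\<Sum>i\<in>s. 1 - inc i) = (\<Sum>i\<in>U - s. inc i)"
    using s by (subst sum_diff) (auto simp: sum_subtractf sum_inc)
  moreover have "(\<Sum>i\<in>U - s. q) \<le> (\<Sum>i\<in>U - s. inc i)" using inc_ge by (intro sum_mono) auto
  moreover have "(\<Sum>i\<in>U - s. q) = q * (real (card U) - real n)"
    using s card_mono[OF fin s(1)] by (simp add: card_Diff_subset)
  ultimately show ?thesis using gap by linarith
qed

text \<open>The squared deviations of the three totals are of order \<open>1 / n\<close>, one and
  \<open>n\<close>; the coefficients in \<open>hajek_estimator_bound\<close> bring them to the
  common order \<open>1 / n\<close>.\<close>

lemma hajek_consistency:
  "integrable M (\<lambda>\<omega>. (hajek_hat \<omega> - hajek_limit)\<^sup>2)"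
  "expectation (\<lambda>\<omega>. (hajek_hat \<omega> - hajek_limit)\<^sup>2) \<le> 216 * k\<^sup>2 / (g ^ 4 * real n)"
proof -
  define h2 h1 h0 where "h2 i x = (1 - inc i) * (b i x)\<^sup>2" and "h1 i x = (1 - inc i) * b i x" and "h0 i x = 1 - inc i" for i x
  define c2 c1 c0 where "c2 = (\<Sum>i\<in>U. contrast i * m2 i)" and "c1 = (\<Sum>i\<in>U. contrast i * m1 i)" and "c0 = sum contrast U"
  have w2: "(1 - inc i)\<^sup>2 \<le> 1" for i using one_minus_inc[of i] by (simp add: power_le_one)
  have P: "prob_space (L i)" if "i \<in> U" for i using law_prob[OF that] .
  have i2: "integrable (L i) (\<lambda>x. (h2 i x)\<^sup>2)" and i1: "integrable (L i) (\<lambda>x. (h1 i x)\<^sup>2)"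
    and i0: "integrable (L i) (\<lambda>x. (h0 i x)\<^sup>2)" if "i \<in> U" for i
    using b4[OF that] b_integrable[OF that] finite_measure.integrable_const[of "L i"] P[OF that]
    by (auto simp: h2_def h1_def h0_def power_mult_distrib power2_power2 prob_space_def)
  have meas: "h2 i \<in> borel_measurable (N i)" "h1 i \<in> borel_measurable (N i)" "h0 i \<in> borel_measurable (N i)" if "i \<in> U" for i
    using b_meas[OF that] by (auto simp: h2_def[abs_def] h1_def[abs_def] h0_def[abs_def])
  have mean2: "mean (\<lambda>i. \<integral>x. h2 i x \<partial>L i) = c2" and mean1: "mean (\<lambda>i. \<integral>x. h1 i x \<partial>L i) = c1"
    by (simp_all add: mean_def h2_def h1_def c2_def c1_def contrast_def m2_def m1_def mult.assoc)
  have mean0: "mean (\<lambda>i. \<integral>x. h0 i x \<partial>L i) = c0"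
    unfolding mean_def c0_def h0_def contrast_def by (intro sum.cong) (auto simp: prob_space.prob_space[OF P])
  have sq2: "mean (\<lambda>i. \<integral>x. (h2 i x)\<^sup>2 \<partial>L i) \<le> k\<^sup>2 / real n"
  proof (rule order.trans[OF mean_mono mean_m4])
    fix i assume "i \<in> U"
    have "(\<integral>x. (h2 i x)\<^sup>2 \<partial>L i) = (1 - inc i)\<^sup>2 * m4 i"
      by (simp add: h2_def m4_def power_mult_distrib power2_power2)
    then show "(\<integral>x. (h2 i x)\<^sup>2 \<partial>L i) \<le> m4 i" using w2 moments(7)[OF \<open>i \<in> U\<close>] by (simp add: mult_left_le_one_le)
  qed
  have sq1: "mean (\<lambda>i. \<integral>x. (h1 i x)\<^sup>2 \<partial>L i) \<le> k"
  proof (rule order.trans[OF mean_mono mean_m2])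
    fix i assume "i \<in> U"
    have "(\<integral>x. (h1 i x)\<^sup>2 \<partial>L i) = (1 - inc i)\<^sup>2 * m2 i"
      by (simp add: h1_def m2_def power_mult_distrib)
    then show "(\<integral>x. (h1 i x)\<^sup>2 \<partial>L i) \<le> m2 i" using w2 moments(6)[OF \<open>i \<in> U\<close>] by (simp add: mult_left_le_one_le)
  qed
  have sq0: "mean (\<lambda>i. \<integral>x. (h0 i x)\<^sup>2 \<partial>L i) \<le> real n"
  proof -
    have "mean (\<lambda>i. \<integral>x. (h0 i x)\<^sup>2 \<partial>L i) \<le> mean (\<lambda>i. 1)"
      using w2 by (intro mean_mono) (simp add: h0_def prob_space.prob_space[OF P])
    then show ?thesis by (simp add: mean_const)
  qed
  define D2 D1 D0 where "D2 \<omega> = (\<Sum>i\<in>S \<omega>. h2 i (X i \<omega>)) - c2" and "D1 \<omega> = (\<Sum>i\<in>S \<omega>. h1 i (X i \<omega>)) - c1"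
    and "D0 \<omega> = (\<Sum>i\<in>S \<omega>. h0 i (X i \<omega>)) - c0" for \<omega>
  have int: "integrable M (\<lambda>\<omega>. (D2 \<omega>)\<^sup>2)" "integrable M (\<lambda>\<omega>. (D1 \<omega>)\<^sup>2)" "integrable M (\<lambda>\<omega>. (D0 \<omega>)\<^sup>2)"
    unfolding D2_def D1_def D0_def
    using sample_sum_square_integrable[OF meas(1) i2] sample_sum_square_integrable[OF meas(2) i1]
      sample_sum_square_integrable[OF meas(3) i0] by auto
  have E: "expectation (\<lambda>\<omega>. (D2 \<omega>)\<^sup>2) \<le> 3 * (k\<^sup>2 / real n)" "expectation (\<lambda>\<omega>. (D1 \<omega>)\<^sup>2) \<le> 3 * k"
      "expectation (\<lambda>\<omega>. (D0 \<omega>)\<^sup>2) \<le> 3 * real n"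
    using sample_sum_deviation[OF meas(1) i2] sample_sum_deviation[OF meas(2) i1] sample_sum_deviation[OF meas(3) i0] sq2 sq1 sq0
    unfolding D2_def D1_def D0_def mean2 mean1 mean0 by linarith+
  define B where "B \<omega> = 20 * (D2 \<omega>)\<^sup>2 + 48 * k / (g\<^sup>2 * real n) * (D1 \<omega>)\<^sup>2 + 4 * k\<^sup>2 / (g ^ 4 * (real n)\<^sup>2) * (D0 \<omega>)\<^sup>2" for \<omega>
  have c1: "c1\<^sup>2 \<le> real n * k"
  proof -
    have "\<bar>c1\<bar> \<le> mean (\<lambda>i. \<bar>m1 i\<bar>)"
      unfolding c1_def mean_def using contrast_nonneg contrast_le
      by (intro order.trans[OF sum_abs] sum_mono) (simp add: abs_mult mult_right_mono)
    also have "\<dots> \<le> sqrt (real n * mean (\<lambda>i. (m1 i)\<^sup>2))" by (rule mean_abs_le)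
    also have "\<dots> \<le> sqrt (real n * k)" using K2 by (simp add: mult_left_mono)
    finally have "\<bar>c1\<bar>\<^sup>2 \<le> (sqrt (real n * k))\<^sup>2" by (intro power_mono) auto
    then show ?thesis using k_ge_1 by simp
  qed
  have c2: "c2 \<le> k"
  proof -
    have "c2 \<le> mean m2" unfolding c2_def mean_def
      using contrast_le moments(6) by (intro sum_mono mult_right_mono) auto
    then show ?thesis using mean_m2 by simp
  qed
  \<comment> \<open>Only almost everywhere: on a null set \<open>S\<close> may take values of
    another size, for which the denominator is not controlled.\<close>
  have AEb: "AE \<omega> in M. (hajek_hat \<omega> - hajek_limit)\<^sup>2 \<le> B \<omega>"
    using AE_samples
  proof eventually_elim
    fix \<omega> assume s: "S \<omega> \<in> samples"
    let ?M1 = "\<Sum>i\<in>S \<omega>. h1 i (X i \<omega>)" and ?M2 = "\<Sum>i\<in>S \<omega>. h2 i (X i \<omega>)" and ?d = "\<Sum>i\<in>S \<omega>. h0 i (X i \<omega>)"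
    have "?M1\<^sup>2 = (\<Sum>i\<in>S \<omega>. sqrt (1 - inc i) * (sqrt (1 - inc i) * b i (X i \<omega>)))\<^sup>2"
      unfolding h1_def using one_minus_inc by (simp add: mult.assoc[symmetric])
    also have "\<dots> \<le> (\<Sum>i\<in>S \<omega>. (sqrt (1 - inc i))\<^sup>2) * (\<Sum>i\<in>S \<omega>. (sqrt (1 - inc i) * b i (X i \<omega>))\<^sup>2)"
      by (rule Cauchy_Schwarz_ineq_sum)
    also have "\<dots> = ?d * ?M2"
      using inc_le_1 by (simp add: h0_def h2_def power_mult_distrib)
    finally have CS: "?M1\<^sup>2 \<le> ?d * ?M2" .
    have d: "g * real n \<le> ?d" using sum_one_minus_inc_ge[OF s] by (simp add: h0_def)
    have d0: "g * real n \<le> c0" unfolding c0_def by (rule sum_contrast_ge)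
    have eq: "hajek_hat \<omega> = ?M2 - ?M1\<^sup>2 / ?d" "hajek_limit = c2 - c1\<^sup>2 / c0"
      by (simp_all add: hajek_hat_def hajek_limit_def h2_def h1_def h0_def c2_def c1_def c0_def)
    show "(hajek_hat \<omega> - hajek_limit)\<^sup>2 \<le> B \<omega>"
      unfolding eq B_def D2_def D1_def D0_def
      by (rule hajek_estimator_bound[OF g_pos g_le_1 n1 k_ge_1 d d0 CS c1 c2])
  qed
  have iB: "integrable M B" unfolding B_def[abs_def] using int by auto
  show i: "integrable M (\<lambda>\<omega>. (hajek_hat \<omega> - hajek_limit)\<^sup>2)"
  proof (rule Bochner_Integration.integrable_bound[OF iB])
    show "AE \<omega> in M. norm ((hajek_hat \<omega> - hajek_limit)\<^sup>2) \<le> norm (B \<omega>)" using AEb by eventually_elim simp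
  qed (use hajek_hat_measurable in measurable)
  have "expectation (\<lambda>\<omega>. (hajek_hat \<omega> - hajek_limit)\<^sup>2) \<le> expectation B"
    by (rule integral_mono_AE[OF i iB AEb])
  also have "expectation B = 20 * expectation (\<lambda>\<omega>. (D2 \<omega>)\<^sup>2) + 48 * k / (g\<^sup>2 * real n) * expectation (\<lambda>\<omega>. (D1 \<omega>)\<^sup>2) +
      4 * k\<^sup>2 / (g ^ 4 * (real n)\<^sup>2) * expectation (\<lambda>\<omega>. (D0 \<omega>)\<^sup>2)"
    unfolding B_def[abs_def] using int by simp
  also have "\<dots> \<le> 20 * (3 * (k\<^sup>2 / real n)) + 48 * k / (g\<^sup>2 * real n) * (3 * k) + 4 * k\<^sup>2 / (g ^ 4 * (real n)\<^sup>2) * (3 * real n)"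
    using E k_ge_1 by (intro add_mono mult_left_mono) auto
  also have "\<dots> = 60 * (k\<^sup>2 / real n * 1) + 144 * (k\<^sup>2 / real n * (1 / g\<^sup>2)) + 12 * (k\<^sup>2 / real n * (1 / g ^ 4))"
    using n_pos by (simp add: power2_eq_square mult_ac)
  also have "\<dots> \<le> 60 * (k\<^sup>2 / real n * (1 / g ^ 4)) + 144 * (k\<^sup>2 / real n * (1 / g ^ 4)) + 12 * (k\<^sup>2 / real n * (1 / g ^ 4))"
    using g_pos g_le_1 power_decreasing[of 2 4 g] power_le_one[of g 4]
    by (intro add_mono mult_left_mono) (auto simp: frac_le)
  also have "\<dots> = 216 * k\<^sup>2 / (g ^ 4 * real n)" by simp
  finally show "expectation (\<lambda>\<omega>. (hajek_hat \<omega> - hajek_limit)\<^sup>2) \<le> 216 * k\<^sup>2 / (g ^ 4 * real n)" .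
qed

text \<open>The second moment of an estimate is its squared mean plus \<open>vr i\<close>, so a
  second-stage term joins Hajek's variance of the means. For expanded estimates this term is
  \<open>V2\<close>, which is why the first part of the variance estimator targets
  \<open>V1 + V2\<close>.\<close>

lemma hajek_limit_eq: "hajek_limit = hajek_var m1 + (\<Sum>i\<in>U. contrast i * vr i)"
proof -
  have "(\<Sum>i\<in>U. contrast i * m2 i) = (\<Sum>i\<in>U. contrast i * (m1 i)\<^sup>2) + (\<Sum>i\<in>U. contrast i * vr i)"
    unfolding sum.distrib[symmetric] by (intro sum.cong) (auto simp: moments(3) algebra_simps)
  then show ?thesis by (simp add: hajek_limit_def hajek_var_def)
qed

end

section \<open>Characteristic function of the two-stage estimator\<close>

context two_stage_array begin

definition psi :: "real \<Rightarrow> 'i \<Rightarrow> complex" where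
  "psi t i = (CLINT x|L i. iexp (t * (b i x - m1 i)))"

lemma norm_psi: assumes "i \<in> U" shows "norm (psi t i) \<le> 1"
proof -
  interpret Li: prob_space "L i" by (rule law_prob[OF assms])
  have "norm (psi t i) \<le> (\<integral>x. norm (iexp (t * (b i x - m1 i))) \<partial>L i)"
    unfolding psi_def by (rule integral_norm_bound)
  then show ?thesis by (simp add: Li.prob_space)
qed

text \<open>The factor 16 is the price of centring: \<open>diff_power4_le\<close> gives 8 times a
  sum of two terms, each at most \<open>m4 i\<close>.\<close>

lemma psi_approx:
  assumes "i \<in> U"
  shows "norm (psi t i - exp (- (t\<^sup>2 * vr i / 2))) \<le>
    \<bar>t\<bar> ^ 3 / 12 * (m2 i / sqrt (real n) + sqrt (real n) * (16 * m4 i)) + t ^ 4 / 8 * m4 i"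
proof -
  note P = law_prob[OF assms]
  note [measurable] = b_meas_L[OF assms]
  define f where "f x = b i x - m1 i" for x
  have meas: "f \<in> borel_measurable (L i)" unfolding f_def[abs_def] by measurable
  have fm: "finite_measure (L i)" using P by (simp add: prob_space_def)
  have c: "integrable (L i) (\<lambda>x. c)" for c :: real using finite_measure.integrable_const[OF fm] .
  have dom: "f x ^ 4 \<le> 8 * (b i x ^ 4 + m1 i ^ 4)" for x unfolding f_def by (rule diff_power4_le)
  have i4: "integrable (L i) (\<lambda>x. f x ^ 4)"
    by (rule Bochner_Integration.integrable_bound[of _ "\<lambda>x. 8 * (b i x ^ 4 + m1 i ^ 4)"])
      (use b4[OF assms] c meas dom in \<open>auto intro!: AE_I2\<close>)
  have m0: "integral\<^sup>L (L i) f = 0"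
    unfolding f_def[abs_def] using b_integrable(2)[OF assms] c prob_space.prob_space[OF P] by (simp add: m1_def)
  have f4: "integral\<^sup>L (L i) (\<lambda>x. f x ^ 4) \<le> 16 * m4 i"
  proof -
    have "integral\<^sup>L (L i) (\<lambda>x. f x ^ 4) \<le> integral\<^sup>L (L i) (\<lambda>x. 8 * (b i x ^ 4 + m1 i ^ 4))"
      using b4[OF assms] c i4 dom by (intro integral_mono) auto
    also have "\<dots> = 8 * (m4 i + m1 i ^ 4)"
      using b4[OF assms] c prob_space.prob_space[OF P] by (simp add: m4_def)
    finally show ?thesis using moments(8)[OF assms] by simp
  qed
  have v: "integral\<^sup>L (L i) (\<lambda>x. (f x)\<^sup>2) = vr i" by (simp add: f_def vr_def)
  have "norm (psi t i - exp (- (t\<^sup>2 * vr i / 2))) \<le>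
      \<bar>t\<bar> ^ 3 / 12 * (vr i / sqrt (real n) + sqrt (real n) * integral\<^sup>L (L i) (\<lambda>x. f x ^ 4)) + t ^ 4 / 8 * (vr i)\<^sup>2"
    using prob_space.char_second_order[OF P meas i4 m0, of "sqrt (real n)" t] n_pos
    unfolding v psi_def by (simp add: f_def)
  also have "\<dots> \<le> \<bar>t\<bar> ^ 3 / 12 * (m2 i / sqrt (real n) + sqrt (real n) * (16 * m4 i)) + t ^ 4 / 8 * m4 i"
  proof -
    have "(vr i)\<^sup>2 \<le> (m2 i)\<^sup>2" using moments(4,5)[OF assms] by (intro power_mono)
    then have "(vr i)\<^sup>2 \<le> m4 i" using moments(2)[OF assms] by simp
    then show ?thesis using f4 moments(5)[OF assms]
      by (intro add_mono mult_left_mono divide_right_mono) auto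
  qed
  finally show ?thesis .
qed

lemma cond_char:
  assumes "0 < prob (event s)" "s \<subseteq> U"
  shows "integrable (cnd s) (\<lambda>\<omega>. iexp (t * ((\<Sum>i\<in>s. b i (X i \<omega>)) - c)))"
    and "(CLINT \<omega>|cnd s. iexp (t * ((\<Sum>i\<in>s. b i (X i \<omega>)) - c))) = iexp (t * ((\<Sum>i\<in>s. m1 i) - c)) * (\<Prod>i\<in>s. psi t i)"
proof -
  interpret C: prob_space "cnd s" by (rule prob_space_cnd[OF assms(1)])
  define Z where "Z i \<omega> = b i (X i \<omega>) - m1 i" for i \<omega>
  have bm: "(\<lambda>x. b i x - m1 i) \<in> borel_measurable (N i)" if "i \<in> U" for i using b_meas[OF that] by simp
  have Xc: "X i \<in> cnd s \<rightarrow>\<^sub>M N i" if "i \<in> U" for i using X_meas[OF that] by (simp add: cnd_def)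
  have Zm: "Z i \<in> borel_measurable (cnd s)" if "i \<in> s" for i
    unfolding Z_def[abs_def] using measurable_compose[OF Xc bm] that assms(2) by auto
  have ind: "C.indep_vars (\<lambda>_. borel) Z s"
    unfolding Z_def[abs_def] using cond_indep_compose[OF assms, of "\<lambda>i x. b i x - m1 i" borel] bm by simp
  have sumZ: "(\<lambda>\<omega>. \<Sum>i\<in>s. Z i \<omega>) \<in> borel_measurable (cnd s)" using Zm by simp
  have eq: "iexp (t * ((\<Sum>i\<in>s. b i (X i \<omega>)) - c)) = iexp (t * ((\<Sum>i\<in>s. m1 i) - c)) * iexp (t * (\<Sum>i\<in>s. Z i \<omega>))" for \<omega>
  proof -
    have "(\<Sum>i\<in>s. b i (X i \<omega>)) - c = ((\<Sum>i\<in>s. m1 i) - c) + (\<Sum>i\<in>s. Z i \<omega>)"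
      by (simp add: Z_def sum_subtractf)
    then show ?thesis by (simp only: iexp_distrib)
  qed
  have "(CLINT \<omega>|cnd s. iexp (t * (\<Sum>i\<in>s. Z i \<omega>))) = char (distr (cnd s) borel (\<lambda>\<omega>. \<Sum>i\<in>s. Z i \<omega>)) t"
    unfolding char_def by (subst integral_distr[OF sumZ]) auto
  also have "\<dots> = (\<Prod>i\<in>s. char (distr (cnd s) borel (Z i)) t)" by (rule C.char_distr_sum[OF ind])
  also have "\<dots> = (\<Prod>i\<in>s. psi t i)"
  proof (intro prod.cong refl)
    fix i assume i: "i \<in> s"
    have iU: "i \<in> U" using i assms by auto
    have "char (distr (cnd s) borel (Z i)) t = (CLINT \<omega>|cnd s. iexp (t * Z i \<omega>))"
      unfolding char_def by (subst integral_distr[OF Zm[OF i]]) auto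
    also have "\<dots> = psi t i"
      unfolding Z_def psi_def
      by (rule cond_law_integral(2)[OF assms(1) i assms(2)]) (use bm[OF iU] in measurable)
    finally show "char (distr (cnd s) borel (Z i)) t = psi t i" .
  qed
  finally have E: "(CLINT \<omega>|cnd s. iexp (t * (\<Sum>i\<in>s. Z i \<omega>))) = (\<Prod>i\<in>s. psi t i)" .
  have int: "integrable (cnd s) (\<lambda>\<omega>. iexp (t * (\<Sum>i\<in>s. Z i \<omega>)))"
  proof (rule C.integrable_const_bound[of _ 1])
    show "(\<lambda>\<omega>. iexp (t * (\<Sum>i\<in>s. Z i \<omega>))) \<in> borel_measurable (cnd s)" using sumZ by measurable
  qed simp
  show "integrable (cnd s) (\<lambda>\<omega>. iexp (t * ((\<Sum>i\<in>s. b i (X i \<omega>)) - c)))"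
    unfolding eq using int by (rule integrable_mult_right)
  show "(CLINT \<omega>|cnd s. iexp (t * ((\<Sum>i\<in>s. b i (X i \<omega>)) - c))) = iexp (t * ((\<Sum>i\<in>s. m1 i) - c)) * (\<Prod>i\<in>s. psi t i)"
    unfolding eq E[symmetric] by (rule integral_mult_right_zero)
qed

lemma sample_char:
  "(CLINT \<omega>|M. iexp (t * ((\<Sum>i\<in>S \<omega>. b i (X i \<omega>)) - c))) =
     ex (\<lambda>s. iexp (t * ((\<Sum>i\<in>s. m1 i) - c)) * (\<Prod>i\<in>s. psi t i))"
proof -
  have m: "(\<lambda>\<omega>. iexp (t * ((\<Sum>i\<in>s. b i (X i \<omega>)) - c))) \<in> borel_measurable M" if "s \<subseteq> U" for s
    using sample_sum_measurable[OF b_meas that] by measurable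
  have "(CLINT \<omega>|M. iexp (t * ((\<Sum>i\<in>S \<omega>. b i (X i \<omega>)) - c))) =
    (\<Sum>s\<in>Pow U. prob (event s) *\<^sub>R (CLINT \<omega>|cnd s. iexp (t * ((\<Sum>i\<in>s. b i (X i \<omega>)) - c))))"
    by (rule integral_split(2)[where F = "\<lambda>s \<omega>. iexp (t * ((\<Sum>i\<in>s. b i (X i \<omega>)) - c))"])
      (use m cond_char(1) in auto)
  also have "\<dots> = (\<Sum>s\<in>Pow U. prob (event s) *\<^sub>R (iexp (t * ((\<Sum>i\<in>s. m1 i) - c)) * (\<Prod>i\<in>s. psi t i)))"
  proof (intro sum.cong refl)
    fix s assume "s \<in> Pow U"
    then show "prob (event s) *\<^sub>R (CLINT \<omega>|cnd s. iexp (t * ((\<Sum>i\<in>s. b i (X i \<omega>)) - c))) =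
      prob (event s) *\<^sub>R (iexp (t * ((\<Sum>i\<in>s. m1 i) - c)) * (\<Prod>i\<in>s. psi t i))"
      using cond_char(2)[of s t c] by (cases "prob (event s) = 0") (auto simp: zero_less_measure_iff)
  qed
  finally show ?thesis unfolding sum_Pow_eq_ex .
qed

text \<open>Given the sample the characteristic function is \<open>A s\<close>, of modulus one,
  times a product of factors \<open>psi t i\<close>. Factors of modulus at most one can be exchanged
  at the cost of the sum of their errors, which produces a Gaussian factor whose exponent is a
  sample total of \<open>vr\<close>; that total is replaced by its mean. The resulting
  \<open>G\<close> is deterministic, and \<open>char_approx\<close> takes care of the remaining
  \<open>ex A\<close>.\<close>

lemma sample_char_approx:
  "norm ((CLINT \<omega>|M. iexp (t * ((\<Sum>i\<in>S \<omega>. b i (X i \<omega>)) - mean m1))) -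
      exp (- ((covar m1 m1 + mean vr) * t\<^sup>2 / 2))) \<le>
    (2 * \<bar>t\<bar> ^ 3 + t ^ 4 + t\<^sup>2) * (k\<^sup>2 / sqrt (real n)) +
    100 * k\<^sup>2 / (g ^ 3 * sqrt (real n)) * \<bar>t\<bar> * (1 + t\<^sup>2)"
proof -
  let ?r = "sqrt (real n)"
  define A where "A s = iexp (t * ((\<Sum>i\<in>s. m1 i) - mean m1))" for s
  define G where "G = exp (- (t\<^sup>2 * mean vr / 2))"
  define B where "B i = \<bar>t\<bar> ^ 3 / 12 * (m2 i / ?r + ?r * (16 * m4 i)) + t ^ 4 / 8 * m4 i" for i
  have nA: "norm (A s) = 1" for s by (simp add: A_def)
  have vr0: "0 \<le> mean vr" using moments(4) by (intro mean_nonneg)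
  have G: "0 \<le> G" "G \<le> 1" using vr0 by (auto simp: G_def)
  have kk: "k \<le> k\<^sup>2" using k_ge_1 by (simp add: power2_eq_square)
  have pt: "norm (A s * (\<Prod>i\<in>s. psi t i) - complex_of_real G * A s) \<le> (\<Sum>i\<in>s. B i) + t\<^sup>2 / 2 * \<bar>(\<Sum>i\<in>s. vr i) - mean vr\<bar>"
    if s: "s \<in> samples" for s
  proof -
    have sU: "i \<in> U" if "i \<in> s" for i using samplesD(1)[OF s] that by auto
    have "norm (A s * (\<Prod>i\<in>s. psi t i) - complex_of_real G * A s) = norm ((\<Prod>i\<in>s. psi t i) - complex_of_real G)"
      by (metis (no_types) mult.commute mult_1 nA norm_mult right_diff_distrib)
    also have "\<dots> \<le> norm ((\<Prod>i\<in>s. psi t i) - (\<Prod>i\<in>s. complex_of_real (exp (- (t\<^sup>2 * vr i / 2))))) +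
        norm ((\<Prod>i\<in>s. complex_of_real (exp (- (t\<^sup>2 * vr i / 2)))) - complex_of_real G)"
      by (rule norm_diff_triangle_le[OF order.refl order.refl])
    also have "norm ((\<Prod>i\<in>s. psi t i) - (\<Prod>i\<in>s. complex_of_real (exp (- (t\<^sup>2 * vr i / 2))))) \<le>
        (\<Sum>i\<in>s. norm (psi t i - complex_of_real (exp (- (t\<^sup>2 * vr i / 2)))))"
      by (rule norm_prod_diff) (use norm_psi sU moments(4) in \<open>auto simp del: of_real_exp\<close>)
    also have "\<dots> \<le> (\<Sum>i\<in>s. B i)"
      unfolding B_def using psi_approx sU by (intro sum_mono) auto
    also have "norm ((\<Prod>i\<in>s. complex_of_real (exp (- (t\<^sup>2 * vr i / 2)))) - complex_of_real G) =
        \<bar>exp (- (\<Sum>i\<in>s. t\<^sup>2 * vr i / 2)) - G\<bar>"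
      unfolding of_real_prod[symmetric] of_real_diff[symmetric] norm_of_real
      using samplesD(3)[OF s] by (simp add: exp_sum sum_negf[symmetric])
    also have "\<dots> \<le> \<bar>(\<Sum>i\<in>s. t\<^sup>2 * vr i / 2) - t\<^sup>2 * mean vr / 2\<bar>"
      unfolding G_def using vr0 moments(4) sU by (intro exp_neg_diff_bound sum_nonneg) auto
    also have "(\<Sum>i\<in>s. t\<^sup>2 * vr i / 2) = t\<^sup>2 * (\<Sum>i\<in>s. vr i) / 2"
      by (simp add: sum_distrib_left sum_divide_distrib)
    also have "\<bar>t\<^sup>2 * (\<Sum>i\<in>s. vr i) / 2 - t\<^sup>2 * mean vr / 2\<bar> = t\<^sup>2 / 2 * \<bar>(\<Sum>i\<in>s. vr i) - mean vr\<bar>"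
      by (simp add: abs_mult right_diff_distrib[symmetric] diff_divide_distrib[symmetric])
    finally show ?thesis by simp
  qed
  have mB: "mean B \<le> \<bar>t\<bar> ^ 3 / 12 * (k / ?r + ?r * (16 * (k\<^sup>2 / real n))) + t ^ 4 / 8 * (k\<^sup>2 / real n)"
  proof -
    have "mean B = \<bar>t\<bar> ^ 3 / 12 * (1 / ?r * mean m2 + ?r * (16 * mean m4)) + t ^ 4 / 8 * mean m4"
      unfolding B_def[abs_def] mean_add mean_cmult divide_inverse mult.commute[of "m2 _"] by simp
    also have "\<dots> \<le> \<bar>t\<bar> ^ 3 / 12 * (1 / ?r * k + ?r * (16 * (k\<^sup>2 / real n))) + t ^ 4 / 8 * (k\<^sup>2 / real n)"
      using mean_m2 mean_m4 by (intro add_mono mult_left_mono) auto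
    finally show ?thesis by simp
  qed
  have dv: "ex (\<lambda>s. \<bar>(\<Sum>i\<in>s. vr i) - mean vr\<bar>) \<le> 2 * k / ?r"
  proof -
    have "ex (\<lambda>s. \<bar>(\<Sum>i\<in>s. vr i) - mean vr\<bar>) \<le> sqrt (ex (\<lambda>s. ((\<Sum>i\<in>s. vr i) - mean vr)\<^sup>2))" by (rule ex_abs_le)
    also have "\<dots> \<le> sqrt (2 * mean (\<lambda>i. (vr i)\<^sup>2))" using variance_le by simp
    also have "\<dots> \<le> sqrt ((2 * k / ?r)\<^sup>2)"
    proof (rule real_sqrt_le_mono)
      have "mean (\<lambda>i. (vr i)\<^sup>2) \<le> mean m4"
        by (intro mean_mono order.trans[OF power_mono moments(2)] moments(4,5))
      then have "2 * mean (\<lambda>i. (vr i)\<^sup>2) \<le> 2 * (k\<^sup>2 / real n)" using mean_m4 by simp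
      also have "\<dots> \<le> 4 * (k\<^sup>2 / real n)" by (intro mult_right_mono) auto
      also have "\<dots> = (2 * k / ?r)\<^sup>2" by (simp add: power_mult_distrib power_divide)
      finally show "2 * mean (\<lambda>i. (vr i)\<^sup>2) \<le> (2 * k / ?r)\<^sup>2" .
    qed
    also have "\<dots> = 2 * k / ?r" using k_ge_1 by simp
    finally show ?thesis .
  qed
  have rn: "k\<^sup>2 / real n \<le> k\<^sup>2 / ?r" "?r * (k\<^sup>2 / real n) = k\<^sup>2 / ?r" "k / ?r \<le> k\<^sup>2 / ?r"
  proof -
    have "?r \<le> real n" using n1 sqrt_n by (metis mult_left_mono mult.right_neutral order.trans zero_le_one)
    then show "k\<^sup>2 / real n \<le> k\<^sup>2 / ?r" using n_pos by (intro frac_le) auto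
    show "?r * (k\<^sup>2 / real n) = k\<^sup>2 / ?r" using n_pos sqrt_n(1) by (simp add: field_simps)
    show "k / ?r \<le> k\<^sup>2 / ?r" using kk by (intro divide_right_mono) auto
  qed
  have arith: "a / 12 * (x + 16 * x) + b / 8 * x + c / 2 * (2 * x) = (17 / 12 * a + b / 8 + c) * x" for a b c x :: real
    by (simp add: field_simps)
  have 1: "norm (ex (\<lambda>s. A s * (\<Prod>i\<in>s. psi t i)) - complex_of_real G * ex A) \<le> (2 * \<bar>t\<bar> ^ 3 + t ^ 4 + t\<^sup>2) * (k\<^sup>2 / ?r)"
  proof -
    have "norm (ex (\<lambda>s. A s * (\<Prod>i\<in>s. psi t i)) - complex_of_real G * ex A) =
        norm (ex (\<lambda>s. A s * (\<Prod>i\<in>s. psi t i) - complex_of_real G * A s))"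
      by (simp only: ex_diff ex_cmult)
    also have "\<dots> \<le> ex (\<lambda>s. (\<Sum>i\<in>s. B i) + t\<^sup>2 / 2 * \<bar>(\<Sum>i\<in>s. vr i) - mean vr\<bar>)"
      by (rule order.trans[OF norm_ex_le]) (intro ex_mono pt)
    also have "\<dots> = mean B + t\<^sup>2 / 2 * ex (\<lambda>s. \<bar>(\<Sum>i\<in>s. vr i) - mean vr\<bar>)"
      by (simp only: ex_add ex_cmult ex_mean)
    also have "\<dots> \<le> \<bar>t\<bar> ^ 3 / 12 * (k / ?r + 16 * (?r * (k\<^sup>2 / real n))) + t ^ 4 / 8 * (k\<^sup>2 / real n) + t\<^sup>2 / 2 * (2 * k / ?r)"
      using mB dv by (intro add_mono mult_left_mono) (auto simp: mult_ac)
    also have "\<dots> \<le> \<bar>t\<bar> ^ 3 / 12 * (k\<^sup>2 / ?r + 16 * (k\<^sup>2 / ?r)) + t ^ 4 / 8 * (k\<^sup>2 / ?r) + t\<^sup>2 / 2 * (2 * (k\<^sup>2 / ?r))"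
      using rn by (intro add_mono mult_left_mono) auto
    also have "\<dots> = (17 / 12 * \<bar>t\<bar> ^ 3 + t ^ 4 / 8 + t\<^sup>2) * (k\<^sup>2 / ?r)"
      by (rule arith)
    also have "\<dots> \<le> (2 * \<bar>t\<bar> ^ 3 + t ^ 4 + t\<^sup>2) * (k\<^sup>2 / ?r)"
    proof (intro mult_right_mono)
      have "0 \<le> \<bar>t\<bar> ^ 3" "0 \<le> t ^ 4" by auto
      then show "17 / 12 * \<bar>t\<bar> ^ 3 + t ^ 4 / 8 + t\<^sup>2 \<le> 2 * \<bar>t\<bar> ^ 3 + t ^ 4 + t\<^sup>2" by linarith
    qed auto
    finally show ?thesis .
  qed
  define E where "E = exp (- (covar m1 m1 * t\<^sup>2 / 2))"
  have 2: "norm (complex_of_real G * ex A - complex_of_real G * complex_of_real E) \<le>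
      100 * k\<^sup>2 / (g ^ 3 * ?r) * \<bar>t\<bar> * (1 + t\<^sup>2)"
  proof -
    have "norm (complex_of_real G * ex A - complex_of_real G * complex_of_real E) = G * norm (ex A - complex_of_real E)"
      using G by (simp add: right_diff_distrib[symmetric] norm_mult)
    also have "\<dots> \<le> 1 * norm (ex A - complex_of_real E)" using G by (intro mult_right_mono) auto
    finally show ?thesis using char_approx[of t] unfolding A_def[abs_def] E_def by simp
  qed
  have "complex_of_real G * complex_of_real E = exp (- ((covar m1 m1 + mean vr) * t\<^sup>2 / 2))"
    unfolding G_def E_def of_real_mult[symmetric] exp_add[symmetric] by (simp add: algebra_simps add_divide_distrib)
  then show ?thesis
    using norm_triangle_mono[OF 1 2] unfolding sample_char A_def[symmetric] by simp
qed

end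

section \<open>Samples of independent draws\<close>

lemma indep_vars_PiM_components:
  assumes "K \<noteq> {}" and P: "\<And>k. k \<in> K \<Longrightarrow> prob_space (Q k)"
  shows "prob_space.indep_vars (PiM K Q) Q (\<lambda>k x. x k) K"
proof -
  interpret prob_space "PiM K Q" by (rule prob_space_PiM[OF P])
  have "distr (PiM K Q) (PiM K Q) (\<lambda>x. \<lambda>k\<in>K. x k) = distr (PiM K Q) (PiM K Q) (\<lambda>x. x)"
    by (intro distr_cong refl) (auto simp: space_PiM PiE_def extensional_restrict)
  also have "\<dots> = PiM K (\<lambda>k. distr (PiM K Q) (Q k) (\<lambda>x. x k))"
    unfolding distr_id by (rule PiM_cong) (auto intro!: distr_PiM_component[symmetric] P)
  finally show ?thesis using assms(1) by (subst indep_vars_iff_distr_eq_PiM') auto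
qed

definition iid_sum :: "'k set \<Rightarrow> ('x \<Rightarrow> real) \<Rightarrow> ('k \<Rightarrow> 'x) \<Rightarrow> real" where
  "iid_sum K r x = (\<Sum>k\<in>K. r (x k))"

text \<open>The leading factor makes it unbiased for the variance of the whole sum
  \<open>iid_sum\<close>, not for that of a single summand.\<close>

definition iid_var :: "'k set \<Rightarrow> ('x \<Rightarrow> real) \<Rightarrow> ('k \<Rightarrow> 'x) \<Rightarrow> real" where
  "iid_var K r x = real (card K) / (real (card K) - 1) * (\<Sum>k\<in>K. (r (x k) - iid_sum K r x / real (card K))\<^sup>2)"

context
  fixes K :: "'k set" and Q :: "'x measure" and r :: "'x \<Rightarrow> real"
  assumes K: "finite K" "K \<noteq> {}" and Q: "prob_space Q"
    and r: "r \<in> borel_measurable Q" and r4: "integrable Q (\<lambda>x. r x ^ 4)"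
begin

interpretation Q: prob_space Q by (rule Q)
interpretation K: prob_space "PiM K (\<lambda>_. Q)" by (intro prob_space_PiM Q)

lemma iid_component:
  fixes h :: "'x \<Rightarrow> real"
  assumes "k \<in> K" "h \<in> borel_measurable Q"
  shows "integrable (PiM K (\<lambda>_. Q)) (\<lambda>x. h (x k)) \<longleftrightarrow> integrable Q h"
    "(\<integral>x. h (x k) \<partial>PiM K (\<lambda>_. Q)) = integral\<^sup>L Q h"
proof -
  have d: "distr (PiM K (\<lambda>_. Q)) Q (\<lambda>x. x k) = Q" by (rule distr_PiM_component[OF Q assms(1)])
  have m: "(\<lambda>x. x k) \<in> PiM K (\<lambda>_. Q) \<rightarrow>\<^sub>M Q" using assms(1) by simp
  show "integrable (PiM K (\<lambda>_. Q)) (\<lambda>x. h (x k)) \<longleftrightarrow> integrable Q h"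
    using integrable_distr_eq[OF m assms(2)] d by simp
  show "(\<integral>x. h (x k) \<partial>PiM K (\<lambda>_. Q)) = integral\<^sup>L Q h"
    using integral_distr[OF m assms(2)] d by simp
qed

lemma iid_integrable: "integrable Q (\<lambda>x. (r x)\<^sup>2)" "integrable Q r"
proof -
  note [measurable] = r
  have "integrable Q (\<lambda>x. ((r x)\<^sup>2)\<^sup>2)" using r4 by (simp only: power2_power2)
  then show 1: "integrable Q (\<lambda>x. (r x)\<^sup>2)" by (rule Q.square_integrable_imp_integrable[rotated]) measurable
  show "integrable Q r" by (rule Q.square_integrable_imp_integrable[OF _ 1]) measurable
qed

lemma iid_measurable [measurable]:
  "iid_sum K r \<in> borel_measurable (PiM K (\<lambda>_. Q))" "iid_var K r \<in> borel_measurable (PiM K (\<lambda>_. Q))"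
proof -
  have "(\<lambda>x. r (x k)) \<in> borel_measurable (PiM K (\<lambda>_. Q))" if "k \<in> K" for k
    using that r by (intro measurable_compose[OF measurable_component_singleton]) auto
  note [measurable] = this
  show *[measurable]: "iid_sum K r \<in> borel_measurable (PiM K (\<lambda>_. Q))"
    unfolding iid_sum_def[abs_def] by (intro borel_measurable_sum) auto
  show "iid_var K r \<in> borel_measurable (PiM K (\<lambda>_. Q))"
    unfolding iid_var_def[abs_def]
    by (intro borel_measurable_times borel_measurable_sum borel_measurable_power borel_measurable_diff borel_measurable_divide) auto
qed

lemma iid_comp_integrable:
  assumes "k \<in> K"
  shows "integrable (PiM K (\<lambda>_. Q)) (\<lambda>x. r (x k))" "integrable (PiM K (\<lambda>_. Q)) (\<lambda>x. (r (x k))\<^sup>2)"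
    "integrable (PiM K (\<lambda>_. Q)) (\<lambda>x. r (x k) ^ 4)"
  using iid_component(1)[OF assms, of r] iid_component(1)[OF assms, of "\<lambda>x. (r x)\<^sup>2"]
    iid_component(1)[OF assms, of "\<lambda>x. r x ^ 4"] iid_integrable r4 r by auto

lemma iid_sum_mean: "integral\<^sup>L (PiM K (\<lambda>_. Q)) (iid_sum K r) = real (card K) * integral\<^sup>L Q r"
  unfolding iid_sum_def[abs_def] using iid_comp_integrable iid_component(2)[OF _ r]
  by (simp add: Bochner_Integration.integral_sum)

lemma iid_sum_var:
  "integrable (PiM K (\<lambda>_. Q)) (\<lambda>x. (iid_sum K r x - c)\<^sup>2)"
  "(\<integral>x. (iid_sum K r x - real (card K) * integral\<^sup>L Q r)\<^sup>2 \<partial>PiM K (\<lambda>_. Q)) =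
    real (card K) * ((\<integral>x. (r x)\<^sup>2 \<partial>Q) - (integral\<^sup>L Q r)\<^sup>2)"
proof -
  have ind: "K.indep_vars (\<lambda>_. borel) (\<lambda>k x. r (x k)) K"
    by (rule K.indep_vars_compose2[OF indep_vars_PiM_components[OF K(2) Q]]) (use r in auto)
  have sq: "\<And>k. k \<in> K \<Longrightarrow> integrable (PiM K (\<lambda>_. Q)) (\<lambda>x. (r (x k))\<^sup>2)" by (rule iid_comp_integrable)
  show "integrable (PiM K (\<lambda>_. Q)) (\<lambda>x. (iid_sum K r x - c)\<^sup>2)"
    unfolding iid_sum_def by (rule K.indep_sum_second_moment(1)[OF K(1) ind sq])
  show "(\<integral>x. (iid_sum K r x - real (card K) * integral\<^sup>L Q r)\<^sup>2 \<partial>PiM K (\<lambda>_. Q)) =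
    real (card K) * ((\<integral>x. (r x)\<^sup>2 \<partial>Q) - (integral\<^sup>L Q r)\<^sup>2)"
    unfolding iid_sum_def
    by (subst K.indep_sum_second_moment(2)[OF K(1) ind sq], assumption)
      (use iid_component(2)[OF _ r] iid_component(2)[of _ "\<lambda>x. (r x)\<^sup>2"] r in simp)
qed

lemma iid_sum_sq: "(iid_sum K r x)\<^sup>2 \<le> real (card K) * (\<Sum>k\<in>K. (r (x k))\<^sup>2)"
  unfolding iid_sum_def using sum_squared_le_sum_of_squares[of "\<lambda>k. r (x k)" K] K by (simp add: mult.commute)

lemma iid_sum_sq_sq: "(\<Sum>k\<in>K. (r (x k))\<^sup>2)\<^sup>2 \<le> real (card K) * (\<Sum>k\<in>K. r (x k) ^ 4)"
  using sum_squared_le_sum_of_squares[of "\<lambda>k. (r (x k))\<^sup>2" K] K by (simp add: mult.commute power2_power2)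

text \<open>The power mean inequality, applied twice. The factor \<open>card K ^ 4\<close> is
  harmless because the summands will be ratios already divided by the number of draws, so the final
  bound does not depend on that number.\<close>

lemma iid_sum_power4:
  "integrable (PiM K (\<lambda>_. Q)) (\<lambda>x. iid_sum K r x ^ 4)"
  "(\<integral>x. iid_sum K r x ^ 4 \<partial>PiM K (\<lambda>_. Q)) \<le> real (card K) ^ 4 * (\<integral>x. r x ^ 4 \<partial>Q)"
proof -
  define m where "m = real (card K)"
  have m: "0 \<le> m" by (simp add: m_def)
  define B where "B x = m ^ 3 * (\<Sum>k\<in>K. r (x k) ^ 4)" for x
  have iB: "integrable (PiM K (\<lambda>_. Q)) B" unfolding B_def[abs_def] using iid_comp_integrable(3) by auto
  have le: "iid_sum K r x ^ 4 \<le> B x" for x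
  proof -
    have "((iid_sum K r x)\<^sup>2)\<^sup>2 \<le> (m * (\<Sum>k\<in>K. (r (x k))\<^sup>2))\<^sup>2"
      unfolding m_def by (intro power_mono iid_sum_sq) simp
    also have "\<dots> = m\<^sup>2 * (\<Sum>k\<in>K. (r (x k))\<^sup>2)\<^sup>2" by (simp add: power_mult_distrib)
    also have "\<dots> \<le> m\<^sup>2 * (m * (\<Sum>k\<in>K. r (x k) ^ 4))"
      unfolding m_def by (intro mult_left_mono iid_sum_sq_sq) simp
    finally show ?thesis by (simp add: B_def power3_eq_cube power4_eq_xxxx power2_eq_square mult.assoc)
  qed
  show i: "integrable (PiM K (\<lambda>_. Q)) (\<lambda>x. iid_sum K r x ^ 4)"
    by (rule Bochner_Integration.integrable_bound[OF iB]) (use le in \<open>auto intro!: AE_I2 order.trans[OF le abs_ge_self]\<close>)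
  have "(\<integral>x. iid_sum K r x ^ 4 \<partial>PiM K (\<lambda>_. Q)) \<le> integral\<^sup>L (PiM K (\<lambda>_. Q)) B"
    by (intro integral_mono i iB le)
  also have "\<dots> = m ^ 3 * (m * (\<integral>x. r x ^ 4 \<partial>Q))"
    unfolding B_def[abs_def] using iid_comp_integrable(3) iid_component(2)[of _ "\<lambda>x. r x ^ 4"] r
    by (simp add: Bochner_Integration.integral_sum m_def)
  finally show "(\<integral>x. iid_sum K r x ^ 4 \<partial>PiM K (\<lambda>_. Q)) \<le> real (card K) ^ 4 * (\<integral>x. r x ^ 4 \<partial>Q)"
    by (simp add: m_def power3_eq_cube power4_eq_xxxx mult.assoc)
qed

lemma iid_var_eq:
  "iid_var K r x = real (card K) / (real (card K) - 1) * ((\<Sum>k\<in>K. (r (x k))\<^sup>2) - (iid_sum K r x)\<^sup>2 / real (card K))"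
proof -
  define m where "m = real (card K)"
  have m: "m \<noteq> 0" using K by (simp add: m_def)
  have "(\<Sum>k\<in>K. (r (x k) - iid_sum K r x / m)\<^sup>2) =
      (\<Sum>k\<in>K. (r (x k))\<^sup>2) - 2 * (iid_sum K r x / m) * (\<Sum>k\<in>K. r (x k)) + m * (iid_sum K r x / m)\<^sup>2"
    by (simp add: power2_diff sum.distrib sum_subtractf sum_distrib_left sum_divide_distrib m_def mult_ac)
  also have "\<dots> = (\<Sum>k\<in>K. (r (x k))\<^sup>2) - (iid_sum K r x)\<^sup>2 / m"
    using m by (simp add: iid_sum_def[symmetric] power2_eq_square field_simps)
  finally show ?thesis by (simp add: iid_var_def m_def)
qed

lemma iid_var_mean:
  assumes "2 \<le> card K"
  shows "integral\<^sup>L (PiM K (\<lambda>_. Q)) (iid_var K r) = real (card K) * ((\<integral>x. (r x)\<^sup>2 \<partial>Q) - (integral\<^sup>L Q r)\<^sup>2)"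
proof -
  define m mu w where "m = real (card K)" and "mu = integral\<^sup>L Q r" and "w = (\<integral>x. (r x)\<^sup>2 \<partial>Q)"
  have m: "2 \<le> m" using assms by (simp add: m_def)
  have i1: "integrable (PiM K (\<lambda>_. Q)) (iid_sum K r)"
    unfolding iid_sum_def[abs_def] using iid_comp_integrable(1) by auto
  have i2: "integrable (PiM K (\<lambda>_. Q)) (\<lambda>x. (iid_sum K r x)\<^sup>2)" using iid_sum_var(1)[of 0] by simp
  have "(\<integral>x. (iid_sum K r x - m * mu)\<^sup>2 \<partial>PiM K (\<lambda>_. Q)) = (\<integral>x. (iid_sum K r x)\<^sup>2 \<partial>PiM K (\<lambda>_. Q)) - (m * mu)\<^sup>2"
    using K.variance_eq[OF i1 i2] by (simp add: iid_sum_mean m_def mu_def)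
  then have e2: "(\<integral>x. (iid_sum K r x)\<^sup>2 \<partial>PiM K (\<lambda>_. Q)) = m * (w - mu\<^sup>2) + (m * mu)\<^sup>2"
    using iid_sum_var(2) by (simp add: m_def mu_def w_def)
  have e1: "(\<integral>x. (\<Sum>k\<in>K. (r (x k))\<^sup>2) \<partial>PiM K (\<lambda>_. Q)) = m * w"
    using iid_comp_integrable(2) iid_component(2)[of _ "\<lambda>x. (r x)\<^sup>2"] r
    by (simp add: Bochner_Integration.integral_sum m_def w_def)
  have "integral\<^sup>L (PiM K (\<lambda>_. Q)) (iid_var K r) = m / (m - 1) * (m * w - (m * (w - mu\<^sup>2) + (m * mu)\<^sup>2) / m)"
    unfolding iid_var_eq[abs_def] using i2 iid_comp_integrable(2) by (simp add: e1 e2 m_def[symmetric])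
  also have "\<dots> = m * (w - mu\<^sup>2)"
    using m by (simp add: field_simps power2_eq_square)
  finally show ?thesis by (simp add: m_def mu_def w_def)
qed

text \<open>The natural factor \<open>4 * card K ^ 2\<close> is enlarged to
  \<open>card K ^ 4\<close>, as two draws permit, so that one moment bound covers the estimate and
  its variance estimate.\<close>

lemma iid_var_sq:
  assumes "2 \<le> card K"
  shows "integrable (PiM K (\<lambda>_. Q)) (\<lambda>x. (iid_var K r x)\<^sup>2)"
    "(\<integral>x. (iid_var K r x)\<^sup>2 \<partial>PiM K (\<lambda>_. Q)) \<le> real (card K) ^ 4 * (\<integral>x. r x ^ 4 \<partial>Q)"
proof -
  define m where "m = real (card K)"
  have m: "2 \<le> m" using assms by (simp add: m_def)
  define B where "B x = 4 * (m * (\<Sum>k\<in>K. r (x k) ^ 4))" for x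
  have iB: "integrable (PiM K (\<lambda>_. Q)) B" unfolding B_def[abs_def] using iid_comp_integrable(3) by auto
  have le: "(iid_var K r x)\<^sup>2 \<le> B x" for x
  proof -
    have f: "0 \<le> m / (m - 1)" "m / (m - 1) \<le> 2" using m by (auto simp: field_simps)
    have nn: "0 \<le> iid_var K r x" unfolding iid_var_def m_def[symmetric] using f by (intro mult_nonneg_nonneg sum_nonneg) auto
    have "iid_var K r x \<le> 2 * (\<Sum>k\<in>K. (r (x k))\<^sup>2)"
      unfolding iid_var_eq m_def[symmetric]
    proof (intro order.trans[OF mult_left_mono mult_right_mono])
      show "(\<Sum>k\<in>K. (r (x k))\<^sup>2) - (iid_sum K r x)\<^sup>2 / m \<le> (\<Sum>k\<in>K. (r (x k))\<^sup>2)" using m by simp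
    qed (use f in \<open>auto intro!: sum_nonneg\<close>)
    then have "(iid_var K r x)\<^sup>2 \<le> (2 * (\<Sum>k\<in>K. (r (x k))\<^sup>2))\<^sup>2" using nn by (intro power_mono)
    also have "\<dots> = 4 * (\<Sum>k\<in>K. (r (x k))\<^sup>2)\<^sup>2" by (simp add: power_mult_distrib)
    also have "\<dots> \<le> B x" unfolding B_def m_def by (intro mult_left_mono iid_sum_sq_sq) simp
    finally show ?thesis .
  qed
  show i: "integrable (PiM K (\<lambda>_. Q)) (\<lambda>x. (iid_var K r x)\<^sup>2)"
    by (rule Bochner_Integration.integrable_bound[OF iB]) (use le in \<open>auto intro!: AE_I2 order.trans[OF le abs_ge_self]\<close>)
  have "(\<integral>x. (iid_var K r x)\<^sup>2 \<partial>PiM K (\<lambda>_. Q)) \<le> integral\<^sup>L (PiM K (\<lambda>_. Q)) B"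
    by (intro integral_mono i iB le)
  also have "\<dots> = 4 * (m * (m * (\<integral>x. r x ^ 4 \<partial>Q)))"
    unfolding B_def[abs_def] using iid_comp_integrable(3) iid_component(2)[of _ "\<lambda>x. r x ^ 4"] r
    by (simp add: Bochner_Integration.integral_sum m_def)
  also have "\<dots> = 2\<^sup>2 * m\<^sup>2 * (\<integral>x. r x ^ 4 \<partial>Q)" by (simp add: power2_eq_square)
  also have "\<dots> \<le> m\<^sup>2 * m\<^sup>2 * (\<integral>x. r x ^ 4 \<partial>Q)"
    using m by (intro mult_right_mono power_mono Bochner_Integration.integral_nonneg) auto
  finally show "(\<integral>x. (iid_var K r x)\<^sup>2 \<partial>PiM K (\<lambda>_. Q)) \<le> real (card K) ^ 4 * (\<integral>x. r x ^ 4 \<partial>Q)"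
    by (simp add: m_def power2_eq_square power4_eq_xxxx mult.assoc)
qed

end

section \<open>From Poisson parameters to the normalised design\<close>

text \<open>As the common odds factor \<open>l\<close> runs through the positive reals, the sum
  passes continuously from near the number of units with \<open>u i = 1\<close> to near
  \<open>card U\<close>, and the intermediate value theorem applies.\<close>

lemma exists_tilting:
  fixes u :: "'i \<Rightarrow> real"
  assumes U: "finite U" and u: "\<And>i. i \<in> U \<Longrightarrow> 0 < u i \<and> u i \<le> 1"
    and lo: "card {i \<in> U. u i = 1} < n" and hi: "n < card U"
  shows "\<exists>l>0. (\<Sum>i\<in>U. l * u i / (l * u i + (1 - u i))) = real n"
proof -
  define f where "f l = (\<Sum>i\<in>U. l * u i / (l * u i + (1 - u i)))" for l :: real
  have den: "0 < l * u i + (1 - u i)" if "0 < l" "i \<in> U" for l i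
    using u[OF that(2)] that(1) by (intro add_pos_nonneg mult_pos_pos) auto
  have "((\<lambda>l. \<Sum>i\<in>U. u i / (u i + (1 - u i) / l)) \<longlongrightarrow> (\<Sum>i\<in>U. u i / (u i + 0))) at_top"
  proof (intro tendsto_sum tendsto_divide tendsto_add tendsto_const)
    fix i assume "i \<in> U"
    show "((\<lambda>l. (1 - u i) / l) \<longlongrightarrow> 0) at_top"
      by (rule tendsto_divide_0[OF tendsto_const filterlim_at_top_imp_at_infinity[OF filterlim_ident]])
    show "u i + 0 \<noteq> 0" using u[OF \<open>i \<in> U\<close>] by simp
  qed
  moreover have "(\<Sum>i\<in>U. u i / (u i + 0)) = real (card U)"
  proof -
    have "(\<Sum>i\<in>U. u i / (u i + 0)) = (\<Sum>i\<in>U. 1)" using u by (intro sum.cong) force+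
    then show ?thesis by simp
  qed
  moreover have "eventually (\<lambda>l. (\<Sum>i\<in>U. u i / (u i + (1 - u i) / l)) = f l) at_top"
    using eventually_gt_at_top[of 0]
  proof eventually_elim
    fix l :: real assume l: "0 < l"
    have "u i / (u i + (1 - u i) / l) = l * u i / (l * u i + (1 - u i))" for i
    proof -
      have "l * u i / (l * u i + (1 - u i)) = l * u i / (l * (u i + (1 - u i) / l))"
        using l by (simp add: distrib_left)
      then show ?thesis using l by simp
    qed
    then show "(\<Sum>i\<in>U. u i / (u i + (1 - u i) / l)) = f l" by (simp add: f_def)
  qed
  ultimately have "(f \<longlongrightarrow> real (card U)) at_top" using Lim_transform_eventually by fastforce
  from order_tendstoD(1)[OF this, of "real n"] have "eventually (\<lambda>l. real n < f l) at_top" using hi by simp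
  then have "eventually (\<lambda>l. real n < f l \<and> 1 \<le> l) at_top"
    using eventually_ge_at_top[of 1] by eventually_elim auto
  from eventually_happens'[OF trivial_limit_at_top_linorder this]
  obtain l2 where l2: "real n < f l2" "1 \<le> l2" by blast
  \<comment> \<open>At \<open>l = 0\<close> a unit with \<open>u i = 1\<close> contributes 0 / 0,
    which evaluates to 0. \<open>h\<close> inserts the correct limit 1 there and agrees with
    \<open>f\<close> for positive \<open>l\<close>.\<close>
  define h where "h l = (\<Sum>i\<in>U. if u i = 1 then 1 else l * u i / (l * u i + (1 - u i)))" for l :: real
  have "(h \<longlongrightarrow> (\<Sum>i\<in>U. if u i = 1 then 1 else 0 * u i / (0 * u i + (1 - u i)))) (at_right 0)"
    unfolding h_def[abs_def]
  proof (intro tendsto_sum)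
    fix i assume "i \<in> U"
    show "((\<lambda>l. if u i = 1 then 1 else l * u i / (l * u i + (1 - u i))) \<longlongrightarrow>
        (if u i = 1 then 1 else 0 * u i / (0 * u i + (1 - u i)))) (at_right 0)"
      by (cases "u i = 1") (auto intro!: tendsto_eq_intros)
  qed
  moreover have "(\<Sum>i\<in>U. if u i = 1 then 1 else 0 * u i / (0 * u i + (1 - u i))) = real (card {i \<in> U. u i = 1})"
    using U by (simp add: sum.If_cases Int_def)
  moreover have "eventually (\<lambda>l. h l = f l) (at_right 0)"
    using eventually_at_right_less[of 0]
    by eventually_elim (auto simp: f_def h_def intro!: sum.cong)
  ultimately have "(f \<longlongrightarrow> real (card {i \<in> U. u i = 1})) (at_right 0)"
    using Lim_transform_eventually by fastforce
  from order_tendstoD(2)[OF this, of "real n"] have "eventually (\<lambda>l. f l < real n) (at_right 0)" using lo by simp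
  moreover have "eventually (\<lambda>l. l < 1) (at_right (0::real))" by (rule eventually_at_right_real[THEN eventually_mono]) auto
  moreover have "eventually (\<lambda>l. 0 < l) (at_right (0::real))" by (rule eventually_at_right_less)
  ultimately have "eventually (\<lambda>l. f l < real n \<and> l < 1 \<and> 0 < l) (at_right 0)" by eventually_elim auto
  then obtain l1 where l1: "f l1 < real n" "l1 < 1" "0 < l1"
    using eventually_happens'[OF trivial_limit_at_right_real] by blast
  have "continuous_on {l1..l2} f" unfolding f_def[abs_def]
  proof (intro continuous_intros ballI)
    fix i x assume "i \<in> U" "x \<in> {l1..l2}"
    then show "x * u i + (1 - u i) \<noteq> 0" using den[of x i] l1 by auto
  qed
  then obtain l where "l1 \<le> l" "f l = real n"
    using IVT'[of f l1 "real n" l2] l1 l2 by auto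
  then show ?thesis using l1 by (intro exI[of _ l]) (auto simp: f_def)
qed

lemma pmf_poisson_design:
  assumes U: "finite U" and p: "\<And>i. i \<in> U \<Longrightarrow> 0 \<le> p i \<and> p i \<le> 1" and s: "s \<subseteq> U"
  shows "pmf (poisson_design U p) s = bern_weight p U s"
proof -
  let ?P = "Pi_pmf U False (\<lambda>i. bernoulli_pmf (p i))"
  have "pmf (poisson_design U p) s = measure ?P ((\<lambda>b. {i \<in> U. b i}) -` {s})"
    by (simp add: poisson_design_def pmf_map)
  also have "\<dots> = measure ?P {\<lambda>i. i \<in> s}"
  proof (rule measure_pmf.finite_measure_eq_AE)
    have "AE b in ?P. \<forall>i. i \<notin> U \<longrightarrow> b i = False"
      using set_Pi_pmf_subset[OF U, of False "\<lambda>i. bernoulli_pmf (p i)"] by (auto simp: AE_measure_pmf_iff)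
    then show "AE b in ?P. b \<in> (\<lambda>b. {i \<in> U. b i}) -` {s} \<longleftrightarrow> b \<in> {\<lambda>i. i \<in> s}"
      by eventually_elim (use s in \<open>auto simp: fun_eq_iff\<close>)
  qed auto
  also have "\<dots> = pmf ?P (\<lambda>i. i \<in> s)" by (simp add: measure_pmf_single)
  also have "\<dots> = (\<Prod>i\<in>U. pmf (bernoulli_pmf (p i)) (i \<in> s))"
    using s by (intro pmf_Pi' U) auto
  also have "\<dots> = (\<Prod>i\<in>U. if i \<in> s then p i else 1 - p i)"
    using p by (intro prod.cong) auto
  also have "\<dots> = bern_weight p U s"
    using U s by (simp add: prod.If_cases bern_weight_def Int_absorb1 Diff_eq)
  finally show ?thesis .
qed

text \<open>The extra factor depends on \<open>s\<close> only through its size, so on sets of a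
  fixed size the tilted and the original weights are proportional.\<close>

lemma bern_weight_tilt:
  assumes "finite U" "s \<subseteq> U" "\<And>i. i \<in> U \<Longrightarrow> l * u i + (1 - u i) \<noteq> 0"
  shows "bern_weight (\<lambda>i. l * u i / (l * u i + (1 - u i))) U s =
    l ^ card s / (\<Prod>i\<in>U. l * u i + (1 - u i)) * bern_weight u U s"
proof -
  define d where "d i = l * u i + (1 - u i)" for i
  have d: "d i \<noteq> 0" if "i \<in> U" for i using assms(3)[OF that] by (simp add: d_def)
  have "(\<Prod>i\<in>U - s. 1 - l * u i / d i) = (\<Prod>i\<in>U - s. (1 - u i) / d i)"
    using d by (intro prod.cong) (auto simp: d_def field_simps)
  moreover have "(\<Prod>i\<in>U. d i) = (\<Prod>i\<in>U - s. d i) * (\<Prod>i\<in>s. d i)"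
    by (rule prod.subset_diff[OF assms(2,1)])
  ultimately show ?thesis
    by (simp add: bern_weight_def d_def[symmetric] prod_dividef prod.distrib mult_ac)
qed

lemma (in prob_space) prob_finite_valued:
  assumes U: "finite U" and S: "S \<in> M \<rightarrow>\<^sub>M count_space (Pow U)"
  shows "prob {\<omega> \<in> space M. Q (S \<omega>)} = (\<Sum>s\<in>Pow U. of_bool (Q s) * prob {\<omega> \<in> space M. S \<omega> = s})"
proof -
  define A where "A s = {\<omega> \<in> space M. S \<omega> = s}" for s
  have A: "A s \<in> events" if "s \<in> Pow U" for s
  proof -
    have "A s = S -` {s} \<inter> space M" by (auto simp: A_def)
    then show ?thesis using measurable_sets[OF S, of "{s}"] that by simp
  qed
  have eq: "{\<omega> \<in> space M. Q (S \<omega>)} = (\<Union>s\<in>{s\<in>Pow U. Q s}. A s)"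
    using measurable_space[OF S] by (auto simp: A_def)
  have "prob (\<Union>s\<in>{s\<in>Pow U. Q s}. A s) = (\<Sum>s\<in>{s\<in>Pow U. Q s}. prob (A s))"
    by (rule finite_measure_finite_Union) (use U A in \<open>auto simp: disjoint_family_on_def A_def\<close>)
  also have "\<dots> = (\<Sum>s\<in>Pow U. of_bool (Q s) * prob (A s))"
    using U by (intro sum.mono_neutral_cong_left) auto
  finally show ?thesis unfolding eq A_def .
qed

text \<open>Tilting requires all parameters positive and fewer than \<open>n\<close> of them equal
  to 1. Both come from positive inclusion probabilities: every unit lies in a sample of size
  \<open>n\<close> with positive weight, and such a sample has no unit of parameter 0 and contains
  all units of parameter 1.\<close>

lemma rejective_first_stage_tilted:
  assumes fs: "rejective_first_stage D" and n: "0 < size1 D" "size1 D < num_psu D"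
    and pos: "\<And>i. i < num_psu D \<Longrightarrow> 0 < incl D i"
  obtains p where "rejective {..<num_psu D} (size1 D) p (\<lambda>s. measure (prb D) {\<omega> \<in> space (prb D). smp1 D \<omega> = s})"
    and "\<And>s. s \<subseteq> {..<num_psu D} \<Longrightarrow> card s \<noteq> size1 D \<Longrightarrow> measure (prb D) {\<omega> \<in> space (prb D). smp1 D \<omega> = s} = 0"
proof -
  define U u n where "U = {..<num_psu D}" and "u = prm D" and "n = size1 D"
  define Pr where "Pr s = measure (prb D) {\<omega> \<in> space (prb D). smp1 D \<omega> = s}" for s
  define Z0 where "Z0 = measure (poisson_design U u) {s. card s = n}"
  have U: "finite U" by (simp add: U_def)
  have P: "prob_space (prb D)" and u01: "\<And>i. i \<in> U \<Longrightarrow> 0 \<le> u i \<and> u i \<le> 1"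
    and ne: "set_pmf (poisson_design U u) \<inter> {s. card s = n} \<noteq> {}"
    and S: "smp1 D \<in> prb D \<rightarrow>\<^sub>M count_space (Pow U)"
    and law: "\<And>s. s \<subseteq> U \<Longrightarrow> Pr s = pmf (rejective_design U u n) s"
    and inc: "\<And>i. i \<in> U \<Longrightarrow> measure (prb D) {\<omega> \<in> space (prb D). i \<in> smp1 D \<omega>} = incl D i"
    using fs unfolding rejective_first_stage_def U_def u_def n_def Pr_def by auto
  have Z0: "0 < Z0" using measure_measure_pmf_not_zero[OF ne] by (simp add: Z0_def zero_less_measure_iff)
  have Pr: "Pr s = (if card s = n then bern_weight u U s / Z0 else 0)" if "s \<subseteq> U" for s
    using law[OF that] pmf_cond[OF ne] pmf_poisson_design[OF U u01 that]
    by (simp add: rejective_design_def Z0_def)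
  have ex_s: "\<exists>s. s \<subseteq> U \<and> i \<in> s \<and> card s = n \<and> 0 < bern_weight u U s" if i: "i \<in> U" for i
  proof (rule ccontr)
    assume neg: "\<not> ?thesis"
    have "Pr s = 0" if "s \<subseteq> U" "i \<in> s" for s
    proof (cases "card s = n")
      case True
      then have "\<not> 0 < bern_weight u U s" using neg that by blast
      moreover have "0 \<le> bern_weight u U s" using u01 that(1) by (rule bern_weight_nonneg)
      ultimately show ?thesis using Pr[OF that(1)] by simp
    qed (simp add: Pr[OF that(1)])
    then have "measure (prb D) {\<omega> \<in> space (prb D). i \<in> smp1 D \<omega>} = 0"
      unfolding prob_space.prob_finite_valued[OF P U S, of "\<lambda>s. i \<in> s"] Pr_def[symmetric]
      by (intro sum.neutral) auto
    then show False using inc[OF i] pos[of i] i by (simp add: U_def)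
  qed
  have sub: "{j \<in> U. u j = 1} \<subseteq> s" if "s \<subseteq> U" "0 < bern_weight u U s" for s
  proof (rule ccontr)
    assume "\<not> ?thesis"
    then obtain j where "j \<in> U - s" "u j = 1" by auto
    then have "(\<Prod>i\<in>U - s. 1 - u i) = 0" using U by (intro prod_zero) auto
    then show False using that(2) by (simp add: bern_weight_def)
  qed
  have upos: "0 < u i \<and> u i \<le> 1" if i: "i \<in> U" for i
  proof -
    obtain s where s: "s \<subseteq> U" "i \<in> s" "0 < bern_weight u U s" using ex_s[OF i] by auto
    have "u i \<noteq> 0"
    proof
      assume "u i = 0"
      then have "(\<Prod>i\<in>s. u i) = 0" using s U finite_subset by (intro prod_zero) auto
      then show False using s(3) by (simp add: bern_weight_def)
    qed
    then show ?thesis using u01[OF i] by auto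
  qed
  \<comment> \<open>Some parameter differs from 1, since otherwise a possible sample would be all of
    \<open>U\<close>, which has more than \<open>n\<close> units. A possible sample through such a
    unit contains all units of parameter 1 and at least one more.\<close>
  have lo: "card {j \<in> U. u j = 1} < n"
  proof -
    have "\<exists>i\<in>U. u i \<noteq> 1"
    proof (rule ccontr)
      assume "\<not> ?thesis"
      then have all: "{j \<in> U. u j = 1} = U" by auto
      have "0 \<in> U" using n by (simp add: U_def)
      from ex_s[OF this] obtain s where s: "s \<subseteq> U" "card s = n" "0 < bern_weight u U s" by auto
      then have "U \<subseteq> s" using sub all by blast
      then have "card U \<le> n" using s U card_mono finite_subset by blast
      then show False using n by (simp add: U_def n_def)
    qed
    then obtain i where i: "i \<in> U" "u i \<noteq> 1" by auto
    obtain s where s: "s \<subseteq> U" "i \<in> s" "card s = n" "0 < bern_weight u U s" using ex_s[OF i(1)] by auto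
    have "{j \<in> U. u j = 1} \<subset> s" using sub[OF s(1,4)] s(2) i by auto
    then show ?thesis using psubset_card_mono[of s] s U finite_subset by auto
  qed
  obtain l where l: "0 < l" "(\<Sum>i\<in>U. l * u i / (l * u i + (1 - u i))) = real n"
    using exists_tilting[OF U upos lo] n by (auto simp: U_def n_def)
  define p where "p i = l * u i / (l * u i + (1 - u i))" for i
  have den: "0 < l * u i + (1 - u i)" if "i \<in> U" for i
    using upos[OF that] l by (intro add_pos_nonneg mult_pos_pos) auto
  have zero: "Pr s = 0" if "s \<subseteq> U" "card s \<noteq> n" for s using Pr[OF that(1)] that(2) by simp
  have "rejective U n p Pr"
  proof
    show "finite U" by (rule U)
    show "0 \<le> p i \<and> p i \<le> 1" if "i \<in> U" for i
      using upos[OF that] l den[OF that] by (auto simp: p_def divide_le_eq)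
    show "sum p U = real n" using l by (simp add: p_def)
    show "0 < n" using n by (simp add: n_def)
    define c where "c = l ^ n / (\<Prod>i\<in>U. l * u i + (1 - u i))"
    have c: "0 < c" unfolding c_def using l den by (intro divide_pos_pos prod_pos) auto
    define Z where "Z = Z0 * c"
    have "0 < Z" unfolding Z_def using Z0 c by simp
    moreover have "Pr s = bern_weight p U s / Z" if s: "s \<subseteq> U" "card s = n" for s
    proof -
      have "bern_weight p U s = l ^ card s / (\<Prod>i\<in>U. l * u i + (1 - u i)) * bern_weight u U s"
        unfolding p_def[abs_def] by (rule bern_weight_tilt[OF U s(1)]) (metis den order_less_irrefl)
      then have "bern_weight p U s = c * bern_weight u U s" by (simp only: s(2) c_def)
      moreover have "Pr s = bern_weight u U s / Z0" using Pr[OF s(1)] s(2) by simp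
      ultimately show ?thesis using c by (simp add: Z_def)
    qed
    ultimately show "\<exists>Z>0. \<forall>s. s \<subseteq> U \<and> card s = n \<longrightarrow> Pr s = bern_weight p U s / Z" by auto
    have "1 = measure (prb D) {\<omega> \<in> space (prb D). True}" using prob_space.prob_space[OF P] by simp
    also have "\<dots> = (\<Sum>s\<in>Pow U. Pr s)"
      unfolding prob_space.prob_finite_valued[OF P U S, of "\<lambda>_. True"] by (simp add: Pr_def)
    also have "\<dots> = sum Pr {s. s \<subseteq> U \<and> card s = n}"
      using U zero by (intro sum.mono_neutral_right) auto
    finally show "sum Pr {s. s \<subseteq> U \<and> card s = n} = 1" by simp
  qed
  then show ?thesis using that zero by (simp add: U_def n_def Pr_def[abs_def])
qed

section \<open>Surveys\<close>

text \<open>\<open>e i\<close> is any lower bound of the second-stage density in PSU \<open>i\<close>; the draws in PSU \<open>i\<close> are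
  collected in one random vector indexed by the pairs \<open>(i, j)\<close>.\<close>
locale survey_model =
  fixes F :: "'a::euclidean_space set" and \<rho> :: "'a \<Rightarrow> real" and D :: "('a, 'w) survey"
    and e :: "nat \<Rightarrow> real"
  assumes rho_meas: "\<rho> \<in> borel_measurable lebesgue"
    and rho_int: "set_integrable lebesgue F \<rho>"
    and rho4_int: "set_integrable lebesgue F (\<lambda>x. \<rho> x ^ 4)"
    and part: "psu_partition F D" and first: "rejective_first_stage D" and second: "second_stage D"
    and size1_pos: "0 < size1 D" and size1_less: "size1 D < num_psu D"
    and incl_pos: "\<And>i. i < num_psu D \<Longrightarrow> 0 < incl D i"
    and size2_ge: "\<And>i. i < num_psu D \<Longrightarrow> 2 \<le> size2 D i"
    and e_pos: "\<And>i. i < num_psu D \<Longrightarrow> 0 < e i"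
    and dens_ge: "\<And>i x. i < num_psu D \<Longrightarrow> x \<in> psu D i \<Longrightarrow> e i \<le> dens D i x"
begin

definition idx :: "nat \<Rightarrow> (nat \<times> nat) set" where "idx i = {i} \<times> {..<size2 D i}"
definition draw_space :: "nat \<Rightarrow> (nat \<times> nat \<Rightarrow> 'a) measure" where "draw_space i = PiM (idx i) (\<lambda>_. lebesgue)"
definition draws :: "nat \<Rightarrow> 'w \<Rightarrow> nat \<times> nat \<Rightarrow> 'a" where
  "draws i \<omega> = (\<lambda>k\<in>idx i. (case k of (i, j) \<Rightarrow> pt D i j \<omega>))"
definition draw_dist :: "nat \<Rightarrow> 'a measure" where "draw_dist i = density lebesgue (\<lambda>x. ennreal (dens D i x))"
definition draws_dist :: "nat \<Rightarrow> (nat \<times> nat \<Rightarrow> 'a) measure" where "draws_dist i = PiM (idx i) (\<lambda>_. draw_dist i)"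
definition ratio :: "nat \<Rightarrow> 'a \<Rightarrow> real" where "ratio i x = \<rho> x / piII D i x"

lemma prob_prb: "prob_space (prb D)" using first by (simp add: rejective_first_stage_def)

lemma smp1_meas: "smp1 D \<in> prb D \<rightarrow>\<^sub>M count_space (Pow {..<num_psu D})"
  using first by (simp add: rejective_first_stage_def)

lemma incl_eq: "i < num_psu D \<Longrightarrow> measure (prb D) {\<omega> \<in> space (prb D). i \<in> smp1 D \<omega>} = incl D i"
  using first by (simp add: rejective_first_stage_def)

lemma dens_props:
  assumes "i < num_psu D"
  shows "dens D i \<in> borel_measurable lebesgue" "0 \<le> dens D i x" "x \<notin> psu D i \<Longrightarrow> dens D i x = 0"
    "(\<integral>\<^sup>+x. ennreal (dens D i x) \<partial>lebesgue) = 1" "x \<in> psu D i \<Longrightarrow> 0 < dens D i x"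
  using second assms e_pos[OF assms] dens_ge[OF assms, of x] by (auto simp: second_stage_def)

lemma psu_sets: "i < num_psu D \<Longrightarrow> psu D i \<in> sets lebesgue" "i < num_psu D \<Longrightarrow> psu D i \<subseteq> F"
  using part by (auto simp: psu_partition_def)

lemma idx_props: assumes "i < num_psu D"
  shows "finite (idx i)" "idx i \<noteq> {}" "card (idx i) = size2 D i"
proof -
  have "(i, 0) \<in> idx i" using size2_ge[OF assms] by (auto simp: idx_def)
  then show "idx i \<noteq> {}" by auto
qed (auto simp: idx_def)

lemma prob_draw_dist: assumes "i < num_psu D" shows "prob_space (draw_dist i)"
proof
  have "dens D i \<in> borel_measurable lebesgue" using dens_props[OF assms] by simp
  then show "emeasure (draw_dist i) (space (draw_dist i)) = 1"
    using dens_props(4)[OF assms] unfolding draw_dist_def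
    by (subst emeasure_density) (auto simp: space_density)
qed

lemma sets_draw_dist [simp, measurable_cong]: "sets (draw_dist i) = sets lebesgue" by (simp add: draw_dist_def)

lemma draw_dist_integral:
  assumes i: "i < num_psu D" and h: "h \<in> borel_measurable lebesgue"
  shows "integrable (draw_dist i) h \<longleftrightarrow> integrable lebesgue (\<lambda>x. dens D i x * h x)"
    "integral\<^sup>L (draw_dist i) h = (\<integral>x. dens D i x * h x \<partial>lebesgue)"
  using integrable_density[OF h, of "dens D i"] integral_density[OF h, of "dens D i"] dens_props[OF i]
  unfolding draw_dist_def by auto

lemma ratio_meas: "i < num_psu D \<Longrightarrow> ratio i \<in> borel_measurable lebesgue"
  unfolding ratio_def[abs_def] piII_def using rho_meas dens_props(1)
  by (intro borel_measurable_divide borel_measurable_times) auto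

lemma dens_ratio:
  assumes i: "i < num_psu D"
  shows "dens D i x * ratio i x = indicator (psu D i) x * \<rho> x / real (size2 D i)"
  using dens_props(3,5)[OF i, of x] by (cases "x \<in> psu D i") (auto simp: ratio_def piII_def)

lemma rho_psu_integrable:
  assumes "i < num_psu D"
  shows "set_integrable lebesgue (psu D i) \<rho>" "set_integrable lebesgue (psu D i) (\<lambda>x. \<rho> x ^ 4)"
  using set_integrable_subset[OF rho_int] set_integrable_subset[OF rho4_int] psu_sets[OF assms] by auto

text \<open>One factor of the density cancels in the integrand and its inverse cube remains, which
  \<open>e i\<close> bounds. The fourth power of the number of draws cancels as well.\<close>

lemma dens_ratio4:
  assumes i: "i < num_psu D"
  shows "integrable (draw_dist i) (\<lambda>x. ratio i x ^ 4)"
    "real (size2 D i) ^ 4 * (\<integral>x. ratio i x ^ 4 \<partial>draw_dist i) \<le> (1 / e i) ^ 3 * (LINT x:psu D i|lebesgue. \<rho> x ^ 4)"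
proof -
  define m where "m = real (size2 D i)"
  have m: "0 < m" using size2_ge[OF i] by (simp add: m_def)
  define B where "B x = (1 / e i) ^ 3 / m ^ 4 * (indicator (psu D i) x *\<^sub>R \<rho> x ^ 4)" for x
  have le: "dens D i x * ratio i x ^ 4 \<le> B x" for x
  proof (cases "x \<in> psu D i")
    case True
    define f where "f = dens D i x"
    have f: "0 < f" "e i \<le> f" using True dens_props(5)[OF i] dens_ge[OF i] by (auto simp: f_def)
    have "f * ratio i x ^ 4 = (1 / f ^ 3) * (\<rho> x ^ 4 / m ^ 4)"
      using f m unfolding ratio_def piII_def f_def[symmetric] m_def[symmetric]
      by (simp add: power_divide power_mult_distrib power3_eq_cube power4_eq_xxxx field_simps)
    also have "\<dots> \<le> (1 / e i ^ 3) * (\<rho> x ^ 4 / m ^ 4)"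
      using f e_pos[OF i] by (intro mult_right_mono frac_le power_mono) auto
    also have "\<dots> = B x" using True by (simp add: B_def power_divide)
    finally show ?thesis by (simp add: f_def)
  next
    case False
    then show ?thesis using dens_props(3)[OF i] by (simp add: B_def)
  qed
  have iB: "integrable lebesgue B"
    unfolding B_def[abs_def] using rho_psu_integrable(2)[OF i] unfolding set_integrable_def by (rule integrable_mult_right)
  have m4: "(\<lambda>x. ratio i x ^ 4) \<in> borel_measurable lebesgue" using ratio_meas[OF i] by measurable
  have mm: "(\<lambda>x. dens D i x * ratio i x ^ 4) \<in> borel_measurable lebesgue"
    using m4 dens_props(1)[OF i] by measurable
  have nn: "0 \<le> dens D i x * ratio i x ^ 4" for x using dens_props(2)[OF i] by simp
  have i1: "integrable lebesgue (\<lambda>x. dens D i x * ratio i x ^ 4)"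
    by (rule Bochner_Integration.integrable_bound[OF iB mm]) (use le nn in \<open>auto intro!: AE_I2 order.trans[OF le abs_ge_self] simp: abs_of_nonneg\<close>)
  then show "integrable (draw_dist i) (\<lambda>x. ratio i x ^ 4)" using draw_dist_integral(1)[OF i m4] by simp
  have "(\<integral>x. ratio i x ^ 4 \<partial>draw_dist i) \<le> integral\<^sup>L lebesgue B"
    unfolding draw_dist_integral(2)[OF i m4] by (intro integral_mono i1 iB le)
  also have "\<dots> = (1 / e i) ^ 3 / m ^ 4 * (LINT x:psu D i|lebesgue. \<rho> x ^ 4)"
    unfolding B_def[abs_def] set_lebesgue_integral_def by (rule integral_mult_right_zero)
  finally have "m ^ 4 * (\<integral>x. ratio i x ^ 4 \<partial>draw_dist i) \<le> m ^ 4 * ((1 / e i) ^ 3 / m ^ 4 * (LINT x:psu D i|lebesgue. \<rho> x ^ 4))"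
    by (intro mult_left_mono) auto
  then show "real (size2 D i) ^ 4 * (\<integral>x. ratio i x ^ 4 \<partial>draw_dist i) \<le> (1 / e i) ^ 3 * (LINT x:psu D i|lebesgue. \<rho> x ^ 4)"
    using m by (simp add: m_def)
qed

lemma ratio_mean:
  assumes i: "i < num_psu D"
  shows "integral\<^sup>L (draw_dist i) (ratio i) = tau_psu \<rho> D i / real (size2 D i)"
  unfolding draw_dist_integral(2)[OF i ratio_meas[OF i]] dens_ratio[OF i] tau_psu_def set_lebesgue_integral_def by simp

definition est :: "nat \<Rightarrow> (nat \<times> nat \<Rightarrow> 'a) \<Rightarrow> real" where "est i = iid_sum (idx i) (ratio i)"
definition vest :: "nat \<Rightarrow> (nat \<times> nat \<Rightarrow> 'a) \<Rightarrow> real" where "vest i = iid_var (idx i) (ratio i)"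
text \<open>Common bound for the fourth moment of a PSU estimate and the second moment of its
  variance estimate.\<close>

definition moment_bound :: "nat \<Rightarrow> real" where
  "moment_bound i = (1 / e i) ^ 3 * (LINT x:psu D i|lebesgue. \<rho> x ^ 4)"

lemma ratio_meas': "i < num_psu D \<Longrightarrow> ratio i \<in> borel_measurable (draw_dist i)"
  using ratio_meas by (simp cong: measurable_cong_sets)

text \<open>On the PSU \<open>piII\<close> is the number of draws times the density, and the
  subtracted constant is the mean of \<open>ratio i\<close>; outside the density vanishes. So the
  integral is the number of draws times the variance of one ratio.\<close>

lemma V_psu_eq:
  assumes i: "i < num_psu D"
  shows "V_psu \<rho> D i = real (size2 D i) * ((\<integral>x. (ratio i x)\<^sup>2 \<partial>draw_dist i) - (integral\<^sup>L (draw_dist i) (ratio i))\<^sup>2)"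
proof -
  define mu where "mu = integral\<^sup>L (draw_dist i) (ratio i)"
  note I = iid_integrable[OF idx_props(1,2)[OF i] prob_draw_dist[OF i] ratio_meas'[OF i] dens_ratio4(1)[OF i]]
  have meas: "(\<lambda>x. (ratio i x - mu)\<^sup>2) \<in> borel_measurable lebesgue" using ratio_meas[OF i] by measurable
  have "(\<integral>x. (ratio i x)\<^sup>2 \<partial>draw_dist i) - mu\<^sup>2 = (\<integral>x. (ratio i x - mu)\<^sup>2 \<partial>draw_dist i)"
    using prob_space.variance_eq[OF prob_draw_dist[OF i] I(2,1)] by (simp add: mu_def)
  also have "\<dots> = (\<integral>x. dens D i x * (ratio i x - mu)\<^sup>2 \<partial>lebesgue)" by (rule draw_dist_integral(2)[OF i meas])
  finally have 1: "real (size2 D i) * ((\<integral>x. (ratio i x)\<^sup>2 \<partial>draw_dist i) - mu\<^sup>2) =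
      (\<integral>x. real (size2 D i) * (dens D i x * (ratio i x - mu)\<^sup>2) \<partial>lebesgue)" by simp
  have "(indicator (psu D i) x :: real) *\<^sub>R (piII D i x * (\<rho> x / piII D i x - tau_psu \<rho> D i / real (size2 D i))\<^sup>2) =
      real (size2 D i) * (dens D i x * (ratio i x - mu)\<^sup>2)" for x
    using dens_props(3)[OF i, of x] ratio_mean[OF i] by (cases "x \<in> psu D i") (auto simp: ratio_def piII_def mu_def)
  then show ?thesis unfolding V_psu_def set_lebesgue_integral_def 1[unfolded mu_def[symmetric], symmetric] mu_def[symmetric]
    by (simp add: 1)
qed

lemma est_moments:
  assumes i: "i < num_psu D"
  shows "integrable (draws_dist i) (\<lambda>x. est i x ^ 4)" "(\<integral>x. est i x ^ 4 \<partial>draws_dist i) \<le> moment_bound i"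
    "integral\<^sup>L (draws_dist i) (est i) = tau_psu \<rho> D i"
    "(\<integral>x. (est i x - tau_psu \<rho> D i)\<^sup>2 \<partial>draws_dist i) = V_psu \<rho> D i"
    "integrable (draws_dist i) (\<lambda>x. (vest i x)\<^sup>2)" "(\<integral>x. (vest i x)\<^sup>2 \<partial>draws_dist i) \<le> moment_bound i"
    "integral\<^sup>L (draws_dist i) (vest i) = V_psu \<rho> D i"
    "est i \<in> borel_measurable (draw_space i)" "vest i \<in> borel_measurable (draw_space i)"
proof -
  note A = idx_props(1,2)[OF i] prob_draw_dist[OF i] ratio_meas'[OF i] dens_ratio4(1)[OF i]
  note c = idx_props(3)[OF i]
  have c2: "2 \<le> card (idx i)" using size2_ge[OF i] c by simp
  have m0: "real (size2 D i) \<noteq> 0" using size2_ge[OF i] by simp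
  have mean: "real (size2 D i) * integral\<^sup>L (draw_dist i) (ratio i) = tau_psu \<rho> D i"
    using ratio_mean[OF i] m0 by simp
  show "integrable (draws_dist i) (\<lambda>x. est i x ^ 4)"
    unfolding est_def draws_dist_def by (rule iid_sum_power4(1)[OF A])
  show "(\<integral>x. est i x ^ 4 \<partial>draws_dist i) \<le> moment_bound i"
    using iid_sum_power4(2)[OF A] dens_ratio4(2)[OF i] unfolding est_def draws_dist_def moment_bound_def c by linarith
  show "integral\<^sup>L (draws_dist i) (est i) = tau_psu \<rho> D i"
    using iid_sum_mean[OF A] unfolding est_def draws_dist_def c mean .
  show "(\<integral>x. (est i x - tau_psu \<rho> D i)\<^sup>2 \<partial>draws_dist i) = V_psu \<rho> D i"
    using iid_sum_var(2)[OF A] V_psu_eq[OF i] unfolding est_def draws_dist_def c mean by simp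
  show "integrable (draws_dist i) (\<lambda>x. (vest i x)\<^sup>2)"
    unfolding vest_def draws_dist_def by (rule iid_var_sq(1)[OF A c2])
  show "(\<integral>x. (vest i x)\<^sup>2 \<partial>draws_dist i) \<le> moment_bound i"
    using iid_var_sq(2)[OF A c2] dens_ratio4(2)[OF i] unfolding vest_def draws_dist_def moment_bound_def c by linarith
  show "integral\<^sup>L (draws_dist i) (vest i) = V_psu \<rho> D i"
    using iid_var_mean[OF A c2] V_psu_eq[OF i] unfolding vest_def draws_dist_def c by simp
  have s: "sets (PiM (idx i) (\<lambda>_. draw_dist i)) = sets (draw_space i)"
    unfolding draw_space_def by (intro sets_PiM_cong) auto
  show "est i \<in> borel_measurable (draw_space i)" "vest i \<in> borel_measurable (draw_space i)"
    using iid_measurable[OF A] s unfolding est_def vest_def by (simp_all cong: measurable_cong_sets)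
qed

lemma sum_idx: "(\<Sum>k\<in>idx i. h (draws i \<omega> k)) = (\<Sum>j<size2 D i. h (pt D i j \<omega>))"
proof -
  have "(\<Sum>k\<in>idx i. h (draws i \<omega> k)) = (\<Sum>j<size2 D i. h (draws i \<omega> (i, j)))"
    by (rule sum.reindex_bij_witness[of _ "\<lambda>j. (i, j)" snd]) (auto simp: idx_def)
  also have "\<dots> = (\<Sum>j<size2 D i. h (pt D i j \<omega>))"
    by (intro sum.cong) (auto simp: draws_def idx_def)
  finally show ?thesis .
qed

lemma est_draws: "est i (draws i \<omega>) = tau_psu_hat \<rho> D i \<omega>"
  unfolding est_def iid_sum_def sum_idx by (simp add: tau_psu_hat_def ratio_def)

lemma vest_draws: "i < num_psu D \<Longrightarrow> vest i (draws i \<omega>) = V_psu_hat \<rho> D i \<omega>"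
  unfolding vest_def iid_var_def sum_idx[of "\<lambda>x. (ratio i x - _)\<^sup>2"] est_def[symmetric] est_draws
  by (simp add: V_psu_hat_def ratio_def idx_props)

sublocale two_stage "prb D" "{..<num_psu D}" "smp1 D" draw_space draws draws_dist
proof -
  interpret prob_space "prb D" by (rule prob_prb)
  let ?ev = "\<lambda>s. {\<omega> \<in> space (prb D). smp1 D \<omega> = s}"
  have c: "prob_space.indep_vars (given_smp1 D s) (\<lambda>_. lebesgue) (\<lambda>(i, j). pt D i j) (SIGMA i:s. {..<size2 D i})"
    "\<And>i j. i \<in> s \<Longrightarrow> j < size2 D i \<Longrightarrow> distributed (given_smp1 D s) lebesgue (pt D i j) (\<lambda>x. ennreal (dens D i x))"
    if "0 < prob (?ev s)" for s
    using second that unfolding second_stage_def by auto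
  have sub: "s \<subseteq> {..<num_psu D}" if "0 < prob (?ev s)" for s
  proof -
    have "?ev s \<noteq> {}" using that by (metis less_irrefl measure_empty)
    then show ?thesis using measurable_space[OF smp1_meas] by auto
  qed
  \<comment> \<open>\<open>second_stage\<close> gives measurability only under a conditional
    measure. Conditioning keeps the sigma-algebra, and a unit with positive inclusion probability
    belongs to some sample of positive probability.\<close>
  have ptm: "pt D i j \<in> prb D \<rightarrow>\<^sub>M lebesgue" if "i < num_psu D" "j < size2 D i" for i j
  proof -
    have "0 < prob {\<omega> \<in> space (prb D). i \<in> smp1 D \<omega>}" using incl_eq incl_pos that by simp
    then have pos: "0 < (\<Sum>s\<in>Pow {..<num_psu D}. of_bool (i \<in> s) * prob (?ev s))"
      unfolding prob_finite_valued[OF finite_lessThan smp1_meas, of "\<lambda>s. i \<in> s"] .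
    have "\<exists>s. i \<in> s \<and> 0 < prob (?ev s)"
    proof (rule ccontr)
      assume "\<not> ?thesis"
      then have "prob (?ev s) = 0" if "i \<in> s" for s using that by (auto simp: zero_less_measure_iff)
      then have "(\<Sum>s\<in>Pow {..<num_psu D}. of_bool (i \<in> s) * prob (?ev s)) = 0"
        by (intro sum.neutral) auto
      then show False using pos by simp
    qed
    then obtain s where "i \<in> s" "0 < prob (?ev s)" by blast
    then have "pt D i j \<in> given_smp1 D s \<rightarrow>\<^sub>M lebesgue" using c(2) that(2) by (auto simp: distributed_def)
    then show ?thesis by (simp add: given_smp1_def cong: measurable_cong_sets)
  qed
  show "two_stage (prb D) {..<num_psu D} (smp1 D) draw_space draws draws_dist"
  proof (intro two_stage.intro two_stage_axioms.intro)
    show "prob_space (prb D)" by (rule prob_prb)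
    show "finite {..<num_psu D}" by simp
    show "smp1 D \<in> prb D \<rightarrow>\<^sub>M count_space (Pow {..<num_psu D})" by (rule smp1_meas)
    show "draws i \<in> prb D \<rightarrow>\<^sub>M draw_space i" if "i \<in> {..<num_psu D}" for i
      unfolding draws_def[abs_def] draw_space_def using that
      by (intro measurable_restrict) (auto simp: idx_def intro!: ptm)
    show "prob_space (draws_dist i)" if "i \<in> {..<num_psu D}" for i
      unfolding draws_dist_def using that by (intro prob_space_PiM prob_draw_dist) auto
    show "sets (draws_dist i) = sets (draw_space i)" for i
      unfolding draws_dist_def draw_space_def by (intro sets_PiM_cong) auto
    fix s assume s: "0 < prob (?ev s)"
    have g: "uniform_measure (prb D) (?ev s) = given_smp1 D s" by (simp add: given_smp1_def)
    interpret C: prob_space "given_smp1 D s"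
      unfolding g[symmetric] using s by (intro prob_space_uniform_measure) (auto simp: emeasure_eq_measure)
    \<comment> \<open>Different PSUs correspond to disjoint blocks of pairs, so joint independence
      of all single draws yields independence of the vectors.\<close>
    have "C.indep_vars (\<lambda>i. PiM (idx i) (\<lambda>_. lebesgue))
        (\<lambda>i \<omega>. restrict (\<lambda>k. (case k of (i, j) \<Rightarrow> pt D i j) \<omega>) (idx i)) s"
      by (rule C.indep_vars_restrict[OF c(1)[OF s]]) (auto simp: idx_def disjoint_family_on_def)
    moreover have "(\<lambda>i \<omega>. restrict (\<lambda>k. (case k of (i, j) \<Rightarrow> pt D i j) \<omega>) (idx i)) = draws"
      by (auto simp: fun_eq_iff draws_def restrict_def)
    ultimately show "prob_space.indep_vars (uniform_measure (prb D) (?ev s)) draw_space draws s"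
      unfolding g by (simp add: draw_space_def[abs_def])
    show "distr (uniform_measure (prb D) (?ev s)) (draw_space i) (draws i) = draws_dist i" if i: "i \<in> s" for i
    proof -
      have iN: "i < num_psu D" using sub[OF s] i by auto
      have ind: "C.indep_vars (\<lambda>_. lebesgue) (\<lambda>(i, j). pt D i j) (idx i)"
        by (rule C.indep_vars_subset[OF c(1)[OF s]]) (use i in \<open>auto simp: idx_def\<close>)
      have rv: "(case k of (i, j) \<Rightarrow> pt D i j) \<in> given_smp1 D s \<rightarrow>\<^sub>M lebesgue" if "k \<in> idx i" for k
        using that c(2)[OF s i] by (auto simp: idx_def distributed_def)
      have "distr (given_smp1 D s) (PiM (idx i) (\<lambda>_. lebesgue)) (\<lambda>\<omega>. \<lambda>k\<in>idx i. (case k of (i, j) \<Rightarrow> pt D i j) \<omega>) =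
          PiM (idx i) (\<lambda>k. distr (given_smp1 D s) lebesgue (case k of (i, j) \<Rightarrow> pt D i j))"
        using C.indep_vars_iff_distr_eq_PiM'[OF idx_props(2)[OF iN] rv] ind by (simp add: case_prod_beta')
      also have "\<dots> = draws_dist i"
        unfolding draws_dist_def using c(2)[OF s i]
        by (intro PiM_cong) (auto simp: idx_def draw_dist_def distributed_def)
      finally show ?thesis unfolding g draw_space_def
        by (simp add: draws_def[abs_def] restrict_def case_prod_beta' cong: if_cong)
    qed
  qed
qed

end

text \<open>If the weights sum to zero they all vanish, and both sides are zero whatever the
  quotients evaluate to.\<close>

lemma weighted_square_deviation:
  fixes w b :: "'i \<Rightarrow> real"
  assumes "finite s" "\<And>i. i \<in> s \<Longrightarrow> 0 \<le> w i"
  shows "(\<Sum>i\<in>s. w i * (b i - 1 / (\<Sum>i\<in>s. w i) * (\<Sum>i\<in>s. w i * b i))\<^sup>2) =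
    (\<Sum>i\<in>s. w i * (b i)\<^sup>2) - (\<Sum>i\<in>s. w i * b i)\<^sup>2 / (\<Sum>i\<in>s. w i)"
proof (cases "(\<Sum>i\<in>s. w i) = 0")
  case True
  then have "w i = 0" if "i \<in> s" for i using assms that by (simp add: sum_nonneg_eq_0_iff)
  then show ?thesis using True by simp
next
  case False
  define d m R where "d = (\<Sum>i\<in>s. w i)" and "m = (\<Sum>i\<in>s. w i * b i)" and "R = 1 / d * m"
  have "w i * (b i - R)\<^sup>2 = w i * (b i)\<^sup>2 - 2 * R * (w i * b i) + R\<^sup>2 * w i" for i
    by (simp add: power2_eq_square algebra_simps)
  then have "(\<Sum>i\<in>s. w i * (b i - R)\<^sup>2) = (\<Sum>i\<in>s. w i * (b i)\<^sup>2) - 2 * R * m + R\<^sup>2 * d"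
    by (simp only: sum.distrib sum_subtractf sum_distrib_left[symmetric] d_def m_def)
  also have "\<dots> = (\<Sum>i\<in>s. w i * (b i)\<^sup>2) - m\<^sup>2 / d"
    using False by (simp add: R_def d_def[symmetric] power2_eq_square field_simps)
  finally show ?thesis unfolding R_def d_def m_def .
qed

lemma square_integrable_add:
  fixes f h :: "'a \<Rightarrow> real"
  assumes "f \<in> borel_measurable M" "h \<in> borel_measurable M"
    "integrable M (\<lambda>x. (f x)\<^sup>2)" "integrable M (\<lambda>x. (h x)\<^sup>2)"
  shows "integrable M (\<lambda>x. (f x + h x)\<^sup>2)"
    "(\<integral>x. (f x + h x)\<^sup>2 \<partial>M) \<le> 2 * (\<integral>x. (f x)\<^sup>2 \<partial>M) + 2 * (\<integral>x. (h x)\<^sup>2 \<partial>M)"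
proof -
  have le: "(x + y)\<^sup>2 \<le> 2 * x\<^sup>2 + 2 * y\<^sup>2" for x y :: real
    using diff_power2_le[of x "- y"] by simp
  have iB: "integrable M (\<lambda>x. 2 * (f x)\<^sup>2 + 2 * (h x)\<^sup>2)" using assms by auto
  show i: "integrable M (\<lambda>x. (f x + h x)\<^sup>2)"
    by (rule Bochner_Integration.integrable_bound[OF iB]) (use assms le in \<open>auto intro!: AE_I2\<close>)
  have "(\<integral>x. (f x + h x)\<^sup>2 \<partial>M) \<le> (\<integral>x. 2 * (f x)\<^sup>2 + 2 * (h x)\<^sup>2 \<partial>M)"
    by (intro integral_mono i iB le)
  then show "(\<integral>x. (f x + h x)\<^sup>2 \<partial>M) \<le> 2 * (\<integral>x. (f x)\<^sup>2 \<partial>M) + 2 * (\<integral>x. (h x)\<^sup>2 \<partial>M)"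
    using assms by simp
qed

section \<open>Measurability and integrability of the survey estimators\<close>

context survey_model begin

lemma smp1_subset: "\<omega> \<in> space (prb D) \<Longrightarrow> smp1 D \<omega> \<subseteq> {..<num_psu D}" by (rule S_subset)

lemma incl_le_1: "i < num_psu D \<Longrightarrow> incl D i \<le> 1"
  using incl_eq[of i] by (metis prob_le_1)

lemma V_psu_nonneg: "i < num_psu D \<Longrightarrow> 0 \<le> V_psu \<rho> D i"
  using est_moments(4)[of i, symmetric] by (simp add: Bochner_Integration.integral_nonneg)

lemma moment_bound_nonneg: assumes "i < num_psu D" shows "0 \<le> moment_bound i"
proof -
  have "0 \<le> (\<integral>x. (vest i x)\<^sup>2 \<partial>draws_dist i)" by (intro Bochner_Integration.integral_nonneg) simp
  then show ?thesis using est_moments(6)[OF assms] by linarith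
qed

lemma V_HAJ_A_eq:
  assumes "\<omega> \<in> space (prb D)"
  shows "V_HAJ_A \<rho> D \<omega> = (\<Sum>i\<in>smp1 D \<omega>. (1 - incl D i) * (est i (draws i \<omega>) / incl D i)\<^sup>2) -
    (\<Sum>i\<in>smp1 D \<omega>. (1 - incl D i) * (est i (draws i \<omega>) / incl D i))\<^sup>2 / (\<Sum>i\<in>smp1 D \<omega>. 1 - incl D i)"
proof -
  have s: "smp1 D \<omega> \<subseteq> {..<num_psu D}" using smp1_subset[OF assms] .
  have "0 \<le> 1 - incl D i" if "i \<in> smp1 D \<omega>" for i using incl_le_1 s that by auto
  moreover have "finite (smp1 D \<omega>)" using s finite_subset by blast
  ultimately show ?thesis unfolding V_HAJ_A_def R_hat_def d_hat_def est_draws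
    by (intro weighted_square_deviation)
qed

text \<open>The estimator lies between zero and its raw sum of squares, a sample total with
  square-integrable summands. Integrability is wanted for every survey of the sequence, including
  those with a small sample to which the moment estimates do not apply.\<close>

lemma V_HAJ_A_square_integrable:
  "V_HAJ_A \<rho> D \<in> borel_measurable (prb D)"
  "integrable (prb D) (\<lambda>\<omega>. (V_HAJ_A \<rho> D \<omega>)\<^sup>2)"
proof -
  define F1 where "F1 s \<omega> = (\<Sum>i\<in>s. (1 - incl D i) * (est i (draws i \<omega>) / incl D i)\<^sup>2) -
    (\<Sum>i\<in>s. (1 - incl D i) * (est i (draws i \<omega>) / incl D i))\<^sup>2 / (\<Sum>i\<in>s. 1 - incl D i)" for s \<omega>
  have em: "(\<lambda>\<omega>. est i (draws i \<omega>)) \<in> borel_measurable (prb D)" if "i < num_psu D" for i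
    using measurable_compose[OF X_meas est_moments(8)] that by auto
  have "(\<lambda>\<omega>. F1 (smp1 D \<omega>) \<omega>) \<in> borel_measurable (prb D)"
  proof (rule sample_measurable)
    fix s assume s: "s \<subseteq> {..<num_psu D}"
    show "F1 s \<in> borel_measurable (prb D)" unfolding F1_def[abs_def]
      using em s by (intro borel_measurable_diff borel_measurable_divide borel_measurable_power borel_measurable_sum borel_measurable_times) auto
  qed
  then show m: "V_HAJ_A \<rho> D \<in> borel_measurable (prb D)"
    by (rule measurable_cong[THEN iffD1, rotated]) (simp add: V_HAJ_A_eq F1_def)
  define h where "h i x = (1 - incl D i) * (est i x / incl D i)\<^sup>2" for i x
  have i: "integrable (prb D) (\<lambda>\<omega>. ((\<Sum>i\<in>smp1 D \<omega>. h i (draws i \<omega>)) - 0)\<^sup>2)"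
  proof (rule sample_sum_square_integrable)
    show "h i \<in> borel_measurable (draw_space i)" if "i \<in> {..<num_psu D}" for i
      unfolding h_def[abs_def] using est_moments(8)[of i] that
      by (intro borel_measurable_times borel_measurable_power borel_measurable_divide) auto
    show "integrable (draws_dist i) (\<lambda>x. (h i x)\<^sup>2)" if "i \<in> {..<num_psu D}" for i
    proof -
      have "(\<lambda>x. (h i x)\<^sup>2) = (\<lambda>x. (1 - incl D i)\<^sup>2 / incl D i ^ 4 * est i x ^ 4)"
        by (simp add: h_def power_mult_distrib power_divide fun_eq_iff flip: power_mult)
      then show ?thesis using est_moments(1)[of i] that by simp
    qed
  qed
  show "integrable (prb D) (\<lambda>\<omega>. (V_HAJ_A \<rho> D \<omega>)\<^sup>2)"
  proof (rule Bochner_Integration.integrable_bound[OF i])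
    show "(\<lambda>\<omega>. (V_HAJ_A \<rho> D \<omega>)\<^sup>2) \<in> borel_measurable (prb D)" using m by measurable
    show "AE \<omega> in prb D. norm ((V_HAJ_A \<rho> D \<omega>)\<^sup>2) \<le> norm (((\<Sum>i\<in>smp1 D \<omega>. h i (draws i \<omega>)) - 0)\<^sup>2)"
    proof (rule AE_I2)
      fix \<omega> assume w: "\<omega> \<in> space (prb D)"
      have n: "0 \<le> 1 - incl D i" if "i \<in> smp1 D \<omega>" for i using incl_le_1 smp1_subset[OF w] that by auto
      have "V_HAJ_A \<rho> D \<omega> \<le> (\<Sum>i\<in>smp1 D \<omega>. h i (draws i \<omega>))"
        unfolding V_HAJ_A_eq[OF w] h_def using n by (simp add: sum_nonneg)
      moreover have "0 \<le> V_HAJ_A \<rho> D \<omega>" unfolding V_HAJ_A_def using n by (intro sum_nonneg) auto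
      ultimately show "norm ((V_HAJ_A \<rho> D \<omega>)\<^sup>2) \<le> norm (((\<Sum>i\<in>smp1 D \<omega>. h i (draws i \<omega>)) - 0)\<^sup>2)"
        by (simp add: power_mono)
    qed
  qed
qed

lemma vest_square_integrable:
  assumes "i \<in> {..<num_psu D}"
  shows "(\<lambda>x. vest i x / incl D i) \<in> borel_measurable (draw_space i)"
    "integrable (draws_dist i) (\<lambda>x. (vest i x / incl D i)\<^sup>2)"
  using est_moments(5,9)[of i] assms by (auto simp: power_divide)

lemma V_B_hat_eq: "\<omega> \<in> space (prb D) \<Longrightarrow> V_B_hat \<rho> D \<omega> = (\<Sum>i\<in>smp1 D \<omega>. vest i (draws i \<omega>) / incl D i)"
  unfolding V_B_hat_def using smp1_subset[of \<omega>] by (intro sum.cong) (auto simp: vest_draws)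

lemma V_B_hat_square_integrable:
  "V_B_hat \<rho> D \<in> borel_measurable (prb D)"
  "integrable (prb D) (\<lambda>\<omega>. (V_B_hat \<rho> D \<omega> - c)\<^sup>2)"
proof -
  note v = vest_square_integrable
  have "(\<lambda>\<omega>. \<Sum>i\<in>smp1 D \<omega>. vest i (draws i \<omega>) / incl D i) \<in> borel_measurable (prb D)"
    by (rule sample_measurable[where F = "\<lambda>s \<omega>. \<Sum>i\<in>s. vest i (draws i \<omega>) / incl D i"])
      (rule sample_sum_measurable[where h = "\<lambda>i x. vest i x / incl D i", OF v(1)])
  then show "V_B_hat \<rho> D \<in> borel_measurable (prb D)"
    by (rule measurable_cong[THEN iffD1, rotated]) (simp add: V_B_hat_eq)
  have "integrable (prb D) (\<lambda>\<omega>. ((\<Sum>i\<in>smp1 D \<omega>. vest i (draws i \<omega>) / incl D i) - c)\<^sup>2)"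
    by (rule sample_sum_square_integrable[where h = "\<lambda>i x. vest i x / incl D i", OF v])
  then show "integrable (prb D) (\<lambda>\<omega>. (V_B_hat \<rho> D \<omega> - c)\<^sup>2)"
    by (rule Bochner_Integration.integrable_cong[THEN iffD1, rotated 2]) (simp_all add: V_B_hat_eq)
qed

lemma tau_sum: "(LINT x:F|lebesgue. \<rho> x) = (\<Sum>i<num_psu D. tau_psu \<rho> D i)"
  and tau4_sum: "(LINT x:F|lebesgue. \<rho> x ^ 4) = (\<Sum>i<num_psu D. LINT x:psu D i|lebesgue. \<rho> x ^ 4)"
proof -
  have F: "F = (\<Union>i\<in>{..<num_psu D}. psu D i)" and dj: "disjoint_family_on (psu D) {..<num_psu D}"
    using part by (auto simp: psu_partition_def)
  have sum: "(LINT x:F|lebesgue. f x) = (\<Sum>i<num_psu D. LINT x:psu D i|lebesgue. f x)"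
    if f: "\<And>i. i < num_psu D \<Longrightarrow> set_integrable lebesgue (psu D i) f" for f :: "'a \<Rightarrow> real"
    by (subst F, rule set_integral_finite_Union) (use f dj psu_sets in auto)
  show "(LINT x:F|lebesgue. \<rho> x) = (\<Sum>i<num_psu D. tau_psu \<rho> D i)"
    unfolding tau_psu_def by (intro sum rho_psu_integrable)
  show "(LINT x:F|lebesgue. \<rho> x ^ 4) = (\<Sum>i<num_psu D. LINT x:psu D i|lebesgue. \<rho> x ^ 4)"
    by (intro sum rho_psu_integrable)
qed

lemma tau_hat_measurable: "tau_hat \<rho> D \<in> borel_measurable (prb D)"
proof -
  have "(\<lambda>\<omega>. \<Sum>i\<in>smp1 D \<omega>. est i (draws i \<omega>) / incl D i) \<in> borel_measurable (prb D)"
    by (rule sample_measurable[where F = "\<lambda>s \<omega>. \<Sum>i\<in>s. est i (draws i \<omega>) / incl D i"])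
      (rule sample_sum_measurable[where h = "\<lambda>i x. est i x / incl D i"], use est_moments(8) in auto)
  then show ?thesis by (simp add: tau_hat_def[abs_def] est_draws)
qed

end

text \<open>\<open>p\<close> and \<open>q\<close> belong to one survey, while \<open>g\<close> and
  \<open>C0\<close> will be shared by the whole sequence. The left-hand side of \<open>C0\<close>
  dominates the \<open>incl\<close>-weighted fourth moments of the expanded PSU estimates. Its order
  is the inverse cube of the sample size: PSU areas are of order \<open>1 / N\<close>, inclusion
  probabilities of order \<open>n / N\<close>, and \<open>N\<close> cancels.\<close>

locale survey_rejective = survey_model F \<rho> D e
  for F :: "'a::euclidean_space set" and \<rho> :: "'a \<Rightarrow> real" and D :: "('a, 'w) survey" and e :: "nat \<Rightarrow> real" +
  fixes p :: "nat \<Rightarrow> real" and q g C0 :: real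
  assumes rej: "rejective {..<num_psu D} (size1 D) p (\<lambda>s. measure (prb D) {\<omega> \<in> space (prb D). smp1 D \<omega> = s})"
    and size: "\<And>s. s \<subseteq> {..<num_psu D} \<Longrightarrow> card s \<noteq> size1 D \<Longrightarrow> measure (prb D) {\<omega> \<in> space (prb D). smp1 D \<omega> = s} = 0"
    and g_positive: "0 < g" and q_positive: "0 < q"
    and incl_ge: "\<And>i. i < num_psu D \<Longrightarrow> q \<le> incl D i"
    and gap_incl: "g * real (size1 D) \<le> q * (real (num_psu D) - real (size1 D))"
    and C0: "(\<Sum>i<num_psu D. incl D i * (moment_bound i / incl D i ^ 4)) \<le> C0 / real (size1 D) ^ 3"
begin

sublocale R: two_stage_rejective "prb D" "{..<num_psu D}" "smp1 D" draw_space draws draws_dist "size1 D" p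
  by (intro two_stage_rejective.intro two_stage_rejective_axioms.intro rej size) unfold_locales

lemma ex_prob:
  "R.ex (\<lambda>s. of_bool (Q s)) = measure (prb D) {\<omega> \<in> space (prb D). Q (smp1 D \<omega>)}"
  unfolding prob_finite_valued[OF finite_lessThan smp1_meas, of Q] R.sum_Pow_eq_ex[symmetric] event_def
  by (simp add: mult.commute)

lemma inc_eq: "i < num_psu D \<Longrightarrow> R.inc i = incl D i"
  unfolding R.inc_def ex_prob using incl_eq by simp

lemma inc2_eq: "R.inc2 i j = incl2 D i j"
  unfolding R.inc2_def incl2_def using ex_prob[of "\<lambda>s. i \<in> s \<and> j \<in> s"] by (simp add: of_bool_conj)

lemma mean_eq: "R.mean f = (\<Sum>i<num_psu D. incl D i * f i)"
  unfolding R.mean_def by (intro sum.cong) (auto simp: inc_eq)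

lemma covar_eq: "R.covar (\<lambda>i. c * (tau_psu \<rho> D i / incl D i)) (\<lambda>i. c * (tau_psu \<rho> D i / incl D i)) = c\<^sup>2 * V1 \<rho> D"
  unfolding R.covar_def V1_def sum_distrib_left
  by (intro sum.cong refl) (simp add: R.cov_def Delta1_def inc_eq inc2_eq power2_eq_square)

lemma V_B_bound:
  "expectation (\<lambda>\<omega>. (V_B_hat \<rho> D \<omega> - V3 \<rho> D)\<^sup>2) \<le> 3 * C0 / real (size1 D) ^ 3"
proof -
  note v = vest_square_integrable
  have V3: "R.mean (\<lambda>i. \<integral>x. vest i x / incl D i \<partial>draws_dist i) = V3 \<rho> D"
    unfolding mean_eq V3_def using est_moments(7) incl_pos by (intro sum.cong) (auto simp: less_imp_neq[symmetric])
  have "expectation (\<lambda>\<omega>. (V_B_hat \<rho> D \<omega> - V3 \<rho> D)\<^sup>2) =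
      expectation (\<lambda>\<omega>. ((\<Sum>i\<in>smp1 D \<omega>. vest i (draws i \<omega>) / incl D i) - V3 \<rho> D)\<^sup>2)"
    by (intro Bochner_Integration.integral_cong) (simp_all add: V_B_hat_eq)
  also have "\<dots> \<le> 3 * R.mean (\<lambda>i. \<integral>x. (vest i x / incl D i)\<^sup>2 \<partial>draws_dist i)"
    using R.sample_sum_deviation[where h = "\<lambda>i x. vest i x / incl D i", OF v] unfolding V3 .
  also have "R.mean (\<lambda>i. \<integral>x. (vest i x / incl D i)\<^sup>2 \<partial>draws_dist i) \<le>
      (\<Sum>i<num_psu D. incl D i * (moment_bound i / incl D i ^ 4))"
    unfolding mean_eq
  proof (intro sum_mono mult_left_mono)
    fix i assume "i \<in> {..<num_psu D}"
    then have i: "i < num_psu D" by simp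
    note pos = incl_pos[OF i]
    show "0 \<le> incl D i" using pos by simp
    have "(\<integral>x. (vest i x / incl D i)\<^sup>2 \<partial>draws_dist i) = (\<integral>x. (vest i x)\<^sup>2 \<partial>draws_dist i) / (incl D i)\<^sup>2"
      by (simp add: power_divide)
    also have "\<dots> \<le> moment_bound i / (incl D i)\<^sup>2" using est_moments(6)[OF i] by (intro divide_right_mono) auto
    \<comment> \<open>Two more divisions by a probability only enlarge the term, and in this form
      \<open>C0\<close> covers it.\<close>
    also have "\<dots> \<le> moment_bound i / incl D i ^ 4"
      using pos incl_le_1[OF i] moment_bound_nonneg[OF i] by (intro divide_left_mono power_decreasing) auto
    finally show "(\<integral>x. (vest i x / incl D i)\<^sup>2 \<partial>draws_dist i) \<le> moment_bound i / incl D i ^ 4" .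
  qed
  also note C0
  finally show ?thesis by simp
qed

text \<open>The scale \<open>c\<close> is free. The last assumption says that it is at most of order
  \<open>sqrt n\<close>, and turns the fourth moment total \<open>C0 / n ^ 3\<close> into the
  \<open>k^2 / n\<close> of an array.\<close>

lemma array:
  assumes "4 \<le> g * real (size1 D)" "1 \<le> k" and c: "c ^ 4 * C0 \<le> k\<^sup>2 * (real (size1 D))\<^sup>2"
  shows "two_stage_array (prb D) {..<num_psu D} (smp1 D) draw_space draws draws_dist (size1 D) p q g
    (\<lambda>i x. c * (est i x / incl D i)) k"
proof (intro two_stage_array.intro rejective_regular.intro rejective_regular_axioms.intro two_stage_array_axioms.intro)
  show "two_stage_rejective (prb D) {..<num_psu D} (smp1 D) draw_space draws draws_dist (size1 D) p"
    by unfold_locales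
  show "rejective {..<num_psu D} (size1 D) p (\<lambda>s. measure (prb D) {\<omega> \<in> space (prb D). smp1 D \<omega> = s})" by (rule rej)
  show "0 < g" "0 < q" by (rule g_positive, rule q_positive)
  show "q \<le> R.inc i" if "i \<in> {..<num_psu D}" for i using that incl_ge inc_eq by simp
  show "g * real (size1 D) \<le> q * (real (card {..<num_psu D}) - real (size1 D))" using gap_incl by simp
  show "4 \<le> g * real (size1 D)" "1 \<le> k" by fact+
  show "(\<lambda>x. c * (est i x / incl D i)) \<in> borel_measurable (draw_space i)" if "i \<in> {..<num_psu D}" for i
    using that est_moments(8)[of i] by (intro borel_measurable_times borel_measurable_divide) auto
  have eq: "(c * (est i x / incl D i)) ^ 4 = c ^ 4 / incl D i ^ 4 * est i x ^ 4" for i x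
    by (simp add: power_mult_distrib power_divide)
  show "integrable (draws_dist i) (\<lambda>x. (c * (est i x / incl D i)) ^ 4)" if "i \<in> {..<num_psu D}" for i
    unfolding eq using that est_moments(1)[of i] by simp
  show "R.mean (\<lambda>i. \<integral>x. (c * (est i x / incl D i)) ^ 4 \<partial>draws_dist i) \<le> k\<^sup>2 / real (size1 D)"
  proof -
    have "R.mean (\<lambda>i. \<integral>x. (c * (est i x / incl D i)) ^ 4 \<partial>draws_dist i) \<le>
        (\<Sum>i<num_psu D. c ^ 4 * (incl D i * (moment_bound i / incl D i ^ 4)))"
      unfolding mean_eq eq
    proof (intro sum_mono)
      fix i assume "i \<in> {..<num_psu D}"
      then have i: "i < num_psu D" by simp
      have "(\<integral>x. c ^ 4 / incl D i ^ 4 * est i x ^ 4 \<partial>draws_dist i) \<le> c ^ 4 / incl D i ^ 4 * moment_bound i"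
        unfolding integral_mult_right_zero using est_moments(2)[OF i] by (intro mult_left_mono) auto
      then have "incl D i * (\<integral>x. c ^ 4 / incl D i ^ 4 * est i x ^ 4 \<partial>draws_dist i) \<le> incl D i * (c ^ 4 / incl D i ^ 4 * moment_bound i)"
        using incl_pos[OF i] by (intro mult_left_mono) auto
      then show "incl D i * (\<integral>x. c ^ 4 / incl D i ^ 4 * est i x ^ 4 \<partial>draws_dist i) \<le> c ^ 4 * (incl D i * (moment_bound i / incl D i ^ 4))"
        by (simp add: mult_ac)
    qed
    also have "\<dots> \<le> c ^ 4 * (C0 / real (size1 D) ^ 3)"
      unfolding sum_distrib_left[symmetric] using C0 by (intro mult_left_mono) auto
    also have "\<dots> \<le> k\<^sup>2 * (real (size1 D))\<^sup>2 / real (size1 D) ^ 3"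
      using c by (simp add: divide_right_mono)
    also have "\<dots> = k\<^sup>2 / real (size1 D)" using size1_pos by (simp add: power2_eq_square power3_eq_cube)
    finally show ?thesis .
  qed
qed

lemma scaled_moments:
  assumes i: "i < num_psu D"
  shows "(\<integral>x. c * (est i x / incl D i) \<partial>draws_dist i) = c * (tau_psu \<rho> D i / incl D i)"
    "(\<integral>x. (c * (est i x / incl D i) - c * (tau_psu \<rho> D i / incl D i))\<^sup>2 \<partial>draws_dist i) = c\<^sup>2 * (V_psu \<rho> D i / (incl D i)\<^sup>2)"
proof -
  show "(\<integral>x. c * (est i x / incl D i) \<partial>draws_dist i) = c * (tau_psu \<rho> D i / incl D i)"
    using est_moments(3)[OF i] by simp
  have "(c * (est i x / incl D i) - c * (tau_psu \<rho> D i / incl D i))\<^sup>2 = (c / incl D i)\<^sup>2 * (est i x - tau_psu \<rho> D i)\<^sup>2" for x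
    by (simp add: power_mult_distrib[symmetric] algebra_simps diff_divide_distrib)
  then show "(\<integral>x. (c * (est i x / incl D i) - c * (tau_psu \<rho> D i / incl D i))\<^sup>2 \<partial>draws_dist i) = c\<^sup>2 * (V_psu \<rho> D i / (incl D i)\<^sup>2)"
    using est_moments(4)[OF i] by (simp add: power_divide)
qed

text \<open>After scaling, the estimator is \<open>hajek_hat\<close>, but \<open>V1\<close> is the
  exact variance of the first stage, whereas \<open>hajek_limit\<close> contains Hajek's
  approximation of it. The random error is therefore accompanied by the deterministic error
  \<open>d\<close>, of order \<open>1 / sqrt n\<close>.\<close>

lemma V_HAJ_A_bound:
  assumes large: "4 \<le> g * real (size1 D)" and k: "1 \<le> k" and c: "c ^ 4 * C0 \<le> k\<^sup>2 * (real (size1 D))\<^sup>2"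
  shows "expectation (\<lambda>\<omega>. (c\<^sup>2 * (V_HAJ_A \<rho> D \<omega> - V1 \<rho> D - V2 \<rho> D))\<^sup>2) \<le>
    (432 * k\<^sup>2 / g ^ 4 + 20000 * k\<^sup>2 / g ^ 6) / real (size1 D)"
proof -
  interpret T: two_stage_array "prb D" "{..<num_psu D}" "smp1 D" draw_space draws draws_dist "size1 D" p q g
    "\<lambda>i x. c * (est i x / incl D i)" k by (rule array[OF assms])
  have m1: "T.m1 i = c * (tau_psu \<rho> D i / incl D i)" and vr: "T.vr i = c\<^sup>2 * (V_psu \<rho> D i / (incl D i)\<^sup>2)"
    if "i < num_psu D" for i
    unfolding T.vr_def T.m1_def scaled_moments(1)[OF that] scaled_moments(2)[OF that] by simp_all
  have cov: "R.covar T.m1 T.m1 = c\<^sup>2 * V1 \<rho> D"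
    unfolding covar_eq[symmetric] R.covar_def using m1 by (intro sum.cong) auto
  have V2: "(\<Sum>i<num_psu D. T.contrast i * T.vr i) = c\<^sup>2 * V2 \<rho> D"
    unfolding V2_def sum_distrib_left
  proof (intro sum.cong refl)
    fix i assume "i \<in> {..<num_psu D}"
    then have i: "i < num_psu D" by simp
    show "T.contrast i * T.vr i = c\<^sup>2 * ((1 - incl D i) / incl D i * V_psu \<rho> D i)"
      unfolding T.contrast_def inc_eq[OF i] vr[OF i] using incl_pos[OF i] by (simp add: power2_eq_square)
  qed
  have hh: "T.hajek_hat \<omega> = c\<^sup>2 * V_HAJ_A \<rho> D \<omega>" if w: "\<omega> \<in> space (prb D)" for \<omega>
  proof -
    have s: "i < num_psu D" if "i \<in> smp1 D \<omega>" for i using smp1_subset[OF w] that by auto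
    have "T.hajek_hat \<omega> = (\<Sum>i\<in>smp1 D \<omega>. c\<^sup>2 * ((1 - incl D i) * (est i (draws i \<omega>) / incl D i)\<^sup>2)) -
      (\<Sum>i\<in>smp1 D \<omega>. c * ((1 - incl D i) * (est i (draws i \<omega>) / incl D i)))\<^sup>2 / (\<Sum>i\<in>smp1 D \<omega>. 1 - incl D i)"
      unfolding T.hajek_hat_def using s
      by (intro arg_cong2[where f = "(-)"] arg_cong2[where f = "(/)"] arg_cong[where f = "\<lambda>x. x\<^sup>2"] sum.cong)
        (auto simp: inc_eq power_mult_distrib power_divide)
    then show ?thesis
      unfolding V_HAJ_A_eq[OF w] sum_distrib_left[symmetric] by (simp add: power_mult_distrib right_diff_distrib)
  qed
  define d where "d = R.covar T.m1 T.m1 - T.hajek_var T.m1"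
  have d: "d\<^sup>2 \<le> 10000 * k\<^sup>2 / (g ^ 6 * real (size1 D))"
  proof -
    have "\<bar>d\<bar>\<^sup>2 \<le> (100 * k / (g ^ 3 * sqrt (real (size1 D))))\<^sup>2"
      using T.variance_approx unfolding d_def by (intro power_mono) auto
    then show ?thesis by (simp add: power_mult_distrib power_divide flip: power_mult)
  qed
  have eq: "c\<^sup>2 * (V_HAJ_A \<rho> D \<omega> - V1 \<rho> D - V2 \<rho> D) = (T.hajek_hat \<omega> - T.hajek_limit) + (- d)"
    if "\<omega> \<in> space (prb D)" for \<omega>
    unfolding T.hajek_limit_eq d_def cov V2 hh[OF that] by (simp add: algebra_simps)
  have "expectation (\<lambda>\<omega>. (c\<^sup>2 * (V_HAJ_A \<rho> D \<omega> - V1 \<rho> D - V2 \<rho> D))\<^sup>2) =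
      expectation (\<lambda>\<omega>. ((T.hajek_hat \<omega> - T.hajek_limit) + (- d))\<^sup>2)"
    by (intro Bochner_Integration.integral_cong) (simp_all only: eq)
  also have "\<dots> \<le> 2 * expectation (\<lambda>\<omega>. (T.hajek_hat \<omega> - T.hajek_limit)\<^sup>2) + 2 * expectation (\<lambda>\<omega>. (- d)\<^sup>2)"
    using T.hajek_hat_measurable T.hajek_consistency(1) by (intro square_integrable_add(2)) auto
  also have "\<dots> \<le> 2 * (216 * k\<^sup>2 / (g ^ 4 * real (size1 D))) + 2 * (10000 * k\<^sup>2 / (g ^ 6 * real (size1 D)))"
    using T.hajek_consistency(2) d by (simp add: prob_space)
  also have "\<dots> = (432 * k\<^sup>2 / g ^ 4 + 20000 * k\<^sup>2 / g ^ 6) / real (size1 D)"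
    by (simp add: add_divide_distrib)
  finally show ?thesis .
qed

text \<open>Stated for a free scale because the limit law divides by the standard deviation of the
  estimator itself.\<close>

lemma tau_hat_char:
  assumes large: "4 \<le> g * real (size1 D)" and k: "1 \<le> k" and c: "c ^ 4 * C0 \<le> k\<^sup>2 * (real (size1 D))\<^sup>2"
  shows "norm ((CLINT \<omega>|prb D. iexp (t * (c * (tau_hat \<rho> D \<omega> - (LINT x:F|lebesgue. \<rho> x))))) -
      exp (- (c\<^sup>2 * V_tot \<rho> D * t\<^sup>2 / 2))) \<le>
    ((2 * \<bar>t\<bar> ^ 3 + t ^ 4 + t\<^sup>2) * k\<^sup>2 + 100 * k\<^sup>2 / g ^ 3 * \<bar>t\<bar> * (1 + t\<^sup>2)) / sqrt (real (size1 D))"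
proof -
  interpret T: two_stage_array "prb D" "{..<num_psu D}" "smp1 D" draw_space draws draws_dist "size1 D" p q g
    "\<lambda>i x. c * (est i x / incl D i)" k by (rule array[OF assms])
  have m1: "T.m1 i = c * (tau_psu \<rho> D i / incl D i)" and vr: "T.vr i = c\<^sup>2 * (V_psu \<rho> D i / (incl D i)\<^sup>2)"
    if "i < num_psu D" for i
    unfolding T.vr_def T.m1_def scaled_moments(1)[OF that] scaled_moments(2)[OF that] by simp_all
  have cov: "R.covar T.m1 T.m1 = c\<^sup>2 * V1 \<rho> D"
    unfolding covar_eq[symmetric] R.covar_def using m1 by (intro sum.cong) auto
  have mv: "R.mean T.vr = c\<^sup>2 * (V2 \<rho> D + V3 \<rho> D)"
    unfolding V2_def V3_def mean_eq sum.distrib[symmetric] sum_distrib_left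
  proof (intro sum.cong refl)
    fix i assume "i \<in> {..<num_psu D}"
    then have i: "i < num_psu D" by simp
    show "incl D i * T.vr i = c\<^sup>2 * ((1 - incl D i) / incl D i * V_psu \<rho> D i + V_psu \<rho> D i)"
      unfolding vr[OF i] using incl_pos[OF i] by (simp add: power2_eq_square field_simps)
  qed
  have v: "R.covar T.m1 T.m1 + R.mean T.vr = c\<^sup>2 * V_tot \<rho> D"
    unfolding cov mv V_tot_def by (simp add: algebra_simps)
  have mm: "R.mean T.m1 = c * (LINT x:F|lebesgue. \<rho> x)"
    unfolding mean_eq tau_sum sum_distrib_left
    using m1 incl_pos by (intro sum.cong) (auto simp: less_imp_neq[symmetric])
  have s: "(\<Sum>i\<in>smp1 D \<omega>. c * (est i (draws i \<omega>) / incl D i)) - R.mean T.m1 = c * (tau_hat \<rho> D \<omega> - (LINT x:F|lebesgue. \<rho> x))" for \<omega>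
    unfolding mm tau_hat_def est_draws sum_distrib_left[symmetric] by (simp add: right_diff_distrib)
  show ?thesis
    using T.sample_char_approx[of t] unfolding v s by (simp add: add_divide_distrib)
qed

end

context survey_model begin

lemma V_HAJ_measurable: "V_HAJ \<rho> D \<in> borel_measurable (prb D)"
  unfolding V_HAJ_def[abs_def] using V_HAJ_A_square_integrable(1) V_B_hat_square_integrable(1) by simp

lemma scaled_square_integrable:
  "integrable (prb D) (\<lambda>\<omega>. (c * (V_HAJ_A \<rho> D \<omega> - a - b))\<^sup>2)"
  "integrable (prb D) (\<lambda>\<omega>. (c * (V_HAJ \<rho> D \<omega> - v))\<^sup>2)"
proof -
  have 0: "integrable (prb D) (\<lambda>\<omega>. (V_HAJ_A \<rho> D \<omega> + u)\<^sup>2)" for u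
    using square_integrable_add(1)[OF V_HAJ_A_square_integrable(1) _ V_HAJ_A_square_integrable(2), of "\<lambda>_. u"] by simp
  then have "integrable (prb D) (\<lambda>\<omega>. c\<^sup>2 * (V_HAJ_A \<rho> D \<omega> + - (a + b))\<^sup>2)" by (intro integrable_mult_right)
  then show "integrable (prb D) (\<lambda>\<omega>. (c * (V_HAJ_A \<rho> D \<omega> - a - b))\<^sup>2)"
    by (simp only: power_mult_distrib diff_diff_eq add_uminus_conv_diff)
  have "integrable (prb D) (\<lambda>\<omega>. (V_HAJ_A \<rho> D \<omega> + (V_B_hat \<rho> D \<omega> - v))\<^sup>2)"
    using square_integrable_add(1)[OF V_HAJ_A_square_integrable(1) _ V_HAJ_A_square_integrable(2), of "\<lambda>\<omega>. V_B_hat \<rho> D \<omega> - v"]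
      V_B_hat_square_integrable by simp
  then have "integrable (prb D) (\<lambda>\<omega>. c\<^sup>2 * (V_HAJ_A \<rho> D \<omega> + (V_B_hat \<rho> D \<omega> - v))\<^sup>2)" by (intro integrable_mult_right)
  then show "integrable (prb D) (\<lambda>\<omega>. (c * (V_HAJ \<rho> D \<omega> - v))\<^sup>2)"
    by (simp add: power_mult_distrib V_HAJ_def add_diff_eq)
qed

lemma V1_le_V_tot: "V1 \<rho> D \<le> V_tot \<rho> D"
proof -
  have "0 \<le> V2 \<rho> D" unfolding V2_def using V_psu_nonneg incl_le_1 incl_pos
    by (intro sum_nonneg mult_nonneg_nonneg divide_nonneg_pos) auto
  moreover have "0 \<le> V3 \<rho> D" unfolding V3_def using V_psu_nonneg by (intro sum_nonneg) auto
  ultimately show ?thesis by (simp add: V_tot_def)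
qed

end

context survey_rejective begin

lemma V_HAJ_bound:
  assumes large: "4 \<le> g * real (size1 D)" and k: "1 \<le> k" and c: "c ^ 4 * C0 \<le> k\<^sup>2 * (real (size1 D))\<^sup>2"
  shows "expectation (\<lambda>\<omega>. (c\<^sup>2 * (V_HAJ \<rho> D \<omega> - V_tot \<rho> D))\<^sup>2) \<le>
    (2 * (432 * k\<^sup>2 / g ^ 4 + 20000 * k\<^sup>2 / g ^ 6) + 6 * k\<^sup>2) / real (size1 D)"
proof -
  let ?A = "\<lambda>\<omega>. c\<^sup>2 * (V_HAJ_A \<rho> D \<omega> - V1 \<rho> D - V2 \<rho> D)" and ?B = "\<lambda>\<omega>. c\<^sup>2 * (V_B_hat \<rho> D \<omega> - V3 \<rho> D)"
  have "expectation (\<lambda>\<omega>. (c\<^sup>2 * (V_HAJ \<rho> D \<omega> - V_tot \<rho> D))\<^sup>2) = expectation (\<lambda>\<omega>. (?A \<omega> + ?B \<omega>)\<^sup>2)"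
    by (simp add: V_HAJ_def V_tot_def algebra_simps)
  also have "\<dots> \<le> 2 * expectation (\<lambda>\<omega>. (?A \<omega>)\<^sup>2) + 2 * expectation (\<lambda>\<omega>. (?B \<omega>)\<^sup>2)"
  proof (rule square_integrable_add(2))
    show "integrable (prb D) (\<lambda>\<omega>. (?A \<omega>)\<^sup>2)" by (rule scaled_square_integrable)
    have "integrable (prb D) (\<lambda>\<omega>. (c\<^sup>2)\<^sup>2 * (V_B_hat \<rho> D \<omega> - V3 \<rho> D)\<^sup>2)"
      by (intro integrable_mult_right V_B_hat_square_integrable)
    then show "integrable (prb D) (\<lambda>\<omega>. (?B \<omega>)\<^sup>2)" by (simp only: power_mult_distrib)
  qed (use V_HAJ_A_square_integrable(1) V_B_hat_square_integrable(1) in auto)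
  also have "expectation (\<lambda>\<omega>. (?B \<omega>)\<^sup>2) \<le> 3 * (k\<^sup>2 / real (size1 D))"
  proof -
    have "expectation (\<lambda>\<omega>. (?B \<omega>)\<^sup>2) = c ^ 4 * expectation (\<lambda>\<omega>. (V_B_hat \<rho> D \<omega> - V3 \<rho> D)\<^sup>2)"
      unfolding power_mult_distrib integral_mult_right_zero power2_power2 ..
    also have "\<dots> \<le> c ^ 4 * (3 * C0 / real (size1 D) ^ 3)" by (intro mult_left_mono V_B_bound) simp
    also have "\<dots> = 3 * ((c ^ 4 * C0) / real (size1 D) ^ 3)" by simp
    also have "\<dots> \<le> 3 * ((k\<^sup>2 * (real (size1 D))\<^sup>2) / real (size1 D) ^ 3)"
      using c by (intro mult_left_mono divide_right_mono) auto
    also have "\<dots> = 3 * (k\<^sup>2 / real (size1 D))" using size1_pos by (simp add: power2_eq_square power3_eq_cube)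
    finally show ?thesis .
  qed
  also note V_HAJ_A_bound[OF assms]
  finally show ?thesis by (simp add: add_divide_distrib)
qed

end

section \<open>The limit theorem\<close>

lemma mean_square_null_cong:
  assumes "\<And>k \<omega>. \<omega> \<in> space (P k) \<Longrightarrow> X k \<omega> = Y k \<omega>"
  shows "mean_square_null P X \<longleftrightarrow> mean_square_null P Y"
  unfolding mean_square_null_def using assms
  by (intro arg_cong2[where f = "(\<and>)"] all_cong1 arg_cong[where f = "\<lambda>f. f \<longlonglongrightarrow> 0"] ext
      Bochner_Integration.integrable_cong Bochner_Integration.integral_cong) auto

lemma tendsto_in_prob_cong:
  assumes "\<And>k \<omega>. \<omega> \<in> space (P k) \<Longrightarrow> X k \<omega> = Y k \<omega>"
  shows "tendsto_in_prob P X c \<longleftrightarrow> tendsto_in_prob P Y c"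
proof -
  have "X k \<in> borel_measurable (P k) \<longleftrightarrow> Y k \<in> borel_measurable (P k)" for k
    using assms by (intro measurable_cong)
  moreover have "{\<omega> \<in> space (P k). \<bar>X k \<omega> - c\<bar> > \<epsilon>} = {\<omega> \<in> space (P k). \<bar>Y k \<omega> - c\<bar> > \<epsilon>}" for k \<epsilon>
    using assms by auto
  ultimately show ?thesis by (simp add: tendsto_in_prob_def)
qed

lemma mean_square_nullI:
  assumes int: "\<And>k. integrable (P k) (\<lambda>\<omega>. (X k \<omega>)\<^sup>2)"
    and bound: "eventually (\<lambda>k. (\<integral>\<omega>. (X k \<omega>)\<^sup>2 \<partial>P k) \<le> K / real (n k)) sequentially"
    and n: "filterlim n at_top sequentially"
  shows "mean_square_null P X"
  unfolding mean_square_null_def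
proof (intro conjI allI int)
  have "filterlim (\<lambda>k. real (n k)) at_infinity sequentially"
    using filterlim_compose[OF filterlim_real_sequentially n] filterlim_at_top_imp_at_infinity by blast
  then have lim: "(\<lambda>k. K / real (n k)) \<longlonglongrightarrow> 0" by (rule tendsto_divide_0[OF tendsto_const])
  show "(\<lambda>k. \<integral>\<omega>. (X k \<omega>)\<^sup>2 \<partial>P k) \<longlonglongrightarrow> 0"
    by (rule tendsto_sandwich[OF _ bound tendsto_const lim]) (auto intro!: always_eventually Bochner_Integration.integral_nonneg)
qed

text \<open>The limit statements for a function measurable on the whole space. What remains to be
  done is to choose constants valid along the whole sequence and to insert the bounds for single
  surveys.\<close>

lemma proposition6_measurable:
  fixes F :: "'a::euclidean_space set" and \<rho> :: "'a \<Rightarrow> real" and D :: "nat \<Rightarrow> ('a, 'w) survey"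
  assumes rho_meas: "\<rho> \<in> borel_measurable lebesgue"
    and F_pos: "0 < measure lebesgue F" and rho_int: "set_integrable lebesgue F \<rho>"
    and partition: "\<And>k. psu_partition F (D k)"
    and first_stage: "\<And>k. rejective_first_stage (D k)"
    and second_stage: "\<And>k. second_stage (D k)"
    and size1_lim: "filterlim (\<lambda>k. size1 (D k)) at_top sequentially"
    and FS1: "FS1 D" and SS1: "SS1 F D" and VA1: "VA1 F \<rho>"
  shows
    "mean_square_null (\<lambda>k. prb (D k))
       (\<lambda>k \<omega>. real (size1 (D k)) / (measure lebesgue F)\<^sup>2 *
                (V_HAJ_A \<rho> (D k) \<omega> - V1 \<rho> (D k) - V2 \<rho> (D k)))" (is ?thesis1)
    and "VA2 F \<rho> D \<Longrightarrow>
        weak_conv_m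
          (\<lambda>k. distr (prb (D k)) borel
                 (\<lambda>\<omega>. (tau_hat \<rho> (D k) \<omega> - (LINT x:F|lebesgue. \<rho> x)) / sqrt (V_tot \<rho> (D k))))
          std_normal_distribution" (is "_ \<Longrightarrow> ?thesis2")
    and "mean_square_null (\<lambda>k. prb (D k))
          (\<lambda>k \<omega>. real (size1 (D k)) / (measure lebesgue F)\<^sup>2 *
                   (V_HAJ \<rho> (D k) \<omega> - V_tot \<rho> (D k)))" (is ?thesis3)
    and "VA2 F \<rho> D \<Longrightarrow> tendsto_in_prob (\<lambda>k. prb (D k))
          (\<lambda>k \<omega>. V_HAJ \<rho> (D k) \<omega> / V_tot \<rho> (D k)) 1" (is "_ \<Longrightarrow> ?thesis4")
proof -
  define A I4 where "A = measure lebesgue F" and "I4 = (LINT x:F|lebesgue. \<rho> x ^ 4)"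
  define N n where "N k = num_psu (D k)" and "n k = size1 (D k)" for k
  have A: "0 < A" using F_pos by (simp add: A_def)
  have I4: "0 \<le> I4" unfolding I4_def set_lebesgue_integral_def by (intro Bochner_Integration.integral_nonneg) simp
  obtain f0 c1 where c1: "f0 < 1" "0 < c1" "\<And>k. real (n k) / real (N k) \<le> f0"
      "\<And>k i. i < N k \<Longrightarrow> c1 \<le> real (N k) / real (n k) * incl (D k) i"
    using FS1 unfolding FS1_def N_def n_def by blast
  obtain ph Ph c2 where c2: "0 < ph" "0 < c2"
      "\<And>k i. i < N k \<Longrightarrow> ph * A / real (N k) \<le> measure lebesgue (psu (D k) i)"
      "\<And>k i. i < N k \<Longrightarrow> measure lebesgue (psu (D k) i) \<le> Ph * A / real (N k)"
      "\<And>k i x. i < N k \<Longrightarrow> x \<in> psu (D k) i \<Longrightarrow> c2 / measure lebesgue (psu (D k) i) \<le> dens (D k) i x"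
      "\<And>k i. i < N k \<Longrightarrow> 2 \<le> size2 (D k) i"
    using SS1 unfolding SS1_def N_def A_def by blast
  have N0: "0 < N k" for k
  proof (rule ccontr)
    assume "\<not> 0 < N k"
    then have "F = {}" using partition[of k] by (auto simp: psu_partition_def N_def)
    then show False using F_pos by simp
  qed
  \<comment> \<open>A quotient with denominator 0 evaluates to 0, so an empty first-stage sample
    would contradict the positive lower bound \<open>c1\<close>.\<close>
  have n0: "0 < n k" for k
    using c1(4)[OF N0, of k] c1(2) by (cases "n k = 0") auto
  have nN: "n k < N k" for k
  proof -
    have "real (n k) / real (N k) < 1" using c1(1) c1(3)[of k] by linarith
    then show ?thesis using N0[of k] by (simp add: divide_less_eq)
  qed
  \<comment> \<open>\<open>q\<close> is the lower bound that (FS1) gives for the inclusion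
    probabilities, and the factor \<open>1 - f0\<close> of \<open>g\<close> comes from
    \<open>N - n\<close> being at least \<open>(1 - f0) * N\<close>.\<close>
  define q g where "q = (\<lambda>k. c1 * real (n k) / real (N k))" and "g = c1 * (1 - f0)"
  have q: "0 < q k" for k using c1(2) N0 n0 by (simp add: q_def)
  have g: "0 < g" using c1 by (simp add: g_def)
  have incl_q: "q k \<le> incl (D k) i" if "i < N k" for k i
    using c1(4)[OF that] N0[of k] n0[of k] by (simp add: q_def field_simps)
  have gap: "g * real (n k) \<le> q k * (real (N k) - real (n k))" for k
  proof -
    have "g * real (n k) = c1 * real (n k) * (1 - f0)" by (simp add: g_def)
    also have "\<dots> \<le> c1 * real (n k) * (1 - real (n k) / real (N k))" using c1 by (intro mult_left_mono) auto
    also have "\<dots> = q k * (real (N k) - real (n k))" using N0[of k] by (simp add: q_def field_simps)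
    finally show ?thesis .
  qed
  define e where "e k i = c2 / measure lebesgue (psu (D k) i)" for k i
  have Ai: "0 < measure lebesgue (psu (D k) i)" if "i < N k" for k i
  proof -
    have "0 < ph * A / real (N k)" using c2(1) A N0 by simp
    then show ?thesis using c2(3)[OF that] by linarith
  qed
  have rho4: "set_integrable lebesgue F (\<lambda>x. \<rho> x ^ 4)" using VA1 by (simp add: VA1_def)
  have SM: "survey_model F \<rho> (D k) (e k)" for k
  proof
    show "\<rho> \<in> borel_measurable lebesgue" "set_integrable lebesgue F \<rho>" "set_integrable lebesgue F (\<lambda>x. \<rho> x ^ 4)"
      "psu_partition F (D k)" "rejective_first_stage (D k)" "second_stage (D k)" by fact+
    show "0 < size1 (D k)" "size1 (D k) < num_psu (D k)" using n0[of k] nN[of k] by (simp_all add: n_def N_def)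
    show "0 < incl (D k) i" if "i < num_psu (D k)" for i
      using incl_q[of i k] q[of k] that by (simp add: N_def)
    show "2 \<le> size2 (D k) i" "0 < e k i" if "i < num_psu (D k)" for i
      using c2(6)[of i k] c2(2) Ai[of i k] that by (simp_all add: N_def e_def)
    show "e k i \<le> dens (D k) i x" if "i < num_psu (D k)" "x \<in> psu (D k) i" for i x
      using c2(5)[of i k x] that by (simp add: N_def e_def)
  qed
  \<comment> \<open>A PSU has measure at most \<open>Ph * A / N\<close> and inclusion probability at
    least \<open>c1 * n / N\<close>, so \<open>N\<close> cancels in the quotient. The cube collects
    three inverse powers of the density bound and of the inclusion probability.\<close>
  define C0 where "C0 = (Ph * A / (c1 * c2)) ^ 3 * I4"
  have Ph: "0 < Ph * A"
  proof -
    have "0 < Ph * A / real (N 0)" using Ai[OF N0, of 0] c2(4)[OF N0, of 0] by linarith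
    then show ?thesis using N0[of 0] by (simp add: zero_less_divide_iff)
  qed
  have C0_nonneg: "0 \<le> C0" unfolding C0_def using Ph c1(2) c2(2) I4 by (intro mult_nonneg_nonneg) auto
  have "\<exists>p. survey_rejective F \<rho> (D k) (e k) p (q k) g C0" for k
  proof -
    interpret S: survey_model F \<rho> "D k" "e k" by (rule SM)
    obtain p where p: "rejective {..<num_psu (D k)} (size1 (D k)) p (\<lambda>s. measure (prb (D k)) {\<omega> \<in> space (prb (D k)). smp1 (D k) \<omega> = s})"
      "\<And>s. s \<subseteq> {..<num_psu (D k)} \<Longrightarrow> card s \<noteq> size1 (D k) \<Longrightarrow> measure (prb (D k)) {\<omega> \<in> space (prb (D k)). smp1 (D k) \<omega> = s} = 0"
      using rejective_first_stage_tilted[OF first_stage[of k] S.size1_pos S.size1_less S.incl_pos] by blast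
    have "survey_rejective F \<rho> (D k) (e k) p (q k) g C0"
    proof (intro survey_rejective.intro survey_rejective_axioms.intro SM p g q)
      show "q k \<le> incl (D k) i" if "i < num_psu (D k)" for i using incl_q that by (simp add: N_def)
      show "g * real (size1 (D k)) \<le> q k * (real (num_psu (D k)) - real (size1 (D k)))"
        using gap[of k] by (simp add: n_def N_def)
      have "(\<Sum>i<num_psu (D k). incl (D k) i * (S.moment_bound i / incl (D k) i ^ 4)) \<le>
          (\<Sum>i<num_psu (D k). (Ph * A / (c1 * c2 * real (n k))) ^ 3 * (LINT x:psu (D k) i|lebesgue. \<rho> x ^ 4))"
      proof (intro sum_mono)
        fix i assume "i \<in> {..<num_psu (D k)}"
        then have i: "i < N k" "i < num_psu (D k)" by (simp_all add: N_def)
        define J where "J = (LINT x:psu (D k) i|lebesgue. \<rho> x ^ 4)"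
        have J: "0 \<le> J" unfolding J_def set_lebesgue_integral_def by (intro Bochner_Integration.integral_nonneg) simp
        note pos = S.incl_pos[OF i(2)]
        have "incl (D k) i * (S.moment_bound i / incl (D k) i ^ 4) = (measure lebesgue (psu (D k) i) / (c2 * incl (D k) i)) ^ 3 * J"
          using pos by (simp add: S.moment_bound_def e_def J_def power_divide power_mult_distrib power3_eq_cube power4_eq_xxxx mult_ac)
        also have "\<dots> \<le> ((Ph * A / real (N k)) / (c2 * q k)) ^ 3 * J"
          using c2(2) c2(4)[OF i(1)] Ai[OF i(1)] incl_q[OF i(1)] q[of k] J pos
          by (intro mult_right_mono power_mono frac_le mult_left_mono) auto
        also have "(Ph * A / real (N k)) / (c2 * q k) = Ph * A / (c1 * c2 * real (n k))"
          using N0[of k] by (simp add: q_def)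
        finally show "incl (D k) i * (S.moment_bound i / incl (D k) i ^ 4) \<le> (Ph * A / (c1 * c2 * real (n k))) ^ 3 * J" .
      qed
      also have "\<dots> = (Ph * A / (c1 * c2 * real (n k))) ^ 3 * I4"
        unfolding sum_distrib_left[symmetric] S.tau4_sum[symmetric] I4_def ..
      also have "\<dots> = C0 / real (size1 (D k)) ^ 3"
        by (simp add: C0_def n_def power_divide power_mult_distrib)
      finally show "(\<Sum>i<num_psu (D k). incl (D k) i * (S.moment_bound i / incl (D k) i ^ 4)) \<le> C0 / real (size1 (D k)) ^ 3" .
    qed
    then show ?thesis by blast
  qed
  then obtain p where SR: "\<And>k. survey_rejective F \<rho> (D k) (e k) (p k) (q k) g C0" by metis
  have large: "eventually (\<lambda>k. 4 \<le> g * real (n k)) sequentially"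
  proof -
    have "filterlim (\<lambda>k. real (n k)) at_top sequentially"
      using filterlim_compose[OF filterlim_real_sequentially size1_lim] by (simp add: n_def)
    then have "eventually (\<lambda>k. 4 / g \<le> real (n k)) sequentially" by (simp add: filterlim_at_top)
    then show ?thesis by eventually_elim (use g in \<open>simp add: field_simps\<close>)
  qed
  \<comment> \<open>The square of \<open>c k\<close> is the factor in front of the variance error in
    the statement, and \<open>kk\<close> is the smallest admissible array constant for this
    scale.\<close>
  define kk where "kk = max 1 (sqrt C0 / A\<^sup>2)"
  define c where "c k = sqrt (real (n k)) / A" for k
  have c_sq: "(c k)\<^sup>2 = real (size1 (D k)) / (measure lebesgue F)\<^sup>2" for k
    by (simp add: c_def A_def n_def power_divide)
  have c4: "c k ^ 4 * C0 \<le> kk\<^sup>2 * (real (size1 (D k)))\<^sup>2" for k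
  proof -
    have "c k ^ 4 * C0 = ((c k)\<^sup>2)\<^sup>2 * C0" by (simp only: power2_power2)
    also have "\<dots> = (sqrt C0 / A\<^sup>2)\<^sup>2 * (real (size1 (D k)))\<^sup>2"
      unfolding c_sq using C0_nonneg by (simp add: A_def power_divide mult_ac)
    also have "\<dots> \<le> kk\<^sup>2 * (real (size1 (D k)))\<^sup>2"
      using C0_nonneg by (intro mult_right_mono power_mono) (auto simp: kk_def)
    finally show ?thesis .
  qed
  have kk: "1 \<le> kk" by (simp add: kk_def)
  show ?thesis1
  proof (rule mean_square_nullI[OF _ _ size1_lim])
    fix k
    show "integrable (prb (D k)) (\<lambda>\<omega>. (real (size1 (D k)) / (measure lebesgue F)\<^sup>2 * (V_HAJ_A \<rho> (D k) \<omega> - V1 \<rho> (D k) - V2 \<rho> (D k)))\<^sup>2)"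
      by (rule survey_model.scaled_square_integrable(1)[OF SM])
  next
    show "eventually (\<lambda>k. (\<integral>\<omega>. (real (size1 (D k)) / (measure lebesgue F)\<^sup>2 * (V_HAJ_A \<rho> (D k) \<omega> - V1 \<rho> (D k) - V2 \<rho> (D k)))\<^sup>2 \<partial>prb (D k))
      \<le> (432 * kk\<^sup>2 / g ^ 4 + 20000 * kk\<^sup>2 / g ^ 6) / real (size1 (D k))) sequentially"
      using large
    proof eventually_elim
      case (elim k)
      then have "4 \<le> g * real (size1 (D k))" by (simp add: n_def)
      from survey_rejective.V_HAJ_A_bound[OF SR this kk c4] show ?case unfolding c_sq .
    qed
  qed
  show th3: ?thesis3
  proof (rule mean_square_nullI[OF _ _ size1_lim])
    fix k
    show "integrable (prb (D k)) (\<lambda>\<omega>. (real (size1 (D k)) / (measure lebesgue F)\<^sup>2 * (V_HAJ \<rho> (D k) \<omega> - V_tot \<rho> (D k)))\<^sup>2)"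
      by (rule survey_model.scaled_square_integrable(2)[OF SM])
  next
    show "eventually (\<lambda>k. (\<integral>\<omega>. (real (size1 (D k)) / (measure lebesgue F)\<^sup>2 * (V_HAJ \<rho> (D k) \<omega> - V_tot \<rho> (D k)))\<^sup>2 \<partial>prb (D k))
      \<le> (2 * (432 * kk\<^sup>2 / g ^ 4 + 20000 * kk\<^sup>2 / g ^ 6) + 6 * kk\<^sup>2) / real (size1 (D k))) sequentially"
      using large
    proof eventually_elim
      case (elim k)
      then have "4 \<le> g * real (size1 (D k))" by (simp add: n_def)
      from survey_rejective.V_HAJ_bound[OF SR this kk c4] show ?case unfolding c_sq .
    qed
  qed
  assume VA2: "VA2 F \<rho> D"
  obtain m where m: "0 < m" "\<And>k. m \<le> real (n k) * V1 \<rho> (D k) / A\<^sup>2"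
    using VA2 unfolding VA2_def A_def n_def by blast
  define V where "V k = V_tot \<rho> (D k)" for k
  have V_ge: "m * A\<^sup>2 / real (n k) \<le> V k" for k
  proof -
    have "m * A\<^sup>2 / real (n k) \<le> V1 \<rho> (D k)" using m(2)[of k] A n0[of k] by (simp add: field_simps)
    then show ?thesis using survey_model.V1_le_V_tot[OF SM, of k] by (simp add: V_def)
  qed
  have V_pos: "0 < V k" for k
  proof -
    have "0 < m * A\<^sup>2 / real (n k)" using m(1) A n0 by simp
    then show ?thesis using V_ge[of k] by linarith
  qed
  show ?thesis2
  proof (rule levy_continuity)
    fix k
    interpret S: survey_model F \<rho> "D k" "e k" by (rule SM)
    show "real_distribution (distr (prb (D k)) borel (\<lambda>\<omega>. (tau_hat \<rho> (D k) \<omega> - (LINT x:F|lebesgue. \<rho> x)) / sqrt (V_tot \<rho> (D k))))"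
      using S.tau_hat_measurable by (intro S.real_distribution_distr) simp
  next
    show "real_distribution std_normal_distribution" by (rule real_dist_normal_dist)
  next
    fix t :: real
    \<comment> \<open>Here the scale is \<open>1 / sqrt V\<close>, which \<open>V_ge\<close> bounds
      by \<open>sqrt n / (A * sqrt m)\<close>; this is how \<open>m\<close> enters the
      constant.\<close>
    define k2 where "k2 = max 1 (sqrt C0 / (m * A\<^sup>2))"
    define B where "B = (2 * \<bar>t\<bar> ^ 3 + t ^ 4 + t\<^sup>2) * k2\<^sup>2 + 100 * k2\<^sup>2 / g ^ 3 * \<bar>t\<bar> * (1 + t\<^sup>2)"
    let ?ch = "\<lambda>k. char (distr (prb (D k)) borel (\<lambda>\<omega>. (tau_hat \<rho> (D k) \<omega> - (LINT x:F|lebesgue. \<rho> x)) / sqrt (V_tot \<rho> (D k)))) t"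
    have "eventually (\<lambda>k. norm (?ch k - char std_normal_distribution t) \<le> B / sqrt (real (n k))) sequentially"
      using large
    proof eventually_elim
      case (elim k)
      interpret S: survey_model F \<rho> "D k" "e k" by (rule SM)
      define r where "r = 1 / sqrt (V k)"
      have r2: "r\<^sup>2 * V k = 1" using V_pos[of k] by (simp add: r_def power_divide)
      have r4: "r ^ 4 * C0 \<le> k2\<^sup>2 * (real (size1 (D k)))\<^sup>2"
      proof -
        have "r\<^sup>2 = 1 / V k" using V_pos[of k] by (simp add: r_def power_divide)
        also have "\<dots> \<le> 1 / (m * A\<^sup>2 / real (n k))" using V_ge m(1) A n0 by (intro frac_le) auto
        also have "\<dots> = real (n k) / (m * A\<^sup>2)" by simp
        finally have "(r\<^sup>2)\<^sup>2 * C0 \<le> (real (n k) / (m * A\<^sup>2))\<^sup>2 * C0" using C0_nonneg by (intro mult_right_mono power_mono) auto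
        also have "\<dots> = (sqrt C0 / (m * A\<^sup>2))\<^sup>2 * (real (n k))\<^sup>2" using C0_nonneg by (simp add: power_divide)
        also have "\<dots> \<le> k2\<^sup>2 * (real (n k))\<^sup>2"
          using C0_nonneg m A by (intro mult_right_mono power_mono) (auto simp: k2_def)
        finally show ?thesis by (simp add: n_def power2_power2)
      qed
      have "?ch k = (CLINT \<omega>|prb (D k). iexp (t * (r * (tau_hat \<rho> (D k) \<omega> - (LINT x:F|lebesgue. \<rho> x)))))"
        unfolding char_def using S.tau_hat_measurable by (subst integral_distr) (auto simp: r_def V_def)
      moreover have "char std_normal_distribution t = exp (- (r\<^sup>2 * V_tot \<rho> (D k) * t\<^sup>2 / 2))"
        using r2 by (simp add: char_std_normal_distribution V_def)
      moreover have "4 \<le> g * real (size1 (D k))" using elim by (simp add: n_def)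
      note survey_rejective.tau_hat_char[OF SR this _ r4, of t]
      ultimately show ?case by (simp add: B_def n_def k2_def)
    qed
    moreover have "(\<lambda>k. B / sqrt (real (n k))) \<longlonglongrightarrow> 0"
    proof -
      have "filterlim (\<lambda>k. sqrt (real (n k))) at_top sequentially"
        unfolding n_def by (intro filterlim_compose[OF sqrt_at_top] filterlim_compose[OF filterlim_real_sequentially size1_lim])
      then show ?thesis by (intro tendsto_divide_0[OF tendsto_const] filterlim_at_top_imp_at_infinity)
    qed
    ultimately have "(\<lambda>k. ?ch k - char std_normal_distribution t) \<longlonglongrightarrow> 0" by (rule Lim_null_comparison)
    then show "?ch \<longlonglongrightarrow> char std_normal_distribution t" by (rule LIM_zero_cancel)
  qed
  show ?thesis4
    unfolding tendsto_in_prob_def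
  proof (intro conjI allI impI)
    fix k
    show "(\<lambda>\<omega>. V_HAJ \<rho> (D k) \<omega> / V_tot \<rho> (D k)) \<in> borel_measurable (prb (D k))"
      using survey_model.V_HAJ_measurable[OF SM] by simp
  next
    fix \<epsilon> :: real assume eps: "0 < \<epsilon>"
    let ?X = "\<lambda>k \<omega>. real (size1 (D k)) / (measure lebesgue F)\<^sup>2 * (V_HAJ \<rho> (D k) \<omega> - V_tot \<rho> (D k))"
    \<comment> \<open>Chebyshev's inequality. The lower bound of \<open>V k\<close> turns a relative
      error above \<open>\<epsilon>\<close> into a scaled error of at least
      \<open>\<epsilon> * m\<close>, to which the mean-square statement applies.\<close>
    have le: "measure (prb (D k)) {\<omega> \<in> space (prb (D k)). \<bar>V_HAJ \<rho> (D k) \<omega> / V_tot \<rho> (D k) - 1\<bar> > \<epsilon>} \<le>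
        (\<integral>\<omega>. (?X k \<omega>)\<^sup>2 \<partial>prb (D k)) / (\<epsilon> * m)\<^sup>2" for k
    proof -
      interpret S: survey_model F \<rho> "D k" "e k" by (rule SM)
      have int: "integrable (prb (D k)) (\<lambda>\<omega>. (?X k \<omega>)\<^sup>2)" by (rule S.scaled_square_integrable(2))
      have imp: "(\<epsilon> * m)\<^sup>2 \<le> (?X k \<omega>)\<^sup>2" if "\<bar>V_HAJ \<rho> (D k) \<omega> / V_tot \<rho> (D k) - 1\<bar> > \<epsilon>" for \<omega>
      proof -
        have "V_HAJ \<rho> (D k) \<omega> / V k - 1 = (V_HAJ \<rho> (D k) \<omega> - V k) / V k" using V_pos[of k] by (simp add: diff_divide_distrib)
        then have "\<epsilon> < \<bar>V_HAJ \<rho> (D k) \<omega> - V k\<bar> / V k" using that V_pos[of k] by (simp add: V_def)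
        then have 1: "\<epsilon> * V k < \<bar>V_HAJ \<rho> (D k) \<omega> - V k\<bar>" using V_pos[of k] by (simp add: pos_less_divide_eq)
        have "\<epsilon> * (m * A\<^sup>2 / real (n k)) \<le> \<epsilon> * V k" using V_ge eps by (intro mult_left_mono) auto
        then have 2: "\<epsilon> * (m * A\<^sup>2 / real (n k)) \<le> \<bar>V_HAJ \<rho> (D k) \<omega> - V k\<bar>" using 1 by linarith
        have "\<epsilon> * m = real (n k) / A\<^sup>2 * (\<epsilon> * (m * A\<^sup>2 / real (n k)))" using n0[of k] A by simp
        also have "\<dots> \<le> real (n k) / A\<^sup>2 * \<bar>V_HAJ \<rho> (D k) \<omega> - V k\<bar>" using 2 by (intro mult_left_mono) auto
        also have "\<dots> = \<bar>?X k \<omega>\<bar>" by (simp add: n_def A_def V_def abs_mult)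
        finally have "(\<epsilon> * m)\<^sup>2 \<le> \<bar>?X k \<omega>\<bar>\<^sup>2" using eps m(1) by (intro power_mono) auto
        then show ?thesis by (simp only: power2_abs)
      qed
      have "measure (prb (D k)) {\<omega> \<in> space (prb (D k)). \<bar>V_HAJ \<rho> (D k) \<omega> / V_tot \<rho> (D k) - 1\<bar> > \<epsilon>} \<le>
          measure (prb (D k)) {\<omega> \<in> space (prb (D k)). (\<epsilon> * m)\<^sup>2 \<le> (?X k \<omega>)\<^sup>2}"
      proof (rule S.finite_measure_mono)
        show "{\<omega> \<in> space (prb (D k)). (\<epsilon> * m)\<^sup>2 \<le> (?X k \<omega>)\<^sup>2} \<in> S.events"
          using borel_measurable_integrable[OF int] by measurable
      qed (use imp in auto)
      also have "\<dots> \<le> (\<integral>\<omega>. (?X k \<omega>)\<^sup>2 \<partial>prb (D k)) / (\<epsilon> * m)\<^sup>2"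
        using eps m(1) by (intro integral_Markov_inequality_measure[OF int, of "{}"]) auto
      finally show ?thesis .
    qed
    have "(\<lambda>k. (\<integral>\<omega>. (?X k \<omega>)\<^sup>2 \<partial>prb (D k)) / (\<epsilon> * m)\<^sup>2) \<longlonglongrightarrow> 0 / (\<epsilon> * m)\<^sup>2"
      using th3 eps m(1) unfolding mean_square_null_def by (intro tendsto_divide tendsto_const) auto
    then have lim0: "(\<lambda>k. (\<integral>\<omega>. (?X k \<omega>)\<^sup>2 \<partial>prb (D k)) / (\<epsilon> * m)\<^sup>2) \<longlonglongrightarrow> 0" by simp
    show "(\<lambda>k. measure (prb (D k)) {\<omega> \<in> space (prb (D k)). \<bar>V_HAJ \<rho> (D k) \<omega> / V_tot \<rho> (D k) - 1\<bar> > \<epsilon>}) \<longlonglongrightarrow> 0"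
      by (rule tendsto_sandwich[OF _ _ tendsto_const lim0]) (use le in \<open>auto intro!: always_eventually\<close>)
  qed
qed

text \<open>\<open>\<rho>\<close> is only known to be measurable on \<open>F\<close>, and the draws of unselected PSUs may leave \<open>F\<close>.\<close>
lemma restrict_survey:
  fixes F :: "'a::euclidean_space set" and D :: "('a, 'w) survey"
  defines "r \<equiv> (\<lambda>\<rho> x. indicator F x * \<rho> x :: real)"
  assumes part: "psu_partition F D" and sec: "second_stage D" and fs: "rejective_first_stage D"
  shows "V1 (r \<rho>) D = V1 \<rho> D" "V2 (r \<rho>) D = V2 \<rho> D" "V_tot (r \<rho>) D = V_tot \<rho> D"
    and "\<omega> \<in> space (prb D) \<Longrightarrow> tau_hat (r \<rho>) D \<omega> = tau_hat \<rho> D \<omega>"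
    and "\<omega> \<in> space (prb D) \<Longrightarrow> V_HAJ_A (r \<rho>) D \<omega> = V_HAJ_A \<rho> D \<omega>"
    and "\<omega> \<in> space (prb D) \<Longrightarrow> V_HAJ (r \<rho>) D \<omega> = V_HAJ \<rho> D \<omega>"
proof -
  have sub: "psu D i \<subseteq> F" if "i < num_psu D" for i using part that by (auto simp: psu_partition_def)
  have tau: "tau_psu (r \<rho>) D i = tau_psu \<rho> D i" if "i < num_psu D" for i
    unfolding tau_psu_def set_lebesgue_integral_def r_def using sub[OF that]
    by (intro Bochner_Integration.integral_cong refl) (auto simp: indicator_def)
  have V: "V_psu (r \<rho>) D i = V_psu \<rho> D i" if "i < num_psu D" for i
    unfolding V_psu_def set_lebesgue_integral_def tau[OF that] unfolding r_def using sub[OF that]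
    by (intro Bochner_Integration.integral_cong refl) (auto simp: indicator_def)
  show V1: "V1 (r \<rho>) D = V1 \<rho> D" unfolding V1_def using tau by (intro sum.cong) auto
  show V2: "V2 (r \<rho>) D = V2 \<rho> D" unfolding V2_def using V by (intro sum.cong) auto
  have "V3 (r \<rho>) D = V3 \<rho> D" unfolding V3_def using V by (intro sum.cong) auto
  then show "V_tot (r \<rho>) D = V_tot \<rho> D" using V1 V2 by (simp add: V_tot_def)
  have "smp1 D \<in> prb D \<rightarrow>\<^sub>M count_space (Pow {..<num_psu D})" using fs by (simp add: rejective_first_stage_def)
  from measurable_space[OF this] have lt: "i < num_psu D" if "\<omega> \<in> space (prb D)" "i \<in> smp1 D \<omega>" for \<omega> i
    using that by auto
  have pt: "r \<rho> (pt D i j \<omega>) = \<rho> (pt D i j \<omega>)"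
    if "\<omega> \<in> space (prb D)" "i \<in> smp1 D \<omega>" "j < size2 D i" for \<omega> i j
  proof -
    have "pt D i j \<omega> \<in> psu D i" using sec that unfolding second_stage_def by blast
    then show ?thesis using sub[OF lt[OF that(1,2)]] by (auto simp: r_def)
  qed
  have hat: "tau_psu_hat (r \<rho>) D i \<omega> = tau_psu_hat \<rho> D i \<omega>" if "\<omega> \<in> space (prb D)" "i \<in> smp1 D \<omega>" for \<omega> i
    unfolding tau_psu_hat_def using pt[OF that] by (intro sum.cong) auto
  have vhat: "V_psu_hat (r \<rho>) D i \<omega> = V_psu_hat \<rho> D i \<omega>" if "\<omega> \<in> space (prb D)" "i \<in> smp1 D \<omega>" for \<omega> i
    unfolding V_psu_hat_def hat[OF that] using pt[OF that] by (intro arg_cong2[where f = "(*)"] sum.cong) auto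
  assume w: "\<omega> \<in> space (prb D)"
  show "tau_hat (r \<rho>) D \<omega> = tau_hat \<rho> D \<omega>" unfolding tau_hat_def using hat[OF w] by (intro sum.cong) auto
  have "R_hat (r \<rho>) D \<omega> = R_hat \<rho> D \<omega>" unfolding R_hat_def using hat[OF w] by (intro arg_cong2[where f = "(*)"] sum.cong) auto
  then show A: "V_HAJ_A (r \<rho>) D \<omega> = V_HAJ_A \<rho> D \<omega>" unfolding V_HAJ_A_def using hat[OF w] by (intro sum.cong) auto
  have "V_B_hat (r \<rho>) D \<omega> = V_B_hat \<rho> D \<omega>" unfolding V_B_hat_def using vhat[OF w] by (intro sum.cong) auto
  then show "V_HAJ (r \<rho>) D \<omega> = V_HAJ \<rho> D \<omega>" using A by (simp add: V_HAJ_def)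
qed

theorem proposition6:
  fixes F :: "'a::euclidean_space set"
    and \<rho> :: "'a \<Rightarrow> real"
    and D :: "nat \<Rightarrow> ('a, 'w) survey"
  assumes F_meas: "F \<in> sets lebesgue" and F_bounded: "bounded F"
    and F_pos: "0 < measure lebesgue F"
    and rho_int: "set_integrable lebesgue F \<rho>"
    and partition: "\<And>k. psu_partition F (D k)"
    and first_stage: "\<And>k. rejective_first_stage (D k)"
    and second_stage: "\<And>k. second_stage (D k)"
    and num_psu_lim: "filterlim (\<lambda>k. num_psu (D k)) at_top sequentially"
    and diam_lim: "(\<lambda>k. MAX i\<in>{..<num_psu (D k)}. diameter (psu (D k) i)) \<longlonglongrightarrow> 0"
    and size1_lim: "filterlim (\<lambda>k. size1 (D k)) at_top sequentially"
    and FS1: "FS1 D" and SS1: "SS1 F D" and VA1: "VA1 F \<rho>"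
  shows
    "mean_square_null (\<lambda>k. prb (D k))
       (\<lambda>k \<omega>. real (size1 (D k)) / (measure lebesgue F)\<^sup>2 *
                (V_HAJ_A \<rho> (D k) \<omega> - V1 \<rho> (D k) - V2 \<rho> (D k))) \<and>
     (VA2 F \<rho> D \<longrightarrow>
        weak_conv_m
          (\<lambda>k. distr (prb (D k)) borel
                 (\<lambda>\<omega>. (tau_hat \<rho> (D k) \<omega> - (LINT x:F|lebesgue. \<rho> x)) / sqrt (V_tot \<rho> (D k))))
          std_normal_distribution \<and>
        mean_square_null (\<lambda>k. prb (D k))
          (\<lambda>k \<omega>. real (size1 (D k)) / (measure lebesgue F)\<^sup>2 *
                   (V_HAJ \<rho> (D k) \<omega> - V_tot \<rho> (D k))) \<and>
        tendsto_in_prob (\<lambda>k. prb (D k))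
          (\<lambda>k \<omega>. V_HAJ \<rho> (D k) \<omega> / V_tot \<rho> (D k)) 1)"
proof -
  define r where "r = (\<lambda>x. indicator F x * \<rho> x :: real)"
  have ind: "indicator F x *\<^sub>R r x = indicator F x *\<^sub>R \<rho> x"
    "indicator F x *\<^sub>R r x ^ 4 = indicator F x *\<^sub>R \<rho> x ^ 4" for x
    by (simp_all add: r_def indicator_def)
  \<comment> \<open>Set integrability on \<open>F\<close> is integrability of the product with the
    indicator, so the function cut off outside \<open>F\<close> is measurable everywhere.\<close>
  have meas: "r \<in> borel_measurable lebesgue"
    using borel_measurable_integrable[OF rho_int[unfolded set_integrable_def]] by (simp add: r_def)
  have int: "set_integrable lebesgue F r" using rho_int by (simp only: set_integrable_def ind)
  have LINT: "(LINT x:F|lebesgue. r x) = (LINT x:F|lebesgue. \<rho> x)" by (simp only: set_lebesgue_integral_def ind)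
  have VA1': "VA1 F r" using VA1 by (simp only: VA1_def set_integrable_def set_lebesgue_integral_def ind)
  note eq = restrict_survey[OF partition second_stage first_stage, where \<rho> = \<rho>, folded r_def]
  have VA2': "VA2 F r D \<longleftrightarrow> VA2 F \<rho> D" by (simp only: VA2_def eq)
  note main = proposition6_measurable[OF meas F_pos int partition first_stage second_stage size1_lim FS1 SS1 VA1', unfolded VA2']
  have "mean_square_null (\<lambda>k. prb (D k))
       (\<lambda>k \<omega>. real (size1 (D k)) / (measure lebesgue F)\<^sup>2 * (V_HAJ_A \<rho> (D k) \<omega> - V1 \<rho> (D k) - V2 \<rho> (D k)))"
    by (rule mean_square_null_cong[THEN iffD1, OF _ main(1)]) (simp only: eq)
  moreover have "mean_square_null (\<lambda>k. prb (D k))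
       (\<lambda>k \<omega>. real (size1 (D k)) / (measure lebesgue F)\<^sup>2 * (V_HAJ \<rho> (D k) \<omega> - V_tot \<rho> (D k)))"
    by (rule mean_square_null_cong[THEN iffD1, OF _ main(3)]) (simp only: eq)
  moreover have "tendsto_in_prob (\<lambda>k. prb (D k)) (\<lambda>k \<omega>. V_HAJ \<rho> (D k) \<omega> / V_tot \<rho> (D k)) 1" if "VA2 F \<rho> D"
    by (rule tendsto_in_prob_cong[THEN iffD1, OF _ main(4)[OF that]]) (simp only: eq)
  moreover have "distr (prb (D k)) borel (\<lambda>\<omega>. (tau_hat r (D k) \<omega> - (LINT x:F|lebesgue. r x)) / sqrt (V_tot r (D k))) =
      distr (prb (D k)) borel (\<lambda>\<omega>. (tau_hat \<rho> (D k) \<omega> - (LINT x:F|lebesgue. \<rho> x)) / sqrt (V_tot \<rho> (D k)))" for k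
    by (intro distr_cong refl) (simp only: eq LINT)
  ultimately show ?thesis using main(2) by simp
qed

end
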